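(* Let $\nu>0$ and let $u^\nu\in L^\infty((0,T);L^2(\mathbb{T}^2))$ be the unique solution of the Navier-Stokes equations $$\partial_t u^\nu+u^\nu\cdot\nabla u^\nu+\nabla p^\nu=\nu\Delta u^\nu+f^\nu,\quad \operatorname{div}u^\nu=0\ \text{ on }\mathbb{T}^2\times(0,T),\qquad u^\nu|_{t=0}=u_0^\nu,$$ with forcing $f^\nu\in L^1((0,T);L^2(\mathbb{T}^2))$ and initial data $u_0^\nu\in L^2(\mathbb{T}^2)$, both divergence-free. Assume that $\omega_0^\nu=\operatorname{curl}u_0^\nu\in L^1(\mathbb{T}^2)$ and $g^\nu=\operatorname{curl}f^\nu\in L^1((0,T);L^1(\mathbb{T}^2))$, and let $\omega^\nu=\operatorname{curl}u^\nu$. Then for any $t\in[0,T]$ and any $0\le s\le|\mathbb{T}^2|$, $$\mathcal{M}_s(\omega^\nu(t))\le\mathcal{M}_s(\omega_0^\nu)+\int_0^t\mathcal{M}_s(g^\nu(\tau))\,d\tau.$$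
   Context: Fix $T>0$; $\mathbb{T}^2$ is the flat torus with $|\mathbb{T}^2|=(2\pi)^2$; $\operatorname{curl}v=\partial_1v_2-\partial_2v_1$. The unique solution of Navier-Stokes is the one in $L^\infty((0,T);L^2(\mathbb{T}^2))\cap L^2((0,T);H^1(\mathbb{T}^2))$. For $h\in L^1(\mathbb{T}^2)$ and $0\le s\le|\mathbb{T}^2|$, $\mathcal{M}_s(h):=\sup\{\int_E|h(x)|\,dx: E\subset\mathbb{T}^2\text{ measurable},\ |E|=s\}$. *)

theory Defs
  imports "HOL-Analysis.Analysis"
begin

text \<open>
  The flat torus is identified, as a measure space, with the cell \<open>[0, 2\<pi>)\<^sup>2\<close> carrying Lebesgue
  measure.  Functions on the torus are only ever used through their values on the cell; the
  differentiable structure enters through smooth test functions that are \<open>2\<pi>\<close>-periodic on the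
  whole plane.
\<close>

definition torus :: "(real^2) set" where
  "torus = {x. \<forall>i. 0 \<le> x $ i \<and> x $ i < 2 * pi}"

lemma torus_sets: "torus \<in> sets lebesgue"
  and measure_torus: "measure lebesgue torus = (2 * pi)\<^sup>2"
proof -
  let ?l = "0 :: real^2" and ?u = "(\<chi> i. 2 * pi) :: real^2"
  have sub: "box ?l ?u \<subseteq> torus" "torus \<subseteq> cbox ?l ?u"
    by (auto simp: torus_def mem_box_cart less_imp_le)
  have eq: "torus = (\<Inter>i. {x. 0 \<le> x $ i} \<inter> {x. x $ i < 2 * pi})"
    by (auto simp: torus_def)
  show sets: "torus \<in> sets lebesgue"
  proof -
    have "torus \<in> sets borel"
      unfolding eq by (intro sets.finite_INT sets.Int) auto
    then show ?thesis
      by (intro sets_completionI_sets) simp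
  qed
  have c: "measure lebesgue (cbox ?l ?u) = (2 * pi)\<^sup>2"
  proof -
    have "cbox ?l ?u \<noteq> {}"
      by (simp add: interval_ne_empty_cart)
    then have "measure lebesgue (cbox ?l ?u) = (\<Prod>i\<in>UNIV. ?u $ i - ?l $ i)"
      by (simp add: content_cbox_if_cart)
    also have "\<dots> = (2 * pi)\<^sup>2"
      by simp
    finally show ?thesis .
  qed
  have "measure lebesgue (box ?l ?u) \<le> measure lebesgue torus"
    using sub sets by (intro measure_mono_fmeasurable) (auto intro!: fmeasurableI2[of "cbox ?l ?u"])
  moreover have "measure lebesgue torus \<le> measure lebesgue (cbox ?l ?u)"
    using sub sets by (intro measure_mono_fmeasurable) auto
  moreover have "measure lebesgue (box ?l ?u) = measure lebesgue (cbox ?l ?u)"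
    by (simp add: measure_lborel_box_eq measure_lborel_cbox_eq)
  ultimately show "measure lebesgue torus = (2 * pi)\<^sup>2"
    using c by linarith
qed

abbreviation torus_measure :: "(real^2) measure" where
  "torus_measure \<equiv> lebesgue_on torus"

abbreviation spacetime_measure :: "real \<Rightarrow> (real \<times> (real^2)) measure" where
  "spacetime_measure T \<equiv> lebesgue_on ({0<..<T} \<times> torus)"


section \<open>Lebesgue and Bochner spaces\<close>

definition Lp_torus :: "nat \<Rightarrow> (real^2 \<Rightarrow> 'b::euclidean_space) \<Rightarrow> bool" where
  "Lp_torus p h \<longleftrightarrow>
     h \<in> borel_measurable torus_measure \<and> integrable torus_measure (\<lambda>x. norm (h x) ^ p)"

definition Lp_norm :: "nat \<Rightarrow> (real^2 \<Rightarrow> 'b::euclidean_space) \<Rightarrow> real" where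
  "Lp_norm p h = root p (LINT x|torus_measure. norm (h x) ^ p)"

text \<open>
  For finite \<open>p\<close> the space \<open>L\<^sup>p\<close> of the torus is separable, so strongly measurable functions
  of time with values in it correspond to jointly measurable functions of \<open>(t, x)\<close>.
\<close>

definition Lq_Lp :: "nat \<Rightarrow> nat \<Rightarrow> real \<Rightarrow> (real \<Rightarrow> real^2 \<Rightarrow> 'b::euclidean_space) \<Rightarrow> bool" where
  "Lq_Lp q p T h \<longleftrightarrow>
     (\<lambda>(t, x). h t x) \<in> borel_measurable (spacetime_measure T) \<and>
     (AE t in lebesgue_on {0<..<T}. Lp_torus p (h t)) \<and>
     integrable (lebesgue_on {0<..<T}) (\<lambda>t. Lp_norm p (h t) ^ q)"

definition Linf_Lp :: "nat \<Rightarrow> real \<Rightarrow> (real \<Rightarrow> real^2 \<Rightarrow> 'b::euclidean_space) \<Rightarrow> bool" where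
  "Linf_Lp p T h \<longleftrightarrow>
     (\<lambda>(t, x). h t x) \<in> borel_measurable (spacetime_measure T) \<and>
     (\<exists>C. AE t in lebesgue_on {0<..<T}. Lp_torus p (h t) \<and> Lp_norm p (h t) \<le> C)"


section \<open>Test functions and weak derivatives\<close>

primrec Ck :: "nat \<Rightarrow> ('a::euclidean_space \<Rightarrow> 'b::euclidean_space) \<Rightarrow> bool" where
  "Ck 0 f \<longleftrightarrow> continuous_on UNIV f"
| "Ck (Suc k) f \<longleftrightarrow>
     (\<forall>x. f differentiable (at x)) \<and> (\<forall>v. Ck k (\<lambda>x. frechet_derivative f (at x) v))"

definition smooth :: "('a::euclidean_space \<Rightarrow> 'b::euclidean_space) \<Rightarrow> bool" where
  "smooth f \<longleftrightarrow> (\<forall>k. Ck k f)"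

definition periodic :: "(real^2 \<Rightarrow> 'b) \<Rightarrow> bool" where
  "periodic f \<longleftrightarrow> (\<forall>x i. f (x + axis i (2 * pi)) = f x)"

definition pderiv_at :: "2 \<Rightarrow> (real^2 \<Rightarrow> 'b::euclidean_space) \<Rightarrow> real^2 \<Rightarrow> 'b" where
  "pderiv_at i f x = frechet_derivative f (at x) (axis i 1)"

definition laplacian :: "(real^2 \<Rightarrow> 'b::euclidean_space) \<Rightarrow> real^2 \<Rightarrow> 'b" where
  "laplacian f x = (\<Sum>i\<in>UNIV. pderiv_at i (pderiv_at i f) x)"

definition test_function :: "(real^2 \<Rightarrow> real) \<Rightarrow> bool" where
  "test_function \<phi> \<longleftrightarrow> smooth \<phi> \<and> periodic \<phi>"

definition has_weak_pderiv :: "2 \<Rightarrow> (real^2 \<Rightarrow> real) \<Rightarrow> (real^2 \<Rightarrow> real) \<Rightarrow> bool" where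
  "has_weak_pderiv i h d \<longleftrightarrow> Lp_torus 1 h \<and> Lp_torus 1 d \<and>
     (\<forall>\<phi>. test_function \<phi> \<longrightarrow>
        (LINT x|torus_measure. d x * \<phi> x) = - (LINT x|torus_measure. h x * pderiv_at i \<phi> x))"

text \<open>The distributional curl \<open>\<partial>\<^sub>1 v\<^sub>2 - \<partial>\<^sub>2 v\<^sub>1\<close> of \<open>v\<close> is the integrable function \<open>w\<close>.\<close>

definition has_weak_curl :: "(real^2 \<Rightarrow> real^2) \<Rightarrow> (real^2 \<Rightarrow> real) \<Rightarrow> bool" where
  "has_weak_curl v w \<longleftrightarrow> Lp_torus 1 v \<and> Lp_torus 1 w \<and>
     (\<forall>\<phi>. test_function \<phi> \<longrightarrow>
        (LINT x|torus_measure. w x * \<phi> x) =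
        (LINT x|torus_measure. v x $ 1 * pderiv_at 2 \<phi> x - v x $ 2 * pderiv_at 1 \<phi> x))"

definition weakly_div_free :: "(real^2 \<Rightarrow> real^2) \<Rightarrow> bool" where
  "weakly_div_free v \<longleftrightarrow> Lp_torus 1 v \<and>
     (\<forall>\<phi>. test_function \<phi> \<longrightarrow>
        (LINT x|torus_measure. (\<Sum>i\<in>UNIV. v x $ i * pderiv_at i \<phi> x)) = 0)"

text \<open>In the weak gradient \<open>G\<close>, the entry \<open>G t x $ j $ i\<close> is \<open>\<partial>\<^sub>i u\<^sub>j\<close>.\<close>

definition L2_H1 :: "real \<Rightarrow> (real \<Rightarrow> real^2 \<Rightarrow> real^2) \<Rightarrow> bool" where
  "L2_H1 T u \<longleftrightarrow> Lq_Lp 2 2 T u \<and>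
     (\<exists>G :: real \<Rightarrow> real^2 \<Rightarrow> real^2^2. Lq_Lp 2 2 T G \<and>
        (AE t in lebesgue_on {0<..<T}. \<forall>i j.
           has_weak_pderiv i (\<lambda>x. u t x $ j) (\<lambda>x. G t x $ j $ i)))"


section \<open>The Navier-Stokes equations\<close>

text \<open>
  Divergence-free space-time test fields, supported in \<open>[0, T')\<close> for some \<open>T' < T\<close>; they need
  not vanish at \<open>t = 0\<close>.
\<close>

definition ns_test_field :: "real \<Rightarrow> (real \<Rightarrow> real^2 \<Rightarrow> real^2) \<Rightarrow> bool" where
  "ns_test_field T \<phi> \<longleftrightarrow>
     smooth (\<lambda>(t, x). \<phi> t x) \<and> (\<forall>t. periodic (\<phi> t)) \<and>
     (\<forall>t x. (\<Sum>i\<in>UNIV. pderiv_at i (\<phi> t) x $ i) = 0) \<and>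
     (\<exists>T'<T. \<forall>t\<ge>T'. \<forall>x. \<phi> t x = 0)"

text \<open>
  Solutions of \<open>\<partial>\<^sub>t u + u \<cdot> \<nabla>u + \<nabla>p = \<nu> \<Delta>u + f\<close>, \<open>div u = 0\<close>, \<open>u(0) = u0\<close> in
  \<open>L\<^sup>\<infinity>((0,T); L\<^sup>2) \<inter> L\<^sup>2((0,T); H\<^sup>1)\<close>, in the usual weak sense: the equation is tested against
  divergence-free fields, which removes the pressure; \<open>u \<cdot> \<nabla>u = div (u \<otimes> u)\<close> as \<open>u\<close> is
  divergence-free; and the initial datum enters as the boundary term at \<open>t = 0\<close>.
\<close>

definition navier_stokes_solution ::
  "real \<Rightarrow> real \<Rightarrow> (real^2 \<Rightarrow> real^2) \<Rightarrow> (real \<Rightarrow> real^2 \<Rightarrow> real^2) \<Rightarrow>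
   (real \<Rightarrow> real^2 \<Rightarrow> real^2) \<Rightarrow> bool" where
  "navier_stokes_solution \<nu> T u0 f u \<longleftrightarrow>
     Linf_Lp 2 T u \<and> L2_H1 T u \<and>
     (AE t in lebesgue_on {0<..<T}. weakly_div_free (u t)) \<and>
     (\<forall>\<phi>. ns_test_field T \<phi> \<longrightarrow>
        (LINT z|spacetime_measure T. (case z of (t, x) \<Rightarrow>
            u t x \<bullet> vector_derivative (\<lambda>r. \<phi> r x) (at t)
          + (\<Sum>i\<in>UNIV. u t x $ i * (u t x \<bullet> pderiv_at i (\<phi> t) x))
          + \<nu> * (u t x \<bullet> laplacian (\<phi> t) x)
          + f t x \<bullet> \<phi> t x))
        + (LINT x|torus_measure. u0 x \<bullet> \<phi> 0 x) = 0)"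

text \<open>
  An element of \<open>L\<^sup>\<infinity>((0,T); L\<^sup>2)\<close> has no value at an individual time.  A Navier-Stokes solution
  agrees for almost every \<open>t\<close> with exactly one weakly continuous map \<open>[0,T] \<rightarrow> L\<^sup>2\<close>, and
  \<open>u(t)\<close> for \<open>t \<in> [0,T]\<close> refers to that representative.
\<close>

definition weakly_continuous_L2 :: "real \<Rightarrow> (real \<Rightarrow> real^2 \<Rightarrow> real^2) \<Rightarrow> bool" where
  "weakly_continuous_L2 T u \<longleftrightarrow>
     (\<forall>t\<in>{0..T}. Lp_torus 2 (u t)) \<and>
     (\<forall>\<psi> :: real^2 \<Rightarrow> real^2. Lp_torus 2 \<psi> \<longrightarrow>
        continuous_on {0..T} (\<lambda>t. LINT x|torus_measure. u t x \<bullet> \<psi> x))"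


section \<open>The maximal vorticity function\<close>

text \<open>
  For integrable \<open>h\<close> and \<open>0 \<le> s \<le> |torus|\<close> the supremum is over a nonempty set that is bounded
  above; outside this range the value is unspecified.
\<close>

definition maximal_vorticity :: "real \<Rightarrow> (real^2 \<Rightarrow> real) \<Rightarrow> real" where
  "maximal_vorticity s h =
     (SUP E\<in>{E. E \<subseteq> torus \<and> E \<in> sets lebesgue \<and> measure lebesgue E = s}.
        LINT x:E|lebesgue. \<bar>h x\<bar>)"

end

theory Submission
  imports Defs
begin

text \<open>
  In the plane the vorticity \<open>\<omega>\<close> solves \<open>\<partial>\<^sub>t\<omega> + u \<cdot> \<nabla>\<omega> = \<nu> \<Delta>\<omega> + g\<close> with a divergence-free velocity.  Transport by \<open>u\<close>
  rearranges its values and leaves every \<open>\<M>\<^sub>s\<close> unchanged, diffusion decreases it, and \<open>g\<close> adds at most \<open>\<M>\<^sub>s(g)\<close> per unit of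
  time.  The work lies in making this rigorous when \<open>\<omega>\<close> is only integrable at time \<open>0\<close> and the equation holds only weakly.

  Mollification in space by \<open>(1 + cos z\<^sub>1)\<^sup>n (1 + cos z\<^sub>2)\<^sup>n\<close>, normalised to mass one, turns the weak formulation into
  finitely many scalar equations, because this trigonometric polynomial is a separable kernel
  \<open>\<rho>\<^sub>n(x - y) = \<Sum>\<^sub>j A\<^sub>j(x) B\<^sub>j(y)\<close> (\<open>separable_cos_kernel\<close>).  The coefficients \<open>\<integral> u(t) \<bullet> \<nabla>\<^sup>\<bottom> A\<^sub>j\<close> of the mollified vorticity are defined
  at every time and are absolutely continuous (\<open>navier_stokes_integrated\<close>).  Hence the mollified vorticity is a trigonometric
  polynomial with absolutely continuous coefficients.  Its equation is the vorticity equation in which the source is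
  \<open>\<rho>\<^sub>n * g\<close> plus the commutator of \<open>u \<cdot> \<nabla>\<close> with mollification (\<open>mollified_vorticity_equation\<close>).

  For almost every time \<open>\<nabla>u\<close>, and with it \<open>\<omega>\<close>, is square integrable.  The commutator then tends to zero in \<open>L\<^sup>1\<close> and is bounded
  by a multiple of \<open>\<parallel>\<nabla>u\<parallel>\<^sup>2\<close> (\<open>commutator_tendsto_0\<close>, \<open>commutator_uniform_bound\<close>), which is the argument of DiPerna and Lions.
  Dominated convergence in time makes the total error small (\<open>source_error_tendsto\<close>).

  For a smooth solution the bound comes from the duality \<open>\<M>\<^sub>s(h) = min\<^sub>l (l s + \<integral> (\<bar>h\<bar> - l)\<^sup>+)\<close>.  With the positive part replaced by
  a smooth convex function, the minimiser \<open>l\<close> depends continuously on time.  The rate of change is the pairing of the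
  right-hand side of the equation with a monotone function \<open>\<phi>\<close> of the vorticity for which \<open>\<bar>\<phi>\<bar> \<le> 1\<close> and \<open>\<integral> \<bar>\<phi>\<bar> \<le> s\<close>.  Transport
  contributes nothing to this pairing, diffusion a nonpositive amount (\<open>slope_dissipation\<close>), and a source at most its \<open>\<M>\<^sub>s\<close>
  (\<open>maximal_vorticity_pairing\<close>).  This gives \<open>maximal_vorticity_evolution\<close>.

  Finally, at \<open>s = (2 \<pi>)\<^sup>2\<close> the maximal vorticity is the \<open>L\<^sup>1\<close> norm.  Applied to the difference of two mollifications, the same
  estimate shows that they are a Cauchy sequence in \<open>L\<^sup>1\<close> at every time (\<open>moll_difference_le\<close>).  The limit is the curl of
  \<open>u(t)\<close>, and the estimate passes to the limit because \<open>\<M>\<^sub>s\<close> is Lipschitz in \<open>L\<^sup>1\<close>.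
\<close>

section \<open>Iterated integrals for Lebesgue measurable functions\<close>

text \<open>A null set of the completed measure is contained in a null set of the product of the Borel measures, to which
  Tonelli's theorem applies.\<close>

lemma AE_lebesgue_pair:
  fixes P :: "'a::euclidean_space \<times> 'b::euclidean_space \<Rightarrow> bool"
  assumes "AE z in lebesgue. P z"
  shows "AE x in lebesgue. AE y in lebesgue. P (x, y)"
proof -
  have "AE z in lborel \<Otimes>\<^sub>M lborel. P z"
    using assms unfolding AE_completion_iff lborel_prod .
  then have "AE x in lborel. AE y in lborel. P (x, y)"
    by (rule lborel_pair.AE_pair)
  then show ?thesis
    by (simp add: AE_completion_iff)
qed

lemma AE_lebesgue_pair_fst:
  fixes P :: "'a::euclidean_space \<Rightarrow> bool"
  assumes "AE x in lebesgue. P x"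
  shows "AE z in (lebesgue :: ('a \<times> 'b::euclidean_space) measure). P (fst z)"
proof -
  have "AE x in lborel. P x"
    using assms by (simp add: AE_completion_iff)
  then obtain N where N: "N \<in> null_sets lborel" "{x. \<not> P x} \<subseteq> N"
    by (auto elim!: AE_E simp: null_sets_def)
  have "emeasure (lborel \<Otimes>\<^sub>M (lborel :: 'b measure)) (N \<times> UNIV) = 0"
    using N by (subst lborel.emeasure_pair_measure_Times) (auto simp: null_sets_def)
  moreover have "N \<times> UNIV \<in> sets (lborel \<Otimes>\<^sub>M (lborel :: 'b measure))"
    using N by (intro pair_measureI) (auto simp: null_sets_def)
  ultimately have "N \<times> UNIV \<in> null_sets (lborel :: ('a \<times> 'b) measure)"
    unfolding lborel_prod by (simp add: null_sets_def)
  then have "AE z in (lborel :: ('a \<times> 'b) measure). P (fst z)"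
    using N(2) by (intro AE_I'[of "N \<times> UNIV"]) auto
  then show ?thesis
    by (simp add: AE_completion_iff)
qed

lemma lebesgue_measurable_cong_AE:
  fixes f g :: "'a::euclidean_space \<Rightarrow> 'b::topological_space"
  assumes "g \<in> borel_measurable lborel" "AE x in lebesgue. f x = g x"
  shows "f \<in> borel_measurable lebesgue"
proof (rule measurableI)
  fix A :: "'b set" assume A: "A \<in> sets borel"
  have g: "g \<in> borel_measurable lebesgue"
    using assms(1) by (rule measurable_completion)
  obtain N where N: "N \<in> null_sets lebesgue" "\<And>x. x \<notin> N \<Longrightarrow> f x = g x"
    using assms(2) unfolding completion.AE_iff_null_sets by auto
  have "f -` A \<inter> N \<in> null_sets lebesgue"
    using N(1) by (rule completion.complete2[rotated]) auto
  moreover have "g -` A \<in> sets lebesgue"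
    using measurable_sets[OF g A] by simp
  moreover have "N \<in> sets lebesgue"
    using N(1) by auto
  ultimately have "(g -` A - N) \<union> (f -` A \<inter> N) \<in> sets lebesgue"
    by auto
  moreover have "(g -` A - N) \<union> (f -` A \<inter> N) = f -` A"
    using N(2) by auto
  ultimately show "f -` A \<inter> space lebesgue \<in> sets lebesgue"
    by simp
qed simp

text \<open>A Lebesgue measurable function agrees almost everywhere with a Borel function, and almost all slices
  inherit this.\<close>

lemma nn_integral_lebesgue_pair:
  fixes F :: "'a::euclidean_space \<times> 'b::euclidean_space \<Rightarrow> ennreal"
  assumes F: "F \<in> borel_measurable lebesgue"
  shows "AE x in lebesgue. (\<lambda>y. F (x, y)) \<in> borel_measurable lebesgue"
    and "(\<lambda>x. \<integral>\<^sup>+y. F (x, y) \<partial>lebesgue) \<in> borel_measurable lebesgue"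
    and "(\<integral>\<^sup>+z. F z \<partial>lebesgue) = (\<integral>\<^sup>+x. \<integral>\<^sup>+y. F (x, y) \<partial>lebesgue \<partial>lebesgue)"
proof -
  obtain F' where F': "F' \<in> borel_measurable lborel" "AE z in lborel. F z = F' z"
    using completion_ex_borel_measurable[OF F] by auto
  have [measurable]: "F' \<in> borel_measurable (lborel \<Otimes>\<^sub>M lborel)"
    using F'(1) by (simp add: lborel_prod)
  have ae: "AE x in lebesgue. AE y in lebesgue. F (x, y) = F' (x, y)"
    using F'(2) by (intro AE_lebesgue_pair) (simp add: AE_completion_iff)
  show "AE x in lebesgue. (\<lambda>y. F (x, y)) \<in> borel_measurable lebesgue"
    using ae
  proof eventually_elim
    case (elim x)
    show ?case
      by (rule lebesgue_measurable_cong_AE[OF _ elim]) simp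
  qed
  have inner: "AE x in lebesgue. (\<integral>\<^sup>+y. F (x, y) \<partial>lebesgue) = (\<integral>\<^sup>+y. F' (x, y) \<partial>lborel)"
    using ae
  proof eventually_elim
    case (elim x)
    have "(\<integral>\<^sup>+y. F (x, y) \<partial>lebesgue) = (\<integral>\<^sup>+y. F' (x, y) \<partial>lebesgue)"
      by (rule nn_integral_cong_AE[OF elim])
    then show ?case
      by (simp add: nn_integral_completion)
  qed
  show "(\<lambda>x. \<integral>\<^sup>+y. F (x, y) \<partial>lebesgue) \<in> borel_measurable lebesgue"
    by (rule lebesgue_measurable_cong_AE[OF _ inner]) simp
  have "(\<integral>\<^sup>+z. F z \<partial>lebesgue) = (\<integral>\<^sup>+z. F' z \<partial>lborel)"
    using F'(2) by (subst nn_integral_completion) (rule nn_integral_cong_AE)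
  also have "\<dots> = (\<integral>\<^sup>+x. \<integral>\<^sup>+y. F' (x, y) \<partial>lborel \<partial>lborel)"
    by (subst lborel.nn_integral_fst) (use F'(1) in \<open>simp_all only: lborel_prod\<close>)
  also have "\<dots> = (\<integral>\<^sup>+x. \<integral>\<^sup>+y. F' (x, y) \<partial>lborel \<partial>lebesgue)"
    by (simp add: nn_integral_completion)
  also have "\<dots> = (\<integral>\<^sup>+x. \<integral>\<^sup>+y. F (x, y) \<partial>lebesgue \<partial>lebesgue)"
    using inner by (intro nn_integral_cong_AE) (auto elim: AE_mp)
  finally show "(\<integral>\<^sup>+z. F z \<partial>lebesgue) = (\<integral>\<^sup>+x. \<integral>\<^sup>+y. F (x, y) \<partial>lebesgue \<partial>lebesgue)" .
qed

lemma integral_lebesgue_pair: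
  fixes F :: "'a::euclidean_space \<times> 'b::euclidean_space \<Rightarrow> real"
  assumes F: "integrable lebesgue F"
  shows "AE x in lebesgue. integrable lebesgue (\<lambda>y. F (x, y))"
    and "integrable lebesgue (\<lambda>x. LINT y|lebesgue. F (x, y))"
    and "(LINT z|lebesgue. F z) = (LINT x|lebesgue. LINT y|lebesgue. F (x, y))"
proof -
  obtain F' where F': "F' \<in> borel_measurable lborel" "AE z in lborel. F z = F' z"
    using completion_ex_borel_measurable_real[of F lborel] F by auto
  have [measurable]: "F' \<in> borel_measurable (lborel \<Otimes>\<^sub>M lborel)"
    using F'(1) by (simp add: lborel_prod)
  have F'_leb: "F' \<in> borel_measurable lebesgue"
    using F'(1) by (rule measurable_completion)
  have ae0: "AE z in lebesgue. F z = F' z"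
    using F'(2) by (simp add: AE_completion_iff)
  have "integrable lebesgue F'"
    using F F'_leb ae0 by (subst integrable_cong_AE[of _ _ F]) (auto elim: AE_mp)
  then have int: "integrable (lborel \<Otimes>\<^sub>M lborel) F'"
    using F' by (simp add: integrable_completion lborel_prod)
  have ae: "AE x in lebesgue. AE y in lebesgue. F (x, y) = F' (x, y)"
    using ae0 by (rule AE_lebesgue_pair)
  have meas: "AE x in lebesgue. (\<lambda>y. F (x, y)) \<in> borel_measurable lebesgue"
    using ae
  proof eventually_elim
    case (elim x)
    show ?case
      by (rule lebesgue_measurable_cong_AE[OF _ elim]) simp
  qed
  have i': "AE x in lebesgue. integrable lborel (\<lambda>y. F' (x, y))"
    using lborel_pair.AE_integrable_fst'[OF int] by (simp add: AE_completion_iff)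
  show "AE x in lebesgue. integrable lebesgue (\<lambda>y. F (x, y))"
    using ae i' meas
  proof eventually_elim
    case (elim x)
    have "integrable lebesgue (\<lambda>y. F' (x, y))"
      using elim(2) by (simp add: integrable_completion)
    then show ?case
      using elim by (subst integrable_cong_AE[of _ _ "\<lambda>y. F' (x, y)"]) auto
  qed
  have inner: "AE x in lebesgue. (LINT y|lebesgue. F (x, y)) = (LINT y|lborel. F' (x, y))"
    using ae meas
  proof eventually_elim
    case (elim x)
    have "(LINT y|lebesgue. F (x, y)) = (LINT y|lebesgue. F' (x, y))"
      using elim by (intro integral_cong_AE) (auto intro: measurable_completion)
    then show ?case
      by (simp add: integral_completion)
  qed
  have m: "(\<lambda>x. LINT y|lebesgue. F (x, y)) \<in> borel_measurable lebesgue"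
    by (rule lebesgue_measurable_cong_AE[OF _ inner]) simp
  have outer: "integrable lborel (\<lambda>x. LINT y|lborel. F' (x, y))"
    by (rule lborel_pair.integrable_fst'[OF int])
  show "integrable lebesgue (\<lambda>x. LINT y|lebesgue. F (x, y))"
    using m inner outer
    by (subst integrable_cong_AE[of _ _ "\<lambda>x. LINT y|lborel. F' (x, y)"])
       (auto simp: integrable_completion intro: measurable_completion)
  have "(LINT z|lebesgue. F z) = (LINT z|lebesgue. F' z)"
    using F ae0 F'_leb by (intro integral_cong_AE) auto
  also have "\<dots> = (LINT z|(lborel \<Otimes>\<^sub>M lborel). F' z)"
    using F' by (simp add: integral_completion lborel_prod)
  also have "\<dots> = (LINT x|lborel. LINT y|lborel. F' (x, y))"
    by (rule lborel_pair.integral_fst'[OF int, symmetric])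
  also have "\<dots> = (LINT x|lebesgue. LINT y|lborel. F' (x, y))"
    using outer by (simp add: integral_completion)
  also have "\<dots> = (LINT x|lebesgue. LINT y|lebesgue. F (x, y))"
    using inner m outer by (intro integral_cong_AE) (auto intro: measurable_completion elim: AE_mp)
  finally show "(LINT z|lebesgue. F z) = (LINT x|lebesgue. LINT y|lebesgue. F (x, y))" .
qed


lemma nn_integral_lebesgue_on_Times:
  fixes F :: "'a::euclidean_space \<times> 'b::euclidean_space \<Rightarrow> ennreal"
  assumes A: "A \<in> sets borel" and B: "B \<in> sets borel"
    and F: "F \<in> borel_measurable (lebesgue_on (A \<times> B))"
  shows "AE x in lebesgue_on A. (\<lambda>y. F (x, y)) \<in> borel_measurable (lebesgue_on B)"
    and "(\<lambda>x. \<integral>\<^sup>+y. F (x, y) \<partial>lebesgue_on B) \<in> borel_measurable (lebesgue_on A)"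
    and "(\<integral>\<^sup>+z. F z \<partial>lebesgue_on (A \<times> B)) =
         (\<integral>\<^sup>+x. \<integral>\<^sup>+y. F (x, y) \<partial>lebesgue_on B \<partial>lebesgue_on A)"
proof -
  have sets: "A \<in> sets lebesgue" "B \<in> sets lebesgue" "A \<times> B \<in> sets lebesgue"
    using A B borel_Times[OF A B] by auto
  define F1 where "F1 z = F z * indicator (A \<times> B) z" for z
  have F1: "F1 \<in> borel_measurable lebesgue"
    using F sets unfolding F1_def by (subst borel_measurable_restrict_space_iff_ennreal[symmetric]) auto
  have ind: "F1 (x, y) = F (x, y) * indicator B y * indicator A x" for x y
    by (simp add: F1_def indicator_def)
  have in_A: "F1 (x, y) = F (x, y) * indicator B y" if "x \<in> A" for x y
    using that by (simp add: ind)
  note fub = nn_integral_lebesgue_pair[OF F1]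
  show "AE x in lebesgue_on A. (\<lambda>y. F (x, y)) \<in> borel_measurable (lebesgue_on B)"
  proof -
    have "AE x in lebesgue. x \<in> A \<longrightarrow> (\<lambda>y. F (x, y)) \<in> borel_measurable (lebesgue_on B)"
      using fub(1) by eventually_elim (use sets in_A in \<open>auto simp: borel_measurable_restrict_space_iff_ennreal\<close>)
    then show ?thesis
      using sets by (simp add: AE_restrict_space_iff)
  qed
  have inner: "(\<integral>\<^sup>+y. F1 (x, y) \<partial>lebesgue) = (\<integral>\<^sup>+y. F (x, y) \<partial>lebesgue_on B) * indicator A x" for x
    using sets by (cases "x \<in> A") (simp_all add: in_A nn_integral_restrict_space ind)
  show "(\<lambda>x. \<integral>\<^sup>+y. F (x, y) \<partial>lebesgue_on B) \<in> borel_measurable (lebesgue_on A)"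
    using fub(2) sets unfolding inner by (subst borel_measurable_restrict_space_iff_ennreal) auto
  have "(\<integral>\<^sup>+z. F z \<partial>lebesgue_on (A \<times> B)) = (\<integral>\<^sup>+z. F1 z \<partial>lebesgue)"
    using sets by (simp add: nn_integral_restrict_space F1_def)
  also have "\<dots> = (\<integral>\<^sup>+x. \<integral>\<^sup>+y. F (x, y) \<partial>lebesgue_on B \<partial>lebesgue_on A)"
    using sets unfolding fub(3) inner by (simp add: nn_integral_restrict_space)
  finally show "(\<integral>\<^sup>+z. F z \<partial>lebesgue_on (A \<times> B)) =
         (\<integral>\<^sup>+x. \<integral>\<^sup>+y. F (x, y) \<partial>lebesgue_on B \<partial>lebesgue_on A)" .
qed

lemma integral_lebesgue_on_Times:
  fixes F :: "'a::euclidean_space \<times> 'b::euclidean_space \<Rightarrow> real"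
  assumes A: "A \<in> sets borel" and B: "B \<in> sets borel"
    and F: "integrable (lebesgue_on (A \<times> B)) F"
  shows "AE x in lebesgue_on A. integrable (lebesgue_on B) (\<lambda>y. F (x, y))"
    and "integrable (lebesgue_on A) (\<lambda>x. LINT y|lebesgue_on B. F (x, y))"
    and "(LINT z|lebesgue_on (A \<times> B). F z) = (LINT x|lebesgue_on A. LINT y|lebesgue_on B. F (x, y))"
proof -
  have sets: "A \<in> sets lebesgue" "B \<in> sets lebesgue" "A \<times> B \<in> sets lebesgue"
    using A B borel_Times[OF A B] by auto
  define F1 where "F1 z = indicator (A \<times> B) z *\<^sub>R F z" for z
  have F1: "integrable lebesgue F1"
    using F sets unfolding F1_def by (subst integrable_restrict_space[symmetric]) auto
  have ind: "F1 (x, y) = indicator A x *\<^sub>R indicator B y *\<^sub>R F (x, y)" for x y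
    by (simp add: F1_def indicator_def)
  have in_A: "F1 (x, y) = indicator B y *\<^sub>R F (x, y)" if "x \<in> A" for x y
    using that by (simp add: ind)
  note fub = integral_lebesgue_pair[OF F1]
  show "AE x in lebesgue_on A. integrable (lebesgue_on B) (\<lambda>y. F (x, y))"
  proof -
    have "AE x in lebesgue. x \<in> A \<longrightarrow> integrable (lebesgue_on B) (\<lambda>y. F (x, y))"
      using fub(1) by eventually_elim (use sets in_A in \<open>auto simp: integrable_restrict_space\<close>)
    then show ?thesis
      using sets by (simp add: AE_restrict_space_iff)
  qed
  have inner: "(LINT y|lebesgue. F1 (x, y)) = indicator A x *\<^sub>R (LINT y|lebesgue_on B. F (x, y))" for x
    using sets by (cases "x \<in> A") (simp_all add: in_A integral_restrict_space ind)
  show "integrable (lebesgue_on A) (\<lambda>x. LINT y|lebesgue_on B. F (x, y))"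
    using fub(2) sets unfolding inner by (subst integrable_restrict_space) auto
  have "(LINT z|lebesgue_on (A \<times> B). F z) = (LINT z|lebesgue. F1 z)"
    using sets by (simp add: integral_restrict_space F1_def)
  also have "\<dots> = (LINT x|lebesgue_on A. LINT y|lebesgue_on B. F (x, y))"
    using sets unfolding fub(3) inner by (simp add: integral_restrict_space)
  finally show "(LINT z|lebesgue_on (A \<times> B). F z) = (LINT x|lebesgue_on A. LINT y|lebesgue_on B. F (x, y))" .
qed

text \<open>The measurability of a function of the first variable alone is not a matter of
  composition, because projections need not pull back Lebesgue null sets measurably; it holds
  because null sets pull back to null sets.\<close>

lemma measurable_fst_lebesgue_on_Times:
  fixes b :: "'a::euclidean_space \<Rightarrow> real"
  assumes A: "A \<in> sets borel" and B: "B \<in> sets borel"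
    and b: "b \<in> borel_measurable (lebesgue_on A)"
  shows "(\<lambda>z. b (fst z)) \<in> borel_measurable (lebesgue_on (A \<times> (B :: 'b::euclidean_space set)))"
proof -
  have sets: "A \<in> sets lebesgue" "A \<times> B \<in> sets lebesgue"
    using A borel_Times[OF A B] by auto
  define b1 where "b1 x = indicator A x *\<^sub>R b x" for x
  have "b1 \<in> borel_measurable lebesgue"
    using b sets unfolding b1_def by (subst borel_measurable_restrict_space_iff[symmetric]) auto
  then obtain b' where b': "b' \<in> borel_measurable lborel" "AE x in lborel. b1 x = b' x"
    using completion_ex_borel_measurable_real by blast
  have "AE z in (lebesgue :: ('a \<times> 'b) measure). b1 (fst z) = b' (fst z)"
    using b'(2) by (intro AE_lebesgue_pair_fst) (simp add: AE_completion_iff)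
  moreover have "(\<lambda>z::'a \<times> 'b. b' (fst z)) \<in> borel_measurable lborel"
    using b'(1) by (simp add: borel_prod[symmetric])
  ultimately have "(\<lambda>z::'a \<times> 'b. b1 (fst z)) \<in> borel_measurable lebesgue"
    by (intro lebesgue_measurable_cong_AE) auto
  then have "(\<lambda>z::'a \<times> 'b. b1 (fst z)) \<in> borel_measurable (lebesgue_on (A \<times> B))"
    by (rule measurable_restrict_space1)
  then show ?thesis
    by (subst measurable_cong[of _ _ "\<lambda>z. b1 (fst z)"]) (auto simp: b1_def)
qed

text \<open>Tonelli's criterion in the form in which Bochner spaces supply it: \<open>C\<close> will be a power of the norm of a slice.\<close>

lemma integrable_lebesgue_on_Times:
  fixes F :: "'a::euclidean_space \<times> 'b::euclidean_space \<Rightarrow> real"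
  assumes A: "A \<in> sets borel" and B: "B \<in> sets borel"
    and F: "F \<in> borel_measurable (lebesgue_on (A \<times> B))"
    and bound: "AE x in lebesgue_on A. integrable (lebesgue_on B) (\<lambda>y. F (x, y)) \<and>
                  (LINT y|lebesgue_on B. \<bar>F (x, y)\<bar>) \<le> C x"
    and C: "integrable (lebesgue_on A) C"
  shows "integrable (lebesgue_on (A \<times> B)) F"
proof (rule integrableI_bounded)
  have m: "(\<lambda>z. ennreal (norm (F z))) \<in> borel_measurable (lebesgue_on (A \<times> B))"
    using F by measurable
  have "(\<integral>\<^sup>+z. ennreal (norm (F z)) \<partial>lebesgue_on (A \<times> B)) =
        (\<integral>\<^sup>+x. \<integral>\<^sup>+y. ennreal (norm (F (x, y))) \<partial>lebesgue_on B \<partial>lebesgue_on A)"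
    by (rule nn_integral_lebesgue_on_Times(3)[OF A B m])
  also have "\<dots> \<le> (\<integral>\<^sup>+x. ennreal \<bar>C x\<bar> \<partial>lebesgue_on A)"
    using bound
    by (intro nn_integral_mono_AE, eventually_elim)
       (auto simp: nn_integral_eq_integral intro!: ennreal_leI)
  also have "\<dots> < \<infinity>"
    using C by (simp add: integrable_iff_bounded)
  finally show "(\<integral>\<^sup>+z. ennreal (norm (F z)) \<partial>lebesgue_on (A \<times> B)) < \<infinity>" .
qed (rule F)

section \<open>The torus as a finite measure space\<close>

abbreviation torus_integral :: "(real^2 \<Rightarrow> real) \<Rightarrow> real" (binder \<open>TINT \<close> [60] 60) where
  "torus_integral h \<equiv> integral\<^sup>L torus_measure h"

lemma torus_borel: "torus \<in> sets borel"
proof -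
  have "torus = (\<Inter>i. {x. 0 \<le> x $ i} \<inter> {x. x $ i < 2 * pi})"
    by (auto simp: torus_def)
  also have "\<dots> \<in> sets borel"
    by (intro sets.finite_INT sets.Int) auto
  finally show ?thesis .
qed

lemma torus_lmeasurable: "torus \<in> lmeasurable"
proof (rule fmeasurableI2)
  show "torus \<subseteq> cbox 0 (\<chi> i. 2 * pi)"
    by (auto simp: torus_def mem_box_cart less_imp_le)
qed (auto simp: torus_sets)

interpretation TM: finite_measure torus_measure
  by (rule finite_measure_lebesgue_on[OF torus_lmeasurable])

interpretation TM2: pair_sigma_finite torus_measure torus_measure ..

lemma measure_torus_measure: "measure torus_measure torus = (2 * pi)\<^sup>2"
  using torus_sets by (simp add: measure_restrict_space measure_torus)

lemma continuous_measurable_torus: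
  fixes h :: "real^2 \<Rightarrow> 'b::euclidean_space"
  assumes "continuous_on UNIV h"
  shows "h \<in> borel_measurable torus_measure"
  using assms torus_sets
  by (intro continuous_imp_measurable_on_sets_lebesgue) (auto intro: continuous_on_subset)

lemma continuous_bounded_torus:
  fixes h :: "real^2 \<Rightarrow> 'b::euclidean_space"
  assumes "continuous_on UNIV h"
  obtains C where "C \<ge> 0" "\<And>x. x \<in> torus \<Longrightarrow> norm (h x) \<le> C"
proof -
  have "bounded (h ` cbox 0 (\<chi> i. 2 * pi))"
    using assms by (intro compact_imp_bounded compact_continuous_image) (auto intro: continuous_on_subset)
  then obtain C where C: "C > 0" "\<forall>x\<in>cbox 0 (\<chi> i. 2 * pi). norm (h x) \<le> C"
    by (auto simp: bounded_pos)
  have "torus \<subseteq> cbox 0 (\<chi> i. 2 * pi)"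
    by (auto simp: torus_def mem_box_cart less_imp_le)
  then show ?thesis
    using C that[of C] by auto
qed

lemma integrable_torus_bounded:
  fixes h :: "real^2 \<Rightarrow> 'b::euclidean_space"
  assumes "h \<in> borel_measurable torus_measure" "\<And>x. x \<in> torus \<Longrightarrow> norm (h x) \<le> C"
  shows "integrable torus_measure h"
  using assms by (intro TM.integrable_const_bound[of _ C]) auto

lemma integrable_torus_continuous:
  fixes h :: "real^2 \<Rightarrow> 'b::euclidean_space"
  assumes "continuous_on UNIV h"
  shows "integrable torus_measure h"
proof -
  obtain C where "\<And>x. x \<in> torus \<Longrightarrow> norm (h x) \<le> C"
    using continuous_bounded_torus[OF assms] by blast
  then show ?thesis
    using continuous_measurable_torus[OF assms] integrable_torus_bounded by blast
qed

lemma integrable_torus_mult_bounded: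
  fixes h k :: "real^2 \<Rightarrow> real"
  assumes "integrable torus_measure h" "k \<in> borel_measurable torus_measure"
    "\<And>x. x \<in> torus \<Longrightarrow> \<bar>k x\<bar> \<le> C"
  shows "integrable torus_measure (\<lambda>x. h x * k x)"
proof (rule Bochner_Integration.integrable_bound)
  show "integrable torus_measure (\<lambda>x. \<bar>C\<bar> * h x)"
    using assms(1) by simp
  show "AE x in torus_measure. norm (h x * k x) \<le> norm (\<bar>C\<bar> * h x)"
  proof (rule AE_I2)
    fix x assume "x \<in> space torus_measure"
    then have "\<bar>k x\<bar> \<le> \<bar>C\<bar>"
      using assms(3)[of x] by simp
    then show "norm (h x * k x) \<le> norm (\<bar>C\<bar> * h x)"
      using mult_right_mono[of "\<bar>k x\<bar>" "\<bar>C\<bar>" "\<bar>h x\<bar>"] by (simp add: abs_mult mult.commute)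
  qed
qed (use assms in simp)

lemma integrable_torus_mult_continuous:
  fixes h k :: "real^2 \<Rightarrow> real"
  assumes "integrable torus_measure h" "continuous_on UNIV k"
  shows "integrable torus_measure (\<lambda>x. h x * k x)"
proof -
  obtain C where "\<And>x. x \<in> torus \<Longrightarrow> norm (k x) \<le> C"
    using continuous_bounded_torus[OF assms(2)] by blast
  then show ?thesis
    using integrable_torus_mult_bounded[OF assms(1) continuous_measurable_torus[OF assms(2)], of C]
    by simp
qed

section \<open>Calculus of smooth functions\<close>

lemma Ck_SucI:
  assumes "\<And>x. (f has_derivative f' x) (at x)" "\<And>v. Ck k (\<lambda>x. f' x v)"
  shows "Ck (Suc k) f"
proof -
  have "frechet_derivative f (at x) = f' x" for x
    using assms(1)[of x] by (rule frechet_derivative_at[symmetric])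
  then show ?thesis
    using assms by (auto simp: differentiable_def)
qed

lemma Ck_has_derivative:
  assumes "Ck (Suc k) f"
  shows "(f has_derivative frechet_derivative f (at x)) (at x)"
  using assms by (simp add: frechet_derivative_works)

lemma Ck_SucD: "Ck (Suc k) f \<Longrightarrow> Ck k f"
proof (induction k arbitrary: f)
  case 0
  then show ?case
    by (auto simp: continuous_on_eq_continuous_at intro: differentiable_imp_continuous_within)
next
  case (Suc k)
  then show ?case by auto
qed

lemma Ck_const: "Ck k (\<lambda>x. c)"
proof (induction k arbitrary: c)
  case (Suc k)
  show ?case
    by (rule Ck_SucI[where f' = "\<lambda>x v. 0"]) (auto intro: Suc)
qed simp

lemma Ck_add: "Ck k f \<Longrightarrow> Ck k g \<Longrightarrow> Ck k (\<lambda>x. f x + g x)"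
proof (induction k arbitrary: f g)
  case 0
  then show ?case by (auto intro: continuous_on_add)
next
  case (Suc k)
  show ?case
    by (rule Ck_SucI[OF has_derivative_add[OF Ck_has_derivative Ck_has_derivative]])
       (use Suc in auto)
qed

lemma Ck_scaleR:
  fixes f :: "'a::euclidean_space \<Rightarrow> real" and g :: "'a \<Rightarrow> 'b::euclidean_space"
  shows "Ck k f \<Longrightarrow> Ck k g \<Longrightarrow> Ck k (\<lambda>x. f x *\<^sub>R g x)"
proof (induction k arbitrary: f g)
  case 0
  then show ?case by (auto intro: continuous_on_scaleR)
next
  case (Suc k)
  show ?case
  proof (rule Ck_SucI[OF has_derivative_scaleR[OF Ck_has_derivative Ck_has_derivative]])
    show "Ck k (\<lambda>x. f x *\<^sub>R frechet_derivative g (at x) v + frechet_derivative f (at x) v *\<^sub>R g x)" for v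
      using Suc.prems Suc.prems[THEN Ck_SucD] by (intro Ck_add Suc.IH) auto
  qed (use Suc in auto)
qed

lemma Ck_compose_linear:
  fixes f :: "'b::euclidean_space \<Rightarrow> 'c::euclidean_space" and L :: "'a::euclidean_space \<Rightarrow> 'b"
  assumes "bounded_linear L"
  shows "Ck k f \<Longrightarrow> Ck k (\<lambda>x. f (L x))"
proof (induction k arbitrary: f)
  case 0
  then show ?case
    using assms
    by (simp add: continuous_on_compose2[of UNIV f UNIV L] linear_continuous_on)
next
  case (Suc k)
  show ?case
  proof (rule Ck_SucI)
    show "((\<lambda>x. f (L x)) has_derivative (\<lambda>v. frechet_derivative f (at (L x)) (L v))) (at x)" for x
      using has_derivative_compose[OF bounded_linear_imp_has_derivative[OF assms] Ck_has_derivative[OF Suc.prems]]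
      by simp
    show "Ck k (\<lambda>x. frechet_derivative f (at (L x)) (L v))" for v
      using Suc by auto
  qed
qed

lemma smooth_has_derivative:
  assumes "smooth f"
  shows "(f has_derivative frechet_derivative f (at x)) (at x)"
  using assms Ck_has_derivative[of 0 f x] unfolding smooth_def by blast

lemma smooth_derivative: "smooth f \<Longrightarrow> smooth (\<lambda>x. frechet_derivative f (at x) v)"
  unfolding smooth_def using Ck.simps(2) by blast

lemma smoothI:
  assumes "\<And>x. (f has_derivative f' x) (at x)" "\<And>v. smooth (\<lambda>x. f' x v)"
  shows "smooth f"
proof -
  have "Ck (Suc k) f" for k
    using assms by (intro Ck_SucI) (auto simp: smooth_def)
  then show ?thesis
    unfolding smooth_def using Ck_SucD by blast
qed

lemma smooth_continuous: "smooth f \<Longrightarrow> continuous_on UNIV f"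
  unfolding smooth_def using Ck.simps(1) by blast

lemma smooth_const: "smooth (\<lambda>x. c)"
  by (simp add: smooth_def Ck_const)

lemma smooth_add: "smooth f \<Longrightarrow> smooth g \<Longrightarrow> smooth (\<lambda>x. f x + g x)"
  by (simp add: smooth_def Ck_add)

lemma smooth_scaleR: "smooth f \<Longrightarrow> smooth g \<Longrightarrow> smooth (\<lambda>x. f x *\<^sub>R g x)"
  by (simp add: smooth_def Ck_scaleR)

lemma smooth_mult: "smooth f \<Longrightarrow> smooth g \<Longrightarrow> smooth (\<lambda>x. f x * g x :: real)"
  using smooth_scaleR[of f g] by simp

lemma smooth_minus: "smooth f \<Longrightarrow> smooth (\<lambda>x. - f x)"
  using smooth_scaleR[OF smooth_const[of "-1"], of f] by simp

lemma smooth_diff: "smooth f \<Longrightarrow> smooth g \<Longrightarrow> smooth (\<lambda>x. f x - g x)"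
  using smooth_add[OF _ smooth_minus, of f g] by simp

lemma smooth_power: "smooth f \<Longrightarrow> smooth (\<lambda>x. f x ^ n :: real)"
  by (induction n) (auto intro: smooth_const smooth_mult)

lemma smooth_sum: "(\<And>j. j \<in> J \<Longrightarrow> smooth (f j)) \<Longrightarrow> smooth (\<lambda>x. \<Sum>j\<in>J. f j x)"
  by (induction J rule: infinite_finite_induct) (auto intro: smooth_const smooth_add)

lemma smooth_compose_linear: "smooth f \<Longrightarrow> bounded_linear L \<Longrightarrow> smooth (\<lambda>x. f (L x))"
  by (simp add: smooth_def Ck_compose_linear)

lemma smooth_linear: "bounded_linear L \<Longrightarrow> smooth L"
  by (rule smoothI[where f' = "\<lambda>x. L"]) (auto intro: bounded_linear_imp_has_derivative smooth_const)

lemma smooth_nth: "smooth (\<lambda>x::real^2. x $ i)"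
  by (intro smooth_linear bounded_linear_vec_nth)

text \<open>Composition with a real function from a family that is closed under differentiation up to
  linear combinations with smooth coefficients.  The families below are \<open>exp\<close>; \<open>sin, cos\<close>; the powers of
  \<open>inverse\<close>; and the functions \<open>x \<mapsto> x^(-n) exp (-1/x)\<close>.\<close>

lemma smooth_compose_family:
  fixes F :: "nat \<Rightarrow> real \<Rightarrow> real" and h :: "'a::euclidean_space \<Rightarrow> real"
  assumes h: "smooth h"
    and F: "\<And>n x. (F n has_real_derivative (\<Sum>m\<in>M n. c n m * F m (h x))) (at (h x))"
  shows "smooth (\<lambda>x. F n (h x))"
proof -
  have D: "((\<lambda>x. F n (h x)) has_derivative
      (\<lambda>v. (\<Sum>m\<in>M n. c n m * F m (h x)) * frechet_derivative h (at x) v)) (at x)" for n x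
    using has_derivative_compose[OF smooth_has_derivative[OF h, of x]
        F[of n x, unfolded has_field_derivative_def]] .
  have sum: "Ck k (\<lambda>x. \<Sum>m\<in>N. c n m * F m (h x))" if "\<And>m. Ck k (\<lambda>x. F m (h x))" for k n and N :: "nat set"
  proof (induction N rule: infinite_finite_induct)
    case (insert m N)
    have "Ck k (\<lambda>x. c n m *\<^sub>R F m (h x))"
      by (intro Ck_scaleR Ck_const that)
    then show ?case
      using insert by (auto intro!: Ck_add)
  qed (auto intro: Ck_const)
  have "Ck k (\<lambda>x. F n (h x))" for k n
  proof (induction k arbitrary: n)
    case 0
    show ?case
      unfolding Ck.simps continuous_on_eq_continuous_at[OF open_UNIV]
      using D has_derivative_continuous by blast
  next
    case (Suc k)
    have "Ck k (\<lambda>x. (\<Sum>m\<in>M n. c n m * F m (h x)) *\<^sub>R frechet_derivative h (at x) v)" for v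
      using smooth_derivative[OF h, of v] by (intro Ck_scaleR sum Suc.IH) (auto simp: smooth_def)
    then show ?case
      by (intro Ck_SucI[OF D]) simp
  qed
  then show ?thesis
    by (simp add: smooth_def)
qed

lemma smooth_exp: "smooth h \<Longrightarrow> smooth (\<lambda>x. exp (h x) :: real)"
  by (rule smooth_compose_family[where F = "\<lambda>n. exp" and M = "\<lambda>n. {0}" and c = "\<lambda>n m. 1" and n = 0])
     (auto intro!: derivative_eq_intros)

lemma inverse_power_has_derivative:
  fixes x :: real
  assumes "x \<noteq> 0"
  shows "((\<lambda>x. inverse x ^ n) has_real_derivative - real n * inverse x ^ Suc n) (at x)"
proof (cases n)
  case (Suc m)
  have "((\<lambda>x. inverse x ^ Suc m) has_real_derivative real (Suc m) * (- (inverse x ^ 2) * inverse x ^ m)) (at x)"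
    using DERIV_power[OF DERIV_inverse[OF assms], of "Suc m"]
    by (simp add: numeral_2_eq_2 mult.assoc del: power_Suc of_nat_Suc)
  moreover have "real (Suc m) * (- (inverse x ^ 2) * inverse x ^ m) = - real (Suc m) * inverse x ^ Suc (Suc m)"
    unfolding power2_eq_square power_Suc minus_mult_left[symmetric] by (simp only: mult_minus_left mult_minus_right mult.assoc)
  ultimately show ?thesis
    using Suc by (simp only:)
qed simp

lemma smooth_inverse:
  assumes "smooth h" "\<And>x. h x \<noteq> 0"
  shows "smooth (\<lambda>x. inverse (h x) :: real)"
proof -
  have "smooth (\<lambda>x. inverse (h x) ^ 1)"
  proof (rule smooth_compose_family[where F = "\<lambda>n x. inverse x ^ n" and M = "\<lambda>n. {Suc n}" and c = "\<lambda>n m. - real n" and n = 1])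
    show "((\<lambda>x. inverse x ^ n) has_real_derivative (\<Sum>m\<in>{Suc n}. - real n * inverse (h x) ^ m)) (at (h x))" for n x
      using inverse_power_has_derivative[OF assms(2)[of x], of n] by simp
  qed (rule assms)
  then show ?thesis by simp
qed

lemma smooth_cos: "smooth h \<Longrightarrow> smooth (\<lambda>x. cos (h x) :: real)"
  and smooth_sin: "smooth h \<Longrightarrow> smooth (\<lambda>x. sin (h x) :: real)"
proof -
  assume h: "smooth h"
  let ?F = "\<lambda>n::nat. if n = 0 then cos else sin :: real \<Rightarrow> real"
  have "smooth (\<lambda>x. ?F n (h x))" for n
  proof (rule smooth_compose_family[where F = ?F and M = "\<lambda>n. {if n = 0 then 1 else 0}" and c = "\<lambda>n m. if n = 0 then -1 else 1" and n = n, OF h])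
    show "(?F n has_real_derivative (\<Sum>m\<in>{if n = 0 then 1 else 0}. (if n = 0 then -1 else 1) * ?F m (h x))) (at (h x))" for n x
      using DERIV_cos[of "h x"] DERIV_sin[of "h x"] by simp
  qed
  from this[of 0] this[of 1] show "smooth (\<lambda>x. cos (h x))" "smooth (\<lambda>x. sin (h x))"
    by simp_all
qed

text \<open>The derivatives of \<open>exp (-1/x)\<close> are linear combinations of these functions, which are flat at \<open>0\<close>.\<close>

definition flat_exp :: "nat \<Rightarrow> real \<Rightarrow> real" where
  "flat_exp n x = (if x \<le> 0 then 0 else inverse x ^ n * exp (- inverse x))"

lemma flat_exp_tendsto_0: "(flat_exp n \<longlongrightarrow> 0) (at 0)"
proof -
  have "((\<lambda>t::real. t ^ n / exp t) \<longlongrightarrow> 0) at_top"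
    by (rule tendsto_power_div_exp_0)
  then have "((\<lambda>x::real. inverse x ^ n / exp (inverse x)) \<longlongrightarrow> 0) (at_right 0)"
    by (rule filterlim_compose[OF _ filterlim_inverse_at_top_right])
  then have "(flat_exp n \<longlongrightarrow> 0) (at_right 0)"
    by (rule Lim_transform_eventually)
       (auto simp: eventually_at_filter flat_exp_def exp_minus divide_inverse)
  moreover have "(flat_exp n \<longlongrightarrow> 0) (at_left 0)"
    by (rule Lim_transform_eventually[OF tendsto_const])
       (auto simp: eventually_at_filter flat_exp_def)
  ultimately show ?thesis
    by (simp add: filterlim_split_at)
qed

lemma flat_exp_has_derivative:
  "(flat_exp n has_real_derivative (\<Sum>m\<in>{Suc n, Suc (Suc n)}. (if m = Suc n then - real n else 1) * flat_exp m x)) (at x)"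
  for x :: real
proof -
  consider "x < 0" | "x = 0" | "x > 0" by linarith
  then show ?thesis
  proof cases
    case 1
    have "(flat_exp n has_real_derivative 0) (at x)"
      by (rule has_field_derivative_transform_within_open[OF DERIV_const, where S = "{..<0}"])
         (use 1 in \<open>auto simp: flat_exp_def\<close>)
    then show ?thesis
      using 1 by (simp add: flat_exp_def)
  next
    case 2
    have "(\<lambda>h. flat_exp n (0 + h) / h) = flat_exp (Suc n)"
      by (auto simp: flat_exp_def fun_eq_iff field_simps)
    then have "(flat_exp n has_real_derivative 0) (at 0)"
      using flat_exp_tendsto_0[of "Suc n"] by (simp add: DERIV_def flat_exp_def)
    then show ?thesis
      using 2 by (simp add: flat_exp_def)
  next
    case 3
    have "((\<lambda>x. inverse x ^ n * exp (- inverse x)) has_real_derivative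
            (\<Sum>m\<in>{Suc n, Suc (Suc n)}. (if m = Suc n then - real n else 1) * flat_exp m x)) (at x)"
    proof (rule DERIV_cong)
      have "((\<lambda>x. exp (- inverse x)) has_real_derivative exp (- inverse x) * inverse x ^ 2) (at x)"
        using 3 by (auto intro!: derivative_eq_intros simp: numeral_2_eq_2)
      from DERIV_mult[OF inverse_power_has_derivative[of x n] this]
      show "((\<lambda>x. inverse x ^ n * exp (- inverse x)) has_real_derivative
          - real n * inverse x ^ Suc n * exp (- inverse x) + exp (- inverse x) * inverse x ^ 2 * inverse x ^ n) (at x)"
        using 3 by simp
      show "- real n * inverse x ^ Suc n * exp (- inverse x) + exp (- inverse x) * inverse x ^ 2 * inverse x ^ n =
          (\<Sum>m\<in>{Suc n, Suc (Suc n)}. (if m = Suc n then - real n else 1) * flat_exp m x)"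
        using 3 by (simp add: flat_exp_def power2_eq_square)
    qed
    then show ?thesis
      by (rule has_field_derivative_transform_within_open[where S = "{0<..}"])
         (use 3 in \<open>auto simp: flat_exp_def\<close>)
  qed
qed

lemma smooth_flat_exp: "smooth h \<Longrightarrow> smooth (\<lambda>x. flat_exp n (h x))"
  by (rule smooth_compose_family[OF _ flat_exp_has_derivative])

text \<open>A smooth antiderivative of the bump \<open>exp (-1/(x+1)) exp (1/x)\<close> on \<open>(-1, 0)\<close>.\<close>

lemma smooth_step_exists:
  obtains S \<eta> :: "real \<Rightarrow> real" where
    "\<And>x. (S has_real_derivative - \<eta> x) (at x)"
    "continuous_on UNIV \<eta>" "\<And>x. \<eta> x \<ge> 0" "\<And>x. x \<notin> {-1<..<0} \<Longrightarrow> \<eta> x = 0"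
    "\<And>x. x \<le> -1 \<Longrightarrow> S x = 1" "\<And>x. x \<ge> 0 \<Longrightarrow> S x = 0"
    "\<And>h :: real \<times> (real^2) \<Rightarrow> real. smooth h \<Longrightarrow> smooth (\<lambda>z. S (h z))"
proof -
  define b where "b x = flat_exp 0 (x + 1) * flat_exp 0 (- x)" for x :: real
  have smooth_b: "smooth (\<lambda>z. b (h z))" if "smooth h" for h :: "'a::euclidean_space \<Rightarrow> real"
    unfolding b_def
    using that by (intro smooth_mult smooth_flat_exp smooth_add smooth_const smooth_minus)
  have cont: "continuous_on UNIV b"
    using smooth_b[OF smooth_linear[OF bounded_linear_ident]] by (rule smooth_continuous)
  have nonneg: "b x \<ge> 0" for x
    by (simp add: b_def flat_exp_def)
  have zero: "b x = 0" if "x \<notin> {-1<..<0}" for x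
    using that by (auto simp: b_def flat_exp_def)
  define I where "I x = integral {-2..x} b" for x
  have int_b: "b integrable_on {u..v}" for u v
    using cont by (intro integrable_continuous_interval) (auto intro: continuous_on_subset)
  have I_deriv: "(I has_real_derivative b x) (at x)" for x
  proof (cases "x < -1")
    case True
    have "I y = 0" if "y < -1" for y
    proof -
      have "I y = integral {-2..y} (\<lambda>x. 0)"
        unfolding I_def using that by (intro integral_cong zero) auto
      then show ?thesis by simp
    qed
    then have "(I has_real_derivative 0) (at x)"
      using True by (intro has_field_derivative_transform_within_open[OF DERIV_const, where S = "{..<-1}"]) auto
    then show ?thesis
      using True zero[of x] by simp
  next
    case False
    have "(I has_real_derivative b x) (at x within {-2..x+1})"
      unfolding I_def using False cont
      by (intro integral_has_real_derivative) (auto intro: continuous_on_subset)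
    then show ?thesis
      using False by (simp add: at_within_Icc_at)
  qed
  have I_low: "I x = 0" if "x \<le> -1" for x
  proof -
    have "I x = integral {-2..x} (\<lambda>x. 0)"
      unfolding I_def using that by (intro integral_cong zero) auto
    then show ?thesis by simp
  qed
  have I_high: "I x = I 0" if "x \<ge> 0" for x
  proof -
    have "I x = I 0 + integral {0..x} b"
      unfolding I_def using that by (subst Henstock_Kurzweil_Integration.integral_combine) (auto intro: int_b)
    also have "integral {0..x} b = integral {0..x} (\<lambda>x. 0)"
      using that by (intro integral_cong zero) auto
    finally show ?thesis by simp
  qed
  have I0: "I 0 > 0"
  proof -
    have "I 0 \<ge> 0"
      unfolding I_def by (intro integral_nonneg int_b nonneg)
    moreover have "I 0 \<noteq> 0"
    proof
      assume "I 0 = 0"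
      then have "\<forall>x\<in>{-2..0}. b x = 0"
        using integral_eq_0_iff[OF continuous_on_subset[OF cont subset_UNIV], of "-2" 0] nonneg
        unfolding I_def by simp
      then have "b (-1/2) = 0"
        by (rule bspec) simp
      then show False
        by (simp add: b_def flat_exp_def)
    qed
    ultimately show ?thesis by linarith
  qed
  define S where "S x = 1 - I x / I 0" for x
  have S_deriv: "(S has_real_derivative - (b x / I 0)) (at x)" for x
    unfolding S_def
    by (rule DERIV_cong[OF DERIV_diff[OF DERIV_const DERIV_cdivide[OF I_deriv]]]) simp
  have S_smooth: "smooth (\<lambda>z. S (h z))" if h: "smooth h" for h :: "real \<times> (real^2) \<Rightarrow> real"
  proof (rule smoothI)
    show "((\<lambda>z. S (h z)) has_derivative (\<lambda>v. - (b (h z) / I 0) * frechet_derivative h (at z) v)) (at z)" for z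
      using has_derivative_compose[OF smooth_has_derivative[OF h, of z]
          S_deriv[unfolded has_field_derivative_def]] .
    have "smooth (\<lambda>z. - ((1 / I 0) * b (h z)) * frechet_derivative h (at z) v)" for v
      by (intro smooth_mult smooth_minus smooth_const smooth_b h smooth_derivative)
    then show "smooth (\<lambda>z. - (b (h z) / I 0) * frechet_derivative h (at z) v)" for v
      by simp
  qed
  show ?thesis
  proof (rule that)
    show "(S has_real_derivative - (b x / I 0)) (at x)" for x
      by (rule S_deriv)
    show "continuous_on UNIV (\<lambda>x. b x / I 0)"
      using I0 by (intro continuous_intros cont) auto
    show "b x / I 0 \<ge> 0" for x
      using nonneg[of x] I0 by simp
    show "b x / I 0 = 0" if "x \<notin> {-1<..<0}" for x
      using zero[OF that] by simp
    show "S x = 1" if "x \<le> -1" for x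
      using I_low[OF that] by (simp add: S_def)
    show "S x = 0" if "x \<ge> 0" for x
      using I_high[OF that] I0 by (simp add: S_def)
    show "smooth (\<lambda>z. S (h z))" if "smooth h" for h :: "real \<times> (real^2) \<Rightarrow> real"
      by (rule S_smooth[OF that])
  qed
qed

section \<open>Periodic functions and integration by parts on the torus\<close>

lemma pderiv_atI: "(f has_derivative f') (at x) \<Longrightarrow> pderiv_at i f x = f' (axis i 1)"
  unfolding pderiv_at_def by (simp add: frechet_derivative_at[symmetric])

lemma smooth_pderiv: "smooth f \<Longrightarrow> smooth (pderiv_at i f)"
  unfolding pderiv_at_def[abs_def] by (rule smooth_derivative)

lemma pderiv_const: "pderiv_at i (\<lambda>x. c) x = 0"
  by (rule pderiv_atI[OF has_derivative_const])

lemma pderiv_add: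
  assumes "smooth f" "smooth g"
  shows "pderiv_at i (\<lambda>x. f x + g x) x = pderiv_at i f x + pderiv_at i g x"
  using pderiv_atI[OF has_derivative_add[OF smooth_has_derivative[OF assms(1)] smooth_has_derivative[OF assms(2)]]]
  by (simp add: pderiv_at_def)

lemma pderiv_scaleR:
  fixes f :: "real^2 \<Rightarrow> real"
  assumes "smooth f" "smooth g"
  shows "pderiv_at i (\<lambda>x. f x *\<^sub>R g x) x = f x *\<^sub>R pderiv_at i g x + pderiv_at i f x *\<^sub>R g x"
  using pderiv_atI[OF has_derivative_scaleR[OF smooth_has_derivative[OF assms(1)] smooth_has_derivative[OF assms(2)]]]
  by (simp add: pderiv_at_def)

lemma pderiv_mult:
  fixes f g :: "real^2 \<Rightarrow> real"
  shows "smooth f \<Longrightarrow> smooth g \<Longrightarrow>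
    pderiv_at i (\<lambda>x. f x * g x) x = f x * pderiv_at i g x + pderiv_at i f x * g x"
  using pderiv_scaleR[of f g i x] by (simp only: real_scaleR_def)

lemma pderiv_cmult:
  fixes f :: "real^2 \<Rightarrow> real"
  shows "smooth f \<Longrightarrow> pderiv_at i (\<lambda>x. c * f x) x = c * pderiv_at i f x"
  by (simp add: pderiv_mult smooth_const pderiv_const)

lemma pderiv_sum:
  "(\<And>j. j \<in> J \<Longrightarrow> smooth (f j)) \<Longrightarrow>
    pderiv_at i (\<lambda>x. \<Sum>j\<in>J. f j x) x = (\<Sum>j\<in>J. pderiv_at i (f j) x)"
  by (induction J rule: infinite_finite_induct) (auto simp: pderiv_const pderiv_add smooth_sum)

lemma pderiv_chain:
  fixes h :: "real^2 \<Rightarrow> real"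
  assumes "smooth h" "(F has_real_derivative F') (at (h x))"
  shows "pderiv_at i (\<lambda>x. F (h x)) x = F' * pderiv_at i h x"
  using pderiv_atI[OF has_derivative_compose[OF smooth_has_derivative[OF assms(1)]
        assms(2)[unfolded has_field_derivative_def]]]
  by (simp add: pderiv_at_def)

lemma pderiv_along_axis:
  fixes f :: "real^2 \<Rightarrow> real"
  assumes "smooth f"
  shows "((\<lambda>t. f (x + axis i t)) has_real_derivative pderiv_at i f (x + axis i t)) (at t)"
proof -
  have "linear (axis i :: real \<Rightarrow> real^2)"
    by (rule linearI) (auto simp: axis_def vec_eq_iff)
  then have "bounded_linear (axis i :: real \<Rightarrow> real^2)"
    by (rule linear_conv_bounded_linear[THEN iffD1])
  then have "((\<lambda>t. x + axis i t) has_derivative (axis i :: real \<Rightarrow> real^2)) (at t)"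
    by (auto intro!: derivative_eq_intros bounded_linear_imp_has_derivative)
  from has_derivative_compose[OF this smooth_has_derivative[OF assms]]
  have D: "((\<lambda>t. f (x + axis i t)) has_derivative
      (\<lambda>s. frechet_derivative f (at (x + axis i t)) (axis i s))) (at t)" .
  have lin: "linear (frechet_derivative f (at (x + axis i t)))"
    using smooth_has_derivative[OF assms] has_derivative_linear by blast
  have "s *\<^sub>R (axis i 1 :: real^2) = axis i s" for s
    by (auto simp: axis_def vec_eq_iff)
  then have "frechet_derivative f (at (x + axis i t)) (axis i s) = pderiv_at i f (x + axis i t) * s" for s
    using linear_scale[OF lin, of s "axis i 1"] by (simp add: pderiv_at_def mult.commute)
  then have "(\<lambda>s. frechet_derivative f (at (x + axis i t)) (axis i s)) = (*) (pderiv_at i f (x + axis i t))"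
    by (rule ext)
  with D show ?thesis
    unfolding has_field_derivative_def by (simp only:)
qed

lemma periodic_pderiv:
  assumes f: "smooth f" and per: "periodic f"
  shows "periodic (pderiv_at i f)"
  unfolding periodic_def
proof (intro allI)
  fix x :: "real^2" and j
  let ?c = "axis j (2 * pi) :: real^2"
  have "((\<lambda>y. y + ?c) has_derivative (\<lambda>v. v)) (at x)"
    by (auto intro!: derivative_eq_intros)
  from has_derivative_compose[OF this smooth_has_derivative[OF f]]
  have "((\<lambda>y. f (y + ?c)) has_derivative frechet_derivative f (at (x + ?c))) (at x)" .
  moreover have "(\<lambda>y. f (y + ?c)) = f"
    using per by (auto simp: periodic_def)
  ultimately have "(f has_derivative frechet_derivative f (at (x + ?c))) (at x)"
    by (simp only:)
  from pderiv_atI[OF this, of i] show "pderiv_at i f (x + ?c) = pderiv_at i f x"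
    unfolding pderiv_at_def[of i f "x + ?c"] by (rule sym)
qed

lemma test_function_smooth: "test_function f \<Longrightarrow> smooth f"
  by (simp add: test_function_def)

lemma test_function_continuous: "test_function f \<Longrightarrow> continuous_on UNIV f"
  by (simp add: test_function_def smooth_continuous)

lemma test_function_pderiv: "test_function f \<Longrightarrow> test_function (pderiv_at i f)"
  by (simp add: test_function_def smooth_pderiv periodic_pderiv)

lemma test_function_const: "test_function (\<lambda>x. c)"
  by (simp add: test_function_def smooth_const periodic_def)

lemma test_function_add: "test_function f \<Longrightarrow> test_function g \<Longrightarrow> test_function (\<lambda>x. f x + g x)"
  by (simp add: test_function_def smooth_add periodic_def)

lemma test_function_diff: "test_function f \<Longrightarrow> test_function g \<Longrightarrow> test_function (\<lambda>x. f x - g x)"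
  by (simp add: test_function_def smooth_diff periodic_def)

lemma test_function_mult: "test_function f \<Longrightarrow> test_function g \<Longrightarrow> test_function (\<lambda>x. f x * g x)"
  by (simp add: test_function_def smooth_mult periodic_def)

lemma test_function_power: "test_function f \<Longrightarrow> test_function (\<lambda>x. f x ^ n)"
  by (simp add: test_function_def smooth_power periodic_def)

lemma test_function_sum:
  "(\<And>j. j \<in> J \<Longrightarrow> test_function (f j)) \<Longrightarrow> test_function (\<lambda>x. \<Sum>j\<in>J. f j x)"
  by (simp add: test_function_def smooth_sum periodic_def)

lemma test_function_laplacian: "test_function f \<Longrightarrow> test_function (laplacian f)"
  unfolding laplacian_def[abs_def] by (intro test_function_sum test_function_pderiv)

lemma periodic_nat: "periodic f \<Longrightarrow> f (x + axis i (2 * pi * real n)) = f x"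
proof (induction n)
  case (Suc n)
  have "x + axis i (2 * pi * real (Suc n)) = (x + axis i (2 * pi * real n)) + axis i (2 * pi)"
    by (auto simp: vec_eq_iff axis_def algebra_simps)
  then have "f (x + axis i (2 * pi * real (Suc n))) = f ((x + axis i (2 * pi * real n)) + axis i (2 * pi))"
    by (simp only:)
  also have "\<dots> = f (x + axis i (2 * pi * real n))"
    using Suc.prems unfolding periodic_def by blast
  finally show ?case
    using Suc.IH[OF Suc.prems] by (simp only:)
next
  case 0
  have "axis i 0 = (0 :: real^2)"
    by (auto simp: vec_eq_iff axis_def)
  then show ?case by (simp only: of_nat_0 mult_zero_right add_0_right)
qed

lemma periodic_int:
  assumes "periodic f"
  shows "f (x + axis i (2 * pi * real_of_int k)) = f x"
proof (cases "k \<ge> 0")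
  case True
  then show ?thesis
    using periodic_nat[OF assms, of x i "nat k"] by simp
next
  case False
  have "(x + axis i (2 * pi * real_of_int k)) + axis i (2 * pi * real (nat (- k))) = x"
    using False by (auto simp: vec_eq_iff axis_def)
  then show ?thesis
    using periodic_nat[OF assms, of "x + axis i (2 * pi * real_of_int k)" i "nat (- k)"] by (simp only:)
qed

lemma lborel_integral_shift:
  fixes F :: "real^2 \<Rightarrow> real"
  assumes "F \<in> borel_measurable borel"
  shows "(LINT x|lborel. F (x + c)) = (LINT x|lborel. F x)"
proof -
  have "(LINT x|lborel. F x) = (LINT x|distr lborel borel ((+) c). F x)"
    by (simp add: lborel_distr_plus)
  also have "\<dots> = (LINT x|lborel. F (c + x))"
    using assms by (subst integral_distr) auto
  finally show ?thesis
    by (simp add: add.commute)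
qed

lemma torus_integral_lborel:
  fixes F :: "real^2 \<Rightarrow> real"
  assumes "F \<in> borel_measurable borel"
  shows "(TINT x. F x) = (LINT x|lborel. indicator torus x * F x)"
  using assms torus_borel torus_sets
  by (simp add: integral_restrict_space integral_completion)

text \<open>A shift along an axis by less than one period pushes a slab out of the cell, and periodicity
  moves the slab back to the other end.\<close>

lemma integral_torus_shift_axis:
  fixes F :: "real^2 \<Rightarrow> real"
  assumes F: "continuous_on UNIV F" and per: "periodic F"
  shows "(TINT x. F (x + axis i h)) = (TINT x. F x)"
proof -
  have meas: "F \<in> borel_measurable borel"
    using F by (rule borel_measurable_continuous_onI)
  have base: "(TINT x. F (x + axis i h)) = (TINT x. F x)"
    if h: "0 \<le> h" "h \<le> 2 * pi" for h
  proof -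
    define A where "A = {x \<in> torus. h \<le> x $ i}"
    define B where "B = {x \<in> torus. x $ i < h}"
    have AB: "A \<in> sets borel" "B \<in> sets borel"
    proof -
      have "A = torus \<inter> {x. h \<le> x $ i}" "B = torus \<inter> {x. x $ i < h}"
        by (auto simp: A_def B_def)
      then show "A \<in> sets borel" "B \<in> sets borel"
        using torus_borel by auto
    qed
    have fin: "emeasure lborel S \<noteq> \<infinity>" if "S \<subseteq> torus" "S \<in> sets borel" for S
    proof -
      have "S \<in> lmeasurable"
        using fmeasurableI2[OF torus_lmeasurable that(1)] that(2) by simp
      then show ?thesis
        using that(2) by (auto simp: fmeasurable_def)
    qed
    obtain C where C: "\<And>x. x \<in> torus \<Longrightarrow> norm (F x) \<le> C"
      using continuous_bounded_torus[OF F] by blast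
    have int: "integrable lborel (\<lambda>x. indicator S x * F x)" if "S \<subseteq> torus" "S \<in> sets borel" for S
    proof (rule integrableI_bounded_set[of S _ _ C])
      show "emeasure lborel S < \<infinity>"
        using fin[OF that] by (simp add: less_top)
      show "AE x in lborel. x \<in> S \<longrightarrow> norm (indicator S x * F x) \<le> C"
        using C that(1) by (auto simp: indicator_def)
    qed (use that meas in auto)
    have split: "indicator torus (x - axis i h) * F x =
        indicator A x * F x + indicator B (x - axis i (2 * pi)) * F x" for x :: "real^2"
    proof -
      define Q where "Q = (\<forall>j. j \<noteq> i \<longrightarrow> 0 \<le> x $ j \<and> x $ j < 2 * pi)"
      have mem: "x - axis i c \<in> torus \<longleftrightarrow> (0 \<le> x $ i - c \<and> x $ i - c < 2 * pi) \<and> Q" for c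
      proof -
        have "(x - axis i c) $ j = (if j = i then x $ i - c else x $ j)" for j
          by (simp add: axis_def)
        then show ?thesis
          unfolding torus_def mem_Collect_eq Q_def by metis
      qed
      have A: "x \<in> A \<longleftrightarrow> (0 \<le> x $ i \<and> x $ i < 2 * pi) \<and> Q \<and> h \<le> x $ i"
        unfolding A_def torus_def Q_def by auto
      have B: "x - axis i (2 * pi) \<in> B \<longleftrightarrow>
          (0 \<le> x $ i - 2 * pi \<and> x $ i - 2 * pi < 2 * pi) \<and> Q \<and> x $ i - 2 * pi < h"
        unfolding B_def using mem[of "2 * pi"] by (auto simp: axis_def)
      have "x - axis i h \<in> torus \<longleftrightarrow> x \<in> A \<or> x - axis i (2 * pi) \<in> B" "\<not> (x \<in> A \<and> x - axis i (2 * pi) \<in> B)"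
        unfolding mem A B using h by (cases Q; linarith)+
      then show ?thesis
        by (auto simp: indicator_def)
    qed
    have B_back: "indicator B (x - axis i (2 * pi)) * F x =
        (\<lambda>y. indicator B y * F (y + axis i (2 * pi))) (x + (- axis i (2 * pi)))" for x
      by simp
    have perF: "F (y + axis i (2 * pi)) = F y" for y
      using per by (simp add: periodic_def)
    have int_B': "integrable lborel (\<lambda>x. indicator B (x - axis i (2 * pi)) * F x)"
    proof -
      have "integrable (distr lborel borel ((+) (- axis i (2 * pi)))) (\<lambda>y. indicator B y * F y)"
        using int[of B] AB by (simp add: lborel_distr_plus B_def)
      then have "integrable lborel (\<lambda>x. indicator B (- axis i (2 * pi) + x) * F (- axis i (2 * pi) + x))"
        using AB meas by (subst (asm) integrable_distr_eq) auto
      moreover have "F (- axis i (2 * pi) + x) = F x" for x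
        using perF[of "- axis i (2 * pi) + x"] by simp
      ultimately show ?thesis
        by simp
    qed
    have "(TINT x. F (x + axis i h)) = (LINT x|lborel. indicator torus x * F (x + axis i h))"
      by (intro torus_integral_lborel measurable_compose[OF _ meas]) simp
    also have "\<dots> = (LINT x|lborel. (\<lambda>y. indicator torus (y - axis i h) * F y) (x + axis i h))"
      by simp
    also have "\<dots> = (LINT y|lborel. indicator torus (y - axis i h) * F y)"
    proof (rule lborel_integral_shift)
      have "(\<lambda>y. indicator torus (y - axis i h) :: real) \<in> borel_measurable borel"
        using torus_borel
        by (intro measurable_compose[of "\<lambda>y. y - axis i h" borel borel "indicator torus"] borel_measurable_indicator) simp_all
      then show "(\<lambda>y. indicator torus (y - axis i h) * F y) \<in> borel_measurable borel"
        using meas by (rule borel_measurable_times)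
    qed
    also have "\<dots> = (LINT y|lborel. indicator A y * F y) + (LINT y|lborel. indicator B (y - axis i (2 * pi)) * F y)"
      unfolding split using AB by (intro Bochner_Integration.integral_add int int_B') (auto simp: A_def)
    also have "(LINT y|lborel. indicator B (y - axis i (2 * pi)) * F y) = (LINT y|lborel. indicator B y * F y)"
      unfolding B_back using AB meas by (subst lborel_integral_shift) (auto simp: perF)
    also have "(LINT y|lborel. indicator A y * F y) + (LINT y|lborel. indicator B y * F y) =
        (LINT y|lborel. indicator torus y * F y)"
    proof -
      have "integrable lborel (\<lambda>y. indicator A y * F y)" "integrable lborel (\<lambda>y. indicator B y * F y)"
        using AB by (auto intro!: int simp: A_def B_def)
      then show ?thesis
        by (intro trans[OF Bochner_Integration.integral_add[symmetric]] Bochner_Integration.integral_cong)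
           (auto simp: A_def B_def indicator_def)
    qed
    also have "\<dots> = (TINT x. F x)"
      using meas by (rule torus_integral_lborel[symmetric])
    finally show ?thesis .
  qed
  define k where "k = \<lfloor>h / (2 * pi)\<rfloor>"
  define h0 where "h0 = h - 2 * pi * k"
  have "real_of_int k \<le> h / (2 * pi)" "h / (2 * pi) < real_of_int k + 1"
    unfolding k_def by linarith+
  then have "0 \<le> h0" "h0 \<le> 2 * pi"
    unfolding h0_def by (auto simp: field_simps)
  have "F (x + axis i h) = F (x + axis i h0)" for x
  proof -
    have "x + axis i h = (x + axis i h0) + axis i (2 * pi * real_of_int k)"
      by (auto simp: vec_eq_iff axis_def h0_def)
    then show ?thesis
      using periodic_int[OF per, of "x + axis i h0" i k] by (simp only:)
  qed
  then show ?thesis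
    using base[OF \<open>0 \<le> h0\<close> \<open>h0 \<le> 2 * pi\<close>] by simp
qed

lemma integral_torus_shift:
  fixes F :: "real^2 \<Rightarrow> real"
  assumes F: "continuous_on UNIV F" and per: "periodic F"
  shows "(TINT x. F (x + z)) = (TINT x. F x)"
proof -
  have z: "x + z = (x + axis 2 (z $ 2)) + axis 1 (z $ 1)" for x :: "real^2"
    by (auto simp: vec_eq_iff axis_def forall_2)
  define F1 where "F1 x = F (x + axis 1 (z $ 1))" for x
  have "continuous_on UNIV F1"
    unfolding F1_def by (intro continuous_on_compose2[OF F] continuous_intros) auto
  moreover have "periodic F1"
    unfolding periodic_def F1_def
  proof (intro allI)
    fix x :: "real^2" and j
    have "x + axis j (2 * pi) + axis 1 (z $ 1) = (x + axis 1 (z $ 1)) + axis j (2 * pi)"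
      by (simp add: algebra_simps)
    moreover have "F ((x + axis 1 (z $ 1)) + axis j (2 * pi)) = F (x + axis 1 (z $ 1))"
      using per unfolding periodic_def by blast
    ultimately show "F (x + axis j (2 * pi) + axis 1 (z $ 1)) = F (x + axis 1 (z $ 1))"
      by (simp only:)
  qed
  ultimately have "(TINT x. F1 (x + axis 2 (z $ 2))) = (TINT x. F1 x)"
    by (rule integral_torus_shift_axis)
  also have "\<dots> = (TINT x. F x)"
    unfolding F1_def by (rule integral_torus_shift_axis[OF F per])
  finally show ?thesis
    unfolding F1_def z .
qed

text \<open>The integral of the difference quotient vanishes by translation invariance.\<close>

lemma integral_torus_pderiv:
  assumes "test_function f"
  shows "(TINT x. pderiv_at i f x) = 0"
proof -
  have f: "smooth f" "continuous_on UNIV f" "periodic f"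
    using assms by (auto simp: test_function_def smooth_continuous)
  have f': "continuous_on UNIV (pderiv_at i f)"
    by (intro smooth_continuous smooth_pderiv f)
  define d where "d n x = (f (x + axis i (1 / real (Suc n))) - f x) * real (Suc n)" for n x
  have cont_shift: "continuous_on UNIV (\<lambda>x. f (x + axis i c))" for c
    by (intro continuous_on_compose2[OF f(2)] continuous_intros) auto
  have d_cont: "continuous_on UNIV (d n)" for n
    unfolding d_def by (intro continuous_intros cont_shift f)
  have "(TINT x. d n x) = 0" for n
    unfolding d_def using integral_torus_shift_axis[OF f(2,3), of i "1 / real (Suc n)"]
    by (simp add: Bochner_Integration.integral_diff integrable_torus_continuous cont_shift f del: of_nat_Suc)
  moreover have "(\<lambda>n. TINT x. d n x) \<longlonglongrightarrow> (TINT x. pderiv_at i f x)"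
  proof -
    let ?K = "cbox 0 (\<chi> i. 2 * pi + 1) :: (real^2) set"
    have "bounded (pderiv_at i f ` ?K)"
      using f' by (intro compact_imp_bounded compact_continuous_image) (auto intro: continuous_on_subset)
    then obtain C where C: "\<And>x. x \<in> ?K \<Longrightarrow> \<bar>pderiv_at i f x\<bar> \<le> C"
      by (auto simp: bounded_iff)
    show ?thesis
    proof (rule integral_dominated_convergence[where w = "\<lambda>x. C"])
      show "AE x in torus_measure. (\<lambda>n. d n x) \<longlonglongrightarrow> pderiv_at i f x"
      proof (rule AE_I2)
        fix x :: "real^2"
        have ax0: "axis i 0 = (0 :: real^2)"
          by (auto simp: vec_eq_iff axis_def)
        have "((\<lambda>h. (f (x + axis i h) - f x) / h) \<longlongrightarrow> pderiv_at i f x) (at 0)"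
          using pderiv_along_axis[OF f(1), of x i 0] by (simp add: DERIV_def ax0)
        moreover have "filterlim (\<lambda>n. 1 / real (Suc n)) (at 0) sequentially"
          using LIMSEQ_inverse_real_of_nat
          by (auto simp: filterlim_at inverse_eq_divide simp del: of_nat_Suc)
        ultimately have "(\<lambda>n. (f (x + axis i (1 / real (Suc n))) - f x) / (1 / real (Suc n))) \<longlonglongrightarrow> pderiv_at i f x"
          by (rule filterlim_compose)
        then show "(\<lambda>n. d n x) \<longlonglongrightarrow> pderiv_at i f x"
          by (simp add: d_def del: of_nat_Suc)
      qed
      show "AE x in torus_measure. norm (d n x) \<le> C" for n
      proof (rule AE_I2)
        fix x assume "x \<in> space torus_measure"
        then have x: "x \<in> torus" by simp
        let ?h = "1 / real (Suc n)"
        have h: "0 < ?h" "?h \<le> 1" by auto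
        have ax0: "axis i 0 = (0 :: real^2)"
          by (auto simp: vec_eq_iff axis_def)
        obtain t where t: "0 < t" "t < ?h"
            "f (x + axis i ?h) - f (x + axis i 0) = (?h - 0) * pderiv_at i f (x + axis i t)"
          using MVT2[of 0 ?h "\<lambda>t. f (x + axis i t)" "\<lambda>t. pderiv_at i f (x + axis i t)"]
            pderiv_along_axis[OF f(1)] h by blast
        have "x + axis i t \<in> ?K"
        proof -
          have "0 \<le> x $ j \<and> x $ j < 2 * pi" for j
            using x by (auto simp: torus_def)
          moreover have "0 \<le> (axis i t :: real^2) $ j \<and> (axis i t :: real^2) $ j \<le> 1" for j
            using t(1) less_imp_le[OF less_le_trans[OF t(2) h(2)]] by (simp add: axis_def del: of_nat_Suc)
          ultimately have "0 \<le> (x + axis i t) $ j \<and> (x + axis i t) $ j \<le> 2 * pi + 1" for j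
            by (metis (no_types, lifting) add_mono add_nonneg_nonneg less_imp_le vector_add_component)
          then show ?thesis
            unfolding mem_box_cart by simp
        qed
        then have "\<bar>pderiv_at i f (x + axis i t)\<bar> \<le> C"
          by (rule C)
        moreover have "d n x = pderiv_at i f (x + axis i t)"
          using t(3) by (simp add: d_def ax0 del: of_nat_Suc)
        ultimately show "norm (d n x) \<le> C"
          by simp
      qed
    qed (auto intro!: continuous_measurable_torus d_cont f' simp: TM.integrable_const)
  qed
  ultimately show ?thesis
    by (simp add: LIMSEQ_const_iff)
qed

lemma integral_torus_by_parts:
  fixes f g :: "real^2 \<Rightarrow> real"
  assumes "test_function f" "test_function g"
  shows "(TINT x. f x * pderiv_at i g x) = - (TINT x. pderiv_at i f x * g x)"
proof -
  have "(TINT x. pderiv_at i (\<lambda>x. f x * g x) x) = 0"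
    by (rule integral_torus_pderiv[OF test_function_mult[OF assms]])
  then have "(TINT x. f x * pderiv_at i g x + pderiv_at i f x * g x) = 0"
    unfolding pderiv_mult[OF test_function_smooth[OF assms(1)] test_function_smooth[OF assms(2)]] .
  moreover have "integrable torus_measure (\<lambda>x. f x * pderiv_at i g x)"
      "integrable torus_measure (\<lambda>x. pderiv_at i f x * g x)"
    by (rule integrable_torus_continuous[OF test_function_continuous];
        rule test_function_mult; (rule test_function_pderiv)?; rule assms)+
  ultimately show ?thesis
    by simp
qed

section \<open>Commuting partial derivatives\<close>

text \<open>Two applications of the mean value theorem.  The second difference is symmetric in \<open>i\<close> and \<open>j\<close>, so that
  letting \<open>h\<close> tend to zero shows that the partial derivatives commute.\<close>

lemma second_difference:
  fixes f :: "real^2 \<Rightarrow> real"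
  assumes f: "smooth f" and h: "h > 0"
  obtains s t where "0 < s" "s < h" "0 < t" "t < h"
    "f (x + axis i h + axis j h) - f (x + axis i h) - f (x + axis j h) + f x =
      h * h * pderiv_at j (pderiv_at i f) (x + axis i s + axis j t)"
proof -
  define G where "G s = f (x + axis j h + axis i s) - f (x + axis i s)" for s
  have ax0: "axis k 0 = (0 :: real^2)" for k
    by (auto simp: vec_eq_iff axis_def)
  have "(G has_real_derivative
      pderiv_at i f (x + axis j h + axis i s) - pderiv_at i f (x + axis i s)) (at s)" for s
    unfolding G_def by (intro DERIV_diff pderiv_along_axis f)
  then obtain s where s: "0 < s" "s < h"
      "G h - G 0 = (h - 0) * (pderiv_at i f (x + axis j h + axis i s) - pderiv_at i f (x + axis i s))"
    using MVT2[OF h, of G "\<lambda>s. pderiv_at i f (x + axis j h + axis i s) - pderiv_at i f (x + axis i s)"] by blast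
  obtain t where t: "0 < t" "t < h"
      "pderiv_at i f (x + axis i s + axis j h) - pderiv_at i f (x + axis i s + axis j 0) =
        (h - 0) * pderiv_at j (pderiv_at i f) (x + axis i s + axis j t)"
    using MVT2[OF h, of "\<lambda>t. pderiv_at i f (x + axis i s + axis j t)"
        "\<lambda>t. pderiv_at j (pderiv_at i f) (x + axis i s + axis j t)"]
      pderiv_along_axis[OF smooth_pderiv[OF f]] by blast
  have comm: "x + axis j h + axis i c = x + axis i c + axis j h" for c
    by (simp add: add.assoc add.commute)
  have "G h - G 0 = h * (h * pderiv_at j (pderiv_at i f) (x + axis i s + axis j t))"
    using s(3) t(3) unfolding comm ax0 by simp
  then show ?thesis
    using that[OF s(1,2) t(1,2)] unfolding G_def comm ax0 by (simp add: algebra_simps)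
qed

lemma pderiv_commute:
  fixes f :: "real^2 \<Rightarrow> real"
  assumes f: "smooth f"
  shows "pderiv_at i (pderiv_at j f) x = pderiv_at j (pderiv_at i f) x"
proof (rule ccontr)
  define a where "a = pderiv_at i (pderiv_at j f)"
  define b where "b = pderiv_at j (pderiv_at i f)"
  assume "\<not> ?thesis"
  then have pos: "\<bar>a x - b x\<bar> / 2 > 0"
    by (simp add: a_def b_def)
  have "continuous_on UNIV a" "continuous_on UNIV b"
    unfolding a_def b_def by (intro smooth_continuous smooth_pderiv f)+
  then obtain d e where d: "d > 0" "\<And>y. dist y x < d \<Longrightarrow> dist (a y) (a x) < \<bar>a x - b x\<bar> / 2"
      and e: "e > 0" "\<And>y. dist y x < e \<Longrightarrow> dist (b y) (b x) < \<bar>a x - b x\<bar> / 2"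
    using pos unfolding continuous_on_iff by (metis UNIV_I)
  define h where "h = min d e / 2"
  have h: "h > 0"
    using d e by (simp add: h_def)
  obtain s t where st: "0 < s" "s < h" "0 < t" "t < h"
    "f (x + axis i h + axis j h) - f (x + axis i h) - f (x + axis j h) + f x =
      h * h * b (x + axis i s + axis j t)"
    unfolding b_def by (rule second_difference[OF f h])
  obtain s' t' where st': "0 < s'" "s' < h" "0 < t'" "t' < h"
    "f (x + axis j h + axis i h) - f (x + axis j h) - f (x + axis i h) + f x =
      h * h * a (x + axis j s' + axis i t')"
    unfolding a_def by (rule second_difference[OF f h])
  have "x + axis j h + axis i h = x + axis i h + axis j h"
    by (simp add: add.assoc add.commute)
  then have "h * h * a (x + axis j s' + axis i t') = h * h * b (x + axis i s + axis j t)"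
    using st(5) st'(5) by (simp only:)
  then have eq: "a (x + axis j s' + axis i t') = b (x + axis i s + axis j t)"
    using h by simp
  have near: "dist (x + axis k s + axis l t) x < 2 * h" if "0 < s" "s < h" "0 < t" "t < h" for k l s t
  proof -
    have "norm (axis k s + axis l t :: real^2) \<le> norm (axis k s :: real^2) + norm (axis l t :: real^2)"
      by (rule norm_triangle_ineq)
    moreover have "norm (axis k s :: real^2) = \<bar>s\<bar>" for k s
    proof -
      have "(axis k s :: real^2) = s *\<^sub>R axis k 1"
        by (auto simp: axis_def vec_eq_iff)
      then show ?thesis
        by (simp only: norm_scaleR norm_axis_1 mult_1_right)
    qed
    ultimately show ?thesis
      using that by (simp add: dist_norm add.assoc)
  qed
  have 1: "dist (b (x + axis i s + axis j t)) (a x) < \<bar>a x - b x\<bar> / 2"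
    using near[OF st'(1-4), of j i] unfolding eq[symmetric] by (intro d) (auto simp: h_def)
  have 2: "dist (b (x + axis i s + axis j t)) (b x) < \<bar>a x - b x\<bar> / 2"
    using near[OF st(1-4), of i j] by (intro e) (auto simp: h_def)
  have "dist (a x) (b x) < \<bar>a x - b x\<bar>"
    using le_less_trans[OF dist_triangle3 add_strict_mono[OF 1 2]] by (simp only: field_sum_of_halves)
  then show False
    by (simp add: dist_real_def)
qed

section \<open>Trigonometric kernels\<close>

lemma pderiv_nth: "pderiv_at i (\<lambda>x. x $ j) x = (if i = j then 1 else 0)"
  using pderiv_atI[OF bounded_linear_imp_has_derivative[OF bounded_linear_vec_nth[of j]], of i x]
  by (simp add: axis_def)

lemma test_function_cos: "test_function (\<lambda>x. cos (x $ i - c))"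
  unfolding test_function_def
proof
  show "smooth (\<lambda>x::real^2. cos (x $ i - c))"
    by (intro smooth_cos smooth_diff smooth_nth smooth_const)
  have "cos (a + 2 * pi - c) = cos (a - c)" for a
    using cos_periodic[of "a - c"] by (simp add: algebra_simps)
  then show "periodic (\<lambda>x::real^2. cos (x $ i - c))"
    by (auto simp: periodic_def axis_def)
qed

lemma test_function_sin: "test_function (\<lambda>x. sin (x $ i - c))"
  unfolding test_function_def
proof
  show "smooth (\<lambda>x::real^2. sin (x $ i - c))"
    by (intro smooth_sin smooth_diff smooth_nth smooth_const)
  have "sin (a + 2 * pi - c) = sin (a - c)" for a
    using sin_periodic[of "a - c"] by (simp add: algebra_simps)
  then show "periodic (\<lambda>x::real^2. sin (x $ i - c))"
    by (auto simp: periodic_def axis_def)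
qed

lemmas test_function_cos0 = test_function_cos[of _ 0, simplified]
lemmas test_function_sin0 = test_function_sin[of _ 0, simplified]

text \<open>The integral of this derivative over a period vanishes, which relates consecutive moments of the weight.\<close>

lemma has_derivative_cos_weight:
  fixes t :: real
  shows "((\<lambda>t. sin t * ((1 - cos t) ^ a * (1 + cos t) ^ m)) has_real_derivative
    (2 * real a + 1) * ((1 - cos t) ^ a * (1 + cos t) ^ m) -
      (real a + real m + 1) * ((1 - cos t) ^ Suc a * (1 + cos t) ^ m)) (at t)"
proof (rule DERIV_cong)
  have 1: "((\<lambda>t. (1 - cos t) ^ a) has_real_derivative real a * ((1 - cos t) ^ (a - 1) * sin t)) (at t)"
    by (rule DERIV_cong[OF DERIV_power[where f = "\<lambda>t. 1 - cos t" and D = "sin t"]])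
       (auto intro!: derivative_eq_intros)
  have 2: "((\<lambda>t. (1 + cos t) ^ m) has_real_derivative real m * ((1 + cos t) ^ (m - 1) * - sin t)) (at t)"
    by (rule DERIV_cong[OF DERIV_power[where f = "\<lambda>t. 1 + cos t" and D = "- sin t"]])
       (auto intro!: derivative_eq_intros)
  show "((\<lambda>t. sin t * ((1 - cos t) ^ a * (1 + cos t) ^ m)) has_real_derivative
     cos t * ((1 - cos t) ^ a * (1 + cos t) ^ m) +
      (real a * ((1 - cos t) ^ (a - 1) * sin t) * (1 + cos t) ^ m +
       real m * ((1 + cos t) ^ (m - 1) * - sin t) * (1 - cos t) ^ a) * sin t) (at t)"
    by (rule DERIV_mult[OF DERIV_sin DERIV_mult[OF 1 2]])
  define p q where "p = 1 - cos t" and "q = 1 + cos t"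
  have s2: "sin t * sin t = p * q"
    using sin_squared_eq[of t] by (simp add: p_def q_def power2_eq_square algebra_simps)
  have a: "real a * p ^ (a - 1) * p = real a * p ^ a"
    by (cases a) auto
  have m: "real m * q ^ (m - 1) * q = real m * q ^ m"
    by (cases m) auto
  have c: "cos t = q - 1" "q = 2 - p"
    by (auto simp: p_def q_def)
  have "cos t * (p ^ a * q ^ m) +
      (real a * (p ^ (a - 1) * sin t) * q ^ m + real m * (q ^ (m - 1) * - sin t) * p ^ a) * sin t =
      cos t * (p ^ a * q ^ m) + (real a * p ^ (a - 1)) * (sin t * sin t) * q ^ m -
        (real m * q ^ (m - 1)) * (sin t * sin t) * p ^ a"
    by (simp add: algebra_simps)
  also have "\<dots> = cos t * (p ^ a * q ^ m) + (real a * p ^ (a - 1) * p) * q * q ^ m -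
        (real m * q ^ (m - 1) * q) * p * p ^ a"
    unfolding s2 by (simp add: algebra_simps)
  also have "\<dots> = (cos t + real a * q - real m * p) * (p ^ a * q ^ m)"
    unfolding a m by (simp add: algebra_simps)
  also have "cos t + real a * q - real m * p = (2 * real a + 1) - (real a + real m + 1) * p"
    unfolding c by (simp add: algebra_simps)
  also have "((2 * real a + 1) - (real a + real m + 1) * p) * (p ^ a * q ^ m) =
      (2 * real a + 1) * (p ^ a * q ^ m) - (real a + real m + 1) * (p ^ Suc a * q ^ m)"
    by (simp add: algebra_simps)
  finally show "cos t * ((1 - cos t) ^ a * (1 + cos t) ^ m) +
      (real a * ((1 - cos t) ^ (a - 1) * sin t) * (1 + cos t) ^ m +
       real m * ((1 + cos t) ^ (m - 1) * - sin t) * (1 - cos t) ^ a) * sin t =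
     (2 * real a + 1) * ((1 - cos t) ^ a * (1 + cos t) ^ m) -
      (real a + real m + 1) * ((1 - cos t) ^ Suc a * (1 + cos t) ^ m)"
    unfolding p_def q_def .
qed

text \<open>The weights \<open>(1 - cos)^a (1 + cos)^m\<close> are Beta densities in the half angle, so each moment is an
  explicit multiple of the previous one.\<close>

lemma cos_moment_step:
  assumes R: "test_function R" "\<And>x. pderiv_at i R x = 0"
  shows "(real a + real m + 1) * (TINT x. (1 - cos (x $ i)) ^ Suc a * (1 + cos (x $ i)) ^ m * R x) =
    (2 * real a + 1) * (TINT x. (1 - cos (x $ i)) ^ a * (1 + cos (x $ i)) ^ m * R x)"
proof -
  define w where "w a x = (1 - cos (x $ i)) ^ a * (1 + cos (x $ i)) ^ m * R x" for a and x :: "real^2"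
  define v where "v x = sin (x $ i) * ((1 - cos (x $ i)) ^ a * (1 + cos (x $ i)) ^ m)" for x :: "real^2"
  have w: "test_function (w a)" for a
    unfolding w_def by (intro test_function_mult test_function_power test_function_diff test_function_add
        test_function_const test_function_cos0 R)
  have v: "test_function v"
    unfolding v_def by (intro test_function_mult test_function_power test_function_diff test_function_add
        test_function_const test_function_cos0 test_function_sin0)
  have dv: "pderiv_at i v x = (2 * real a + 1) * ((1 - cos (x $ i)) ^ a * (1 + cos (x $ i)) ^ m) -
      (real a + real m + 1) * ((1 - cos (x $ i)) ^ Suc a * (1 + cos (x $ i)) ^ m)" for x
    using pderiv_chain[OF smooth_nth has_derivative_cos_weight[of a m "x $ i"], of i]
    by (simp add: v_def[abs_def] pderiv_nth del: power_Suc)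
  have "pderiv_at i (\<lambda>x. v x * R x) x = (2 * real a + 1) * w a x - (real a + real m + 1) * w (Suc a) x" for x
    using pderiv_mult[OF test_function_smooth[OF v] test_function_smooth[OF R(1)], of i x] R(2)[of x]
    unfolding dv w_def by (simp add: algebra_simps)
  moreover have "(TINT x. pderiv_at i (\<lambda>x. v x * R x) x) = 0"
    by (rule integral_torus_pderiv[OF test_function_mult[OF v R(1)]])
  ultimately have "(TINT x. (2 * real a + 1) * w a x - (real a + real m + 1) * w (Suc a) x) = 0"
    by (simp only:)
  moreover have "integrable torus_measure (w a)" for a
    by (intro integrable_torus_continuous test_function_continuous w)
  ultimately have "(2 * real a + 1) * (TINT x. w a x) - (real a + real m + 1) * (TINT x. w (Suc a) x) = 0"
    by simp
  then show ?thesis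
    unfolding w_def by simp
qed

lemma cos_mass_step:
  assumes R: "test_function R" "\<And>x. pderiv_at i R x = 0"
  shows "(TINT x. (1 + cos (x $ i)) ^ Suc m * R x) =
    (2 * real m + 1) / (real m + 1) * (TINT x. (1 + cos (x $ i)) ^ m * R x)"
proof -
  define w where "w a x = (1 - cos (x $ i)) ^ a * (1 + cos (x $ i)) ^ m * R x" for a and x :: "real^2"
  have int: "integrable torus_measure (w a)" for a
    unfolding w_def by (intro integrable_torus_continuous test_function_continuous
        test_function_mult test_function_power test_function_diff test_function_add
        test_function_const test_function_cos0 R)
  have "(TINT x. (1 + cos (x $ i)) ^ Suc m * R x) = (TINT x. 2 * w 0 x - w 1 x)"
    by (intro Bochner_Integration.integral_cong) (auto simp: w_def algebra_simps)
  also have "\<dots> = 2 * (TINT x. w 0 x) - (TINT x. w 1 x)"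
    using int by simp
  also have "(TINT x. w 1 x) = (TINT x. w 0 x) / (real m + 1)"
    using cos_moment_step[OF R, of 0 m] by (simp add: w_def field_simps)
  also have "2 * (TINT x. w 0 x) - (TINT x. w 0 x) / (real m + 1) =
      (2 * real m + 1) / (real m + 1) * (TINT x. w 0 x)"
    by (simp add: field_simps)
  finally show ?thesis
    by (simp add: w_def)
qed

definition cos_bump :: "nat \<Rightarrow> nat \<Rightarrow> real^2 \<Rightarrow> real" where
  "cos_bump m n z = (1 + cos (z $ 1)) ^ m * (1 + cos (z $ 2)) ^ n"

definition cos_mass :: "nat \<Rightarrow> nat \<Rightarrow> real" where
  "cos_mass m n = (TINT z. cos_bump m n z)"

definition cos_kernel :: "nat \<Rightarrow> nat \<Rightarrow> real^2 \<Rightarrow> real" where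
  "cos_kernel m n z = cos_bump m n z / cos_mass m n"

lemma other_factor:
  shows "test_function (\<lambda>x. (1 + cos (x $ j)) ^ n * (1 - cos (x $ j)) ^ b)"
    and "i \<noteq> j \<Longrightarrow> pderiv_at i (\<lambda>x. (1 + cos (x $ j)) ^ n * (1 - cos (x $ j)) ^ b) x = 0"
proof -
  show "test_function (\<lambda>x. (1 + cos (x $ j)) ^ n * (1 - cos (x $ j)) ^ b)"
    by (intro test_function_mult test_function_power test_function_diff test_function_add
        test_function_const test_function_cos0)
  have "((\<lambda>t. (1 + cos t) ^ n * (1 - cos t) ^ b) has_real_derivative
      deriv (\<lambda>t. (1 + cos t) ^ n * (1 - cos t) ^ b) (x $ j)) (at (x $ j))"
    unfolding DERIV_deriv_iff_real_differentiable
    by (intro derivative_intros field_differentiable_imp_differentiable field_differentiable_within_cos)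
  from pderiv_chain[OF smooth_nth this, of i]
  show "pderiv_at i (\<lambda>x. (1 + cos (x $ j)) ^ n * (1 - cos (x $ j)) ^ b) x = 0" if "i \<noteq> j"
    using that by (simp add: pderiv_nth)
qed

lemma cos_mass_Suc1: "cos_mass (Suc m) n = (2 * real m + 1) / (real m + 1) * cos_mass m n"
  using cos_mass_step[OF other_factor(1)[of 2 n 0] other_factor(2)[of 1 2 n 0], of m]
  by (simp add: cos_mass_def cos_bump_def del: power_Suc)

lemma cos_mass_Suc2: "cos_mass m (Suc n) = (2 * real n + 1) / (real n + 1) * cos_mass m n"
  using cos_mass_step[OF other_factor(1)[of 1 m 0] other_factor(2)[of 2 1 m 0], of n]
  by (simp add: cos_mass_def cos_bump_def mult.commute del: power_Suc)

lemma cos_mass_pos: "cos_mass m n > 0"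
proof (induction m)
  case 0
  show ?case
  proof (induction n)
    case 0
    show ?case
      using measure_torus_measure by (simp add: cos_mass_def cos_bump_def[abs_def])
  qed (simp add: cos_mass_Suc2)
qed (simp add: cos_mass_Suc1)

text \<open>The first moments decay like \<open>1 / n\<close>, which gives an approximate identity; the second ones decay like \<open>1 / n\<^sup>2\<close>, which
  compensates the derivative of the kernel in the commutator.\<close>

lemma cos_kernel_moments:
  shows "(TINT z. cos_kernel m n z) = 1"
    and "(TINT z. (1 - cos (z $ 1)) * cos_kernel m n z) = 1 / (real m + 1)"
    and "(TINT z. (1 - cos (z $ 2)) * cos_kernel m n z) = 1 / (real n + 1)"
    and "(TINT z. (1 - cos (z $ 1)) ^ 2 * cos_kernel m n z) = 3 / ((real m + 1) * (real m + 2))"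
    and "(TINT z. (1 - cos (z $ 2)) ^ 2 * cos_kernel m n z) = 3 / ((real n + 1) * (real n + 2))"
    and "(TINT z. (1 - cos (z $ 1)) * (1 - cos (z $ 2)) * cos_kernel m n z) =
          1 / ((real m + 1) * (real n + 1))"
proof -
  define I where "I a b = (TINT z. (1 - cos (z $ 1)) ^ a * (1 - cos (z $ 2)) ^ b * cos_bump m n z)" for a b
  have I: "(TINT z. (1 - cos (z $ 1)) ^ a * (1 - cos (z $ 2)) ^ b * cos_kernel m n z) = I a b / cos_mass m n" for a b
    unfolding I_def cos_kernel_def by (subst Bochner_Integration.integral_divide_zero[symmetric]) simp
  have 1: "I (Suc a) b = (2 * real a + 1) / (real a + real m + 1) * I a b" for a b
    using cos_moment_step[OF other_factor(1)[of 2 n b] other_factor(2)[of 1 2 n b], of a m]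
    by (simp add: I_def cos_bump_def field_simps)
  have 2: "I a (Suc b) = (2 * real b + 1) / (real b + real n + 1) * I a b" for a b
    using cos_moment_step[OF other_factor(1)[of 1 m a] other_factor(2)[of 2 1 m a], of b n]
    by (simp add: I_def cos_bump_def field_simps)
  have 0: "I 0 0 = cos_mass m n"
    by (simp add: I_def cos_mass_def)
  note pos = cos_mass_pos[of m n]
  show "(TINT z. cos_kernel m n z) = 1"
    using I[of 0 0] 0 pos by simp
  show "(TINT z. (1 - cos (z $ 1)) * cos_kernel m n z) = 1 / (real m + 1)"
    using I[of 1 0] 1[of 0 0] 0 pos by simp
  show "(TINT z. (1 - cos (z $ 2)) * cos_kernel m n z) = 1 / (real n + 1)"
    using I[of 0 1] 2[of 0 0] 0 pos by simp
  show "(TINT z. (1 - cos (z $ 1)) ^ 2 * cos_kernel m n z) = 3 / ((real m + 1) * (real m + 2))"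
  proof -
    have "I 2 0 = 3 / (real m + 2) * (1 / (real m + 1) * cos_mass m n)"
      using 1[of 0 0] 1[of 1 0] 0 by (simp add: numeral_2_eq_2 add.commute)
    then show ?thesis
      using I[of 2 0] pos by (simp add: mult.commute)
  qed
  show "(TINT z. (1 - cos (z $ 2)) ^ 2 * cos_kernel m n z) = 3 / ((real n + 1) * (real n + 2))"
  proof -
    have "I 0 2 = 3 / (real n + 2) * (1 / (real n + 1) * cos_mass m n)"
      using 2[of 0 0] 2[of 0 1] 0 by (simp add: numeral_2_eq_2 add.commute)
    then show ?thesis
      using I[of 0 2] pos by (simp add: mult.commute)
  qed
  show "(TINT z. (1 - cos (z $ 1)) * (1 - cos (z $ 2)) * cos_kernel m n z) =
          1 / ((real m + 1) * (real n + 1))"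
    using I[of 1 1] 1[of 0 1] 2[of 0 0] 0 pos by simp
qed

lemma cos_kernel_test_function: "test_function (cos_kernel m n)"
  "test_function (\<lambda>x. cos_kernel m n (x - y))"
  unfolding cos_kernel_def[abs_def] cos_bump_def[abs_def] divide_inverse vector_minus_component
  by (intro test_function_mult test_function_power test_function_add
        test_function_const test_function_cos test_function_cos0)+

lemma cos_kernel_nonneg: "cos_kernel m n z \<ge> 0"
proof -
  have "1 + cos t \<ge> 0" for t :: real
    using cos_ge_minus_one[of t] by linarith
  then show ?thesis
    unfolding cos_kernel_def cos_bump_def using cos_mass_pos[of m n] by simp
qed

lemma cos_kernel_even: "cos_kernel m n (- z) = cos_kernel m n z"
  by (simp add: cos_kernel_def cos_bump_def)


lemma cos_kernel_continuous: "continuous_on UNIV (cos_kernel m n)"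
  by (rule test_function_continuous[OF cos_kernel_test_function(1)])

lemma cos_kernel_periodic: "periodic (cos_kernel m n)"
  using cos_kernel_test_function(1)[of m n] by (simp add: test_function_def)

section \<open>Separable kernels\<close>

text \<open>A mollifier of this form maps \<open>h\<close> to a combination of finitely many test functions, whose coefficients are
  obtained by testing \<open>h\<close> with the functions \<open>A j\<close>.\<close>

definition separable :: "(real^2 \<Rightarrow> real^2 \<Rightarrow> real) \<Rightarrow> bool" where
  "separable k \<longleftrightarrow> (\<exists>(J :: nat set) A B. finite J \<and>
     (\<forall>j. test_function (A j) \<and> test_function (B j)) \<and> (\<forall>x y. k x y = (\<Sum>j\<in>J. A j x * B j y)))"

lemma separableI:
  fixes A B :: "'i \<Rightarrow> real^2 \<Rightarrow> real"
  assumes "finite I" "\<And>i. test_function (A i)" "\<And>i. test_function (B i)"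
    "\<And>x y. k x y = (\<Sum>i\<in>I. A i x * B i y)"
  shows "separable k"
proof -
  obtain h where h: "bij_betw h {0..<card I} I"
    using ex_bij_betw_nat_finite[OF assms(1)] by blast
  have "k x y = (\<Sum>j\<in>{0..<card I}. A (h j) x * B (h j) y)" for x y
    unfolding assms(4) by (rule sum.reindex_bij_betw[OF h, symmetric])
  then show ?thesis
    unfolding separable_def using assms(2,3)
    by (intro exI[of _ "{0..<card I}"] exI[of _ "\<lambda>j. A (h j)"] exI[of _ "\<lambda>j. B (h j)"]) auto
qed

lemma separable_product: "test_function a \<Longrightarrow> test_function b \<Longrightarrow> separable (\<lambda>x y. a x * b y)"
  by (rule separableI[of "{()}" "\<lambda>_. a" "\<lambda>_. b"]) auto

lemma separable_const: "separable (\<lambda>x y. c)"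
  using separable_product[OF test_function_const[of c] test_function_const[of 1]] by simp

lemma separable_add:
  assumes "separable k" "separable l"
  shows "separable (\<lambda>x y. k x y + l x y)"
proof -
  obtain J A B where k: "finite (J::nat set)" "\<And>j. test_function (A j)" "\<And>j. test_function (B j)"
      "\<And>x y. k x y = (\<Sum>j\<in>J. A j x * B j y)"
    using assms(1) unfolding separable_def by auto
  obtain J' A' B' where l: "finite (J'::nat set)" "\<And>j. test_function (A' j)" "\<And>j. test_function (B' j)"
      "\<And>x y. l x y = (\<Sum>j\<in>J'. A' j x * B' j y)"
    using assms(2) unfolding separable_def by auto
  show ?thesis
  proof (rule separableI[of "J <+> J'" "case_sum A A'" "case_sum B B'"])
    show "finite (J <+> J')" using k l by simp
    show "test_function (case_sum A A' i)" "test_function (case_sum B B' i)" for i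
      using k l by (cases i; simp)+
    show "k x y + l x y = (\<Sum>i\<in>J <+> J'. case_sum A A' i x * case_sum B B' i y)" for x y
      using k l by (simp add: sum.Plus)
  qed
qed

lemma separable_mult:
  assumes "separable k" "separable l"
  shows "separable (\<lambda>x y. k x y * l x y)"
proof -
  obtain J A B where k: "finite (J::nat set)" "\<And>j. test_function (A j)" "\<And>j. test_function (B j)"
      "\<And>x y. k x y = (\<Sum>j\<in>J. A j x * B j y)"
    using assms(1) unfolding separable_def by auto
  obtain J' A' B' where l: "finite (J'::nat set)" "\<And>j. test_function (A' j)" "\<And>j. test_function (B' j)"
      "\<And>x y. l x y = (\<Sum>j\<in>J'. A' j x * B' j y)"
    using assms(2) unfolding separable_def by auto
  show ?thesis
  proof (rule separableI[of "J \<times> J'" "\<lambda>(i, j) x. A i x * A' j x" "\<lambda>(i, j) x. B i x * B' j x"])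
    show "finite (J \<times> J')" using k l by simp
    show "test_function ((\<lambda>(i, j) x. A i x * A' j x) p)" "test_function ((\<lambda>(i, j) x. B i x * B' j x) p)" for p
      using k l by (cases p; auto intro: test_function_mult)+
    show "k x y * l x y = (\<Sum>p\<in>J \<times> J'. (\<lambda>(i, j) x. A i x * A' j x) p x * (\<lambda>(i, j) x. B i x * B' j x) p y)" for x y
      unfolding k(4) l(4) sum_product sum.cartesian_product by (intro sum.cong) auto
  qed
qed

lemma separable_power: "separable k \<Longrightarrow> separable (\<lambda>x y. k x y ^ n)"
  by (induction n) (auto intro: separable_const separable_mult)

text \<open>The addition theorem for the cosine makes every trigonometric convolution kernel separable:
  this is the reason for mollifying with trigonometric polynomials.\<close>

lemma separable_cos_kernel: "separable (\<lambda>x y. cos_kernel m n (x - y))"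
proof -
  have "separable (\<lambda>x y. cos (x $ i) * cos (y $ i) + sin (x $ i) * sin (y $ i))" for i
    by (intro separable_add separable_product test_function_cos0 test_function_sin0)
  then have c: "separable (\<lambda>x y. cos (x $ i - y $ i))" for i
    by (simp add: cos_diff)
  have "separable (\<lambda>x y. (1 + cos (x $ 1 - y $ 1)) ^ m * (1 + cos (x $ 2 - y $ 2)) ^ n * (1 / cos_mass m n))"
    by (intro separable_mult separable_power separable_add separable_const c)
  then show ?thesis
    by (simp add: cos_kernel_def cos_bump_def)
qed

lemma cos_kernel_expansion:
  obtains J :: "nat set" and A B where "finite J" "\<And>j. test_function (A j)" "\<And>j. test_function (B j)"
    "\<And>x y. cos_kernel m n (x - y) = (\<Sum>j\<in>J. A j x * B j y)"
  using separable_cos_kernel[of m n] unfolding separable_def by auto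

section \<open>Approximate identities\<close>

definition conv_kernel :: "(real^2 \<Rightarrow> real) \<Rightarrow> bool" where
  "conv_kernel k \<longleftrightarrow> continuous_on UNIV k \<and> periodic k \<and> (\<forall>z. 0 \<le> k z) \<and> (\<forall>z. k (- z) = k z)"

abbreviation (input) kernel_mass :: "(real^2 \<Rightarrow> real) \<Rightarrow> real" where
  "kernel_mass k \<equiv> TINT z. k z"

text \<open>The oscillation of \<open>h\<close> weighted by a kernel.  It dominates the error of mollification, and unlike that
  error it is also what the commutator estimate needs.\<close>

definition oscillation :: "nat \<Rightarrow> (real^2 \<Rightarrow> real) \<Rightarrow> (real^2 \<Rightarrow> real) \<Rightarrow> real" where
  "oscillation p k h =
    (LINT z|(torus_measure \<Otimes>\<^sub>M torus_measure). \<bar>h (snd z) - h (fst z)\<bar> ^ p * k (snd z - fst z))"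

lemma conv_kernel_cos_kernel: "conv_kernel (cos_kernel m n)"
  by (simp add: conv_kernel_def cos_kernel_continuous cos_kernel_periodic cos_kernel_nonneg cos_kernel_even)

lemma kernel_shift_mass:
  assumes "continuous_on UNIV k" "periodic k"
  shows "(TINT x. k (x - y)) = kernel_mass k"
  using integral_torus_shift[OF assms, of "- y"] by simp

lemma kernel_shift_mass':
  assumes "conv_kernel k"
  shows "(TINT y. k (x - y)) = kernel_mass k"
proof -
  have "k (x - y) = k (y - x)" for y
    using assms by (metis conv_kernel_def minus_diff_eq)
  then show ?thesis
    using kernel_shift_mass[of k x] assms by (simp add: conv_kernel_def)
qed

lemma torus_id_measurable [measurable]: "(\<lambda>x. x) \<in> measurable torus_measure borel"
  by (rule continuous_measurable_torus[OF continuous_on_id])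

lemma kernel_diff_measurable:
  fixes k :: "real^2 \<Rightarrow> real"
  assumes "continuous_on UNIV k"
  shows "(\<lambda>z. k (snd z - fst z)) \<in> borel_measurable (torus_measure \<Otimes>\<^sub>M torus_measure)"
proof -
  have k: "k \<in> borel_measurable borel"
    using assms by (rule borel_measurable_continuous_onI)
  have "(\<lambda>z. snd z - fst z) \<in> measurable (torus_measure \<Otimes>\<^sub>M torus_measure) borel"
    by (intro borel_measurable_diff measurable_compose[OF measurable_snd torus_id_measurable]
        measurable_compose[OF measurable_fst torus_id_measurable])
  then show ?thesis
    by (rule measurable_compose[OF _ k])
qed

lemma periodic_bounded:
  fixes k :: "real^2 \<Rightarrow> real"
  assumes "continuous_on UNIV k" "periodic k"
  obtains C where "C \<ge> 0" "\<And>z. \<bar>k z\<bar> \<le> C"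
proof -
  obtain C where C: "C \<ge> 0" "\<And>z. z \<in> torus \<Longrightarrow> norm (k z) \<le> C"
    using continuous_bounded_torus[OF assms(1)] by blast
  have "\<bar>k z\<bar> \<le> C" for z
  proof -
    define a where "a i = - \<lfloor>z $ i / (2 * pi)\<rfloor>" for i
    define w where "w = z + axis 1 (2 * pi * real_of_int (a 1)) + axis 2 (2 * pi * real_of_int (a 2))"
    have "k w = k z"
      unfolding w_def periodic_int[OF assms(2)] ..
    moreover have "w \<in> torus"
    proof -
      have "w $ i = z $ i + 2 * pi * real_of_int (a i)" for i
        using exhaust_2[of i] by (auto simp: w_def axis_def)
      moreover have "0 \<le> z $ i + 2 * pi * real_of_int (a i) \<and> z $ i + 2 * pi * real_of_int (a i) < 2 * pi" for i
      proof -
        have "real_of_int \<lfloor>z $ i / (2 * pi)\<rfloor> \<le> z $ i / (2 * pi)" "z $ i / (2 * pi) < real_of_int \<lfloor>z $ i / (2 * pi)\<rfloor> + 1"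
          by linarith+
        moreover have m2pi_gt_zero: "0 < 2 * pi"
          by simp
        ultimately have "2 * pi * real_of_int \<lfloor>z $ i / (2 * pi)\<rfloor> \<le> z $ i"
            "z $ i < 2 * pi * (real_of_int \<lfloor>z $ i / (2 * pi)\<rfloor> + 1)"
          by (simp_all only: pos_le_divide_eq pos_divide_less_eq mult.commute[of _ "2 * pi"] m2pi_gt_zero)
        then show ?thesis
          unfolding a_def by (simp add: distrib_left)
      qed
      ultimately show ?thesis
        by (simp add: torus_def)
    qed
    ultimately show ?thesis
      using C(2)[of w] by simp
  qed
  then show ?thesis
    using that C(1) by blast
qed

lemma kernel_fst_integral:
  assumes f: "integrable torus_measure f" and k: "continuous_on UNIV k" "periodic k"
  shows "integrable (torus_measure \<Otimes>\<^sub>M torus_measure) (\<lambda>z. f (fst z) * k (snd z - fst z))"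
    and "(LINT z|(torus_measure \<Otimes>\<^sub>M torus_measure). f (fst z) * k (snd z - fst z)) =
          kernel_mass k * (TINT y. f y)"
proof -
  obtain C where C: "C \<ge> 0" "\<And>z. \<bar>k z\<bar> \<le> C"
    using periodic_bounded[OF k] by blast
  have m: "(\<lambda>z. f (fst z) * k (snd z - fst z)) \<in> borel_measurable (torus_measure \<Otimes>\<^sub>M torus_measure)"
    using f by (intro borel_measurable_times kernel_diff_measurable k measurable_compose[OF measurable_fst]) auto
  have shift: "integrable torus_measure (\<lambda>x. k (x - y))" for y
    by (intro integrable_torus_continuous continuous_on_compose2[OF k(1)] continuous_intros) auto
  show int: "integrable (torus_measure \<Otimes>\<^sub>M torus_measure) (\<lambda>z. f (fst z) * k (snd z - fst z))"
  proof (rule TM2.Fubini_integrable[OF m])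
    show "AE y in torus_measure. integrable torus_measure (\<lambda>x. f (fst (y, x)) * k (snd (y, x) - fst (y, x)))"
      using shift by simp
    have "(TINT x. norm (f (fst (y, x)) * k (snd (y, x) - fst (y, x)))) = \<bar>f y\<bar> * kernel_mass (\<lambda>z. \<bar>k z\<bar>)" for y
    proof -
      have "continuous_on UNIV (\<lambda>z. \<bar>k z\<bar>)" "periodic (\<lambda>z. \<bar>k z\<bar>)"
        using k by (auto intro: continuous_on_rabs simp: periodic_def)
      then show ?thesis
        using kernel_shift_mass[of "\<lambda>z. \<bar>k z\<bar>" y] by (simp add: abs_mult)
    qed
    then show "integrable torus_measure (\<lambda>y. TINT x. norm (f (fst (y, x)) * k (snd (y, x) - fst (y, x))))"
      using f by simp
  qed
  show "(LINT z|(torus_measure \<Otimes>\<^sub>M torus_measure). f (fst z) * k (snd z - fst z)) = kernel_mass k * (TINT y. f y)"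
    unfolding TM2.integral_fst'[OF int, symmetric] by (simp add: kernel_shift_mass[OF k] mult.commute)
qed

lemma kernel_snd_integral:
  assumes f: "integrable torus_measure f" and k: "conv_kernel k"
  shows "integrable (torus_measure \<Otimes>\<^sub>M torus_measure) (\<lambda>z. f (snd z) * k (snd z - fst z))"
    and "(LINT z|(torus_measure \<Otimes>\<^sub>M torus_measure). f (snd z) * k (snd z - fst z)) =
          kernel_mass k * (TINT y. f y)"
proof -
  have k': "continuous_on UNIV k" "periodic k"
    using k by (auto simp: conv_kernel_def)
  have even: "k (fst z - snd z) = k (snd z - fst z)" for z :: "(real^2) \<times> (real^2)"
    using k by (metis conv_kernel_def minus_diff_eq)
  note * = kernel_fst_integral[OF f k']
  have swap: "(\<lambda>(x, y). (\<lambda>z. f (snd z) * k (snd z - fst z)) (y, x)) = (\<lambda>z. f (fst z) * k (snd z - fst z))"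
    by (auto simp: fun_eq_iff) (metis even fst_conv snd_conv)
  show 1: "integrable (torus_measure \<Otimes>\<^sub>M torus_measure) (\<lambda>z. f (snd z) * k (snd z - fst z))"
    using *(1) TM2.integrable_product_swap_iff[of "\<lambda>z. f (snd z) * k (snd z - fst z)"] unfolding swap by simp
  have "(LINT z|(torus_measure \<Otimes>\<^sub>M torus_measure). f (snd z) * k (snd z - fst z)) =
      (LINT z|(torus_measure \<Otimes>\<^sub>M torus_measure). (\<lambda>(x, y). (\<lambda>z. f (snd z) * k (snd z - fst z)) (y, x)) z)"
    using TM2.integral_product_swap[of "\<lambda>z. f (snd z) * k (snd z - fst z)"] 1 by simp
  then show "(LINT z|(torus_measure \<Otimes>\<^sub>M torus_measure). f (snd z) * k (snd z - fst z)) =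
          kernel_mass k * (TINT y. f y)"
    unfolding swap using *(2) by simp
qed

lemma power_abs_add_le: "\<bar>a + b\<bar> ^ p \<le> 2 ^ p * (\<bar>a\<bar> ^ p + \<bar>b\<bar> ^ p)" for a b :: real
proof -
  have "\<bar>a + b\<bar> \<le> 2 * max \<bar>a\<bar> \<bar>b\<bar>"
    by linarith
  then have "\<bar>a + b\<bar> ^ p \<le> (2 * max \<bar>a\<bar> \<bar>b\<bar>) ^ p"
    by (intro power_mono) auto
  also have "\<dots> = 2 ^ p * max \<bar>a\<bar> \<bar>b\<bar> ^ p"
    by (simp add: power_mult_distrib)
  also have "max \<bar>a\<bar> \<bar>b\<bar> ^ p \<le> \<bar>a\<bar> ^ p + \<bar>b\<bar> ^ p"
    by (auto simp: max_def)
  finally show ?thesis by simp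
qed

lemma power_abs_diff_le: "\<bar>a - b\<bar> ^ p \<le> 2 ^ p * (\<bar>a\<bar> ^ p + \<bar>b\<bar> ^ p)" for a b :: real
  using power_abs_add_le[of a "- b" p] by simp

lemma Lp_torus_real: "Lp_torus p h \<longleftrightarrow> h \<in> borel_measurable torus_measure \<and> integrable torus_measure (\<lambda>x. \<bar>h x :: real\<bar> ^ p)"
  by (simp add: Lp_torus_def)

lemma Lp_torus_bounded:
  fixes h :: "real^2 \<Rightarrow> real"
  assumes "h \<in> borel_measurable torus_measure" "\<And>x. x \<in> torus \<Longrightarrow> \<bar>h x\<bar> \<le> C"
  shows "Lp_torus p h"
  unfolding Lp_torus_real using assms
  by (auto intro!: integrable_torus_bounded[where C = "C ^ p"] power_mono simp: power_abs)

lemma Lp_torus_diff: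
  fixes f g :: "real^2 \<Rightarrow> real"
  assumes "Lp_torus p f" "Lp_torus p g"
  shows "Lp_torus p (\<lambda>x. f x - g x)"
proof -
  have "integrable torus_measure (\<lambda>x. 2 ^ p * (\<bar>f x\<bar> ^ p + \<bar>g x\<bar> ^ p))"
    using assms by (simp add: Lp_torus_real)
  then have "integrable torus_measure (\<lambda>x. \<bar>f x - g x\<bar> ^ p)"
  proof (rule Bochner_Integration.integrable_bound)
    show "AE x in torus_measure. norm (\<bar>f x - g x\<bar> ^ p) \<le> norm (2 ^ p * (\<bar>f x\<bar> ^ p + \<bar>g x\<bar> ^ p))"
      using power_abs_diff_le by (intro AE_I2) simp
    show "(\<lambda>x. \<bar>f x - g x\<bar> ^ p) \<in> borel_measurable torus_measure"
      using assms by (intro borel_measurable_power borel_measurable_abs borel_measurable_diff) (auto simp: Lp_torus_real)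
  qed
  then show ?thesis
    using assms borel_measurable_diff[of f torus_measure g] by (simp add: Lp_torus_real)
qed

lemma oscillation_integrable:
  assumes h: "Lp_torus p h" and k: "conv_kernel k"
  shows "integrable (torus_measure \<Otimes>\<^sub>M torus_measure) (\<lambda>z. \<bar>h (snd z) - h (fst z)\<bar> ^ p * k (snd z - fst z))"
    and "oscillation p k h \<le> 2 ^ p * (2 * kernel_mass k * (TINT x. \<bar>h x\<bar> ^ p))"
    and "0 \<le> oscillation p k h"
proof -
  have k': "continuous_on UNIV k" "periodic k" "\<And>z. 0 \<le> k z"
    using k by (auto simp: conv_kernel_def)
  have hm: "h \<in> borel_measurable torus_measure" and hi: "integrable torus_measure (\<lambda>x. \<bar>h x\<bar> ^ p)"
    using h by (auto simp: Lp_torus_real)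
  note 1 = kernel_fst_integral[OF hi k'(1,2)] and 2 = kernel_snd_integral[OF hi k]
  let ?B = "\<lambda>z. 2 ^ p * (\<bar>h (snd z)\<bar> ^ p * k (snd z - fst z) + \<bar>h (fst z)\<bar> ^ p * k (snd z - fst z))"
  have le: "\<bar>h (snd z) - h (fst z)\<bar> ^ p * k (snd z - fst z) \<le> ?B z" for z
    using mult_right_mono[OF power_abs_diff_le[of "h (snd z)" "h (fst z)" p] k'(3)[of "snd z - fst z"]]
    by (simp only: distrib_right mult.assoc)
  have B: "integrable (torus_measure \<Otimes>\<^sub>M torus_measure) ?B"
    using 1 2 by simp
  show int: "integrable (torus_measure \<Otimes>\<^sub>M torus_measure) (\<lambda>z. \<bar>h (snd z) - h (fst z)\<bar> ^ p * k (snd z - fst z))"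
  proof (rule Bochner_Integration.integrable_bound[OF B])
    show "(\<lambda>z. \<bar>h (snd z) - h (fst z)\<bar> ^ p * k (snd z - fst z)) \<in> borel_measurable (torus_measure \<Otimes>\<^sub>M torus_measure)"
      by (intro borel_measurable_times borel_measurable_power borel_measurable_abs borel_measurable_diff
          measurable_compose[OF measurable_fst hm] measurable_compose[OF measurable_snd hm] kernel_diff_measurable k')
    show "AE z in torus_measure \<Otimes>\<^sub>M torus_measure. norm (\<bar>h (snd z) - h (fst z)\<bar> ^ p * k (snd z - fst z)) \<le> norm (?B z)"
      using le k'(3) by (intro AE_I2) (smt (verit) mult_nonneg_nonneg real_norm_def zero_le_power abs_ge_zero)
  qed
  have "oscillation p k h \<le> (LINT z|(torus_measure \<Otimes>\<^sub>M torus_measure). ?B z)"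
    unfolding oscillation_def by (intro integral_mono int B le)
  also have "\<dots> = 2 ^ p * (2 * kernel_mass k * (TINT x. \<bar>h x\<bar> ^ p))"
    using 1 2 by simp
  finally show "oscillation p k h \<le> 2 ^ p * (2 * kernel_mass k * (TINT x. \<bar>h x\<bar> ^ p))" .
  show "0 \<le> oscillation p k h"
    unfolding oscillation_def using k'(3) by (intro Bochner_Integration.integral_nonneg) simp
qed

lemma oscillation_add:
  assumes f: "Lp_torus p f" and g: "Lp_torus p g" and k: "conv_kernel k"
  shows "oscillation p k f \<le> 2 ^ p * (oscillation p k g + oscillation p k (\<lambda>x. f x - g x))"
proof -
  note i = oscillation_integrable(1)[OF _ k]
  have k': "\<And>z. 0 \<le> k z"
    using k by (auto simp: conv_kernel_def)
  have le: "\<bar>f (snd z) - f (fst z)\<bar> ^ p * k (snd z - fst z) \<le>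
      2 ^ p * (\<bar>g (snd z) - g (fst z)\<bar> ^ p * k (snd z - fst z) +
        \<bar>(f (snd z) - g (snd z)) - (f (fst z) - g (fst z))\<bar> ^ p * k (snd z - fst z))" for z
    using mult_right_mono[OF power_abs_add_le[of "g (snd z) - g (fst z)" "(f (snd z) - g (snd z)) - (f (fst z) - g (fst z))" p] k'[of "snd z - fst z"]]
    by (simp add: distrib_right mult.assoc)
  have "oscillation p k f \<le> (LINT z|(torus_measure \<Otimes>\<^sub>M torus_measure). 2 ^ p * (\<bar>g (snd z) - g (fst z)\<bar> ^ p * k (snd z - fst z) +
        \<bar>(f (snd z) - g (snd z)) - (f (fst z) - g (fst z))\<bar> ^ p * k (snd z - fst z)))"
    unfolding oscillation_def
    by (intro integral_mono le i f g Lp_torus_diff integrable_mult_right Bochner_Integration.integrable_add)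
  also have "\<dots> = 2 ^ p * (oscillation p k g + oscillation p k (\<lambda>x. f x - g x))"
    unfolding oscillation_def using i[OF g] i[OF Lp_torus_diff[OF f g]] by simp
  finally show ?thesis .
qed

text \<open>As in Korovkin's theorem, concentration at the origin is expressed by a single trigonometric test function.\<close>

definition approx_identity :: "(nat \<Rightarrow> real^2 \<Rightarrow> real) \<Rightarrow> bool" where
  "approx_identity k \<longleftrightarrow> (\<forall>n. conv_kernel (k n) \<and> kernel_mass (k n) = 1) \<and>
     (\<lambda>n. TINT z. (2 - cos (z $ 1) - cos (z $ 2)) * k n z) \<longlonglongrightarrow> 0"

lemma approx_identity_cos_kernel:
  assumes "filterlim m at_top sequentially" "filterlim n at_top sequentially"
  shows "approx_identity (\<lambda>j. cos_kernel (m j) (n j))"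
proof -
  have eq: "(TINT z. (2 - cos (z $ 1) - cos (z $ 2)) * cos_kernel m n z) = 1 / (real m + 1) + 1 / (real n + 1)" for m n
  proof -
    have c: "test_function (\<lambda>z. (1 - cos (z $ i)) * cos_kernel m n z)" for i
      by (intro test_function_mult test_function_diff test_function_const test_function_cos0 cos_kernel_test_function)
    have "(TINT z. (2 - cos (z $ 1) - cos (z $ 2)) * cos_kernel m n z) =
        (TINT z. (1 - cos (z $ 1)) * cos_kernel m n z + (1 - cos (z $ 2)) * cos_kernel m n z)"
      by (intro Bochner_Integration.integral_cong) (auto simp: algebra_simps)
    also have "\<dots> = (TINT z. (1 - cos (z $ 1)) * cos_kernel m n z) + (TINT z. (1 - cos (z $ 2)) * cos_kernel m n z)"
      by (intro Bochner_Integration.integral_add integrable_torus_continuous test_function_continuous c)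
    finally show ?thesis
      by (simp only: cos_kernel_moments)
  qed
  have lim: "(\<lambda>j. 1 / (real (m j) + 1)) \<longlonglongrightarrow> 0" if "filterlim m at_top sequentially" for m
  proof -
    have "(\<lambda>j. 1 / (real j + 1)) \<longlonglongrightarrow> 0"
      using LIMSEQ_inverse_real_of_nat by (simp add: inverse_eq_divide add.commute)
    then show ?thesis
      using that by (rule filterlim_compose)
  qed
  have "(\<lambda>j. 1 / (real (m j) + 1) + 1 / (real (n j) + 1)) \<longlonglongrightarrow> 0 + 0"
    using assms by (intro tendsto_add lim)
  then show ?thesis
    unfolding approx_identity_def eq by (simp add: conv_kernel_cos_kernel cos_kernel_moments)
qed

text \<open>Korovkin's argument: away from the diagonal the second order test function \<open>2 - cos - cos\<close> is
  bounded below.  Points \<open>y\<close> in the interior of the cell have a positive distance from its boundary, where the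
  periodic extension of \<open>h\<close> may be discontinuous.\<close>

lemma korovkin_bound:
  fixes h :: "real^2 \<Rightarrow> real"
  assumes h: "continuous_on UNIV h" "\<And>x. \<bar>h x\<bar> \<le> C"
    and y: "\<And>i. 0 < y $ i" "y \<in> torus" and e: "e > 0" and p: "p > 0"
  obtains K where "K \<ge> 0"
    "\<And>x. x \<in> torus \<Longrightarrow> \<bar>h x - h y\<bar> ^ p \<le> e + K * (2 - cos (x $ 1 - y $ 1) - cos (x $ 2 - y $ 2))"
proof -
  have C: "C \<ge> 0"
    using h(2)[of 0] by linarith
  have "isCont (\<lambda>x. \<bar>h x - h y\<bar> ^ p) y"
    using h(1) by (intro continuous_intros) (simp add: continuous_on_eq_continuous_at)
  then obtain d where d: "d > 0" "\<And>x. dist x y < d \<Longrightarrow> \<bar>h x - h y\<bar> ^ p < e"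
    using e p unfolding continuous_at_eps_delta by (force simp: dist_real_def power_0_left)
  have y2: "y $ i < 2 * pi" for i
    using y(2) by (simp add: torus_def)
  define r where "r = min (min (d / 2) (pi / 2)) (min (min (y $ 1) (y $ 2)) (min (2 * pi - y $ 1) (2 * pi - y $ 2)))"
  have r: "0 < r" "r \<le> d / 2" "r \<le> y $ 1" "r \<le> y $ 2" "r \<le> 2 * pi - y $ 1" "r \<le> 2 * pi - y $ 2" "r \<le> pi / 2"
    using d(1) y(1) y2 unfolding r_def by (simp, linarith+)
  have ri: "r \<le> y $ i" "r \<le> 2 * pi - y $ i" for i
    using r exhaust_2[of i] by auto
  have cosr: "cos r < 1"
    using r cos_monotone_0_pi[of 0 r] by auto
  have low: "cos (x $ i - y $ i) \<le> cos r" if "x \<in> torus" "\<bar>x $ i - y $ i\<bar> \<ge> r" for x i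
  proof -
    have x: "0 \<le> x $ i" "x $ i < 2 * pi"
      using that(1) by (auto simp: torus_def)
    define t where "t = \<bar>x $ i - y $ i\<bar>"
    have t: "r \<le> t" "t \<le> 2 * pi - r"
      using that(2) x ri[of i] unfolding t_def by linarith+
    have ct: "cos (x $ i - y $ i) = cos t"
      by (simp add: t_def)
    show ?thesis
    proof (cases "t \<le> pi")
      case True
      then show ?thesis
        unfolding ct using r t by (intro cos_monotone_0_pi_le) auto
    next
      case False
      have "cos t = cos (2 * pi - t)"
        by (simp add: cos_diff)
      also have "\<dots> \<le> cos r"
        using False r t by (intro cos_monotone_0_pi_le) auto
      finally show ?thesis
        unfolding ct .
    qed
  qed
  define K where "K = (2 * C) ^ p / (1 - cos r)"
  show ?thesis
  proof (rule that[of K])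
    show "K \<ge> 0"
      using C cosr by (simp add: K_def)
    fix x assume x: "x \<in> torus"
    have nonneg: "0 \<le> 1 - cos (x $ i - y $ i)" for i
      by simp
    show "\<bar>h x - h y\<bar> ^ p \<le> e + K * (2 - cos (x $ 1 - y $ 1) - cos (x $ 2 - y $ 2))"
    proof (cases "dist x y < d")
      case True
      then have "\<bar>h x - h y\<bar> ^ p < e"
        by (rule d)
      moreover have "0 \<le> K * (2 - cos (x $ 1 - y $ 1) - cos (x $ 2 - y $ 2))"
        using \<open>K \<ge> 0\<close> nonneg[of 1] nonneg[of 2] by (intro mult_nonneg_nonneg) linarith+
      ultimately show ?thesis by linarith
    next
      case False
      have "dist x y \<le> \<bar>x $ 1 - y $ 1\<bar> + \<bar>x $ 2 - y $ 2\<bar>"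
        using norm_le_l1_cart[of "x - y"] by (simp add: dist_norm UNIV_2)
      then have "\<bar>x $ 1 - y $ 1\<bar> \<ge> r \<or> \<bar>x $ 2 - y $ 2\<bar> \<ge> r"
        using False r by linarith
      then have "1 - cos r \<le> 2 - cos (x $ 1 - y $ 1) - cos (x $ 2 - y $ 2)"
        using low[OF x, of 1] low[OF x, of 2] nonneg[of 1] nonneg[of 2] by linarith
      then have "K * (1 - cos r) \<le> K * (2 - cos (x $ 1 - y $ 1) - cos (x $ 2 - y $ 2))"
        using \<open>K \<ge> 0\<close> by (rule mult_left_mono)
      moreover have "K * (1 - cos r) = (2 * C) ^ p"
        using cosr by (simp add: K_def)
      moreover have "\<bar>h x - h y\<bar> ^ p \<le> (2 * C) ^ p"
        using h(2)[of x] h(2)[of y] by (intro power_mono) auto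
      ultimately show ?thesis
        using e by linarith
    qed
  qed
qed

lemma AE_torus_interior: "AE y in torus_measure. \<forall>i. 0 < y $ i"
proof -
  have "negligible {y :: real^2. y $ i = 0}" for i
    by (rule negligible_standard_hyperplane_cart)
  then have "AE y in lebesgue. y \<notin> {y :: real^2. y $ i = 0}" for i
    by (intro AE_not_in) (simp add: negligible_iff_null_sets)
  then have "AE y in lebesgue. y \<notin> {y :: real^2. y $ 1 = 0} \<and> y \<notin> {y :: real^2. y $ 2 = 0}"
    by (intro AE_conjI)
  then have "AE y in lebesgue. \<forall>i. y \<notin> {y :: real^2. y $ i = 0}"
    by (simp add: forall_2)
  then have "AE y in lebesgue. y \<in> torus \<longrightarrow> (\<forall>i. 0 < y $ i)"
    by eventually_elim (auto simp: torus_def order_less_le)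
  then show ?thesis
    using torus_sets by (simp add: AE_restrict_space_iff)
qed

text \<open>Korovkin's bound gives convergence of the inner integral for almost every \<open>y\<close>; the boundedness of \<open>h\<close> provides the
  majorant.\<close>

lemma oscillation_tendsto_continuous:
  fixes h :: "real^2 \<Rightarrow> real"
  assumes h: "continuous_on UNIV h" "\<And>x. \<bar>h x\<bar> \<le> C" and k: "approx_identity k" and p: "p > 0"
  shows "(\<lambda>n. oscillation p (k n) h) \<longlonglongrightarrow> 0"
proof -
  have kn: "conv_kernel (k n)" "kernel_mass (k n) = 1" "continuous_on UNIV (k n)" "periodic (k n)" "\<And>z. 0 \<le> k n z" for n
    using k by (auto simp: approx_identity_def conv_kernel_def)
  have C: "C \<ge> 0"
    using h(2)[of 0] by linarith
  have Lp: "Lp_torus p h"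
    using h by (intro Lp_torus_bounded[of _ C] continuous_measurable_torus) auto
  define I where "I n y = (TINT x. \<bar>h x - h y\<bar> ^ p * k n (x - y))" for n y
  have kc: "continuous_on UNIV (\<lambda>x. k n (x - y))" for n y
    by (intro continuous_on_compose2[OF kn(3)] continuous_intros) auto
  have inner_int: "integrable torus_measure (\<lambda>x. \<bar>h x - h y\<bar> ^ p * k n (x - y))" for n y
    by (intro integrable_torus_continuous continuous_intros h kc)
  have osc: "oscillation p (k n) h = (TINT y. I n y)" for n
    unfolding oscillation_def I_def TM2.integral_fst'[OF oscillation_integrable(1)[OF Lp kn(1)], symmetric] by simp
  have I_meas: "I n \<in> borel_measurable torus_measure" for n
    using TM2.integrable_fst'[OF oscillation_integrable(1)[OF Lp kn(1)[of n]]]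
    unfolding I_def by (auto intro: borel_measurable_integrable)
  have I_nonneg: "0 \<le> I n y" for n y
    unfolding I_def using kn(5) by (intro Bochner_Integration.integral_nonneg) simp
  have I_le: "I n y \<le> (2 * C) ^ p" for n y
  proof -
    have "I n y \<le> (TINT x. (2 * C) ^ p * k n (x - y))"
      unfolding I_def
    proof (intro integral_mono inner_int integrable_mult_right integrable_torus_continuous kc)
      fix x
      have "\<bar>h x - h y\<bar> ^ p \<le> (2 * C) ^ p"
        using h(2)[of x] h(2)[of y] by (intro power_mono) auto
      then show "\<bar>h x - h y\<bar> ^ p * k n (x - y) \<le> (2 * C) ^ p * k n (x - y)"
        using kn(5) by (rule mult_right_mono)
    qed
    then show ?thesis
      using kernel_shift_mass[OF kn(3,4)] kn(2) by simp
  qed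
  have I_lim: "(\<lambda>n. I n y) \<longlonglongrightarrow> 0" if y: "\<forall>i. 0 < y $ i" "y \<in> torus" for y
  proof (rule LIMSEQ_I)
    fix r :: real assume r: "r > 0"
    obtain K where K: "K \<ge> 0"
      "\<And>x. x \<in> torus \<Longrightarrow> \<bar>h x - h y\<bar> ^ p \<le> r / 2 + K * (2 - cos (x $ 1 - y $ 1) - cos (x $ 2 - y $ 2))"
      using korovkin_bound[OF h, of y "r / 2" p] y r p by auto
    define M where "M n = (TINT z. (2 - cos (z $ 1) - cos (z $ 2)) * k n z)" for n
    have M_shift: "(TINT x. (2 - cos (x $ 1 - y $ 1) - cos (x $ 2 - y $ 2)) * k n (x - y)) = M n" for n
    proof -
      have "periodic (\<lambda>z::real^2. (2 - cos (z $ 1) - cos (z $ 2)) * k n z)"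
        using kn(4)[of n] test_function_cos0[of 1] test_function_cos0[of 2]
        by (simp add: periodic_def test_function_def)
      moreover have "continuous_on UNIV (\<lambda>z::real^2. (2 - cos (z $ 1) - cos (z $ 2)) * k n z)"
        by (intro continuous_intros kn)
      ultimately show ?thesis
        using integral_torus_shift[of "\<lambda>z. (2 - cos (z $ 1) - cos (z $ 2)) * k n z" "- y"] by (simp add: M_def)
    qed
    have bound: "I n y \<le> r / 2 + K * M n" for n
    proof -
      have c: "continuous_on UNIV (\<lambda>x. (2 - cos (x $ 1 - y $ 1) - cos (x $ 2 - y $ 2)) * k n (x - y))"
        by (intro continuous_intros kc)
      have "I n y \<le> (TINT x. r / 2 * k n (x - y) +
          K * ((2 - cos (x $ 1 - y $ 1) - cos (x $ 2 - y $ 2)) * k n (x - y)))"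
        unfolding I_def
      proof (intro integral_mono inner_int Bochner_Integration.integrable_add integrable_mult_right
          integrable_torus_continuous kc c)
        fix x assume "x \<in> space torus_measure"
        then have "\<bar>h x - h y\<bar> ^ p \<le> r / 2 + K * (2 - cos (x $ 1 - y $ 1) - cos (x $ 2 - y $ 2))"
          using K(2) by simp
        from mult_right_mono[OF this kn(5)[of n "x - y"]]
        show "\<bar>h x - h y\<bar> ^ p * k n (x - y) \<le> r / 2 * k n (x - y) +
          K * ((2 - cos (x $ 1 - y $ 1) - cos (x $ 2 - y $ 2)) * k n (x - y))"
          by (simp only: distrib_right mult.assoc)
      qed
      also have "\<dots> = r / 2 * (TINT x. k n (x - y)) + K * M n"
        unfolding M_shift[symmetric]
        using integrable_torus_continuous[OF kc[of n y]] integrable_torus_continuous[OF c] by simp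
      finally show ?thesis
        using kernel_shift_mass[OF kn(3,4)] kn(2) by simp
    qed
    have "(\<lambda>n. K * M n) \<longlonglongrightarrow> K * 0"
      using k unfolding M_def approx_identity_def by (intro tendsto_mult tendsto_const) auto
    then have "\<forall>\<^sub>F n in sequentially. K * M n < r / 2"
      using r by (intro order_tendstoD) auto
    then obtain N where "\<And>n. n \<ge> N \<Longrightarrow> K * M n < r / 2"
      by (auto simp: eventually_sequentially)
    then have "norm (I n y - 0) < r" if "n \<ge> N" for n
      using bound[of n] I_nonneg[of n y] that by fastforce
    then show "\<exists>N. \<forall>n\<ge>N. norm (I n y - 0) < r"
      by blast
  qed
  have "(\<lambda>n. TINT y. I n y) \<longlonglongrightarrow> (TINT y. 0)"
  proof (rule integral_dominated_convergence[where w = "\<lambda>y. (2 * C) ^ p"])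
    show "AE y in torus_measure. (\<lambda>n. I n y) \<longlonglongrightarrow> 0"
      using AE_torus_interior AE_space by eventually_elim (auto intro: I_lim)
    show "AE y in torus_measure. norm (I n y) \<le> (2 * C) ^ p" for n
      using I_nonneg I_le by (intro AE_I2) (simp add: abs_of_nonneg)
  qed (auto intro: I_meas)
  then show ?thesis
    by (simp add: osc)
qed

text \<open>The weighted oscillation is bounded by the \<open>L\<^sup>p\<close> norm uniformly in the kernel, so that its convergence to zero is
  stable under approximation in \<open>L\<^sup>p\<close>.\<close>

lemma oscillation_tendsto_closure:
  assumes h: "Lp_torus p h" and k: "approx_identity k"
    and approx: "\<And>e. e > 0 \<Longrightarrow> \<exists>g. Lp_torus p g \<and> (\<lambda>n. oscillation p (k n) g) \<longlonglongrightarrow> 0 \<and>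
        (TINT x. \<bar>h x - g x\<bar> ^ p) < e"
  shows "(\<lambda>n. oscillation p (k n) h) \<longlonglongrightarrow> 0"
proof (rule LIMSEQ_I)
  have kn: "conv_kernel (k n)" "kernel_mass (k n) = 1" for n
    using k by (auto simp: approx_identity_def)
  fix r :: real assume r: "r > 0"
  define e where "e = r / (2 * (2 ^ p * (2 ^ p * 2)))"
  have e: "e > 0"
    using r by (simp add: e_def)
  obtain g where g: "Lp_torus p g" "(\<lambda>n. oscillation p (k n) g) \<longlonglongrightarrow> 0" "(TINT x. \<bar>h x - g x\<bar> ^ p) < e"
    using approx[OF e] by blast
  have "\<forall>\<^sub>F n in sequentially. oscillation p (k n) g < r / (2 * 2 ^ p)"
    using r by (intro order_tendstoD(2)[OF g(2)]) simp
  then obtain N where N: "\<And>n. n \<ge> N \<Longrightarrow> oscillation p (k n) g < r / (2 * 2 ^ p)"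
    by (auto simp: eventually_sequentially)
  have "norm (oscillation p (k n) h - 0) < r" if "n \<ge> N" for n
  proof -
    have "oscillation p (k n) (\<lambda>x. h x - g x) \<le> 2 ^ p * (2 * 1 * (TINT x. \<bar>h x - g x\<bar> ^ p))"
      using oscillation_integrable(2)[OF Lp_torus_diff[OF h g(1)] kn(1)[of n]] kn(2) by simp
    also have "\<dots> < 2 ^ p * (2 * 1 * e)"
      using g(3) by simp
    finally have "2 ^ p * oscillation p (k n) (\<lambda>x. h x - g x) < 2 ^ p * (2 ^ p * (2 * 1 * e))"
      by simp
    also have "\<dots> = r / 2"
      by (simp add: e_def)
    finally have 1: "2 ^ p * oscillation p (k n) (\<lambda>x. h x - g x) < r / 2" .
    have 2: "2 ^ p * oscillation p (k n) g < r / 2"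
      using N[OF that] by (simp add: field_simps)
    show ?thesis
      using oscillation_add[OF h g(1) kn(1)[of n]] oscillation_integrable(3)[OF h kn(1)[of n]] 1 2
      by (simp add: distrib_left)
  qed
  then show "\<exists>N. \<forall>n\<ge>N. norm (oscillation p (k n) h - 0) < r"
    by blast
qed

lemma clamp_bounds: "0 \<le> C \<Longrightarrow> \<bar>max (- C) (min C t)\<bar> \<le> (C :: real)"
  by auto

text \<open>A measurable function is the limit almost everywhere of continuous ones.  Truncated at the bound \<open>C\<close>
  these also converge in \<open>L\<^sup>p\<close>, by dominated convergence.\<close>

lemma oscillation_tendsto_bounded:
  fixes h :: "real^2 \<Rightarrow> real"
  assumes h: "h \<in> borel_measurable torus_measure" "\<And>x. x \<in> torus \<Longrightarrow> \<bar>h x\<bar> \<le> C"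
    and k: "approx_identity k" and p: "p > 0"
  shows "(\<lambda>n. oscillation p (k n) h) \<longlonglongrightarrow> 0"
proof (rule oscillation_tendsto_closure[OF Lp_torus_bounded[OF h] k])
  have C: "C \<ge> 0"
    using h(2)[of 0] by (simp add: torus_def)
  fix e :: real assume e: "e > 0"
  have "h measurable_on torus"
    using h(1) torus_sets by (simp add: measurable_on_iff_borel_measurable)
  then obtain N g where N: "negligible N" and gc: "\<And>n. continuous_on UNIV (g n)"
    and lim: "\<And>x. x \<notin> N \<Longrightarrow> (\<lambda>n. g n x) \<longlonglongrightarrow> (if x \<in> torus then h x else 0)"
    unfolding measurable_on_def by metis
  define G where "G n x = max (- C) (min C (g n x))" for n :: nat and x
  have Gc: "continuous_on UNIV (G n)" for n
    unfolding G_def by (intro continuous_intros gc)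
  have Gb: "\<bar>G n x\<bar> \<le> C" for n x
    unfolding G_def by (rule clamp_bounds[OF C])
  have GL: "Lp_torus p (G n)" for n
    by (intro Lp_torus_bounded[of _ C] continuous_measurable_torus Gc Gb)
  have "(\<lambda>n. TINT x. \<bar>h x - G n x\<bar> ^ p) \<longlonglongrightarrow> (TINT x. 0)"
  proof (rule integral_dominated_convergence[where w = "\<lambda>y. (2 * C) ^ p"])
    have "AE x in lebesgue. x \<notin> N"
      using N by (intro AE_not_in) (simp add: negligible_iff_null_sets)
    then have "AE x in torus_measure. x \<notin> N"
      using torus_sets by (auto simp: AE_restrict_space_iff elim: AE_mp)
    then show "AE x in torus_measure. (\<lambda>n. \<bar>h x - G n x\<bar> ^ p) \<longlonglongrightarrow> 0"
      using AE_space
    proof eventually_elim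
      case (elim x)
      have "(\<lambda>n. G n x) \<longlonglongrightarrow> max (- C) (min C (h x))"
        unfolding G_def using lim[of x] elim by (intro tendsto_intros) simp
      moreover have "max (- C) (min C (h x)) = h x"
        using h(2)[of x] elim by auto
      ultimately have "(\<lambda>n. \<bar>h x - G n x\<bar> ^ p) \<longlonglongrightarrow> \<bar>h x - h x\<bar> ^ p"
        by (intro tendsto_intros) simp
      then show ?case
        using p by (simp add: power_0_left)
    qed
    show "AE x in torus_measure. norm (\<bar>h x - G n x\<bar> ^ p) \<le> (2 * C) ^ p" for n
    proof (rule AE_I2)
      fix x assume "x \<in> space torus_measure"
      then have "\<bar>h x - G n x\<bar> ^ p \<le> (2 * C) ^ p"
        using h(2)[of x] Gb[of n x] by (intro power_mono) auto
      then show "norm (\<bar>h x - G n x\<bar> ^ p) \<le> (2 * C) ^ p"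
        by simp
    qed
    show "(\<lambda>x. \<bar>h x - G n x\<bar> ^ p) \<in> borel_measurable torus_measure" for n
      using h(1) continuous_measurable_torus[OF Gc] by measurable
  qed auto
  then have "\<forall>\<^sub>F n in sequentially. (TINT x. \<bar>h x - G n x\<bar> ^ p) < e"
    using e by (intro order_tendstoD) auto
  then obtain n where "(TINT x. \<bar>h x - G n x\<bar> ^ p) < e"
    by (auto simp: eventually_sequentially)
  then show "\<exists>g. Lp_torus p g \<and> (\<lambda>n. oscillation p (k n) g) \<longlonglongrightarrow> 0 \<and> (TINT x. \<bar>h x - g x\<bar> ^ p) < e"
    using GL oscillation_tendsto_continuous[OF Gc Gb k p] by blast
qed

theorem oscillation_tendsto_0:
  fixes h :: "real^2 \<Rightarrow> real"
  assumes h: "Lp_torus p h" and k: "approx_identity k" and p: "p > 0"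
  shows "(\<lambda>n. oscillation p (k n) h) \<longlonglongrightarrow> 0"
proof (rule oscillation_tendsto_closure[OF h k])
  fix e :: real assume e: "e > 0"
  have hm: "h \<in> borel_measurable torus_measure" and hi: "integrable torus_measure (\<lambda>x. \<bar>h x\<bar> ^ p)"
    using h by (auto simp: Lp_torus_real)
  define G where "G n x = max (- real n) (min (real n) (h x))" for n x
  have Gm: "G n \<in> borel_measurable torus_measure" for n
    unfolding G_def using hm by measurable
  have Gb: "\<bar>G n x\<bar> \<le> real n" for n x
    unfolding G_def by (rule clamp_bounds) simp
  have "(\<lambda>n. TINT x. \<bar>h x - G n x\<bar> ^ p) \<longlonglongrightarrow> (TINT x. 0)"
  proof (rule integral_dominated_convergence[where w = "\<lambda>x. \<bar>h x\<bar> ^ p"])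
    show "AE x in torus_measure. (\<lambda>n. \<bar>h x - G n x\<bar> ^ p) \<longlonglongrightarrow> 0"
    proof (rule AE_I2)
      fix x
      obtain N where N: "\<bar>h x\<bar> \<le> real N"
        using real_arch_simple by blast
      have "\<bar>h x - G n x\<bar> ^ p = 0" if "n \<ge> N" for n
      proof -
        have "\<bar>h x\<bar> \<le> real n"
          using N that by (meson of_nat_mono order_trans)
        then have "G n x = h x"
          unfolding G_def by auto
        then show ?thesis
          using p by (simp add: power_0_left)
      qed
      then have "\<forall>\<^sub>F n in sequentially. \<bar>h x - G n x\<bar> ^ p = 0"
        by (auto simp: eventually_sequentially)
      then show "(\<lambda>n. \<bar>h x - G n x\<bar> ^ p) \<longlonglongrightarrow> 0"
        by (rule tendsto_eventually)
    qed
    show "AE x in torus_measure. norm (\<bar>h x - G n x\<bar> ^ p) \<le> \<bar>h x\<bar> ^ p" for n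
    proof (rule AE_I2)
      fix x
      have "\<bar>h x - G n x\<bar> \<le> \<bar>h x\<bar>"
        unfolding G_def by auto
      then show "norm (\<bar>h x - G n x\<bar> ^ p) \<le> \<bar>h x\<bar> ^ p"
        by (simp add: power_mono)
    qed
    show "(\<lambda>x. \<bar>h x - G n x\<bar> ^ p) \<in> borel_measurable torus_measure" for n
      using hm Gm by measurable
  qed (auto simp: hi)
  then have "\<forall>\<^sub>F n in sequentially. (TINT x. \<bar>h x - G n x\<bar> ^ p) < e"
    using e by (intro order_tendstoD) auto
  then obtain n where n: "(TINT x. \<bar>h x - G n x\<bar> ^ p) < e"
    by (auto simp: eventually_sequentially)
  have "(\<lambda>j. oscillation p (k j) (G n)) \<longlonglongrightarrow> 0"
    by (rule oscillation_tendsto_bounded[OF Gm Gb k p])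
  moreover have "Lp_torus p (G n)"
    by (rule Lp_torus_bounded[OF Gm Gb])
  ultimately show "\<exists>g. Lp_torus p g \<and> (\<lambda>n. oscillation p (k n) g) \<longlonglongrightarrow> 0 \<and> (TINT x. \<bar>h x - g x\<bar> ^ p) < e"
    using n by blast
qed

section \<open>Mollification\<close>

definition mollify :: "(real^2 \<Rightarrow> real) \<Rightarrow> (real^2 \<Rightarrow> real) \<Rightarrow> real^2 \<Rightarrow> real" where
  "mollify k h y = (TINT x. h x * k (x - y))"

lemma Lp1_iff_integrable: "Lp_torus 1 h \<longleftrightarrow> integrable torus_measure (h :: real^2 \<Rightarrow> 'b::euclidean_space)"
  by (auto simp: Lp_torus_def intro: integrable_norm_cancel)

lemma L2_integrable:
  fixes h :: "real^2 \<Rightarrow> real"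
  assumes "Lp_torus 2 h"
  shows "integrable torus_measure h" "integrable torus_measure (\<lambda>x. (h x)\<^sup>2)"
proof -
  show i: "integrable torus_measure (\<lambda>x. (h x)\<^sup>2)"
    using assms by (simp add: Lp_torus_real)
  show "integrable torus_measure h"
  proof (rule Bochner_Integration.integrable_bound)
    show "integrable torus_measure (\<lambda>x. 1 + (h x)\<^sup>2)"
      using i by simp
    have "\<bar>a\<bar> \<le> 1 + a\<^sup>2" for a :: real
      using sum_squares_bound[of 1 "\<bar>a\<bar>"] by (simp add: power2_abs)
    then show "AE x in torus_measure. norm (h x) \<le> norm (1 + (h x)\<^sup>2)"
      by (intro AE_I2) (simp add: add_nonneg_nonneg)
  qed (use assms in \<open>simp add: Lp_torus_real\<close>)
qed

lemma young: "\<bar>a * b\<bar> \<le> c * a\<^sup>2 + (1 / c) * b\<^sup>2" if "c > 0" for a b c :: real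
proof -
  have "0 \<le> (c * \<bar>a\<bar> - \<bar>b\<bar>)\<^sup>2"
    by simp
  then have "2 * c * (\<bar>a\<bar> * \<bar>b\<bar>) \<le> c\<^sup>2 * a\<^sup>2 + b\<^sup>2"
    by (simp add: power2_diff power_mult_distrib algebra_simps)
  moreover have "0 \<le> c * (\<bar>a\<bar> * \<bar>b\<bar>)"
    using that by simp
  ultimately have "c * (\<bar>a\<bar> * \<bar>b\<bar>) \<le> c\<^sup>2 * a\<^sup>2 + b\<^sup>2"
    by linarith
  also have "\<dots> = c * (c * a\<^sup>2 + (1 / c) * b\<^sup>2)"
    using that by (simp add: power2_eq_square algebra_simps)
  finally have "c * (\<bar>a\<bar> * \<bar>b\<bar>) \<le> c * (c * a\<^sup>2 + (1 / c) * b\<^sup>2)" .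
  then show ?thesis
    using that by (simp add: abs_mult)
qed

lemma L2_mult:
  fixes f g :: "real^2 \<Rightarrow> real"
  assumes "Lp_torus 2 f" "Lp_torus 2 g"
  shows "integrable torus_measure (\<lambda>x. f x * g x)"
    and "c > 0 \<Longrightarrow> (TINT x. \<bar>f x * g x\<bar>) \<le>
      c * (TINT x. (f x)\<^sup>2) + (1 / c) * (TINT x. (g x)\<^sup>2)"
proof -
  have m: "f \<in> borel_measurable torus_measure" "g \<in> borel_measurable torus_measure"
    using assms by (auto simp: Lp_torus_real)
  note i = L2_integrable(2)[OF assms(1)] L2_integrable(2)[OF assms(2)]
  show fg: "integrable torus_measure (\<lambda>x. f x * g x)"
  proof (rule Bochner_Integration.integrable_bound)
    show "integrable torus_measure (\<lambda>x. 1 * (f x)\<^sup>2 + (1 / 1) * (g x)\<^sup>2)"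
      using i by simp
    show "AE x in torus_measure. norm (f x * g x) \<le> norm (1 * (f x)\<^sup>2 + (1 / 1) * (g x)\<^sup>2)"
      using young[of 1] by (intro AE_I2) (simp add: add_nonneg_nonneg)
  qed (use m in measurable)
  assume c: "c > 0"
  have "(TINT x. \<bar>f x * g x\<bar>) \<le> (TINT x. c * (f x)\<^sup>2 + (1 / c) * (g x)\<^sup>2)"
    by (intro integral_mono young[OF c] integrable_abs fg Bochner_Integration.integrable_add integrable_mult_right i)
  then show "(TINT x. \<bar>f x * g x\<bar>) \<le>
      c * (TINT x. (f x)\<^sup>2) + (1 / c) * (TINT x. (g x)\<^sup>2)"
    using i by simp
qed

text \<open>Instead of the Cauchy-Schwarz inequality its additive form \<open>\<bar>a b\<bar> \<le> c a\<^sup>2 + b\<^sup>2 / c\<close> is used, with \<open>c\<close> large.\<close>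

lemma L2_pairing_tendsto:
  fixes f :: "nat \<Rightarrow> real^2 \<Rightarrow> real" and g :: "real^2 \<Rightarrow> real"
  assumes f: "\<And>n. Lp_torus 2 (f n)" "Lp_torus 2 f0" "(\<lambda>n. TINT x. (f n x - f0 x)\<^sup>2) \<longlonglongrightarrow> 0"
    and g: "Lp_torus 2 g"
  shows "(\<lambda>n. TINT x. f n x * g x) \<longlonglongrightarrow> (TINT x. f0 x * g x)"
proof (rule LIMSEQ_I)
  fix r :: real assume r: "r > 0"
  define D where "D n = (TINT x. (f n x - f0 x)\<^sup>2)" for n
  define E where "E = (TINT x. (g x)\<^sup>2)"
  have E: "E \<ge> 0"
    by (simp add: E_def)
  define c where "c = 2 * (E + 1) / r"
  have c: "c > 0"
    using E r by (simp add: c_def)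
  have cE: "(1 / c) * E \<le> r / 2"
    using E r by (simp add: c_def field_simps)
  have "(\<lambda>n. c * D n) \<longlonglongrightarrow> c * 0"
    using f(3) unfolding D_def by (intro tendsto_mult tendsto_const)
  then have "\<forall>\<^sub>F n in sequentially. c * D n < r / 2"
    using r by (intro order_tendstoD) auto
  then obtain N where N: "\<And>n. n \<ge> N \<Longrightarrow> c * D n < r / 2"
    by (auto simp: eventually_sequentially)
  have "norm ((TINT x. f n x * g x) - (TINT x. f0 x * g x)) < r" if "n \<ge> N" for n
  proof -
    have "(TINT x. f n x * g x) - (TINT x. f0 x * g x) =
        (TINT x. (f n x - f0 x) * g x)"
      using L2_mult(1)[OF f(1)[of n] g] L2_mult(1)[OF f(2) g] by (simp add: left_diff_distrib)
    also have "norm \<dots> \<le> (TINT x. \<bar>(f n x - f0 x) * g x\<bar>)"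
      using integral_abs_bound by simp
    also have "\<dots> \<le> c * D n + (1 / c) * E"
      unfolding D_def E_def by (rule L2_mult(2)[OF Lp_torus_diff[OF f(1,2)] g c])
    also have "\<dots> < r"
      using N[OF that] cE by linarith
    finally show ?thesis .
  qed
  then show "\<exists>N. \<forall>n\<ge>N. norm ((TINT x. f n x * g x) - (TINT x. f0 x * g x)) < r"
    by blast
qed

lemma test_function_L2: "test_function f \<Longrightarrow> Lp_torus p f"
proof -
  assume "test_function f"
  then have c: "continuous_on UNIV f"
    by (rule test_function_continuous)
  obtain C where "\<And>x. x \<in> torus \<Longrightarrow> norm (f x) \<le> C"
    using continuous_bounded_torus[OF c] by blast
  then show "Lp_torus p f"
    using Lp_torus_bounded[OF continuous_measurable_torus[OF c], of C] by simp
qed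

lemma L2_mult_test:
  assumes "Lp_torus 2 f" "test_function g"
  shows "Lp_torus 2 (\<lambda>x. f x * g x)"
proof -
  have m: "f \<in> borel_measurable torus_measure" "g \<in> borel_measurable torus_measure"
    using assms by (auto simp: Lp_torus_real intro: continuous_measurable_torus test_function_continuous)
  have "integrable torus_measure (\<lambda>x. (f x)\<^sup>2 * (g x)\<^sup>2)"
    using assms
    by (intro integrable_torus_mult_continuous L2_integrable continuous_intros test_function_continuous)
  then show ?thesis
    using m by (simp add: Lp_torus_real power_mult_distrib)
qed

lemma mollify_expansion:
  assumes "integrable torus_measure h" "finite J" "\<And>j. test_function (A j)"
    "\<And>x y. k (x - y) = (\<Sum>j\<in>J. A j x * B j y)"
  shows "mollify k h y = (\<Sum>j\<in>J. (TINT x. h x * A j x) * B j y)"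
proof -
  have i: "integrable torus_measure (\<lambda>x. h x * A j x * B j y)" for j
    by (intro integrable_mult_left integrable_torus_mult_continuous assms test_function_continuous)
  have "mollify k h y = (TINT x. (\<Sum>j\<in>J. h x * A j x * B j y))"
    by (simp add: mollify_def assms(4) sum_distrib_left mult.assoc)
  also have "\<dots> = (\<Sum>j\<in>J. (TINT x. h x * A j x * B j y))"
    using i by (intro Bochner_Integration.integral_sum)
  finally show ?thesis
    by simp
qed

lemma test_function_mollify:
  assumes "integrable torus_measure h"
  shows "test_function (mollify (cos_kernel m n) h)"
proof -
  obtain J :: "nat set" and A B where e: "finite J" "\<And>j. test_function (A j)" "\<And>j. test_function (B j)"
    "\<And>x y. cos_kernel m n (x - y) = (\<Sum>j\<in>J. A j x * B j y)"
    using cos_kernel_expansion[of m n] by metis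
  have "mollify (cos_kernel m n) h = (\<lambda>y. \<Sum>j\<in>J. (TINT x. h x * A j x) * B j y)"
    by (rule ext) (rule mollify_expansion[OF assms e(1,2,4)])
  then show ?thesis
    using e(3) by (simp add: test_function_sum test_function_mult test_function_const)
qed

lemma pderiv_shift:
  assumes "smooth f"
  shows "pderiv_at i (\<lambda>x. f (x - y)) x = pderiv_at i f (x - y)"
proof -
  have "((\<lambda>x. x - y) has_derivative (\<lambda>v. v)) (at x)"
    by (auto intro!: derivative_eq_intros)
  from pderiv_atI[OF has_derivative_compose[OF this smooth_has_derivative[OF assms]]]
  show ?thesis
    by (simp add: pderiv_at_def)
qed

lemma pderiv_reflect:
  fixes f :: "real^2 \<Rightarrow> real"
  assumes "smooth f"
  shows "pderiv_at i (\<lambda>y. f (x - y)) y = - pderiv_at i f (x - y)"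
proof -
  have "((\<lambda>y. x - y) has_derivative (\<lambda>v. - v)) (at y)"
    by (auto intro!: derivative_eq_intros)
  from pderiv_atI[OF has_derivative_compose[OF this smooth_has_derivative[OF assms]]]
  have "pderiv_at i (\<lambda>y. f (x - y)) y = frechet_derivative f (at (x - y)) (- axis i 1)" .
  also have "\<dots> = - frechet_derivative f (at (x - y)) (axis i 1)"
    using linear_neg[OF has_derivative_linear[OF smooth_has_derivative[OF assms]]] .
  finally show ?thesis
    by (simp add: pderiv_at_def)
qed

lemma pderiv_mollify:
  assumes "integrable torus_measure h"
  shows "pderiv_at i (mollify (cos_kernel m n) h) y = - (TINT x. h x * pderiv_at i (cos_kernel m n) (x - y))"
proof -
  obtain J :: "nat set" and A B where e: "finite J" "\<And>j. test_function (A j)" "\<And>j. test_function (B j)"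
    "\<And>x y. cos_kernel m n (x - y) = (\<Sum>j\<in>J. A j x * B j y)"
    using cos_kernel_expansion[of m n] by metis
  have sB: "smooth (B j)" for j
    using e(3) by (rule test_function_smooth)
  have "mollify (cos_kernel m n) h = (\<lambda>y. \<Sum>j\<in>J. (TINT x. h x * A j x) * B j y)"
    by (rule ext) (rule mollify_expansion[OF assms e(1,2,4)])
  then have "pderiv_at i (mollify (cos_kernel m n) h) y = (\<Sum>j\<in>J. (TINT x. h x * A j x) * pderiv_at i (B j) y)"
    by (simp add: pderiv_sum smooth_mult smooth_const sB pderiv_cmult)
  also have "\<dots> = (\<Sum>j\<in>J. (TINT x. h x * A j x * pderiv_at i (B j) y))"
    by simp
  also have "\<dots> = (TINT x. (\<Sum>j\<in>J. h x * A j x * pderiv_at i (B j) y))"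
    by (intro Bochner_Integration.integral_sum[symmetric] integrable_mult_left
        integrable_torus_mult_continuous assms test_function_continuous e)
  also have "(\<lambda>x. \<Sum>j\<in>J. h x * A j x * pderiv_at i (B j) y) = (\<lambda>x. - (h x * pderiv_at i (cos_kernel m n) (x - y)))"
  proof
    fix x
    have "- pderiv_at i (cos_kernel m n) (x - y) = pderiv_at i (\<lambda>y. cos_kernel m n (x - y)) y"
      by (rule pderiv_reflect[symmetric]) (rule test_function_smooth[OF cos_kernel_test_function(1)])
    also have "\<dots> = (\<Sum>j\<in>J. A j x * pderiv_at i (B j) y)"
      unfolding e(4) by (simp add: pderiv_sum smooth_mult smooth_const sB pderiv_cmult)
    finally have "(\<Sum>j\<in>J. A j x * pderiv_at i (B j) y) = - pderiv_at i (cos_kernel m n) (x - y)"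
      by simp
    then show "(\<Sum>j\<in>J. h x * A j x * pderiv_at i (B j) y) = - (h x * pderiv_at i (cos_kernel m n) (x - y))"
      by (simp add: mult.assoc sum_distrib_left[symmetric])
  qed
  finally show ?thesis
    by simp
qed

text \<open>Mollification commutes with weak differentiation, since the kernel is itself a test function.\<close>

lemma pderiv_mollify_weak:
  assumes "has_weak_pderiv i h d"
  shows "pderiv_at i (mollify (cos_kernel m n) h) y = mollify (cos_kernel m n) d y"
proof -
  have h: "integrable torus_measure h"
    using assms unfolding has_weak_pderiv_def Lp1_iff_integrable by auto
  have "(TINT x. d x * cos_kernel m n (x - y)) =
      - (TINT x. h x * pderiv_at i (\<lambda>x. cos_kernel m n (x - y)) x)"
    using assms cos_kernel_test_function(2)[of m n y] unfolding has_weak_pderiv_def by blast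
  also have "pderiv_at i (\<lambda>x. cos_kernel m n (x - y)) = (\<lambda>x. pderiv_at i (cos_kernel m n) (x - y))"
    by (rule ext) (rule pderiv_shift[OF test_function_smooth[OF cos_kernel_test_function(1)]])
  finally show ?thesis
    unfolding pderiv_mollify[OF h] by (simp add: mollify_def)
qed

text \<open>The kernel is a probability density, so the mollification error at \<open>y\<close> is the mean of \<open>h - h y\<close>.\<close>

lemma mollify_error:
  assumes k: "conv_kernel k" "kernel_mass k = 1"
  shows "Lp_torus 1 h \<Longrightarrow> (TINT y. \<bar>mollify k h y - h y\<bar>) \<le> oscillation 1 k h"
    and "Lp_torus 2 h \<Longrightarrow> (TINT y. (mollify k h y - h y)\<^sup>2) \<le> oscillation 2 k h"
proof -
  have k': "continuous_on UNIV k" "periodic k" "\<And>z. 0 \<le> k z"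
    using k by (auto simp: conv_kernel_def)
  have kc: "continuous_on UNIV (\<lambda>x. k (x - y))" for y
    by (intro continuous_on_compose2[OF k'(1)] continuous_intros) auto
  have mass: "(TINT x. k (x - y)) = 1" for y
    using kernel_shift_mass[OF k'(1,2)] k(2) by simp
  have diff: "mollify k h y - h y = (TINT x. (h x - h y) * k (x - y))"
    and diff_int: "integrable torus_measure (\<lambda>x. (h x - h y) * k (x - y))"
    if "integrable torus_measure h" for y
  proof -
    have i: "integrable torus_measure (\<lambda>x. h x * k (x - y))" "integrable torus_measure (\<lambda>x. h y * k (x - y))"
      by (rule integrable_torus_mult_continuous[OF that kc],
          rule integrable_mult_right[OF integrable_torus_continuous[OF kc]])
    then show "integrable torus_measure (\<lambda>x. (h x - h y) * k (x - y))"
      by (simp add: left_diff_distrib)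
    show "mollify k h y - h y = (TINT x. (h x - h y) * k (x - y))"
      using i by (simp add: left_diff_distrib mollify_def mass)
  qed
  have main: "(TINT y. \<bar>mollify k h y - h y\<bar> ^ p) \<le> oscillation p k h"
    if h: "Lp_torus p h" and ptw: "\<And>y. \<bar>mollify k h y - h y\<bar> ^ p \<le> (TINT x. \<bar>h x - h y\<bar> ^ p * k (x - y))" for p
  proof -
    note osc = oscillation_integrable[OF h k(1)]
    have i: "integrable torus_measure (\<lambda>y. TINT x. \<bar>h x - h y\<bar> ^ p * k (x - y))"
      using TM2.integrable_fst'[OF osc(1)] by simp
    have eq: "oscillation p k h = (TINT y. TINT x. \<bar>h x - h y\<bar> ^ p * k (x - y))"
      unfolding oscillation_def TM2.integral_fst'[OF osc(1), symmetric] by simp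
    show ?thesis
    proof (cases "integrable torus_measure (\<lambda>y. \<bar>mollify k h y - h y\<bar> ^ p)")
      case True
      then show ?thesis
        unfolding eq using i ptw by (intro integral_mono)
    next
      case False
      then show ?thesis
        using osc(3) by (simp add: not_integrable_integral_eq)
    qed
  qed
  show "(TINT y. \<bar>mollify k h y - h y\<bar>) \<le> oscillation 1 k h" if h: "Lp_torus 1 h"
  proof -
    have hi: "integrable torus_measure h"
      using h Lp1_iff_integrable by blast
    have "\<bar>mollify k h y - h y\<bar> ^ 1 \<le> (TINT x. \<bar>h x - h y\<bar> ^ 1 * k (x - y))" for y
      unfolding diff[OF hi] using integral_abs_bound[of torus_measure "\<lambda>x. (h x - h y) * k (x - y)"] k'(3)
      by (simp add: abs_mult)
    from main[OF h this] show ?thesis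
      by simp
  qed
  show "(TINT y. (mollify k h y - h y)\<^sup>2) \<le> oscillation 2 k h" if h: "Lp_torus 2 h"
  proof -
    note hi = L2_integrable[OF h]
    have "\<bar>mollify k h y - h y\<bar> ^ 2 \<le> (TINT x. \<bar>h x - h y\<bar> ^ 2 * k (x - y))" for y
    proof -
      let ?m = "mollify k h y - h y"
      have i0: "integrable torus_measure (\<lambda>x. k (x - y))"
        by (intro integrable_torus_continuous kc)
      have "integrable torus_measure (\<lambda>x. (h x)\<^sup>2 - 2 * h y * h x + (h y)\<^sup>2)"
        using hi by simp
      then have "integrable torus_measure (\<lambda>x. (h x - h y)\<^sup>2)"
        by (simp add: power2_diff algebra_simps)
      then have i2: "integrable torus_measure (\<lambda>x. (h x - h y)\<^sup>2 * k (x - y))"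
        by (intro integrable_torus_mult_continuous kc)
      note i1 = diff_int[OF hi(1), of y]
      \<comment> \<open>Jensen's inequality: the variance of \<open>h - h y\<close> under the probability density \<open>k\<close> is nonnegative.\<close>
      have "0 \<le> (TINT x. (h x - h y - ?m)\<^sup>2 * k (x - y))"
        using k'(3) by (intro Bochner_Integration.integral_nonneg) simp
      also have "(\<lambda>x. (h x - h y - ?m)\<^sup>2 * k (x - y)) =
          (\<lambda>x. (h x - h y)\<^sup>2 * k (x - y) - 2 * ?m * ((h x - h y) * k (x - y)) + ?m\<^sup>2 * k (x - y))"
        by (auto simp: fun_eq_iff power2_eq_square algebra_simps)
      also have "(TINT x. (h x - h y)\<^sup>2 * k (x - y) - 2 * ?m * ((h x - h y) * k (x - y)) + ?m\<^sup>2 * k (x - y)) =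
          (TINT x. (h x - h y)\<^sup>2 * k (x - y)) - 2 * ?m * (TINT x. (h x - h y) * k (x - y))
           + ?m\<^sup>2 * (TINT x. k (x - y))"
        using i0 i1 i2 by simp
      also have "\<dots> = (TINT x. (h x - h y)\<^sup>2 * k (x - y)) - ?m\<^sup>2"
        unfolding mass diff[OF hi(1), symmetric] by (simp add: power2_eq_square)
      finally show ?thesis
        by simp
    qed
    from main[OF h this] show ?thesis
      by simp
  qed
qed

lemma mollify_tendsto_L1:
  assumes "approx_identity k" "Lp_torus 1 h"
  shows "(\<lambda>n. TINT y. \<bar>mollify (k n) h y - h y\<bar>) \<longlonglongrightarrow> 0"
proof (rule tendsto_sandwich[OF _ _ tendsto_const oscillation_tendsto_0[OF assms(2,1)]])
  show "\<forall>\<^sub>F n in sequentially. (TINT y. \<bar>mollify (k n) h y - h y\<bar>) \<le> oscillation 1 (k n) h"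
    using assms mollify_error(1) by (auto simp: approx_identity_def)
qed auto

lemma mollify_tendsto_L2:
  assumes "approx_identity k" "Lp_torus 2 h"
  shows "(\<lambda>n. TINT y. (mollify (k n) h y - h y)\<^sup>2) \<longlonglongrightarrow> 0"
proof (rule tendsto_sandwich[OF _ _ tendsto_const oscillation_tendsto_0[OF assms(2,1)]])
  show "\<forall>\<^sub>F n in sequentially. (TINT y. (mollify (k n) h y - h y)\<^sup>2) \<le> oscillation 2 (k n) h"
    using assms mollify_error(2) by (auto simp: approx_identity_def)
qed auto

abbreviation diag_kernel :: "nat \<Rightarrow> real^2 \<Rightarrow> real" where
  "diag_kernel n \<equiv> cos_kernel (Suc n) (Suc n)"

lemma approx_identity_diag: "approx_identity diag_kernel"
  by (intro approx_identity_cos_kernel filterlim_Suc)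

text \<open>All mollifications of \<open>h\<close> vanish, and they converge to \<open>h\<close>.\<close>

lemma integral_test_functions_zero:
  fixes h :: "real^2 \<Rightarrow> real"
  assumes h: "integrable torus_measure h" and zero: "\<And>\<phi>. test_function \<phi> \<Longrightarrow> (TINT x. h x * \<phi> x) = 0"
  shows "AE x in torus_measure. h x = 0"
proof -
  have "mollify (diag_kernel n) h y = 0" for n y
    unfolding mollify_def by (intro zero cos_kernel_test_function)
  then have "(\<lambda>n::nat. TINT y. \<bar>h y\<bar>) \<longlonglongrightarrow> 0"
    using mollify_tendsto_L1[OF approx_identity_diag Lp1_iff_integrable[THEN iffD2, OF h]] by simp
  then have "(TINT y. \<bar>h y\<bar>) = 0"
    by (simp add: LIMSEQ_const_iff)
  then show ?thesis
    using h by (subst (asm) integral_nonneg_eq_0_iff_AE) auto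
qed

text \<open>The product rule for two functions with square integrable weak derivatives; it suffices to mollify
  one factor, since the other factor then meets a smooth test function.\<close>

lemma weak_product_rule:
  fixes a b :: "real^2 \<Rightarrow> real"
  assumes a: "has_weak_pderiv i a a'" "Lp_torus 2 a" "Lp_torus 2 a'"
    and b: "has_weak_pderiv i b b'" "Lp_torus 2 b" "Lp_torus 2 b'"
    and \<phi>: "test_function \<phi>"
  shows "(TINT x. (a' x * b x + a x * b' x) * \<phi> x) =
    - (TINT x. a x * b x * pderiv_at i \<phi> x)"
proof -
  define A where "A n = mollify (diag_kernel n) a" for n
  define A' where "A' n = mollify (diag_kernel n) a'" for n
  have ai: "integrable torus_measure a" "integrable torus_measure a'"
    using a L2_integrable by auto
  have At: "test_function (A n)" "test_function (A' n)" for n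
    unfolding A_def A'_def by (intro test_function_mollify ai)+
  have dA: "pderiv_at i (A n) x = A' n x" for n x
    unfolding A_def A'_def by (rule pderiv_mollify_weak[OF a(1)])
  have L2: "Lp_torus 2 (\<lambda>x. b' x * \<phi> x)" "Lp_torus 2 (\<lambda>x. b x * \<phi> x)" "Lp_torus 2 (\<lambda>x. b x * pderiv_at i \<phi> x)"
    by (intro L2_mult_test b \<phi> test_function_pderiv)+
  have step: "(TINT x. A n x * (b' x * \<phi> x)) + (TINT x. A' n x * (b x * \<phi> x)) =
      - (TINT x. A n x * (b x * pderiv_at i \<phi> x))" for n
  proof -
    have "(TINT x. b' x * (A n x * \<phi> x)) = - (TINT x. b x * pderiv_at i (\<lambda>x. A n x * \<phi> x) x)"
      using b(1) test_function_mult[OF At(1)[of n] \<phi>] unfolding has_weak_pderiv_def by blast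
    also have "(\<lambda>x. b x * pderiv_at i (\<lambda>x. A n x * \<phi> x) x) = (\<lambda>x. A n x * (b x * pderiv_at i \<phi> x) + A' n x * (b x * \<phi> x))"
      by (auto simp: fun_eq_iff pderiv_mult test_function_smooth At \<phi> dA algebra_simps)
    also have "(TINT x. A n x * (b x * pderiv_at i \<phi> x) + A' n x * (b x * \<phi> x)) =
        (TINT x. A n x * (b x * pderiv_at i \<phi> x)) + (TINT x. A' n x * (b x * \<phi> x))"
      by (intro Bochner_Integration.integral_add L2_mult test_function_L2 At L2)
    finally show ?thesis
      by (simp add: mult.left_commute)
  qed
  have lim: "(\<lambda>n. TINT x. A n x * g x) \<longlonglongrightarrow> (TINT x. a x * g x)"
    and lim': "(\<lambda>n. TINT x. A' n x * g x) \<longlonglongrightarrow> (TINT x. a' x * g x)"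
    if "Lp_torus 2 g" for g
    using that mollify_tendsto_L2[OF approx_identity_diag a(2)] mollify_tendsto_L2[OF approx_identity_diag a(3)]
    unfolding A_def A'_def
    by (auto intro!: L2_pairing_tendsto test_function_L2 test_function_mollify ai a)
  have "(\<lambda>n. (TINT x. A n x * (b' x * \<phi> x)) + (TINT x. A' n x * (b x * \<phi> x))) \<longlonglongrightarrow>
      (TINT x. a x * (b' x * \<phi> x)) + (TINT x. a' x * (b x * \<phi> x))"
    by (intro tendsto_add lim lim' L2)
  moreover have "(\<lambda>n. - (TINT x. A n x * (b x * pderiv_at i \<phi> x))) \<longlonglongrightarrow>
      - (TINT x. a x * (b x * pderiv_at i \<phi> x))"
    by (intro tendsto_minus lim L2)
  ultimately have "(TINT x. a x * (b' x * \<phi> x)) + (TINT x. a' x * (b x * \<phi> x)) =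
      - (TINT x. a x * (b x * pderiv_at i \<phi> x))"
    unfolding step by (rule LIMSEQ_unique)
  moreover have "(TINT x. a' x * (b x * \<phi> x) + a x * (b' x * \<phi> x)) =
      (TINT x. a' x * (b x * \<phi> x)) + (TINT x. a x * (b' x * \<phi> x))"
    by (intro Bochner_Integration.integral_add L2_mult a L2)
  ultimately show ?thesis
    by (simp add: algebra_simps)
qed


section \<open>Oscillation of functions with square integrable gradient\<close>

text \<open>The moments of the kernels are known for \<open>1 - cos\<close>; this bounds squares of distances by it.\<close>

lemma square_le_one_minus_cos: "t\<^sup>2 \<le> 18 * (1 - cos t)" if "\<bar>t\<bar> \<le> pi" for t :: real
proof -
  define x where "x = \<bar>t\<bar> / 2"
  have x: "0 \<le> x" "x \<le> 2"
    using that pi_less_4 by (auto simp: x_def)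
  have "\<bar>sin x - x\<bar> \<le> x ^ 3 / 6"
    using Maclaurin_sin_bound[of x 3] x by (simp add: sin_coeff_def lessThan_nat_numeral fact_numeral)
  moreover have "x ^ 3 / 6 \<le> 2 / 3 * x"
  proof -
    have "x ^ 2 * x \<le> 4 * x"
      using x power_mono[of x 2 2] by (intro mult_right_mono) auto
    then show ?thesis
      by (simp add: power3_eq_cube power2_eq_square)
  qed
  ultimately have "x / 3 \<le> sin x"
    by linarith
  then have "(x / 3)\<^sup>2 \<le> (sin x)\<^sup>2"
    using x by (intro power_mono) auto
  moreover have "cos t = 1 - 2 * (sin x)\<^sup>2"
    using cos_double_sin[of x] by (simp add: x_def)
  ultimately show ?thesis
    by (simp add: x_def power_divide)
qed

text \<open>Translation by \<open>t\<close> is \<open>N\<close> translations by \<open>t / N\<close>; with the Cauchy-Schwarz inequality for the \<open>N\<close>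
  increments this reduces the estimate to infinitesimal translations.\<close>

lemma translation_bound_axis:
  assumes v: "test_function v"
  shows "(TINT y. (v (y + axis i t) - v y)\<^sup>2) \<le>
    t\<^sup>2 * (TINT y. (pderiv_at i v y)\<^sup>2)"
proof -
  define D where "D s = (TINT y. (v (y + axis i s) - v y)\<^sup>2)" for s
  have vc: "continuous_on UNIV v" and vp: "periodic v" and vs: "smooth v"
    using v by (auto simp: test_function_def smooth_continuous)
  have shc: "continuous_on UNIV (\<lambda>y. v (y + c))" for c
    by (intro continuous_on_compose2[OF vc] continuous_intros) auto
  have shp: "periodic (\<lambda>y. v (y + c))" for c
    unfolding periodic_def
  proof (intro allI)
    fix x :: "real^2" and j
    have "v ((x + c) + axis j (2 * pi)) = v (x + c)"
      using vp unfolding periodic_def by blast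
    then show "v (x + axis j (2 * pi) + c) = v (x + c)"
      by (simp add: add_ac)
  qed
  have ax0: "axis i 0 = (0 :: real^2)" and axadd: "axis i a + axis i b = (axis i (a + b) :: real^2)" for a b
    by (auto simp: vec_eq_iff axis_def)
  have step: "D (real N * s) \<le> real N ^ 2 * D s" for N s
  proof -
    have tele: "v (y + axis i (real N * s)) - v y =
        (\<Sum>k<N. v (y + axis i (real (Suc k) * s)) - v (y + axis i (real k * s)))" for y
      using sum_lessThan_telescope[of "\<lambda>k. v (y + axis i (real k * s))" N] by (simp add: ax0)
    have inc: "(TINT y. (v (y + axis i (real (Suc k) * s)) - v (y + axis i (real k * s)))\<^sup>2) = D s" for k
    proof -
      have "continuous_on UNIV (\<lambda>y. (v (y + axis i s) - v y)\<^sup>2)"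
        by (intro continuous_intros shc vc)
      moreover have "periodic (\<lambda>y. (v (y + axis i s) - v y)\<^sup>2)"
        using shp[of "axis i s"] vp by (simp add: periodic_def)
      ultimately have "(TINT y. (v ((y + axis i (real k * s)) + axis i s) - v (y + axis i (real k * s)))\<^sup>2) = D s"
        unfolding D_def by (rule integral_torus_shift_axis)
      moreover have "(y + axis i (real k * s)) + axis i s = y + axis i (real (Suc k) * s)" for y :: "real^2"
        by (simp add: add.assoc axadd algebra_simps)
      ultimately show ?thesis
        by (simp only:)
    qed
    have c: "continuous_on UNIV (\<lambda>y. (v (y + axis i (real (Suc k) * s)) - v (y + axis i (real k * s)))\<^sup>2)" for k
      by (intro continuous_intros shc)
    have "D (real N * s) \<le> (TINT y. real N * (\<Sum>k<N. (v (y + axis i (real (Suc k) * s)) - v (y + axis i (real k * s)))\<^sup>2))"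
      unfolding D_def
    proof (intro integral_mono)
      fix y :: "real^2"
      show "(v (y + axis i (real N * s)) - v y)\<^sup>2 \<le> real N * (\<Sum>k<N. (v (y + axis i (real (Suc k) * s)) - v (y + axis i (real k * s)))\<^sup>2)"
        unfolding tele using Cauchy_Schwarz_ineq_sum[of "\<lambda>k. 1" "\<lambda>k. v (y + axis i (real (Suc k) * s)) - v (y + axis i (real k * s))" "{..<N}"]
        by simp
    next
      show "integrable torus_measure (\<lambda>y. (v (y + axis i (real N * s)) - v y)\<^sup>2)"
        by (intro integrable_torus_continuous continuous_intros shc vc)
      show "integrable torus_measure (\<lambda>y. real N * (\<Sum>k<N. (v (y + axis i (real (Suc k) * s)) - v (y + axis i (real k * s)))\<^sup>2))"
        by (intro integrable_mult_right Bochner_Integration.integrable_sum integrable_torus_continuous c)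
    qed
    also have "\<dots> = real N * (\<Sum>k<N. TINT y. (v (y + axis i (real (Suc k) * s)) - v (y + axis i (real k * s)))\<^sup>2)"
      by (subst integral_mult_right_zero, subst Bochner_Integration.integral_sum) (rule integrable_torus_continuous[OF c] refl)+
    also have "\<dots> = real N * (\<Sum>k<N. D s)"
      by (simp only: inc)
    also have "\<dots> = real N ^ 2 * D s"
      by (simp add: power2_eq_square)
    finally show ?thesis .
  qed
  define q where "q n y = (v (y + axis i (t / real (Suc n))) - v y) * real (Suc n)" for n y
  have bound: "D t \<le> (TINT y. (q n y)\<^sup>2)" for n
  proof -
    have "D t = D (real (Suc n) * (t / real (Suc n)))"
      by simp
    also have "\<dots> \<le> real (Suc n) ^ 2 * D (t / real (Suc n))"
      by (rule step)
    also have "\<dots> = (TINT y. (q n y)\<^sup>2)"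
      unfolding D_def q_def power_mult_distrib by (simp add: mult.commute del: of_nat_Suc)
    finally show ?thesis .
  qed
  have dc: "continuous_on UNIV (pderiv_at i v)"
    by (intro test_function_continuous test_function_pderiv v)
  obtain C where C: "C \<ge> 0" "\<And>z. \<bar>pderiv_at i v z\<bar> \<le> C"
    using periodic_bounded[OF dc] test_function_pderiv[OF v] unfolding test_function_def by blast
  have deriv: "((\<lambda>s. v (y + axis i (t * s))) has_real_derivative pderiv_at i v (y + axis i (t * s)) * t) (at s)" for y s
  proof -
    have "((\<lambda>s. t * s) has_real_derivative t) (at s)"
      by (auto intro!: derivative_eq_intros)
    from DERIV_chain2[where f = "\<lambda>r. v (y + axis i r)", OF pderiv_along_axis[OF vs] this]
    show ?thesis .
  qed
  have "(\<lambda>n. TINT y. (q n y)\<^sup>2) \<longlonglongrightarrow> (TINT y. (t * pderiv_at i v y)\<^sup>2)"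
  proof (rule integral_dominated_convergence[where w = "\<lambda>y. (\<bar>t\<bar> * C)\<^sup>2"])
    show "AE y in torus_measure. (\<lambda>n. (q n y)\<^sup>2) \<longlonglongrightarrow> (t * pderiv_at i v y)\<^sup>2"
    proof (rule AE_I2)
      fix y :: "real^2"
      have "((\<lambda>h. (v (y + axis i (t * h)) - v y) / h) \<longlongrightarrow> pderiv_at i v y * t) (at 0)"
        using deriv[of y 0] by (simp add: DERIV_def ax0)
      moreover have "filterlim (\<lambda>n. 1 / real (Suc n)) (at 0) sequentially"
        using LIMSEQ_inverse_real_of_nat
        by (auto simp: filterlim_at inverse_eq_divide simp del: of_nat_Suc)
      ultimately have "(\<lambda>n. (v (y + axis i (t * (1 / real (Suc n)))) - v y) / (1 / real (Suc n))) \<longlonglongrightarrow> pderiv_at i v y * t"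
        by (rule filterlim_compose)
      then have "(\<lambda>n. q n y) \<longlonglongrightarrow> t * pderiv_at i v y"
        by (simp add: q_def mult.commute del: of_nat_Suc)
      then show "(\<lambda>n. (q n y)\<^sup>2) \<longlonglongrightarrow> (t * pderiv_at i v y)\<^sup>2"
        by (intro tendsto_power)
    qed
    show "AE y in torus_measure. norm ((q n y)\<^sup>2) \<le> (\<bar>t\<bar> * C)\<^sup>2" for n
    proof (rule AE_I2)
      fix y
      obtain s where s: "v (y + axis i (t * (1 / real (Suc n)))) - v (y + axis i (t * 0)) =
          (1 / real (Suc n) - 0) * (pderiv_at i v (y + axis i (t * s)) * t)"
        using MVT2[of 0 "1 / real (Suc n)" "\<lambda>s. v (y + axis i (t * s))" "\<lambda>s. pderiv_at i v (y + axis i (t * s)) * t"] deriv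
        by auto
      have "q n y = pderiv_at i v (y + axis i (t * s)) * t"
        using s by (simp add: q_def ax0 del: of_nat_Suc)
      then have "\<bar>q n y\<bar> \<le> \<bar>t\<bar> * C"
        using mult_left_mono[OF C(2)[of "y + axis i (t * s)"], of "\<bar>t\<bar>"] by (simp add: abs_mult mult.commute)
      then have "\<bar>q n y\<bar>\<^sup>2 \<le> (\<bar>t\<bar> * C)\<^sup>2"
        by (intro power_mono) auto
      then show "norm ((q n y)\<^sup>2) \<le> (\<bar>t\<bar> * C)\<^sup>2"
        by simp
    qed
    show "(\<lambda>y. (q n y)\<^sup>2) \<in> borel_measurable torus_measure" for n
      unfolding q_def by (intro continuous_measurable_torus continuous_intros shc vc)
    show "(\<lambda>y. (t * pderiv_at i v y)\<^sup>2) \<in> borel_measurable torus_measure"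
      by (intro continuous_measurable_torus continuous_intros dc)
  qed auto
  then have "D t \<le> (TINT y. (t * pderiv_at i v y)\<^sup>2)"
    by (rule LIMSEQ_le_const) (use bound in blast)
  then show ?thesis
    by (simp add: D_def power_mult_distrib)
qed

lemma translation_bound_periodic:
  assumes v: "test_function v" and t: "0 \<le> t" "t \<le> 2 * pi"
  shows "(TINT y. (v (y + axis i t) - v y)\<^sup>2) \<le>
    18 * (1 - cos t) * (TINT y. (pderiv_at i v y)\<^sup>2)"
proof -
  have E: "0 \<le> (TINT y. (pderiv_at i v y)\<^sup>2)"
    by simp
  show ?thesis
  proof (cases "t \<le> pi")
    case True
    then show ?thesis
      using translation_bound_axis[OF v, of i t] t square_le_one_minus_cos[of t]
        mult_right_mono[OF _ E, of "t\<^sup>2" "18 * (1 - cos t)"] by linarith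
  next
    case False
    define s where "s = t - 2 * pi"
    have "v (y + axis i t) = v (y + axis i s)" for y
    proof -
      have "v ((y + axis i s) + axis i (2 * pi)) = v (y + axis i s)"
        using v unfolding test_function_def periodic_def by blast
      moreover have "(y + axis i s) + axis i (2 * pi) = y + axis i t"
        by (auto simp: vec_eq_iff axis_def s_def)
      ultimately show ?thesis by (simp only:)
    qed
    moreover have "cos s = cos t"
      by (simp add: s_def cos_diff)
    moreover have "\<bar>s\<bar> \<le> pi"
      using False t by (simp add: s_def)
    ultimately show ?thesis
      using translation_bound_axis[OF v, of i s] square_le_one_minus_cos[of s]
        mult_right_mono[OF _ E, of "s\<^sup>2" "18 * (1 - cos s)"] by simp
  qed
qed

text \<open>The translation estimate is averaged against the kernel.  The translation is shortened to a representative
  in \<open>[-\<pi>, \<pi>]\<close> modulo periods, where its square is controlled by \<open>1 - cos\<close>.\<close>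

lemma oscillation_test_function:
  assumes v: "test_function v" and k: "conv_kernel k"
  shows "oscillation 2 k v \<le>
    36 * (TINT z. (1 - cos (z $ 1)) * k z) * (TINT y. (pderiv_at 1 v y)\<^sup>2) +
    36 * (TINT z. (1 - cos (z $ 2)) * k z) * (TINT y. (pderiv_at 2 v y)\<^sup>2)"
proof -
  have k': "continuous_on UNIV k" "periodic k" "\<And>z. 0 \<le> k z"
    using k by (auto simp: conv_kernel_def)
  have vc: "continuous_on UNIV v" and vp: "periodic v"
    using v by (auto simp: test_function_def smooth_continuous)
  define d where "d i = (TINT y. (pderiv_at i v y)\<^sup>2)" for i
  have shc: "continuous_on UNIV (\<lambda>y. v (y + c))" for c
    by (intro continuous_on_compose2[OF vc] continuous_intros) auto
  have shp: "v (x + axis j (2 * pi) + c) = v (x + c)" for x c j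
  proof -
    have "v ((x + c) + axis j (2 * pi)) = v (x + c)"
      using vp unfolding periodic_def by blast
    then show ?thesis
      by (simp add: add_ac)
  qed
  note osc = oscillation_integrable(1)[OF test_function_L2[OF v, of 2] k]
  define Fz where "Fz p = \<bar>v (fst p + snd p) - v (fst p)\<bar>\<^sup>2 * k (snd p)" for p :: "(real^2) \<times> (real^2)"
  have inner: "(TINT x. \<bar>v x - v y\<bar>\<^sup>2 * k (x - y)) = (TINT z. Fz (y, z))" for y
  proof -
    have "continuous_on UNIV (\<lambda>x. \<bar>v x - v y\<bar>\<^sup>2 * k (x - y))"
      by (intro continuous_intros vc continuous_on_compose2[OF k'(1), of UNIV "\<lambda>x. x - y"]) auto
    moreover have "periodic (\<lambda>x. \<bar>v x - v y\<bar>\<^sup>2 * k (x - y))"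
      unfolding periodic_def
    proof (intro allI)
      fix x :: "real^2" and j
      have "k ((x - y) + axis j (2 * pi)) = k (x - y)" "v (x + axis j (2 * pi)) = v x"
        using k'(2) vp unfolding periodic_def by blast+
      then show "\<bar>v (x + axis j (2 * pi)) - v y\<bar>\<^sup>2 * k (x + axis j (2 * pi) - y) = \<bar>v x - v y\<bar>\<^sup>2 * k (x - y)"
        by (simp add: algebra_simps)
    qed
    ultimately have "(TINT z. \<bar>v (z + y) - v y\<bar>\<^sup>2 * k ((z + y) - y)) = (TINT x. \<bar>v x - v y\<bar>\<^sup>2 * k (x - y))"
      by (rule integral_torus_shift)
    then show ?thesis
      by (simp add: Fz_def add.commute)
  qed
  obtain C where C: "C \<ge> 0" "\<And>z. \<bar>v z\<bar> \<le> C"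
    using periodic_bounded[OF vc vp] by blast
  obtain K where K: "K \<ge> 0" "\<And>z. \<bar>k z\<bar> \<le> K"
    using periodic_bounded[OF k'(1,2)] by blast
  interpret P: finite_measure "torus_measure \<Otimes>\<^sub>M torus_measure"
    by (rule finite_measure_pair_measure) unfold_locales
  have Fm: "Fz \<in> borel_measurable (torus_measure \<Otimes>\<^sub>M torus_measure)"
  proof -
    have vm: "v \<in> borel_measurable borel" and km: "k \<in> borel_measurable borel"
      using vc k' by (auto intro: borel_measurable_continuous_onI)
    have f: "(\<lambda>p. fst p) \<in> measurable (torus_measure \<Otimes>\<^sub>M torus_measure) borel"
      and s: "(\<lambda>p. snd p) \<in> measurable (torus_measure \<Otimes>\<^sub>M torus_measure) borel"
      by (rule measurable_compose[OF measurable_fst torus_id_measurable],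
          rule measurable_compose[OF measurable_snd torus_id_measurable])
    show ?thesis
      unfolding Fz_def[abs_def]
      by (intro borel_measurable_times borel_measurable_power borel_measurable_abs borel_measurable_diff
          measurable_compose[OF _ vm] measurable_compose[OF s km] borel_measurable_add f s)
  qed
  have Fint: "integrable (torus_measure \<Otimes>\<^sub>M torus_measure) Fz"
  proof (rule P.integrable_const_bound[OF _ Fm, where B = "(2 * C)\<^sup>2 * K"])
    have "norm (Fz p) \<le> (2 * C)\<^sup>2 * K" for p
    proof -
      have "\<bar>v (fst p + snd p) - v (fst p)\<bar>\<^sup>2 \<le> (2 * C)\<^sup>2"
        using C(2)[of "fst p + snd p"] C(2)[of "fst p"] by (intro power_mono) auto
      then have "\<bar>v (fst p + snd p) - v (fst p)\<bar>\<^sup>2 * \<bar>k (snd p)\<bar> \<le> (2 * C)\<^sup>2 * K"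
        using K by (intro mult_mono) auto
      then show ?thesis
        by (simp add: Fz_def abs_mult)
    qed
    then show "AE p in torus_measure \<Otimes>\<^sub>M torus_measure. norm (Fz p) \<le> (2 * C)\<^sup>2 * K"
      by simp
  qed
  have slice: "(TINT y. Fz (y, z)) \<le> (36 * d 1) * ((1 - cos (z $ 1)) * k z) + (36 * d 2) * ((1 - cos (z $ 2)) * k z)"
    if z: "z \<in> torus" for z
  proof -
    have z0: "0 \<le> z $ i" "z $ i \<le> 2 * pi" for i
      using z by (auto simp: torus_def less_imp_le)
    let ?a = "\<lambda>y. (v ((y + axis 2 (z $ 2)) + axis 1 (z $ 1)) - v (y + axis 2 (z $ 2)))\<^sup>2"
    let ?b = "\<lambda>y. (v (y + axis 2 (z $ 2)) - v y)\<^sup>2"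
    have zz: "y + z = (y + axis 2 (z $ 2)) + axis 1 (z $ 1)" for y :: "real^2"
      by (auto simp: vec_eq_iff axis_def forall_2)
    have ca: "continuous_on UNIV ?a" "continuous_on UNIV ?b"
      unfolding add.assoc by (intro continuous_intros shc vc)+
    have 1: "(TINT y. ?a y) = (TINT y. (v (y + axis 1 (z $ 1)) - v y)\<^sup>2)"
    proof -
      have "continuous_on UNIV (\<lambda>y. (v (y + axis 1 (z $ 1)) - v y)\<^sup>2)"
        by (intro continuous_intros shc vc)
      moreover have "periodic (\<lambda>y. (v (y + axis 1 (z $ 1)) - v y)\<^sup>2)"
        using vp by (simp add: periodic_def shp)
      ultimately show ?thesis
        by (rule integral_torus_shift_axis)
    qed
    have ptw: "\<bar>v (y + z) - v y\<bar>\<^sup>2 \<le> 2 * ?a y + 2 * ?b y" for y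
    proof -
      define p q r where "p = v ((y + axis 2 (z $ 2)) + axis 1 (z $ 1))" and "q = v (y + axis 2 (z $ 2))" and "r = v y"
      have "(p - r)\<^sup>2 \<le> 2 * (p - q)\<^sup>2 + 2 * (q - r)\<^sup>2"
        using zero_le_power2[of "(p - q) - (q - r)"] by (simp add: power2_eq_square algebra_simps)
      then show ?thesis
        unfolding zz by (simp add: p_def q_def r_def)
    qed
    have "(TINT y. \<bar>v (y + z) - v y\<bar>\<^sup>2) \<le> (TINT y. 2 * ?a y + 2 * ?b y)"
      by (intro integral_mono ptw Bochner_Integration.integrable_add integrable_mult_right
          integrable_torus_continuous ca) (intro continuous_intros shc vc)
    also have "\<dots> = 2 * (TINT y. ?a y) + 2 * (TINT y. ?b y)"
      using integrable_torus_continuous[OF ca(1)] integrable_torus_continuous[OF ca(2)] by simp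
    also have "\<dots> \<le> 2 * (18 * (1 - cos (z $ 1)) * d 1) + 2 * (18 * (1 - cos (z $ 2)) * d 2)"
      unfolding 1 d_def by (intro add_mono mult_left_mono translation_bound_periodic v z0) auto
    finally have "(TINT y. \<bar>v (y + z) - v y\<bar>\<^sup>2) * k z \<le>
        (2 * (18 * (1 - cos (z $ 1)) * d 1) + 2 * (18 * (1 - cos (z $ 2)) * d 2)) * k z"
      using k'(3) by (rule mult_right_mono)
    then show ?thesis
      by (simp add: Fz_def algebra_simps)
  qed
  have "oscillation 2 k v = (TINT y. TINT z. Fz (y, z))"
    unfolding oscillation_def TM2.integral_fst'[OF osc, symmetric] by (simp only: fst_conv snd_conv inner)
  also have "\<dots> = (TINT z. TINT y. Fz (y, z))"
    using TM2.Fubini_integral[of "\<lambda>y z. Fz (y, z)"] Fint by simp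
  also have "\<dots> \<le> (TINT z. (36 * d 1) * ((1 - cos (z $ 1)) * k z) + (36 * d 2) * ((1 - cos (z $ 2)) * k z))"
  proof (intro integral_mono)
    show "integrable torus_measure (\<lambda>z. TINT y. Fz (y, z))"
      using TM2.integrable_snd[of "\<lambda>y z. Fz (y, z)"] Fint by simp
    show "integrable torus_measure (\<lambda>z. (36 * d 1) * ((1 - cos (z $ 1)) * k z) + (36 * d 2) * ((1 - cos (z $ 2)) * k z))"
      by (intro integrable_torus_continuous continuous_intros k')
  qed (use slice in simp)
  also have "\<dots> = (36 * d 1) * (TINT z. (1 - cos (z $ 1)) * k z) + (36 * d 2) * (TINT z. (1 - cos (z $ 2)) * k z)"
  proof -
    have "integrable torus_measure (\<lambda>z. (1 - cos (z $ i)) * k z)" for i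
      by (intro integrable_torus_continuous continuous_intros k')
    then show ?thesis by simp
  qed
  finally show ?thesis
    by (simp add: d_def mult_ac)
qed


lemma L2_square_add_le:
  fixes f g :: "real^2 \<Rightarrow> real"
  assumes "Lp_torus 2 f" "Lp_torus 2 g"
  shows "(TINT x. (f x)\<^sup>2) \<le> 2 * (TINT x. (g x)\<^sup>2) + 2 * (TINT x. (f x - g x)\<^sup>2)"
proof -
  note i = L2_integrable(2)[OF assms(1)] L2_integrable(2)[OF assms(2)] L2_integrable(2)[OF Lp_torus_diff[OF assms]]
  have "(TINT x. (f x)\<^sup>2) \<le> (TINT x. 2 * (g x)\<^sup>2 + 2 * (f x - g x)\<^sup>2)"
  proof (intro integral_mono i Bochner_Integration.integrable_add integrable_mult_right)
    fix x
    show "(f x)\<^sup>2 \<le> 2 * (g x)\<^sup>2 + 2 * (f x - g x)\<^sup>2"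
      using zero_le_power2[of "f x - 2 * g x"] by (simp add: power2_eq_square algebra_simps)
  qed
  then show ?thesis
    using i by simp
qed

text \<open>Mollifications of \<open>v\<close> are test functions whose derivatives converge to those of \<open>v\<close> in \<open>L\<^sup>2\<close>.\<close>

lemma oscillation_H1:
  fixes v :: "real^2 \<Rightarrow> real" and v' :: "2 \<Rightarrow> real^2 \<Rightarrow> real"
  assumes v: "Lp_torus 2 v" "\<And>i. has_weak_pderiv i v (v' i)" "\<And>i. Lp_torus 2 (v' i)" and k: "conv_kernel k"
    and m: "\<And>i. (TINT z. (1 - cos (z $ i)) * k z) \<le> M"
  shows "oscillation 2 k v \<le> 288 * M * (\<Sum>i\<in>UNIV. TINT y. (v' i y)\<^sup>2)"
proof -
  define V where "V n = mollify (diag_kernel n) v" for n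
  define V' where "V' i n = mollify (diag_kernel n) (v' i)" for i n
  define E where "E i n = (TINT y. (V' i n y - v' i y)\<^sup>2)" for i n
  define e where "e n = (TINT y. (V n y - v y)\<^sup>2)" for n
  define d where "d i = (TINT y. (v' i y)\<^sup>2)" for i
  have Vt: "test_function (V n)" "test_function (V' i n)" for i n
    unfolding V_def V'_def using v by (auto intro!: test_function_mollify L2_integrable)
  have VL: "Lp_torus 2 (V n)" "Lp_torus 2 (V' i n)" for i n
    by (intro test_function_L2 Vt)+
  have dV: "pderiv_at i (V n) y = V' i n y" for i n y
    unfolding V_def V'_def by (rule pderiv_mollify_weak[OF v(2)])
  have k0: "\<And>z. 0 \<le> k z"
    using k by (simp add: conv_kernel_def)
  have m0: "0 \<le> (TINT z. (1 - cos (z $ i)) * k z)" for i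
    using k0 by (intro Bochner_Integration.integral_nonneg mult_nonneg_nonneg) auto
  have M: "M \<ge> 0"
    using m0[of 1] m[of 1] by linarith
  have bound: "oscillation 2 k v \<le>
      4 * (36 * M * (2 * d 1 + 2 * E 1 n) + 36 * M * (2 * d 2 + 2 * E 2 n) + 4 * (2 * kernel_mass k * e n))" for n
  proof -
    have "(TINT y. (V' i n y)\<^sup>2) \<le> 2 * d i + 2 * E i n" for i
      unfolding d_def E_def by (rule L2_square_add_le[OF VL(2) v(3)])
    then have t: "36 * (TINT z. (1 - cos (z $ i)) * k z) * (TINT y. (V' i n y)\<^sup>2) \<le>
        36 * M * (2 * d i + 2 * E i n)" for i
      using m0[of i] m[of i] by (intro mult_mono) auto
    have "oscillation 2 k (V n) \<le> 36 * M * (2 * d 1 + 2 * E 1 n) + 36 * M * (2 * d 2 + 2 * E 2 n)"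
      using oscillation_test_function[OF Vt(1)[of n] k] t[of 1] t[of 2] unfolding dV by linarith
    moreover have "oscillation 2 k (\<lambda>y. v y - V n y) \<le> 4 * (2 * kernel_mass k * e n)"
      using oscillation_integrable(2)[OF Lp_torus_diff[OF v(1) VL(1)[of n]] k] by (simp add: e_def power2_commute)
    ultimately show ?thesis
      using oscillation_add[OF v(1) VL(1)[of n] k] by simp
  qed
  have "(\<lambda>n. E i n) \<longlonglongrightarrow> 0" for i
    unfolding E_def V'_def by (rule mollify_tendsto_L2[OF approx_identity_diag v(3)])
  moreover have "e \<longlonglongrightarrow> 0"
    unfolding e_def V_def by (rule mollify_tendsto_L2[OF approx_identity_diag v(1)])
  ultimately have "(\<lambda>n. 4 * (36 * M * (2 * d 1 + 2 * E 1 n) + 36 * M * (2 * d 2 + 2 * E 2 n) + 4 * (2 * kernel_mass k * e n)))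
      \<longlonglongrightarrow> 4 * (36 * M * (2 * d 1 + 2 * 0) + 36 * M * (2 * d 2 + 2 * 0) + 4 * (2 * kernel_mass k * 0))"
    by (intro tendsto_intros)
  then have "oscillation 2 k v \<le> 4 * (36 * M * (2 * d 1 + 2 * 0) + 36 * M * (2 * d 2 + 2 * 0) + 4 * (2 * kernel_mass k * 0))"
    by (rule LIMSEQ_le_const) (use bound in blast)
  then show ?thesis
    by (simp add: d_def UNIV_2 algebra_simps)
qed

section \<open>The commutator of transport and mollification\<close>

lemma pderiv_cos_kernel:
  shows "pderiv_at 1 (cos_kernel (Suc n) N) z = - (real (Suc n) * sin (z $ 1) * (real n + 1) / (2 * real n + 1) * cos_kernel n N z)"
    and "pderiv_at 2 (cos_kernel N (Suc n)) z = - (real (Suc n) * sin (z $ 2) * (real n + 1) / (2 * real n + 1) * cos_kernel N n z)"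
proof -
  have D: "((\<lambda>t::real. (1 + cos t) ^ Suc n) has_real_derivative - (real (Suc n) * sin t * (1 + cos t) ^ n)) (at t)" for t
    by (rule DERIV_cong[OF DERIV_power[where f = "\<lambda>t. 1 + cos t" and D = "- sin t"]])
       (auto intro!: derivative_eq_intros simp: algebra_simps)
  have s: "smooth (\<lambda>z::real^2. (1 + cos (z $ i)) ^ m)" for i m
    by (intro smooth_power smooth_add smooth_const smooth_cos smooth_nth)
  have d1: "pderiv_at i (\<lambda>z. (1 + cos (z $ i)) ^ Suc n) z = - (real (Suc n) * sin (z $ i) * (1 + cos (z $ i)) ^ n)" for i
    using pderiv_chain[OF smooth_nth D, of i i z] by (simp add: pderiv_nth)
  have d0: "pderiv_at i (\<lambda>z. (1 + cos (z $ j)) ^ m) z = 0" if "i \<noteq> j" for i j m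
    using other_factor(2)[OF that, of m 0] by simp
  have inv: "1 / ((2 * real n + 1) / (real n + 1) * Z) = (real n + 1) / (2 * real n + 1) * (1 / Z)" for Z
    by simp
  have c: "cos_kernel m n = (\<lambda>z. (1 / cos_mass m n) * ((1 + cos (z $ 1)) ^ m * (1 + cos (z $ 2)) ^ n))" for m n
    by (auto simp: cos_kernel_def cos_bump_def)
  show "pderiv_at 1 (cos_kernel (Suc n) N) z = - (real (Suc n) * sin (z $ 1) * (real n + 1) / (2 * real n + 1) * cos_kernel n N z)"
    unfolding c pderiv_cmult[OF smooth_mult[OF s s]] pderiv_mult[OF s s] d1 cos_mass_Suc1 inv using d0[of 1 2 N]
    by (simp add: mult_ac)
  show "pderiv_at 2 (cos_kernel N (Suc n)) z = - (real (Suc n) * sin (z $ 2) * (real n + 1) / (2 * real n + 1) * cos_kernel N n z)"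
    unfolding c pderiv_cmult[OF smooth_mult[OF s s]] pderiv_mult[OF s s] d1 cos_mass_Suc2 inv using d0[of 2 1 N]
    by (simp add: mult_ac)
qed

text \<open>The kernel against which the oscillation of the velocity is measured: \<open>\<bar>\<partial>\<^sub>i \<rho>\<bar>\<close> is the geometric mean of
  a lowered kernel and of this one, whose second moments stay bounded as \<open>n\<close> grows.\<close>

definition stretched_kernel :: "2 \<Rightarrow> nat \<Rightarrow> real^2 \<Rightarrow> real" where
  "stretched_kernel i n z = (real (Suc n))\<^sup>2 * ((1 - cos (z $ i)) * diag_kernel n z)"

definition lowered_kernel :: "2 \<Rightarrow> nat \<Rightarrow> real^2 \<Rightarrow> real" where
  "lowered_kernel i n = (if i = 1 then cos_kernel n (Suc n) else cos_kernel (Suc n) n)"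

lemma approx_identity_lowered: "approx_identity (lowered_kernel i)"
proof (cases "i = 1")
  case True
  then have "lowered_kernel i = (\<lambda>n. cos_kernel n (Suc n))"
    by (auto simp: lowered_kernel_def)
  then show ?thesis
    using approx_identity_cos_kernel[OF filterlim_ident filterlim_Suc] by simp
next
  case False
  then have "lowered_kernel i = (\<lambda>n. cos_kernel (Suc n) n)"
    by (auto simp: lowered_kernel_def)
  then show ?thesis
    using approx_identity_cos_kernel[OF filterlim_Suc filterlim_ident] by simp
qed

lemma conv_kernel_lowered: "conv_kernel (lowered_kernel i n)"
  by (simp add: lowered_kernel_def conv_kernel_cos_kernel)

lemma conv_kernel_stretched: "conv_kernel (stretched_kernel i n)"
proof -
  have "test_function (stretched_kernel i n)"
    unfolding stretched_kernel_def[abs_def]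
    by (intro test_function_mult test_function_const test_function_diff test_function_cos0 cos_kernel_test_function)
  then have "continuous_on UNIV (stretched_kernel i n)" "periodic (stretched_kernel i n)"
    by (simp_all add: test_function_continuous test_function_def)
  moreover have "0 \<le> stretched_kernel i n z" "stretched_kernel i n (- z) = stretched_kernel i n z" for z
    using cos_kernel_nonneg[of "Suc n" "Suc n" z] cos_kernel_even[of "Suc n" "Suc n" z]
    by (simp_all add: stretched_kernel_def)
  ultimately show ?thesis
    by (simp add: conv_kernel_def)
qed

lemma stretched_kernel_moment: "(TINT z. (1 - cos (z $ j)) * stretched_kernel i n z) \<le> 3"
proof -
  have aux: "x * (c / D) \<le> c" if "x \<le> D" "0 < D" "0 \<le> c" for x c D :: real
    using mult_left_mono[OF that(1,3)] that(2) by (simp add: pos_divide_le_eq mult.commute)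
  have b1: "(real (Suc n))\<^sup>2 * (3 / ((real (Suc n) + 1) * (real (Suc n) + 2))) \<le> 3"
    unfolding power2_eq_square by (intro aux mult_mono) auto
  have "(real (Suc n))\<^sup>2 * (1 / ((real (Suc n) + 1) * (real (Suc n) + 1))) \<le> 1"
    unfolding power2_eq_square by (intro aux mult_mono) auto
  then have b2: "(real (Suc n))\<^sup>2 * (1 / ((real (Suc n) + 1) * (real (Suc n) + 1))) \<le> 3"
    by (rule order_trans) simp
  note mom = cos_kernel_moments[of "Suc n" "Suc n"]
  have eq: "(TINT z. (1 - cos (z $ j)) * stretched_kernel i n z) =
      (real (Suc n))\<^sup>2 * (TINT z. (1 - cos (z $ j)) * (1 - cos (z $ i)) * diag_kernel n z)"
    unfolding stretched_kernel_def by (subst integral_mult_right_zero[symmetric]) (simp add: mult_ac del: of_nat_Suc)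
  consider "i = 1" "j = 1" | "i = 2" "j = 2" | "i = 1" "j = 2" | "i = 2" "j = 1"
    using exhaust_2[of i] exhaust_2[of j] by blast
  then show ?thesis
  proof cases
    case 1 then show ?thesis
      unfolding eq using mom(4) b1 by (simp only: power2_eq_square)
  next
    case 2 then show ?thesis
      unfolding eq using mom(5) b1 by (simp only: power2_eq_square)
  next
    case 3 then show ?thesis
      unfolding eq using mom(6) b2 by (simp only: mult.commute[of "1 - cos (_ $ 2)"])
  next
    case 4 then show ?thesis
      unfolding eq using mom(6) b2 by (simp only:)
  qed
qed

text \<open>Differentiating \<open>(1 + cos z\<^sub>i)\<^bsup>n+1\<^esup>\<close> costs a factor \<open>n + 1\<close> and one power, and leaves \<open>\<bar>sin z\<^sub>i\<bar>\<close>, whose square is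
  \<open>(1 - cos z\<^sub>i) (1 + cos z\<^sub>i)\<close>: this is the geometric mean to which the inequality between the means applies.\<close>

lemma pderiv_diag_kernel_bound:
  assumes "c > 0"
  shows "\<bar>a * b * pderiv_at i (diag_kernel n) z\<bar> \<le> c * (\<bar>a\<bar>\<^sup>2 * lowered_kernel i n z) + (1 / c) * (\<bar>b\<bar>\<^sup>2 * stretched_kernel i n z)"
proof -
  define N \<kappa> s l where "N = real (Suc n)" and "\<kappa> = (real n + 1) / (2 * real n + 1)" and "s = sin (z $ i)" and "l = lowered_kernel i n z"
  have k: "0 \<le> \<kappa>" "\<kappa> \<le> 1"
    by (auto simp: \<kappa>_def)
  have l: "0 \<le> l"
    by (simp add: l_def lowered_kernel_def cos_kernel_nonneg)
  have D: "pderiv_at i (diag_kernel n) z = - (N * s * \<kappa> * l)"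
    using pderiv_cos_kernel(1)[of n "Suc n" z] pderiv_cos_kernel(2)[of "Suc n" n z] exhaust_2[of i]
    by (auto simp: N_def \<kappa>_def s_def l_def lowered_kernel_def)
  have low: "(1 + cos (z $ i)) * (\<kappa> * l) = diag_kernel n z"
  proof -
    have p: "cos_mass n (Suc n) > 0" "cos_mass (Suc n) n > 0"
      by (rule cos_mass_pos)+
    consider "i = 1" | "i = 2"
      using exhaust_2 by blast
    then show ?thesis
    proof cases
      case 1
      then show ?thesis
        using p(1) unfolding \<kappa>_def l_def lowered_kernel_def cos_kernel_def cos_bump_def cos_mass_Suc1[of n "Suc n"]
        by (simp add: field_simps)
    next
      case 2
      then show ?thesis
        using p(2) unfolding \<kappa>_def l_def lowered_kernel_def cos_kernel_def cos_bump_def cos_mass_Suc2[of "Suc n" n]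
        by (simp add: field_simps)
    qed
  qed
  have st: "stretched_kernel i n z = (N * s)\<^sup>2 * (\<kappa> * l)"
  proof -
    have "s\<^sup>2 = (1 - cos (z $ i)) * (1 + cos (z $ i))"
      using sin_squared_eq[of "z $ i"] by (simp add: s_def power2_eq_square algebra_simps)
    then show ?thesis
      unfolding stretched_kernel_def low[symmetric] N_def by (simp add: power_mult_distrib mult_ac del: of_nat_Suc)
  qed
  have "\<bar>a * b * pderiv_at i (diag_kernel n) z\<bar> = \<bar>a * (b * (N * s))\<bar> * (\<kappa> * l)"
    using k l unfolding D by (simp add: abs_mult mult_ac)
  also have "\<dots> \<le> (c * a\<^sup>2 + (1 / c) * (b * (N * s))\<^sup>2) * (\<kappa> * l)"
    using k l by (intro mult_right_mono young assms) auto
  also have "\<dots> = c * (\<bar>a\<bar>\<^sup>2 * (\<kappa> * l)) + (1 / c) * (\<bar>b\<bar>\<^sup>2 * stretched_kernel i n z)"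
    unfolding st by (simp add: algebra_simps power_mult_distrib)
  also have "\<dots> \<le> c * (\<bar>a\<bar>\<^sup>2 * l) + (1 / c) * (\<bar>b\<bar>\<^sup>2 * stretched_kernel i n z)"
    using k l assms mult_left_le_one_le[of l \<kappa>] by (intro add_right_mono mult_left_mono) auto
  finally show ?thesis
    by (simp add: l_def)
qed

section \<open>Velocity fields at a fixed time\<close>

definition H1_field :: "(real^2 \<Rightarrow> real^2) \<Rightarrow> (real^2 \<Rightarrow> real^2^2) \<Rightarrow> bool" where
  "H1_field u G \<longleftrightarrow> Lp_torus 2 u \<and> Lp_torus 2 G \<and>
     (\<forall>i j. has_weak_pderiv i (\<lambda>x. u x $ j) (\<lambda>x. G x $ j $ i)) \<and> weakly_div_free u"

text \<open>Rows of \<open>G\<close> belong to components and columns to directions, so that this is \<open>\<partial>\<^sub>1 u\<^sub>2 - \<partial>\<^sub>2 u\<^sub>1\<close>.\<close>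

definition curl_of :: "(real^2 \<Rightarrow> real^2^2) \<Rightarrow> real^2 \<Rightarrow> real" where
  "curl_of G x = G x $ 2 $ 1 - G x $ 1 $ 2"

text \<open>Rotated gradients are the divergence-free test fields; pairing with them is the distributional curl.\<close>

definition perp_grad :: "(real^2 \<Rightarrow> real) \<Rightarrow> real^2 \<Rightarrow> real^2" where
  "perp_grad \<phi> x = pderiv_at 2 \<phi> x *\<^sub>R axis 1 1 - pderiv_at 1 \<phi> x *\<^sub>R axis 2 1"

lemma inner_perp_grad: "v \<bullet> perp_grad \<phi> x = v $ 1 * pderiv_at 2 \<phi> x - v $ 2 * pderiv_at 1 \<phi> x"
  by (simp add: perp_grad_def inner_diff_right inner_axis mult.commute)

lemma perp_grad_nth: "perp_grad \<phi> x $ 1 = pderiv_at 2 \<phi> x" "perp_grad \<phi> x $ 2 = - pderiv_at 1 \<phi> x"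
  by (simp_all add: perp_grad_def axis_def)

lemma smooth_perp_grad: "smooth \<phi> \<Longrightarrow> smooth (perp_grad \<phi>)"
  unfolding perp_grad_def[abs_def] by (intro smooth_diff smooth_scaleR smooth_pderiv smooth_const)

lemma periodic_perp_grad: "test_function \<phi> \<Longrightarrow> periodic (perp_grad \<phi>)"
  using periodic_pderiv[of \<phi> 1] periodic_pderiv[of \<phi> 2]
  unfolding test_function_def periodic_def perp_grad_def by simp

lemma pderiv_diff:
  assumes "smooth f" "smooth g"
  shows "pderiv_at i (\<lambda>x. f x - g x) x = pderiv_at i f x - pderiv_at i g x"
  using pderiv_atI[OF has_derivative_diff[OF smooth_has_derivative[OF assms(1)] smooth_has_derivative[OF assms(2)]]]
  by (simp add: pderiv_at_def)

lemma pderiv_perp_grad: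
  assumes s: "smooth \<phi>"
  shows "pderiv_at i (perp_grad \<phi>) x = perp_grad (pderiv_at i \<phi>) x"
proof -
  have p: "smooth (pderiv_at j \<phi>)" for j
    by (rule smooth_pderiv[OF s])
  have "pderiv_at i (perp_grad \<phi>) x =
      pderiv_at i (\<lambda>x. pderiv_at 2 \<phi> x *\<^sub>R axis 1 1) x - pderiv_at i (\<lambda>x. pderiv_at 1 \<phi> x *\<^sub>R (axis 2 1 :: real^2)) x"
    unfolding perp_grad_def[abs_def] by (intro pderiv_diff smooth_scaleR p smooth_const)
  also have "\<dots> = pderiv_at i (pderiv_at 2 \<phi>) x *\<^sub>R axis 1 1 - pderiv_at i (pderiv_at 1 \<phi>) x *\<^sub>R axis 2 1"
    unfolding pderiv_scaleR[OF p smooth_const] pderiv_const by simp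
  finally show ?thesis
    unfolding perp_grad_def pderiv_commute[OF s, of i] .
qed

lemma laplacian_perp_grad: 
  assumes "smooth \<phi>"
  shows "laplacian (perp_grad \<phi>) x = perp_grad (laplacian \<phi>) x"
proof -
  have 1: "pderiv_at i (perp_grad \<phi>) = perp_grad (pderiv_at i \<phi>)" for i
    using pderiv_perp_grad[OF assms] by auto
  have s: "smooth (pderiv_at i \<phi>)" for i
    by (intro smooth_pderiv assms)
  have "laplacian (perp_grad \<phi>) x = (\<Sum>i\<in>UNIV. perp_grad (pderiv_at i (pderiv_at i \<phi>)) x)"
    unfolding laplacian_def 1 using pderiv_perp_grad[OF s] by simp
  also have "\<dots> = perp_grad (laplacian \<phi>) x"
    unfolding perp_grad_def laplacian_def[abs_def]
    by (simp add: pderiv_sum smooth_pderiv s scaleR_sum_left sum_subtractf)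
  finally show ?thesis .
qed

lemma vec_nth_measurable:
  assumes "u \<in> borel_measurable M"
  shows "(\<lambda>x. (u x :: real^'n) $ j) \<in> borel_measurable M"
proof -
  have "(\<lambda>v::real^'n. v $ j) \<in> borel_measurable borel"
    by (intro borel_measurable_continuous_onI continuous_intros)
  from measurable_compose[OF assms this] show ?thesis .
qed

lemma mat_nth_measurable:
  assumes "G \<in> borel_measurable M"
  shows "(\<lambda>x. (G x :: real^'n^'m) $ j $ i) \<in> borel_measurable M"
proof -
  have "(\<lambda>v::real^'n^'m. v $ j $ i) \<in> borel_measurable borel"
    by (intro borel_measurable_continuous_onI continuous_intros)
  from measurable_compose[OF assms this] show ?thesis .
qed

lemma Lp_torus_dominated:
  fixes h :: "real^2 \<Rightarrow> real"
  assumes "Lp_torus p u" "h \<in> borel_measurable torus_measure" "\<And>x. \<bar>h x\<bar> \<le> norm (u x)"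
  shows "Lp_torus p h"
    and "(TINT x. \<bar>h x\<bar> ^ p) \<le> (TINT x. norm (u x) ^ p)"
proof -
  have i: "integrable torus_measure (\<lambda>x. norm (u x) ^ p)"
    using assms(1) by (simp add: Lp_torus_def)
  have le: "\<bar>h x\<bar> ^ p \<le> norm (u x) ^ p" for x
    using assms(3) by (intro power_mono) auto
  have j: "integrable torus_measure (\<lambda>x. \<bar>h x\<bar> ^ p)"
    by (rule Bochner_Integration.integrable_bound[OF i]) (use assms(2) le in auto)
  then show "Lp_torus p h"
    using assms(2) by (simp add: Lp_torus_real)
  show "(TINT x. \<bar>h x\<bar> ^ p) \<le> (TINT x. norm (u x) ^ p)"
    by (intro integral_mono i j le)
qed

lemma mat_nth_le_norm: "\<bar>(A :: real^'n^'m) $ j $ i\<bar> \<le> norm A"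
  by (rule order_trans[OF component_le_norm_cart Finite_Cartesian_Product.norm_nth_le])

lemma L2_components:
  assumes "Lp_torus p u"
  shows "Lp_torus p (\<lambda>x. (u x :: real^'n) $ j)"
  using assms component_le_norm_cart
  by (intro Lp_torus_dominated(1)[OF assms] vec_nth_measurable) (auto simp: Lp_torus_def)

lemma L2_mat_components:
  assumes "Lp_torus 2 G"
  shows "Lp_torus 2 (\<lambda>x. (G x :: real^'n^'m) $ j $ i)"
    and "(TINT x. (G x $ j $ i)\<^sup>2) \<le> (TINT x. (norm (G x))\<^sup>2)"
proof -
  have m: "(\<lambda>x. G x $ j $ i) \<in> borel_measurable torus_measure"
    using assms by (intro mat_nth_measurable) (simp add: Lp_torus_def)
  show "Lp_torus 2 (\<lambda>x. G x $ j $ i)"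
    by (rule Lp_torus_dominated(1)[OF assms m mat_nth_le_norm])
  show "(TINT x. (G x $ j $ i)\<^sup>2) \<le> (TINT x. (norm (G x))\<^sup>2)"
    using Lp_torus_dominated(2)[OF assms m mat_nth_le_norm] by simp
qed

lemma H1_fieldD:
  assumes "H1_field u G"
  shows "Lp_torus 2 (\<lambda>x. u x $ j)" "Lp_torus 2 (\<lambda>x. G x $ j $ i)"
    "has_weak_pderiv i (\<lambda>x. u x $ j) (\<lambda>x. G x $ j $ i)" "Lp_torus 2 (curl_of G)"
  using assms unfolding H1_field_def curl_of_def[abs_def]
  by (auto intro: L2_components L2_mat_components Lp_torus_diff)

lemma L2_triple_integrable:
  assumes "Lp_torus 2 a" "Lp_torus 2 b" "test_function \<eta>"
  shows "integrable torus_measure (\<lambda>x. a x * b x * \<eta> x)"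
  by (intro integrable_torus_mult_continuous L2_mult test_function_continuous assms)

lemma H1_field_divergence:
  assumes H: "H1_field u G"
  shows "AE x in torus_measure. G x $ 1 $ 1 + G x $ 2 $ 2 = 0"
proof (rule integral_test_functions_zero)
  have i: "integrable torus_measure (\<lambda>x. G x $ j $ i)" "integrable torus_measure (\<lambda>x. u x $ j)" for i j
    using H1_fieldD[OF H] L2_integrable by auto
  show "integrable torus_measure (\<lambda>x. G x $ 1 $ 1 + G x $ 2 $ 2)"
    using i by simp
  fix \<phi> assume \<phi>: "test_function \<phi>"
  have int: "integrable torus_measure (\<lambda>x. G x $ j $ i * \<phi> x)"
    "integrable torus_measure (\<lambda>x. u x $ j * pderiv_at i \<phi> x)" for i j
    by (intro integrable_torus_mult_continuous i test_function_continuous \<phi> test_function_pderiv)+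
  have w: "(TINT x. G x $ i $ i * \<phi> x) = - (TINT x. u x $ i * pderiv_at i \<phi> x)" for i
    using H1_fieldD(3)[OF H] \<phi> unfolding has_weak_pderiv_def by blast
  have "(TINT x. (\<Sum>i\<in>UNIV. u x $ i * pderiv_at i \<phi> x)) = 0"
    using H \<phi> unfolding H1_field_def weakly_div_free_def by blast
  then have "(TINT x. u x $ 1 * pderiv_at 1 \<phi> x) + (TINT x. u x $ 2 * pderiv_at 2 \<phi> x) = 0"
    using int by (simp add: UNIV_2)
  then show "(TINT x. (G x $ 1 $ 1 + G x $ 2 $ 2) * \<phi> x) = 0"
    using int w[of 1] w[of 2] by (simp add: distrib_right)
qed

lemma H1_field_curl:
  assumes H: "H1_field u G" and \<phi>: "test_function \<phi>"
  shows "(TINT x. curl_of G x * \<phi> x) = (TINT x. u x \<bullet> perp_grad \<phi> x)"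
proof -
  have i: "integrable torus_measure (\<lambda>x. G x $ j $ i)" "integrable torus_measure (\<lambda>x. u x $ j)" for i j
    using H1_fieldD[OF H] L2_integrable by auto
  have int: "integrable torus_measure (\<lambda>x. G x $ j $ i * \<phi> x)"
    "integrable torus_measure (\<lambda>x. u x $ j * pderiv_at i \<phi> x)" for i j
    by (intro integrable_torus_mult_continuous i test_function_continuous \<phi> test_function_pderiv)+
  have w: "(TINT x. G x $ j $ i * \<phi> x) = - (TINT x. u x $ j * pderiv_at i \<phi> x)" for i j
    using H1_fieldD(3)[OF H] \<phi> unfolding has_weak_pderiv_def by blast
  show ?thesis
    unfolding inner_perp_grad curl_of_def using int w[of 2 1] w[of 1 2] by (simp add: left_diff_distrib)
qed

text \<open>The identity \<open>curl (u \<cdot> \<nabla>u) = u \<cdot> \<nabla>curl u\<close> for divergence-free planar fields in weak form: up to the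
  divergence and the gradient of \<open>|u|\<^sup>2 / 2\<close>, the convection \<open>u \<cdot> \<nabla>u\<close> is \<open>curl u\<close> times the rotated \<open>u\<close>.\<close>

lemma H1_field_convection:
  assumes H: "H1_field u G" and \<phi>: "test_function \<phi>"
  shows "(TINT x. (\<Sum>i\<in>UNIV. u x $ i * (u x \<bullet> pderiv_at i (perp_grad \<phi>) x))) =
    (TINT x. curl_of G x * (\<Sum>i\<in>UNIV. u x $ i * pderiv_at i \<phi> x))"
proof -
  have s: "smooth \<phi>"
    using \<phi> by (rule test_function_smooth)
  note L = H1_fieldD(1,2)[OF H] and W = H1_fieldD(3)[OF H]
  define T where "T a b \<eta> = (TINT x. a x * b x * \<eta> x)" for a b \<eta> :: "real^2 \<Rightarrow> real"
  define U where "U j x = u x $ j" for j x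
  define g where "g j i x = G x $ j $ i" for j i x
  define D where "D = (\<lambda>i. pderiv_at i \<phi>)"
  define DD where "DD = (\<lambda>i j. pderiv_at i (pderiv_at j \<phi>))"
  have UL: "Lp_torus 2 (U j)" and gL: "Lp_torus 2 (g j i)" for i j
    unfolding U_def g_def by (rule L)+
  have Dt: "test_function (D i)" and DDt: "test_function (DD i j)" for i j
    unfolding D_def DD_def by (intro test_function_pderiv \<phi>)+
  have sym: "DD i j = DD j i" for i j
    unfolding DD_def using pderiv_commute[OF s] by blast
  note int = L2_triple_integrable[OF UL UL DDt] L2_triple_integrable[OF gL UL Dt] L2_triple_integrable[OF UL gL Dt]
  have prod: "T (g j i) (U k) (D l) + T (U j) (g k i) (D l) = - T (U j) (U k) (DD i l)" for i j k l
  proof -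
    have "(TINT x. (g j i x * U k x + U j x * g k i x) * D l x) =
        - (TINT x. U j x * U k x * pderiv_at i (D l) x)"
      unfolding g_def U_def by (intro weak_product_rule W L Dt)
    moreover have "(TINT x. (g j i x * U k x + U j x * g k i x) * D l x) =
        T (g j i) (U k) (D l) + T (U j) (g k i) (D l)"
      unfolding T_def distrib_right by (rule Bochner_Integration.integral_add[OF int(2) int(3)])
    ultimately show ?thesis
      unfolding T_def D_def DD_def by simp
  qed
  have trace: "T (g 1 1) (U k) (D l) + T (g 2 2) (U k) (D l) = 0" for k l
  proof -
    have "T (g 1 1) (U k) (D l) + T (g 2 2) (U k) (D l) = (TINT x. (g 1 1 x + g 2 2 x) * (U k x * D l x))"
      unfolding T_def using Bochner_Integration.integral_add[OF int(2)[of 1 1 k l] int(2)[of 2 2 k l]]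
      by (simp add: algebra_simps)
    also have "\<dots> = (TINT x. 0)"
    proof (rule integral_cong_AE)
      show "AE x in torus_measure. (g 1 1 x + g 2 2 x) * (U k x * D l x) = 0"
        using H1_field_divergence[OF H] unfolding g_def by eventually_elim simp
      show "(\<lambda>x. (g 1 1 x + g 2 2 x) * (U k x * D l x)) \<in> borel_measurable torus_measure"
        using gL UL continuous_measurable_torus[OF test_function_continuous[OF Dt]]
        by (intro borel_measurable_times borel_measurable_add) (auto simp: Lp_torus_real)
    qed simp
    finally show ?thesis by simp
  qed
  have Tcomm: "T a b \<eta> = T b a \<eta>" for a b \<eta>
    unfolding T_def by (simp add: mult.commute)
  have lhs: "(TINT x. (\<Sum>i\<in>UNIV. u x $ i * (u x \<bullet> pderiv_at i (perp_grad \<phi>) x))) =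
      T (U 1) (U 1) (DD 1 2) - T (U 1) (U 2) (DD 1 1) + T (U 2) (U 1) (DD 2 2) - T (U 2) (U 2) (DD 2 1)"
  proof -
    have "(\<lambda>x. \<Sum>i\<in>UNIV. u x $ i * (u x \<bullet> pderiv_at i (perp_grad \<phi>) x)) =
        (\<lambda>x. U 1 x * U 1 x * DD 1 2 x - U 1 x * U 2 x * DD 1 1 x + U 2 x * U 1 x * DD 2 2 x - U 2 x * U 2 x * DD 2 1 x)"
    proof
      fix x
      show "(\<Sum>i\<in>UNIV. u x $ i * (u x \<bullet> pderiv_at i (perp_grad \<phi>) x)) =
          U 1 x * U 1 x * DD 1 2 x - U 1 x * U 2 x * DD 1 1 x + U 2 x * U 1 x * DD 2 2 x - U 2 x * U 2 x * DD 2 1 x"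
        unfolding UNIV_2 pderiv_perp_grad[OF s] inner_perp_grad
        using sym[of 1 2] by (simp add: U_def DD_def algebra_simps)
    qed
    then show ?thesis
      unfolding T_def using int(1) by simp
  qed
  have rhs: "(TINT x. curl_of G x * (\<Sum>i\<in>UNIV. u x $ i * pderiv_at i \<phi> x)) =
      T (g 2 1) (U 1) (D 1) - T (g 1 2) (U 1) (D 1) + T (g 2 1) (U 2) (D 2) - T (g 1 2) (U 2) (D 2)"
  proof -
    have "(\<lambda>x. curl_of G x * (\<Sum>i\<in>UNIV. u x $ i * pderiv_at i \<phi> x)) =
        (\<lambda>x. g 2 1 x * U 1 x * D 1 x - g 1 2 x * U 1 x * D 1 x + g 2 1 x * U 2 x * D 2 x - g 1 2 x * U 2 x * D 2 x)"
      by (auto simp: fun_eq_iff UNIV_2 U_def g_def D_def curl_of_def algebra_simps)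
    then show ?thesis
      unfolding T_def using int(2) by simp
  qed
  show ?thesis
    unfolding lhs rhs
    using prod[of 1 1 1 2] prod[of 1 1 2 1] prod[of 2 2 1 2] prod[of 2 2 2 1]
      prod[of 1 2 1 1, unfolded sym[of 2 1]] prod[of 2 1 2 2] trace[of 1 2] trace[of 2 1]
      Tcomm[of "U 1" "g 1 1" "D 2"] Tcomm[of "U 1" "g 2 1" "D 1"] Tcomm[of "U 2" "g 1 2" "D 2"]
      Tcomm[of "U 2" "g 2 2" "D 1"] Tcomm[of "U 1" "g 1 2" "D 1"] Tcomm[of "U 2" "g 2 1" "D 2"]
    unfolding sym[of 2 1] by linarith
qed

lemma H1_field_vorticity_form:
  assumes H: "H1_field u G" and curl: "has_weak_curl f g" and fL: "Lp_torus 2 f" and \<phi>: "test_function \<phi>"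
  shows "(TINT x. (\<Sum>i\<in>UNIV. u x $ i * (u x \<bullet> pderiv_at i (perp_grad \<phi>) x)) +
      \<nu> * (u x \<bullet> laplacian (perp_grad \<phi>) x) + f x \<bullet> perp_grad \<phi> x) =
    (TINT x. curl_of G x * (\<Sum>i\<in>UNIV. u x $ i * pderiv_at i \<phi> x)) +
    \<nu> * (TINT x. curl_of G x * laplacian \<phi> x) + (TINT x. g x * \<phi> x)"
proof -
  have s: "smooth \<phi>"
    using \<phi> by (rule test_function_smooth)
  have fc: "(TINT x. f x \<bullet> perp_grad \<phi> x) = (TINT x. g x * \<phi> x)"
    using curl \<phi> unfolding has_weak_curl_def inner_perp_grad by simp
  have inner_int: "integrable torus_measure (\<lambda>x. v x \<bullet> perp_grad \<eta> x)" if "Lp_torus 2 v" "test_function \<eta>" for v \<eta>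
    unfolding inner_perp_grad
    by (intro Bochner_Integration.integrable_diff integrable_torus_mult_continuous L2_integrable(1)
        L2_components that test_function_continuous test_function_pderiv)
  have uL: "Lp_torus 2 u"
    using H by (simp add: H1_field_def)
  have i1: "integrable torus_measure (\<lambda>x. \<Sum>i\<in>UNIV. u x $ i * (u x \<bullet> pderiv_at i (perp_grad \<phi>) x))"
  proof (intro Bochner_Integration.integrable_sum)
    fix i
    have "integrable torus_measure (\<lambda>x. u x $ i * u x $ 1 * pderiv_at 2 (pderiv_at i \<phi>) x - u x $ i * u x $ 2 * pderiv_at 1 (pderiv_at i \<phi>) x)"
      by (intro Bochner_Integration.integrable_diff L2_triple_integrable H1_fieldD[OF H] test_function_pderiv \<phi>)
    then show "integrable torus_measure (\<lambda>x. u x $ i * (u x \<bullet> pderiv_at i (perp_grad \<phi>) x))"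
      unfolding pderiv_perp_grad[OF s] inner_perp_grad by (simp add: algebra_simps)
  qed
  have i2: "integrable torus_measure (\<lambda>x. u x \<bullet> laplacian (perp_grad \<phi>) x)"
    unfolding laplacian_perp_grad[OF s] by (intro inner_int uL test_function_laplacian \<phi>)
  have lap: "(TINT x. u x \<bullet> laplacian (perp_grad \<phi>) x) = (TINT x. curl_of G x * laplacian \<phi> x)"
    unfolding laplacian_perp_grad[OF s] by (rule H1_field_curl[OF H test_function_laplacian[OF \<phi>], symmetric])
  show ?thesis
    using i1 i2 inner_int[OF fL \<phi>] unfolding H1_field_convection[OF H \<phi>, symmetric] lap[symmetric] fc[symmetric] by simp
qed

text \<open>The mollified \<open>div (u w)\<close> differs in sign from the first integral, because the derivative falls on the variable
  \<open>x\<close> of the kernel; the second sum transports the mollified \<open>w\<close>.\<close>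

definition commutator :: "nat \<Rightarrow> (real^2 \<Rightarrow> real^2) \<Rightarrow> (real^2 \<Rightarrow> real) \<Rightarrow> real^2 \<Rightarrow> real" where
  "commutator n u w y =
    (TINT x. w x * (\<Sum>i\<in>UNIV. u x $ i * pderiv_at i (diag_kernel n) (x - y))) +
    (\<Sum>i\<in>UNIV. u y $ i * pderiv_at i (mollify (diag_kernel n) w) y)"

text \<open>Since \<open>u\<close> is divergence-free, subtracting \<open>w y\<close> changes nothing; the commutator becomes quadratic in
  differences.  One factor is absorbed by the gradient of \<open>u\<close> and pays for the derivative of the kernel, the
  other one tends to zero.\<close>

lemma commutator_pointwise:
  assumes H: "H1_field u G" and w: "Lp_torus 2 w" and c: "c > 0"
  shows "\<bar>commutator n u w y\<bar> \<le> (\<Sum>i\<in>UNIV.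
    c * (TINT x. \<bar>w x - w y\<bar>\<^sup>2 * lowered_kernel i n (x - y)) +
    (1 / c) * (TINT x. \<bar>u x $ i - u y $ i\<bar>\<^sup>2 * stretched_kernel i n (x - y)))"
proof -
  let ?k = "diag_kernel n"
  define D where "D i x = pderiv_at i ?k (x - y)" for i x
  have kt: "test_function ?k" and ks: "smooth ?k"
    by (rule cos_kernel_test_function(1), rule test_function_smooth[OF cos_kernel_test_function(1)])
  have Dt: "test_function (D i)" for i
  proof -
    have "D i = pderiv_at i (\<lambda>x. ?k (x - y))"
      unfolding D_def by (rule ext) (rule pderiv_shift[OF ks, symmetric])
    then show ?thesis
      using test_function_pderiv[OF cos_kernel_test_function(2)[of "Suc n" "Suc n" y]] by (simp only:)
  qed
  have D0: "(TINT x. D i x) = 0" for i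
  proof -
    have "D i = pderiv_at i (\<lambda>x. ?k (x - y))"
      unfolding D_def by (rule ext) (rule pderiv_shift[OF ks, symmetric])
    then show ?thesis
      using integral_torus_pderiv[OF cos_kernel_test_function(2)[of "Suc n" "Suc n" y]] by (simp only:)
  qed
  have uD: "(TINT x. u x $ 1 * D 1 x) + (TINT x. u x $ 2 * D 2 x) = 0"
  proof -
    have i: "integrable torus_measure (\<lambda>x. u x $ i * D i x)" for i
      by (intro integrable_torus_mult_continuous L2_integrable(1) H1_fieldD(1)[OF H] test_function_continuous Dt)
    have "(TINT x. (\<Sum>i\<in>UNIV. u x $ i * pderiv_at i (\<lambda>x. ?k (x - y)) x)) = 0"
      using H cos_kernel_test_function(2)[of "Suc n" "Suc n" y] unfolding H1_field_def weakly_div_free_def by blast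
    then have "(TINT x. (\<Sum>i\<in>UNIV. u x $ i * D i x)) = 0"
      unfolding pderiv_shift[OF ks] D_def .
    then show ?thesis
      using i by (simp add: UNIV_2)
  qed
  note wi = L2_integrable(1)[OF w] and ui = L2_integrable(1)[OF H1_fieldD(1)[OF H]]
  have cD: "continuous_on UNIV (D i)" for i
    by (intro test_function_continuous Dt)
  have int_a: "integrable torus_measure (\<lambda>x. w x * u x $ i * D i x)" for i
    by (intro L2_triple_integrable w H1_fieldD(1)[OF H] Dt)
  have int_b: "integrable torus_measure (\<lambda>x. w x * D i x)" "integrable torus_measure (\<lambda>x. u x $ i * D i x)"
    "integrable torus_measure (D i)" for i
    by (intro integrable_torus_mult_continuous wi ui cD, intro integrable_torus_mult_continuous wi ui cD,
        intro integrable_torus_continuous cD)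
  have expand: "(TINT x. (w x - w y) * (u x $ i - u y $ i) * D i x) =
      (TINT x. w x * u x $ i * D i x) - u y $ i * (TINT x. w x * D i x)
       - w y * (TINT x. u x $ i * D i x) + w y * u y $ i * (TINT x. D i x)"
    and expand_int: "integrable torus_measure (\<lambda>x. (w x - w y) * (u x $ i - u y $ i) * D i x)" for i
  proof -
    have eq: "(\<lambda>x. (w x - w y) * (u x $ i - u y $ i) * D i x) =
        (\<lambda>x. w x * u x $ i * D i x - u y $ i * (w x * D i x) - w y * (u x $ i * D i x) + w y * u y $ i * D i x)"
      by (auto simp: fun_eq_iff algebra_simps)
    show "integrable torus_measure (\<lambda>x. (w x - w y) * (u x $ i - u y $ i) * D i x)"
      unfolding eq using int_a int_b by simp
    show "(TINT x. (w x - w y) * (u x $ i - u y $ i) * D i x) =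
      (TINT x. w x * u x $ i * D i x) - u y $ i * (TINT x. w x * D i x)
       - w y * (TINT x. u x $ i * D i x) + w y * u y $ i * (TINT x. D i x)"
      unfolding eq using int_a[of i] int_b[of i] by simp
  qed
  have com: "commutator n u w y = (\<Sum>i\<in>UNIV. TINT x. (w x - w y) * (u x $ i - u y $ i) * D i x)"
  proof -
    have 1: "(TINT x. w x * (\<Sum>i\<in>UNIV. u x $ i * D i x)) =
        (TINT x. w x * u x $ 1 * D 1 x) + (TINT x. w x * u x $ 2 * D 2 x)"
      using int_a[of 1] int_a[of 2] by (simp add: UNIV_2 distrib_left mult.assoc)
    have 2: "pderiv_at i (mollify ?k w) y = - (TINT x. w x * D i x)" for i
      unfolding D_def by (rule pderiv_mollify[OF wi])
    have "w y * (TINT x. u x $ 1 * D 1 x) + w y * (TINT x. u x $ 2 * D 2 x) = 0"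
      unfolding distrib_left[symmetric] uD by simp
    then show ?thesis
      unfolding commutator_def 2 D_def[symmetric] 1 unfolding UNIV_2 using D0 by (simp add: expand)
  qed
  have each: "\<bar>TINT x. (w x - w y) * (u x $ i - u y $ i) * D i x\<bar> \<le>
      c * (TINT x. \<bar>w x - w y\<bar>\<^sup>2 * lowered_kernel i n (x - y)) +
      (1 / c) * (TINT x. \<bar>u x $ i - u y $ i\<bar>\<^sup>2 * stretched_kernel i n (x - y))" for i
  proof -
    have sq: "integrable torus_measure (\<lambda>x. \<bar>h x - h y\<bar>\<^sup>2 * k (x - y))" if "Lp_torus 2 h" "conv_kernel k" for h k
    proof -
      have "integrable torus_measure (\<lambda>x. (h x)\<^sup>2 - 2 * h y * h x + (h y)\<^sup>2)"
        using L2_integrable[OF that(1)] by simp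
      then have "integrable torus_measure (\<lambda>x. \<bar>h x - h y\<bar>\<^sup>2)"
        by (simp add: power2_diff algebra_simps)
      moreover have "continuous_on UNIV (\<lambda>x. k (x - y))"
        using that(2) unfolding conv_kernel_def
        by (auto intro!: continuous_on_compose2[of UNIV k UNIV "\<lambda>x. x - y"] continuous_intros)
      ultimately show ?thesis
        by (rule integrable_torus_mult_continuous)
    qed
    note s1 = sq[OF w conv_kernel_lowered] and s2 = sq[OF H1_fieldD(1)[OF H] conv_kernel_stretched]
    have "\<bar>TINT x. (w x - w y) * (u x $ i - u y $ i) * D i x\<bar> \<le>
        (TINT x. \<bar>(w x - w y) * (u x $ i - u y $ i) * D i x\<bar>)"
      by (rule integral_abs_bound)
    also have "\<dots> \<le> (TINT x. c * (\<bar>w x - w y\<bar>\<^sup>2 * lowered_kernel i n (x - y)) +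
        (1 / c) * (\<bar>u x $ i - u y $ i\<bar>\<^sup>2 * stretched_kernel i n (x - y)))"
    proof (intro integral_mono integrable_abs expand_int Bochner_Integration.integrable_add integrable_mult_right)
      show "integrable torus_measure (\<lambda>x. \<bar>w x - w y\<bar>\<^sup>2 * lowered_kernel i n (x - y))" by (rule s1)
      show "integrable torus_measure (\<lambda>x. \<bar>u x $ i - u y $ i\<bar>\<^sup>2 * stretched_kernel i n (x - y))" by (rule s2)
      show "\<bar>(w x - w y) * (u x $ i - u y $ i) * D i x\<bar> \<le> c * (\<bar>w x - w y\<bar>\<^sup>2 * lowered_kernel i n (x - y)) +
        (1 / c) * (\<bar>u x $ i - u y $ i\<bar>\<^sup>2 * stretched_kernel i n (x - y))" for x
        unfolding D_def by (rule pderiv_diag_kernel_bound[OF c])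
    qed
    also have "\<dots> = c * (TINT x. \<bar>w x - w y\<bar>\<^sup>2 * lowered_kernel i n (x - y)) +
      (1 / c) * (TINT x. \<bar>u x $ i - u y $ i\<bar>\<^sup>2 * stretched_kernel i n (x - y))"
      using s1[of i n] s2[of i i n] by simp
    finally show ?thesis .
  qed
  show ?thesis
    unfolding com by (rule order_trans[OF sum_abs sum_mono[OF each]])
qed

lemma commutator_bound:
  assumes H: "H1_field u G" and w: "Lp_torus 2 w" and c: "c > 0"
  shows "(TINT y. \<bar>commutator n u w y\<bar>) \<le>
    (\<Sum>i\<in>UNIV. c * oscillation 2 (lowered_kernel i n) w) + (1 / c) * (3456 * (TINT x. (norm (G x))\<^sup>2))"
proof -
  define E where "E = (TINT x. (norm (G x))\<^sup>2)"
  define a where "a i y = (TINT x. \<bar>w x - w y\<bar>\<^sup>2 * lowered_kernel i n (x - y))" for i y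
  define b where "b i y = (TINT x. \<bar>u x $ i - u y $ i\<bar>\<^sup>2 * stretched_kernel i n (x - y))" for i y
  have E: "E \<ge> 0"
    by (simp add: E_def)
  have slice: "integrable torus_measure (\<lambda>y. TINT x. \<bar>h x - h y\<bar>\<^sup>2 * k (x - y))"
    "(TINT y. TINT x. \<bar>h x - h y\<bar>\<^sup>2 * k (x - y)) = oscillation 2 k h"
    if "Lp_torus 2 h" "conv_kernel k" for h k
  proof -
    note osc = oscillation_integrable(1)[OF that]
    show "integrable torus_measure (\<lambda>y. TINT x. \<bar>h x - h y\<bar>\<^sup>2 * k (x - y))"
      using TM2.integrable_fst'[OF osc] by simp
    show "(TINT y. TINT x. \<bar>h x - h y\<bar>\<^sup>2 * k (x - y)) = oscillation 2 k h"
      unfolding oscillation_def TM2.integral_fst'[OF osc, symmetric] by simp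
  qed
  have ai: "integrable torus_measure (a i)" "(TINT y. a i y) = oscillation 2 (lowered_kernel i n) w" for i
    unfolding a_def by (rule slice[OF w conv_kernel_lowered])+
  have bi: "integrable torus_measure (b i)" "(TINT y. b i y) = oscillation 2 (stretched_kernel i n) (\<lambda>x. u x $ i)" for i
    unfolding b_def by (rule slice[OF H1_fieldD(1)[OF H] conv_kernel_stretched])+
  have obound: "oscillation 2 (stretched_kernel i n) (\<lambda>x. u x $ i) \<le> 1728 * E" for i
  proof -
    have "oscillation 2 (stretched_kernel i n) (\<lambda>x. u x $ i) \<le>
        288 * 3 * (\<Sum>j\<in>UNIV. TINT y. (G y $ i $ j)\<^sup>2)"
      by (rule oscillation_H1[OF H1_fieldD(1)[OF H] H1_fieldD(3)[OF H] H1_fieldD(2)[OF H] conv_kernel_stretched stretched_kernel_moment])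
    also have "\<dots> \<le> 288 * 3 * (\<Sum>j\<in>(UNIV::2 set). E)"
      using H unfolding E_def H1_field_def by (intro mult_left_mono sum_mono L2_mat_components) auto
    finally show ?thesis by simp
  qed
  have ptw: "\<bar>commutator n u w y\<bar> \<le> c * a 1 y + (1 / c) * b 1 y + (c * a 2 y + (1 / c) * b 2 y)" for y
    using commutator_pointwise[OF H w c, of n y] unfolding a_def b_def UNIV_2 by simp
  have bi': "integrable torus_measure (\<lambda>y. c * a 1 y + (1 / c) * b 1 y + (c * a 2 y + (1 / c) * b 2 y))"
    using ai bi by simp
  have "(TINT y. \<bar>commutator n u w y\<bar>) \<le> (TINT y. c * a 1 y + (1 / c) * b 1 y + (c * a 2 y + (1 / c) * b 2 y))"
  proof (cases "integrable torus_measure (\<lambda>y. \<bar>commutator n u w y\<bar>)")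
    case True
    then show ?thesis
      by (rule integral_mono[OF _ bi' ptw])
  next
    case False
    then have "(TINT y. \<bar>commutator n u w y\<bar>) = 0"
      by (rule not_integrable_integral_eq)
    also have "0 \<le> (TINT y. c * a 1 y + (1 / c) * b 1 y + (c * a 2 y + (1 / c) * b 2 y))"
      using ptw by (intro Bochner_Integration.integral_nonneg) (meson abs_ge_zero order_trans)
    finally show ?thesis .
  qed
  also have "\<dots> = (\<Sum>i\<in>UNIV. c * oscillation 2 (lowered_kernel i n) w) +
      (1 / c) * (oscillation 2 (stretched_kernel 1 n) (\<lambda>x. u x $ 1) + oscillation 2 (stretched_kernel 2 n) (\<lambda>x. u x $ 2))"
    using ai bi by (simp add: UNIV_2 distrib_left)
  also have "\<dots> \<le> (\<Sum>i\<in>UNIV. c * oscillation 2 (lowered_kernel i n) w) + (1 / c) * (1728 * E + 1728 * E)"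
    using c by (intro add_left_mono mult_left_mono add_mono obound) auto
  finally show ?thesis
    by (simp add: E_def)
qed

lemma curl_of_L2_bound:
  assumes "Lp_torus 2 G"
  shows "(TINT x. (curl_of G x)\<^sup>2) \<le> 4 * (TINT x. (norm (G x))\<^sup>2)"
proof -
  have L: "Lp_torus 2 (\<lambda>x. G x $ 2 $ 1)" "Lp_torus 2 (\<lambda>x. G x $ 1 $ 2)"
    using assms by (auto intro: L2_mat_components)
  have "(TINT x. (curl_of G x)\<^sup>2) \<le> 2 * (TINT x. (G x $ 2 $ 1)\<^sup>2) + 2 * (TINT x. (G x $ 1 $ 2)\<^sup>2)"
    using L2_square_add_le[OF Lp_torus_diff[OF L] L(1)] by (simp add: curl_of_def)
  then show ?thesis
    using L2_mat_components(2)[OF assms, of 2 1] L2_mat_components(2)[OF assms, of 1 2] by linarith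
qed

text \<open>This bound is uniform in \<open>n\<close> and serves as majorant for dominated convergence in time.\<close>

lemma commutator_uniform_bound:
  assumes H: "H1_field u G"
  shows "(TINT y. \<bar>commutator n u (curl_of G) y\<bar>) \<le> 3520 * (TINT x. (norm (G x))\<^sup>2)"
proof -
  have GL: "Lp_torus 2 G"
    using H by (simp add: H1_field_def)
  have "oscillation 2 (lowered_kernel i n) (curl_of G) \<le> 8 * (TINT x. (curl_of G x)\<^sup>2)" for i
    using oscillation_integrable(2)[OF H1_fieldD(4)[OF H] conv_kernel_lowered[of i n]] approx_identity_lowered[of i]
    by (simp add: approx_identity_def)
  then have "(\<Sum>i\<in>(UNIV::2 set). 1 * oscillation 2 (lowered_kernel i n) (curl_of G)) \<le> (\<Sum>i\<in>(UNIV::2 set). 8 * (TINT x. (curl_of G x)\<^sup>2))"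
    by (intro sum_mono) simp
  then show ?thesis
    using commutator_bound[OF H H1_fieldD(4)[OF H], of 1 n] curl_of_L2_bound[OF GL] by simp
qed

text \<open>First \<open>c\<close> is taken so large that the term with the gradient is small; for fixed \<open>c\<close> the oscillation of the
  vorticity then tends to zero.\<close>

lemma commutator_tendsto_0:
  assumes H: "H1_field u G"
  shows "(\<lambda>n. TINT y. \<bar>commutator n u (curl_of G) y\<bar>) \<longlonglongrightarrow> 0"
proof (rule LIMSEQ_I)
  fix r :: real assume r: "r > 0"
  define E where "E = (TINT x. (norm (G x))\<^sup>2)"
  have E: "E \<ge> 0"
    by (simp add: E_def)
  define c where "c = 2 * (3456 * E + 1) / r"
  have c: "c > 0"
    using E r by (simp add: c_def)
  have cE: "(1 / c) * (3456 * E) \<le> r / 2"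
    using E r by (simp add: c_def field_simps)
  have "(\<lambda>n. \<Sum>i\<in>UNIV. c * oscillation 2 (lowered_kernel i n) (curl_of G)) \<longlonglongrightarrow> (\<Sum>i\<in>(UNIV::2 set). c * 0)"
    by (intro tendsto_sum tendsto_mult tendsto_const oscillation_tendsto_0 H1_fieldD(4)[OF H] approx_identity_lowered) simp
  then have "\<forall>\<^sub>F n in sequentially. (\<Sum>i\<in>UNIV. c * oscillation 2 (lowered_kernel i n) (curl_of G)) < r / 2"
    using r by (intro order_tendstoD) auto
  then obtain N where N: "\<And>n. n \<ge> N \<Longrightarrow> (\<Sum>i\<in>UNIV. c * oscillation 2 (lowered_kernel i n) (curl_of G)) < r / 2"
    by (auto simp: eventually_sequentially)
  have "norm ((TINT y. \<bar>commutator n u (curl_of G) y\<bar>) - 0) < r" if "n \<ge> N" for n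
    using commutator_bound[OF H H1_fieldD(4)[OF H] c, of n] N[OF that] cE unfolding E_def by simp
  then show "\<exists>N. \<forall>n\<ge>N. norm ((TINT y. \<bar>commutator n u (curl_of G) y\<bar>) - 0) < r"
    by blast
qed

section \<open>The maximal vorticity function\<close>

lemma torus_subset_measurable:
  assumes "E \<subseteq> torus" "E \<in> sets lebesgue"
  shows "E \<in> lmeasurable" "E \<in> sets torus_measure" "measure torus_measure E = measure lebesgue E"
    "(TINT x. indicator E x) = measure lebesgue E"
proof -
  show 1: "E \<in> lmeasurable"
    using fmeasurableI2[OF torus_lmeasurable assms(1)] assms(2) by simp
  show 2: "E \<in> sets torus_measure"
    using assms torus_sets by (simp add: sets_restrict_space_iff)
  show 3: "measure torus_measure E = measure lebesgue E"
    using assms torus_sets by (simp add: measure_restrict_space)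
  have "space torus_measure \<inter> E = E"
    using assms by auto
  then show "(TINT x. indicator E x) = measure lebesgue E"
    using 2 3 by (simp add: Int_commute)
qed

lemma set_integral_torus:
  fixes h :: "real^2 \<Rightarrow> real"
  assumes "E \<subseteq> torus"
  shows "(LINT x:E|lebesgue. h x) = (TINT x. indicator E x * h x)"
proof -
  have "indicator torus x * (indicator E x * h x) = indicator E x * h x" for x
    using assms by (auto simp: indicator_def)
  moreover have "(TINT x. indicator E x * h x) = (LINT x|lebesgue. indicator torus x *\<^sub>R (indicator E x * h x))"
    using torus_sets by (intro integral_restrict_space) simp
  ultimately show ?thesis
    unfolding set_lebesgue_integral_def real_scaleR_def by (simp only:)
qed

lemma sublevel_measurable:
  fixes h :: "real^2 \<Rightarrow> real"
  assumes "h \<in> borel_measurable torus_measure"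
  shows "{x \<in> torus. c < h x} \<in> sets lebesgue" "{x \<in> torus. h x \<ge> c} \<in> sets lebesgue" "{x \<in> torus. h x = c} \<in> sets lebesgue"
proof -
  have "{x \<in> space torus_measure. c < h x} \<in> sets torus_measure" "{x \<in> space torus_measure. c \<le> h x} \<in> sets torus_measure"
    "{x \<in> space torus_measure. h x = c} \<in> sets torus_measure"
    using assms by measurable
  then show "{x \<in> torus. c < h x} \<in> sets lebesgue" "{x \<in> torus. h x \<ge> c} \<in> sets lebesgue" "{x \<in> torus. h x = c} \<in> sets lebesgue"
    using torus_sets by (auto simp: sets_restrict_space_iff)
qed

text \<open>Lebesgue measure has no atoms: the measure of the part of \<open>A\<close> to the left of a vertical line depends
  continuously on the line.\<close>

lemma subset_of_measure:
  assumes A: "A \<subseteq> torus" "A \<in> sets lebesgue" and s: "0 \<le> s" "s \<le> measure lebesgue A"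
  obtains E where "E \<subseteq> A" "E \<in> sets lebesgue" "measure lebesgue E = s"
proof -
  define P where "P c = A \<inter> {x. x $ 1 \<le> c}" for c
  have half: "{x :: real^2. x $ 1 \<le> c} \<in> sets lebesgue" for c
    by (intro sets_completionI_sets) auto
  have P: "P c \<in> lmeasurable" "P c \<in> sets lebesgue" for c
  proof -
    show *: "P c \<in> sets lebesgue"
      unfolding P_def by (rule sets.Int[OF A(2) half])
    show "P c \<in> lmeasurable"
      by (rule torus_subset_measurable(1)[OF _ *]) (use A(1) in \<open>auto simp: P_def\<close>)
  qed
  have lip: "measure lebesgue (P d) \<le> measure lebesgue (P c) + 2 * pi * (d - c)" if "c \<le> d" for c d
  proof -
    let ?K = "cbox (\<chi> i. if i = 1 then c else 0) (\<chi> i. if i = 1 then d else 2 * pi) :: (real^2) set"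
    have ne: "?K \<noteq> {}"
      using that by (simp add: interval_ne_empty_cart)
    have "measure lebesgue ?K = 2 * pi * (d - c)"
      using ne by (simp add: content_cbox_if_cart UNIV_2)
    moreover have "P d \<subseteq> P c \<union> ?K"
    proof
      fix x assume x: "x \<in> P d"
      then have b: "0 \<le> x $ i" "x $ i \<le> 2 * pi" for i
        using A(1) by (auto simp: P_def torus_def less_imp_le)
      show "x \<in> P c \<union> ?K"
      proof (cases "x $ 1 \<le> c")
        case False
        then have "x \<in> ?K"
          using x b unfolding mem_box_cart by (auto simp: P_def)
        then show ?thesis by blast
      qed (use x in \<open>auto simp: P_def\<close>)
    qed
    then have "measure lebesgue (P d) \<le> measure lebesgue (P c \<union> ?K)"
      using P by (intro measure_mono_fmeasurable) auto
    moreover have "measure lebesgue (P c \<union> ?K) \<le> measure lebesgue (P c) + measure lebesgue ?K"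
      using P by (intro measure_Un_le) auto
    ultimately show ?thesis by linarith
  qed
  have mono: "measure lebesgue (P c) \<le> measure lebesgue (P d)" if "c \<le> d" for c d
    using P that by (intro measure_mono_fmeasurable) (auto simp: P_def)
  have "(2 * pi)-lipschitz_on {-1..2 * pi} (\<lambda>c. measure lebesgue (P c))"
  proof (rule lipschitz_onI)
    fix c d :: real
    show "dist (measure lebesgue (P c)) (measure lebesgue (P d)) \<le> 2 * pi * dist c d"
      using lip[of c d] lip[of d c] mono[of c d] mono[of d c]
      by (cases "c \<le> d") (auto simp: dist_real_def abs_if)
  qed simp
  then have "continuous_on {-1..2 * pi} (\<lambda>c. measure lebesgue (P c))"
    by (rule lipschitz_on_continuous_on)
  moreover have "P (-1) = {}"
  proof -
    have "0 \<le> x $ 1" if "x \<in> A" for x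
      using A(1) that by (auto simp: torus_def)
    then show ?thesis
      by (force simp: P_def)
  qed
  moreover have "P (2 * pi) = A"
    using A(1) by (auto simp: P_def torus_def less_imp_le)
  moreover have "-1 \<le> 2 * pi"
    using pi_gt_zero by linarith
  ultimately obtain c where "measure lebesgue (P c) = s"
    using IVT'[of "\<lambda>c. measure lebesgue (P c)" "-1" s "2 * pi"] s by auto
  then show ?thesis
    using that[of "P c"] P by (auto simp: P_def)
qed

lemma positive_part_integrable:
  fixes h :: "real^2 \<Rightarrow> real"
  assumes "integrable torus_measure h"
  shows "integrable torus_measure (\<lambda>x. max 0 (\<bar>h x\<bar> - l))"
proof (rule Bochner_Integration.integrable_bound[of _ "\<lambda>x. \<bar>h x\<bar> + \<bar>l\<bar>"])
  show "(\<lambda>x. max 0 (\<bar>h x\<bar> - l)) \<in> borel_measurable torus_measure"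
    using assms by measurable
qed (use assms in auto)

text \<open>The threshold is the infimum of all \<open>l\<close> for which the superlevel set has measure at most \<open>s\<close>.  The two inequalities are
  continuity of the measure from below and from above.\<close>

lemma quantile_exists:
  fixes h :: "real^2 \<Rightarrow> real"
  assumes h: "integrable torus_measure h" and s: "0 < s" "s \<le> measure lebesgue torus"
  obtains l where "l \<ge> 0" "measure lebesgue {x \<in> torus. l < \<bar>h x\<bar>} \<le> s" "s \<le> measure lebesgue {x \<in> torus. \<bar>h x\<bar> \<ge> l}"
proof -
  have hm: "(\<lambda>x. \<bar>h x\<bar>) \<in> borel_measurable torus_measure"
    using h by measurable
  define m where "m l = measure torus_measure {x \<in> torus. l < \<bar>h x\<bar>}" for l
  have S: "{x \<in> torus. l < \<bar>h x\<bar>} \<in> sets torus_measure" "{x \<in> torus. \<bar>h x\<bar> \<ge> l} \<in> sets torus_measure" for l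
    using sublevel_measurable[OF hm, of l] by (auto intro: torus_subset_measurable(2))
  have m_leb: "m l = measure lebesgue {x \<in> torus. l < \<bar>h x\<bar>}" for l
    unfolding m_def using sublevel_measurable[OF hm, of l] by (auto intro: torus_subset_measurable(3))
  have m_mono: "m b \<le> m a" if "a \<le> b" for a b
    unfolding m_def using that S by (intro TM.finite_measure_mono) auto
  define L where "L = {l. 0 \<le> l \<and> m l \<le> s}"
  have "L \<noteq> {}"
  proof -
    have "(\<lambda>n. measure torus_measure {x \<in> torus. real n < \<bar>h x\<bar>}) \<longlonglongrightarrow> measure torus_measure (\<Inter>n. {x \<in> torus. real n < \<bar>h x\<bar>})"
      using S by (intro TM.finite_Lim_measure_decseq) (auto simp: decseq_def)
    moreover have "(\<Inter>n. {x \<in> torus. real n < \<bar>h x\<bar>}) = {}"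
    proof -
      have "x \<notin> (\<Inter>n. {x \<in> torus. real n < \<bar>h x\<bar>})" for x
      proof -
        obtain n where "\<bar>h x\<bar> \<le> real n"
          using real_arch_simple by blast
        then show ?thesis
          by (auto intro!: exI[of _ n])
      qed
      then show ?thesis
        by blast
    qed
    ultimately have "(\<lambda>n. m (real n)) \<longlonglongrightarrow> 0"
      by (simp add: m_def)
    then have "\<forall>\<^sub>F n in sequentially. m (real n) < s"
      using s by (intro order_tendstoD) auto
    then obtain n where "m (real n) < s"
      by (auto simp: eventually_sequentially)
    then have "real n \<in> L"
      by (simp add: L_def)
    then show ?thesis by blast
  qed
  have bdd: "bdd_below L"
    by (rule bdd_belowI[of _ 0]) (simp add: L_def)
  define l where "l = Inf L"
  have l0: "l \<ge> 0"
    unfolding l_def using \<open>L \<noteq> {}\<close> by (intro cInf_greatest) (auto simp: L_def)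
  have above: "m a \<le> s" if a: "a > l" for a
  proof -
    obtain b where "b \<in> L" "b < a"
      using cInf_lessD[OF \<open>L \<noteq> {}\<close>, of a] a by (auto simp: l_def)
    then show ?thesis
      using m_mono[of b a] by (simp add: L_def)
  qed
  have below: "m a > s" if "0 \<le> a" "a < l" for a
  proof (rule ccontr)
    assume "\<not> m a > s"
    then have "a \<in> L"
      using that by (simp add: L_def)
    then show False
      using cInf_lower[OF _ bdd, of a] that(2) by (simp add: l_def)
  qed
  have 1: "m l \<le> s"
  proof -
    have "(\<lambda>n. measure torus_measure {x \<in> torus. l + 1 / real (Suc n) < \<bar>h x\<bar>}) \<longlonglongrightarrow>
        measure torus_measure (\<Union>n. {x \<in> torus. l + 1 / real (Suc n) < \<bar>h x\<bar>})"
    proof (intro TM.finite_Lim_measure_incseq)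
      have "1 / real (Suc k) \<le> 1 / real (Suc n)" if "n \<le> k" for n k
        using that by (simp add: frac_le)
      then show "incseq (\<lambda>n. {x \<in> torus. l + 1 / real (Suc n) < \<bar>h x\<bar>})"
        unfolding incseq_def by (intro allI impI Collect_mono conj_mono imp_refl) (metis add_left_mono le_less_trans)
    qed (use S in auto)
    moreover have "(\<Union>n. {x \<in> torus. l + 1 / real (Suc n) < \<bar>h x\<bar>}) = {x \<in> torus. l < \<bar>h x\<bar>}"
    proof -
      have A: "\<exists>n. l + 1 / real (Suc n) < t" if lt: "l < t" for t
      proof -
        obtain n where "inverse (real (Suc n)) < t - l"
          using reals_Archimedean[of "t - l"] lt by auto
        then have "l + 1 / real (Suc n) < t"
          by (simp add: inverse_eq_divide del: of_nat_Suc)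
        then show ?thesis ..
      qed
      have B: "l < t" if "l + 1 / real (Suc n) < t" for n t
      proof -
        have "0 < 1 / real (Suc n)"
          by simp
        then show ?thesis
          using that by linarith
      qed
      show ?thesis
        by (intro set_eqI iffI) (use A B in \<open>auto simp del: of_nat_Suc\<close>)
    qed
    ultimately have "(\<lambda>n. m (l + 1 / real (Suc n))) \<longlonglongrightarrow> m l"
      by (simp add: m_def)
    then show ?thesis
      by (rule LIMSEQ_le_const2) (use above in auto)
  qed
  have 2: "s \<le> measure torus_measure {x \<in> torus. \<bar>h x\<bar> \<ge> l}"
  proof (cases "l = 0")
    case True
    then have "{x \<in> torus. \<bar>h x\<bar> \<ge> l} = torus"
      by auto
    then show ?thesis
      using s torus_subset_measurable(3)[OF subset_refl torus_sets] by simp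
  next
    case False
    have "(\<lambda>n. measure torus_measure {x \<in> torus. l - l / real (Suc n) < \<bar>h x\<bar>}) \<longlonglongrightarrow>
        measure torus_measure (\<Inter>n. {x \<in> torus. l - l / real (Suc n) < \<bar>h x\<bar>})"
    proof (intro TM.finite_Lim_measure_decseq)
      have "l / real (Suc k) \<le> l / real (Suc n)" if "n \<le> k" for n k
        using that l0 by (simp add: frac_le)
      then show "decseq (\<lambda>n. {x \<in> torus. l - l / real (Suc n) < \<bar>h x\<bar>})"
        unfolding decseq_def by (intro allI impI Collect_mono conj_mono imp_refl) (metis diff_left_mono le_less_trans)
    qed (use S in auto)
    moreover have "(\<Inter>n. {x \<in> torus. l - l / real (Suc n) < \<bar>h x\<bar>}) = {x \<in> torus. \<bar>h x\<bar> \<ge> l}"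
    proof -
      have A: "t \<ge> l" if "\<And>n. l - l / real (Suc n) < t" for t
      proof -
        have "(\<lambda>n. l - l * inverse (real (Suc n))) \<longlonglongrightarrow> l - l * 0"
          by (intro tendsto_intros LIMSEQ_inverse_real_of_nat)
        then have "l - l * 0 \<le> t"
          by (rule LIMSEQ_le_const2) (use that in \<open>auto simp: divide_inverse less_imp_le\<close>)
        then show ?thesis by simp
      qed
      have B: "l - l / real (Suc n) < t" if "t \<ge> l" for n t
      proof -
        have "l / real (Suc n) > 0"
          using False l0 by simp
        then show ?thesis
          using that by linarith
      qed
      show ?thesis
        by (intro set_eqI iffI) (use A B in \<open>auto simp del: of_nat_Suc\<close>)
    qed
    ultimately have "(\<lambda>n. m (l - l / real (Suc n))) \<longlonglongrightarrow> measure torus_measure {x \<in> torus. \<bar>h x\<bar> \<ge> l}"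
      by (simp add: m_def)
    moreover have "s \<le> m (l - l / real (Suc n))" for n
    proof (rule less_imp_le[OF below])
      show "0 \<le> l - l / real (Suc n)"
        using l0 by (simp add: field_simps)
      show "l - l / real (Suc n) < l"
        using False l0 by simp
    qed
    ultimately show ?thesis
      by (intro LIMSEQ_le_const) auto
  qed
  show ?thesis
  proof (rule that[OF l0])
    show "measure lebesgue {x \<in> torus. l < \<bar>h x\<bar>} \<le> s"
      using 1 by (simp add: m_leb)
    show "s \<le> measure lebesgue {x \<in> torus. \<bar>h x\<bar> \<ge> l}"
    proof -
      have "measure torus_measure {x \<in> torus. \<bar>h x\<bar> \<ge> l} = measure lebesgue {x \<in> torus. \<bar>h x\<bar> \<ge> l}"
        by (rule torus_subset_measurable(3)[OF _ sublevel_measurable(2)[OF hm]]) blast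
      then show ?thesis
        using 2 by (simp only:)
    qed
  qed
qed

text \<open>Duality: \<open>\<M>\<^sub>s(h)\<close> is the minimum over \<open>l\<close> of the right-hand side, attained at a quantile.  The right-hand side is an
  integral functional of \<open>h\<close> for each \<open>l\<close>, which makes the maximal vorticity function tractable.\<close>

lemma maximal_vorticity_le:
  fixes h :: "real^2 \<Rightarrow> real"
  assumes h: "integrable torus_measure h" and s: "0 \<le> s" "s \<le> measure lebesgue torus"
  shows "maximal_vorticity s h \<le> l * s + (TINT x. max 0 (\<bar>h x\<bar> - l))"
  unfolding maximal_vorticity_def
proof (rule cSUP_least)
  show "{E. E \<subseteq> torus \<and> E \<in> sets lebesgue \<and> measure lebesgue E = s} \<noteq> {}"
    using subset_of_measure[OF subset_refl torus_sets s] by blast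
  fix E assume "E \<in> {E. E \<subseteq> torus \<and> E \<in> sets lebesgue \<and> measure lebesgue E = s}"
  then have E: "E \<subseteq> torus" "E \<in> sets lebesgue" "measure lebesgue E = s"
    by auto
  have ind: "(\<lambda>x. indicator E x :: real) \<in> borel_measurable torus_measure"
    using torus_subset_measurable(2)[OF E(1,2)] by (rule borel_measurable_indicator)
  have i1: "integrable torus_measure (\<lambda>x. indicator E x * \<bar>h x\<bar>)"
    using integrable_torus_mult_bounded[OF integrable_abs[OF h] ind, of 1] by (simp add: mult.commute indicator_def)
  have i2: "integrable torus_measure (\<lambda>x. indicator E x :: real)"
    by (rule integrable_torus_bounded[OF ind, of 1]) (simp add: indicator_def)
  have "(LINT x:E|lebesgue. \<bar>h x\<bar>) = (TINT x. indicator E x * \<bar>h x\<bar>)"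
    by (rule set_integral_torus[OF E(1)])
  also have "\<dots> \<le> (TINT x. l * indicator E x + max 0 (\<bar>h x\<bar> - l))"
    by (intro integral_mono i1 Bochner_Integration.integrable_add integrable_mult_right i2 positive_part_integrable h)
       (auto simp: indicator_def)
  also have "\<dots> = l * s + (TINT x. max 0 (\<bar>h x\<bar> - l))"
    using i2 positive_part_integrable[OF h] torus_subset_measurable(4)[OF E(1,2)] E(3) by simp
  finally show "(LINT x:E|lebesgue. \<bar>h x\<bar>) \<le> l * s + (TINT x. max 0 (\<bar>h x\<bar> - l))" .
qed

lemma maximal_vorticity_upper:
  fixes h :: "real^2 \<Rightarrow> real"
  assumes h: "integrable torus_measure h" and E: "E \<subseteq> torus" "E \<in> sets lebesgue" "measure lebesgue E = s"
  shows "(TINT x. indicator E x * \<bar>h x\<bar>) \<le> maximal_vorticity s h"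
  unfolding set_integral_torus[OF E(1), symmetric] maximal_vorticity_def
proof (rule cSUP_upper)
  have "(LINT x:E|lebesgue. \<bar>h x\<bar>) \<le> (TINT x. \<bar>h x\<bar>)"
    if "E \<in> {E. E \<subseteq> torus \<and> E \<in> sets lebesgue \<and> measure lebesgue E = s}" for E
  proof -
    have ind: "(\<lambda>x. indicator E x :: real) \<in> borel_measurable torus_measure"
      using that torus_subset_measurable(2)[of E] by (intro borel_measurable_indicator) simp
    have i1: "integrable torus_measure (\<lambda>x. indicator E x * \<bar>h x\<bar>)"
      using integrable_torus_mult_bounded[OF integrable_abs[OF h] ind, of 1] by (simp add: mult.commute indicator_def)
    have "(TINT x. indicator E x * \<bar>h x\<bar>) \<le> (TINT x. \<bar>h x\<bar>)"
      by (intro integral_mono i1 integrable_abs h) (auto simp: indicator_def)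
    then show ?thesis
      using that by (simp add: set_integral_torus)
  qed
  then show "bdd_above ((\<lambda>E. LINT x:E|lebesgue. \<bar>h x\<bar>) ` {E. E \<subseteq> torus \<and> E \<in> sets lebesgue \<and> measure lebesgue E = s})"
    by (intro bdd_aboveI2)
qed (use E in auto)

text \<open>The optimal set consists of the points where \<open>\<bar>h\<bar>\<close> exceeds the quantile, filled up to measure \<open>s\<close> inside the level
  set of the quantile.\<close>

lemma maximal_vorticity_attained:
  fixes h :: "real^2 \<Rightarrow> real"
  assumes h: "integrable torus_measure h" and s: "0 < s" "s \<le> measure lebesgue torus"
  obtains l where "l \<ge> 0" "maximal_vorticity s h = l * s + (TINT x. max 0 (\<bar>h x\<bar> - l))"
proof -
  have hm: "(\<lambda>x. \<bar>h x\<bar>) \<in> borel_measurable torus_measure"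
    using h by measurable
  obtain l where l: "l \<ge> 0" "measure lebesgue {x \<in> torus. l < \<bar>h x\<bar>} \<le> s" "s \<le> measure lebesgue {x \<in> torus. \<bar>h x\<bar> \<ge> l}"
    using quantile_exists[OF h s] by blast
  define U where "U = {x \<in> torus. l < \<bar>h x\<bar>}"
  define D where "D = {x \<in> torus. \<bar>h x\<bar> = l}"
  have UD: "U \<in> sets lebesgue" "D \<in> sets lebesgue" "U \<subseteq> torus" "D \<subseteq> torus" "U \<inter> D = {}"
    unfolding U_def D_def using sublevel_measurable[OF hm, of l] by auto
  have lm: "U \<in> lmeasurable" "D \<in> lmeasurable"
    by (rule torus_subset_measurable(1)[OF UD(3,1)], rule torus_subset_measurable(1)[OF UD(4,2)])
  have "{x \<in> torus. \<bar>h x\<bar> \<ge> l} = U \<union> D"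
    by (auto simp: U_def D_def)
  then have "measure lebesgue {x \<in> torus. \<bar>h x\<bar> \<ge> l} = measure lebesgue U + measure lebesgue D"
    using lm UD(5) by (simp add: measure_Un3)
  then have "0 \<le> s - measure lebesgue U" "s - measure lebesgue U \<le> measure lebesgue D"
    using l by (auto simp: U_def)
  then obtain F where F: "F \<subseteq> D" "F \<in> sets lebesgue" "measure lebesgue F = s - measure lebesgue U"
    using subset_of_measure[OF UD(4,2)] by blast
  have Flm: "F \<in> lmeasurable"
    by (rule torus_subset_measurable(1)[OF order_trans[OF F(1) UD(4)] F(2)])
  define E where "E = U \<union> F"
  have E: "E \<subseteq> torus" "E \<in> sets lebesgue" "measure lebesgue E = s"
  proof -
    have "U \<inter> F = {}"
      using F UD by auto
    then show "measure lebesgue E = s"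
      unfolding E_def using lm Flm F(3) by (simp add: measure_Un3)
  qed (use UD F in \<open>auto simp: E_def\<close>)
  have ind: "(\<lambda>x. indicator E x :: real) \<in> borel_measurable torus_measure"
    using torus_subset_measurable(2)[OF E(1,2)] by (rule borel_measurable_indicator)
  have i2: "integrable torus_measure (\<lambda>x. indicator E x :: real)"
    by (rule integrable_torus_bounded[OF ind, of 1]) (simp add: indicator_def)
  have "l * s + (TINT x. max 0 (\<bar>h x\<bar> - l)) = (TINT x. l * indicator E x + max 0 (\<bar>h x\<bar> - l))"
    using i2 positive_part_integrable[OF h] torus_subset_measurable(4)[OF E(1,2)] E(3) by simp
  also have "\<dots> = (TINT x. indicator E x * \<bar>h x\<bar>)"
    using F(1) by (intro Bochner_Integration.integral_cong) (auto simp: E_def U_def D_def indicator_def)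
  also have "\<dots> \<le> maximal_vorticity s h"
    by (rule maximal_vorticity_upper[OF h E])
  finally have "maximal_vorticity s h = l * s + (TINT x. max 0 (\<bar>h x\<bar> - l))"
    using maximal_vorticity_le[OF h less_imp_le[OF s(1)] s(2), of l] by linarith
  then show ?thesis
    using that l(1) by blast
qed

lemma maximal_vorticity_0: "maximal_vorticity 0 h = 0"
proof -
  let ?S = "{E. E \<subseteq> torus \<and> E \<in> sets lebesgue \<and> measure lebesgue E = 0}"
  have "(LINT x:E|lebesgue. \<bar>h x\<bar>) = 0" if "E \<in> ?S" for E
  proof -
    have "E \<in> lmeasurable" "measure lebesgue E = 0"
      using that torus_subset_measurable(1)[of E] by auto
    then have "E \<in> null_sets lebesgue"
      by (simp add: null_sets_def emeasure_eq_measure2 fmeasurableD)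
    then have "AE x in lebesgue. indicator E x *\<^sub>R \<bar>h x\<bar> = 0"
      by (auto intro: AE_I'[of E])
    then show ?thesis
      unfolding set_lebesgue_integral_def by (rule integral_eq_zero_AE)
  qed
  then have "(\<lambda>E. LINT x:E|lebesgue. \<bar>h x\<bar>) ` ?S = (\<lambda>E. 0) ` ?S"
    by (rule image_cong[OF refl])
  also have "\<dots> = {0}"
    by (rule image_constant[of "{}"]) simp
  finally show ?thesis
    unfolding maximal_vorticity_def by simp
qed

text \<open>Evaluate the dual functional of \<open>h\<close> at the threshold that is optimal for \<open>k\<close>.\<close>

lemma maximal_vorticity_lipschitz:
  fixes h k :: "real^2 \<Rightarrow> real"
  assumes h: "integrable torus_measure h" and k: "integrable torus_measure k"
    and s: "0 \<le> s" "s \<le> measure lebesgue torus"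
  shows "maximal_vorticity s h \<le> maximal_vorticity s k + (TINT x. \<bar>h x - k x\<bar>)"
proof (cases "s = 0")
  case True
  then show ?thesis
    by (simp add: maximal_vorticity_0)
next
  case False
  then have "0 < s"
    using s by simp
  then obtain l where l: "maximal_vorticity s k = l * s + (TINT x. max 0 (\<bar>k x\<bar> - l))"
    using maximal_vorticity_attained[OF k _ s(2)] by blast
  have d: "integrable torus_measure (\<lambda>x. \<bar>h x - k x\<bar>)"
    using h k by simp
  have "maximal_vorticity s h \<le> l * s + (TINT x. max 0 (\<bar>h x\<bar> - l))"
    by (rule maximal_vorticity_le[OF h s])
  also have "(TINT x. max 0 (\<bar>h x\<bar> - l)) \<le> (TINT x. max 0 (\<bar>k x\<bar> - l) + \<bar>h x - k x\<bar>)"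
    by (intro integral_mono positive_part_integrable h k Bochner_Integration.integrable_add d) auto
  also have "\<dots> = (TINT x. max 0 (\<bar>k x\<bar> - l)) + (TINT x. \<bar>h x - k x\<bar>)"
    using positive_part_integrable[OF k] d by simp
  finally show ?thesis
    using l by simp
qed

lemma maximal_vorticity_le_L1:
  fixes h :: "real^2 \<Rightarrow> real"
  assumes h: "integrable torus_measure h" and s: "0 \<le> s" "s \<le> measure lebesgue torus"
  shows "maximal_vorticity s h \<le> (TINT x. \<bar>h x\<bar>)"
  using maximal_vorticity_le[OF h s, of 0] by simp

lemma maximal_vorticity_total:
  fixes h :: "real^2 \<Rightarrow> real"
  assumes h: "integrable torus_measure h"
  shows "maximal_vorticity (measure lebesgue torus) h = (TINT x. \<bar>h x\<bar>)"
proof (rule antisym)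
  show "maximal_vorticity (measure lebesgue torus) h \<le> (TINT x. \<bar>h x\<bar>)"
    by (rule maximal_vorticity_le_L1[OF h]) simp_all
  have "(TINT x. \<bar>h x\<bar>) = (TINT x. indicator torus x * \<bar>h x\<bar>)"
    by (intro Bochner_Integration.integral_cong) auto
  also have "\<dots> \<le> maximal_vorticity (measure lebesgue torus) h"
    by (rule maximal_vorticity_upper[OF h subset_refl torus_sets refl])
  finally show "(TINT x. \<bar>h x\<bar>) \<le> maximal_vorticity (measure lebesgue torus) h" .
qed

text \<open>For every \<open>l \<ge> 0\<close>, \<open>\<phi> h \<le> l \<bar>\<phi>\<bar> + \<bar>\<phi>\<bar> (\<bar>h\<bar> - l)\<^sup>+\<close>; the integral of the right-hand side is at most the dual
  functional.\<close>

lemma maximal_vorticity_pairing: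
  fixes h \<phi> :: "real^2 \<Rightarrow> real"
  assumes h: "integrable torus_measure h" and s: "0 < s" "s \<le> measure lebesgue torus"
    and \<phi>: "\<phi> \<in> borel_measurable torus_measure" "\<And>x. \<bar>\<phi> x\<bar> \<le> 1" "(TINT x. \<bar>\<phi> x\<bar>) \<le> s"
  shows "(TINT x. \<phi> x * h x) \<le> maximal_vorticity s h"
proof -
  obtain l where l: "l \<ge> 0" "maximal_vorticity s h = l * s + (TINT x. max 0 (\<bar>h x\<bar> - l))"
    using maximal_vorticity_attained[OF h s] by blast
  have p: "integrable torus_measure (\<lambda>x. \<bar>\<phi> x\<bar>)"
    using \<phi> by (intro integrable_torus_bounded[of _ 1]) auto
  have ph: "integrable torus_measure (\<lambda>x. \<phi> x * h x)"
    using integrable_torus_mult_bounded[OF h \<phi>(1), of 1] \<phi>(2) by (simp add: mult.commute)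
  have "(TINT x. \<phi> x * h x) \<le> (TINT x. l * \<bar>\<phi> x\<bar> + max 0 (\<bar>h x\<bar> - l))"
  proof (intro integral_mono ph Bochner_Integration.integrable_add integrable_mult_right p positive_part_integrable h)
    fix x
    have "\<phi> x * h x \<le> \<bar>\<phi> x\<bar> * (l + max 0 (\<bar>h x\<bar> - l))"
    proof -
      have "\<bar>h x\<bar> \<le> l + max 0 (\<bar>h x\<bar> - l)"
        by linarith
      from mult_left_mono[OF this abs_ge_zero, of "\<phi> x"] show ?thesis
        using abs_ge_self[of "\<phi> x * h x"] by (simp only: abs_mult)
    qed
    also have "\<dots> \<le> l * \<bar>\<phi> x\<bar> + max 0 (\<bar>h x\<bar> - l)"
      using mult_left_le_one_le[of "max 0 (\<bar>h x\<bar> - l)" "\<bar>\<phi> x\<bar>"] \<phi>(2)[of x] by (simp add: algebra_simps)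
    finally show "\<phi> x * h x \<le> l * \<bar>\<phi> x\<bar> + max 0 (\<bar>h x\<bar> - l)" .
  qed
  also have "\<dots> = l * (TINT x. \<bar>\<phi> x\<bar>) + (TINT x. max 0 (\<bar>h x\<bar> - l))"
    using p positive_part_integrable[OF h] by simp
  also have "\<dots> \<le> maximal_vorticity s h"
    using mult_left_mono[OF \<phi>(3) l(1)] l(2) by simp
  finally show ?thesis .
qed

text \<open>Measurability in a parameter: by duality the maximal vorticity function is a countable infimum.\<close>

lemma maximal_vorticity_Inf:
  fixes h :: "real^2 \<Rightarrow> real"
  assumes h: "integrable torus_measure h" and s: "0 < s" "s \<le> measure lebesgue torus"
  shows "maximal_vorticity s h = (INF q\<in>\<rat>. \<bar>q\<bar> * s + (TINT x. max 0 (\<bar>h x\<bar> - \<bar>q\<bar>)))"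
proof -
  define L where "L q = \<bar>q\<bar> * s + (TINT x. max 0 (\<bar>h x\<bar> - \<bar>q\<bar>))" for q :: real
  obtain l where l: "l \<ge> 0" "maximal_vorticity s h = l * s + (TINT x. max 0 (\<bar>h x\<bar> - l))"
    using maximal_vorticity_attained[OF h s] by blast
  have low: "maximal_vorticity s h \<le> L q" for q
    unfolding L_def using s by (intro maximal_vorticity_le[OF h]) auto
  have "Inf (L ` \<rat>) = maximal_vorticity s h"
  proof (rule cInf_eq_non_empty)
    show "L ` \<rat> \<noteq> {}"
      using Rats_0 by blast
    show "maximal_vorticity s h \<le> x" if "x \<in> L ` \<rat>" for x
      using that low by auto
    show "y \<le> maximal_vorticity s h" if y: "\<And>x. x \<in> L ` \<rat> \<Longrightarrow> y \<le> x" for y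
    proof (rule field_le_epsilon)
      fix e :: real assume e: "e > 0"
      obtain q where q: "q \<in> \<rat>" "l < q" "q < l + e / s"
        using Rats_dense_in_real[of l "l + e / s"] e s by auto
      have "L q \<le> q * s + (TINT x. max 0 (\<bar>h x\<bar> - l))"
        unfolding L_def using q l(1) by (auto intro!: integral_mono positive_part_integrable h)
      also have "\<dots> \<le> maximal_vorticity s h + e"
        using mult_right_mono[of q "l + e / s" s] q(3) s(1) by (simp add: l(2) algebra_simps)
      finally show "y \<le> maximal_vorticity s h + e"
        using y[of "L q"] q(1) by auto
    qed
  qed
  then show ?thesis
    by (simp add: L_def)
qed

section \<open>A smooth approximation of the maximal vorticity function\<close>

definition logistic :: "real \<Rightarrow> real" where
  "logistic x = inverse (1 + exp (- x))"

definition softplus :: "real \<Rightarrow> real" where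
  "softplus x = ln (1 + exp x)"

lemma logistic_bounds: "0 < logistic x" "logistic x < 1"
  by (auto simp: logistic_def add_pos_pos inverse_less_1_iff)

lemma logistic_le_exp: "logistic x \<le> exp x"
proof -
  have "inverse (1 + exp (- x)) \<le> inverse (exp (- x))"
    by (intro le_imp_inverse_le) auto
  then show ?thesis
    by (simp add: logistic_def exp_minus)
qed

lemma logistic_minus: "logistic x + logistic (- x) = 1"
proof -
  have "1 + exp x \<noteq> 0" "1 + exp (- x) \<noteq> 0"
    by (smt (verit) exp_gt_zero)+
  then show ?thesis
    by (simp add: logistic_def exp_minus field_simps)
qed

lemma logistic_has_derivative: "(logistic has_real_derivative logistic x * (1 - logistic x)) (at x)"
proof -
  have p: "1 + exp (- x) \<noteq> 0"
    by (smt (verit) exp_gt_zero)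
  have "((\<lambda>x. inverse (1 + exp (- x))) has_real_derivative exp (- x) * (inverse (1 + exp (- x)))\<^sup>2) (at x)"
    using p by (auto intro!: derivative_eq_intros simp: power2_eq_square)
  moreover have "exp (- x) * (inverse (1 + exp (- x)))\<^sup>2 = logistic x * (1 - logistic x)"
    using p by (simp add: logistic_def power2_eq_square field_simps)
  ultimately show ?thesis
    by (simp add: logistic_def[abs_def])
qed

lemma softplus_has_derivative: "(softplus has_real_derivative logistic x) (at x)"
proof -
  have p: "1 + exp x > 0"
    by (smt (verit) exp_gt_zero)
  have "((\<lambda>x. ln (1 + exp x)) has_real_derivative inverse (1 + exp x) * exp x) (at x)"
    using p by (auto intro!: derivative_eq_intros simp: divide_inverse)
  moreover have "inverse (1 + exp x) * exp x = logistic x"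
    using p by (simp add: logistic_def exp_minus field_simps)
  ultimately show ?thesis
    by (simp add: softplus_def[abs_def])
qed

lemma logistic_strict_mono: "x < y \<Longrightarrow> logistic x < logistic y"
  unfolding logistic_def by (intro less_imp_inverse_less) (auto simp: add_pos_pos)

lemma logistic_mono: "x \<le> y \<Longrightarrow> logistic x \<le> logistic y"
  using logistic_strict_mono[of x y] by (cases "x = y") auto

lemma logistic_lipschitz: "\<bar>logistic x - logistic y\<bar> \<le> \<bar>x - y\<bar>"
proof -
  have base: "\<bar>logistic a - logistic b\<bar> \<le> \<bar>a - b\<bar>" if ab: "b < a" for a b
  proof -
    obtain z where z: "logistic a - logistic b = (a - b) * (logistic z * (1 - logistic z))"
      using MVT2[OF ab logistic_has_derivative] by blast
    have "0 \<le> logistic z * (1 - logistic z)" "logistic z * (1 - logistic z) \<le> 1 * 1"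
      using logistic_bounds[of z] by (simp_all add: mult_le_one less_imp_le)
    then show ?thesis
      using ab unfolding z by (simp add: abs_mult mult_left_le)
  qed
  show ?thesis
    using base[of x y] base[of y x] by (cases x y rule: linorder_cases) (auto simp: abs_minus_commute)
qed

lemma softplus_tangent: "softplus x + logistic x * (y - x) \<le> softplus y"
proof (cases x y rule: linorder_cases)
  case less
  then obtain z where z: "x < z" "softplus y - softplus x = (y - x) * logistic z"
    using MVT2[OF less softplus_has_derivative] by blast
  have "(y - x) * logistic x \<le> (y - x) * logistic z"
    using less z(1) by (intro mult_left_mono logistic_mono) auto
  then show ?thesis
    using z(2) by (simp add: mult.commute)
next
  case greater
  then obtain z where z: "z < x" "softplus x - softplus y = (x - y) * logistic z"
    using MVT2[OF greater softplus_has_derivative] by blast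
  have "(x - y) * logistic z \<le> (x - y) * logistic x"
    using greater z(1) by (intro mult_left_mono logistic_mono) auto
  then show ?thesis
    using z(2) by (simp add: algebra_simps)
qed simp

lemma softplus_bounds: "max 0 x \<le> softplus x" "softplus x \<le> max 0 x + ln 2"
proof -
  have p: "1 + exp x > 0"
    by (smt (verit) exp_gt_zero)
  have "ln 1 \<le> ln (1 + exp x)" "ln (exp x) \<le> ln (1 + exp x)"
    using p by (intro ln_mono; simp)+
  then show "max 0 x \<le> softplus x"
    by (simp add: softplus_def)
  have "1 + exp x \<le> exp (max 0 x) * 2"
    by (cases "x \<le> 0") (auto simp: max_def)
  then have "ln (1 + exp x) \<le> ln (exp (max 0 x) * 2)"
    using p by (intro ln_mono) auto
  then show "softplus x \<le> max 0 x + ln 2"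
    by (simp add: softplus_def ln_mult)
qed

text \<open>\<open>pot \<delta> l\<close> smooths \<open>h \<mapsto> (\<bar>h\<bar> - l)\<^sup>+\<close> on the scale \<open>\<delta>\<close>; \<open>slope\<close> and \<open>- level\<close> are its derivatives in \<open>h\<close> and in
  the threshold \<open>l\<close>.  Where \<open>level\<close> has integral \<open>s\<close>, the threshold is optimal and \<open>slope\<close> competes in the dual definition
  of the maximal vorticity function.\<close>

definition pot :: "real \<Rightarrow> real \<Rightarrow> real \<Rightarrow> real" where
  "pot \<delta> l h = \<delta> * softplus ((h - l) / \<delta>) + \<delta> * softplus ((- h - l) / \<delta>)"

definition slope :: "real \<Rightarrow> real \<Rightarrow> real \<Rightarrow> real" where
  "slope \<delta> l h = logistic ((h - l) / \<delta>) - logistic ((- h - l) / \<delta>)"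

definition level :: "real \<Rightarrow> real \<Rightarrow> real \<Rightarrow> real" where
  "level \<delta> l h = logistic ((h - l) / \<delta>) + logistic ((- h - l) / \<delta>)"

text \<open>The smoothed potential is jointly convex in the threshold and the value.\<close>

lemma pot_tangent:
  assumes "\<delta> > 0"
  shows "pot \<delta> l h + slope \<delta> l h * (h' - h) - level \<delta> l h * (l' - l) \<le> pot \<delta> l' h'"
proof -
  have each: "\<delta> * softplus (a / \<delta>) + logistic (a / \<delta>) * (b - a) \<le> \<delta> * softplus (b / \<delta>)" for a b
  proof -
    have "\<delta> * (softplus (a / \<delta>) + logistic (a / \<delta>) * (b / \<delta> - a / \<delta>)) \<le> \<delta> * softplus (b / \<delta>)"
      using assms by (intro mult_left_mono softplus_tangent) auto
    moreover have "\<delta> * (logistic (a / \<delta>) * (b / \<delta> - a / \<delta>)) = logistic (a / \<delta>) * (b - a)"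
      using assms by (simp add: field_simps)
    ultimately show ?thesis
      by (simp add: distrib_left)
  qed
  show ?thesis
    using each[of "h - l" "h' - l'"] each[of "- h - l" "- h' - l'"]
    unfolding pot_def slope_def level_def by (simp add: algebra_simps)
qed

lemma pot_bounds:
  assumes "\<delta> > 0"
  shows "max 0 (\<bar>h\<bar> - l) \<le> pot \<delta> l h" "l \<ge> 0 \<Longrightarrow> pot \<delta> l h \<le> max 0 (\<bar>h\<bar> - l) + 2 * (\<delta> * ln 2)"
proof -
  have each: "max 0 a \<le> \<delta> * softplus (a / \<delta>)" "\<delta> * softplus (a / \<delta>) \<le> max 0 a + \<delta> * ln 2" for a
  proof -
    have "\<delta> * max 0 (a / \<delta>) = max 0 a"
      using assms by (auto simp: max_def zero_le_divide_iff)
    then show "max 0 a \<le> \<delta> * softplus (a / \<delta>)" "\<delta> * softplus (a / \<delta>) \<le> max 0 a + \<delta> * ln 2"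
      using mult_left_mono[OF softplus_bounds(1)[of "a / \<delta>"], of \<delta>] mult_left_mono[OF softplus_bounds(2)[of "a / \<delta>"], of \<delta>] assms
      by (simp_all add: distrib_left)
  qed
  show "max 0 (\<bar>h\<bar> - l) \<le> pot \<delta> l h"
    using each(1)[of "h - l"] each(1)[of "- h - l"] unfolding pot_def by linarith
  show "pot \<delta> l h \<le> max 0 (\<bar>h\<bar> - l) + 2 * (\<delta> * ln 2)" if "l \<ge> 0"
    using each(2)[of "h - l"] each(2)[of "- h - l"] that unfolding pot_def by linarith
qed

lemma slope_level: "\<bar>slope \<delta> l h\<bar> \<le> level \<delta> l h" "\<bar>slope \<delta> l h\<bar> \<le> 1" "0 < level \<delta> l h" "level \<delta> l h \<le> 2"
  using logistic_bounds[of "(h - l) / \<delta>"] logistic_bounds[of "(- h - l) / \<delta>"]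
  unfolding slope_def level_def by linarith+

lemma level_0: "level \<delta> 0 h = 1"
  using logistic_minus[of "h / \<delta>"] by (simp add: level_def)

lemma level_strict_antimono:
  assumes "\<delta> > 0" "l' - l > \<bar>h' - h\<bar>"
  shows "level \<delta> l' h' < level \<delta> l h"
  unfolding level_def using assms
  by (intro add_strict_mono logistic_strict_mono divide_strict_right_mono) linarith+

lemma slope_lipschitz: "\<delta> > 0 \<Longrightarrow> \<bar>slope \<delta> l h - slope \<delta> l' h'\<bar> \<le> (2 / \<delta>) * (\<bar>h - h'\<bar> + \<bar>l - l'\<bar>)"
  and level_lipschitz: "\<delta> > 0 \<Longrightarrow> \<bar>level \<delta> l h - level \<delta> l' h'\<bar> \<le> (2 / \<delta>) * (\<bar>h - h'\<bar> + \<bar>l - l'\<bar>)"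
proof -
  assume d: "\<delta> > 0"
  have "\<bar>logistic ((h - l) / \<delta>) - logistic ((h' - l') / \<delta>)\<bar> \<le> (\<bar>h - h'\<bar> + \<bar>l - l'\<bar>) / \<delta>"
  proof -
    have "\<bar>(h - l) / \<delta> - (h' - l') / \<delta>\<bar> = \<bar>(h - l) - (h' - l')\<bar> / \<delta>"
      using d by (simp add: diff_divide_distrib[symmetric])
    also have "\<dots> \<le> (\<bar>h - h'\<bar> + \<bar>l - l'\<bar>) / \<delta>"
      using d by (intro divide_right_mono) auto
    finally show ?thesis
      using logistic_lipschitz order_trans by blast
  qed
  moreover have "\<bar>logistic ((- h - l) / \<delta>) - logistic ((- h' - l') / \<delta>)\<bar> \<le> (\<bar>h - h'\<bar> + \<bar>l - l'\<bar>) / \<delta>"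
  proof -
    have "\<bar>(- h - l) / \<delta> - (- h' - l') / \<delta>\<bar> = \<bar>(- h - l) - (- h' - l')\<bar> / \<delta>"
      using d by (simp add: diff_divide_distrib[symmetric])
    also have "\<dots> \<le> (\<bar>h - h'\<bar> + \<bar>l - l'\<bar>) / \<delta>"
      using d by (intro divide_right_mono) auto
    finally show ?thesis
      using logistic_lipschitz order_trans by blast
  qed
  ultimately show "\<bar>slope \<delta> l h - slope \<delta> l' h'\<bar> \<le> (2 / \<delta>) * (\<bar>h - h'\<bar> + \<bar>l - l'\<bar>)"
    "\<bar>level \<delta> l h - level \<delta> l' h'\<bar> \<le> (2 / \<delta>) * (\<bar>h - h'\<bar> + \<bar>l - l'\<bar>)"
    unfolding slope_def level_def by (simp_all add: add_divide_distrib)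
qed

lemma pot_has_derivative:
  assumes "\<delta> > 0"
  shows "(pot \<delta> l has_real_derivative slope \<delta> l h) (at h)"
proof -
  have 1: "((\<lambda>h. \<delta> * softplus ((h - l) / \<delta>)) has_real_derivative logistic ((h - l) / \<delta>)) (at h)"
    by (rule DERIV_cong[OF DERIV_cmult[OF DERIV_chain2[OF softplus_has_derivative, where g = "\<lambda>h. (h - l) / \<delta>"]]])
       (use assms in \<open>auto intro!: derivative_eq_intros\<close>)
  have 2: "((\<lambda>h. \<delta> * softplus ((- h - l) / \<delta>)) has_real_derivative - logistic ((- h - l) / \<delta>)) (at h)"
    by (rule DERIV_cong[OF DERIV_cmult[OF DERIV_chain2[OF softplus_has_derivative, where g = "\<lambda>h. (- h - l) / \<delta>"]]])
       (use assms in \<open>auto intro!: derivative_eq_intros\<close>)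
  show ?thesis
    using DERIV_add[OF 1 2] by (simp add: pot_def[abs_def] slope_def)
qed

lemma slope_has_derivative:
  assumes "\<delta> > 0"
  obtains D where "\<And>h. (slope \<delta> l has_real_derivative D h) (at h)" "\<And>h. D h \<ge> 0"
proof -
  define D where "D h = logistic ((h - l) / \<delta>) * (1 - logistic ((h - l) / \<delta>)) * (1 / \<delta>) +
    logistic ((- h - l) / \<delta>) * (1 - logistic ((- h - l) / \<delta>)) * (1 / \<delta>)" for h
  have 1: "((\<lambda>h. logistic ((h - l) / \<delta>)) has_real_derivative logistic ((h - l) / \<delta>) * (1 - logistic ((h - l) / \<delta>)) * (1 / \<delta>)) (at h)" for h
    by (rule DERIV_chain2[OF logistic_has_derivative, where g = "\<lambda>h. (h - l) / \<delta>"])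
       (use assms in \<open>auto intro!: derivative_eq_intros\<close>)
  have 2: "((\<lambda>h. logistic ((- h - l) / \<delta>)) has_real_derivative logistic ((- h - l) / \<delta>) * (1 - logistic ((- h - l) / \<delta>)) * (- 1 / \<delta>)) (at h)" for h
    by (rule DERIV_chain2[OF logistic_has_derivative, where g = "\<lambda>h. (- h - l) / \<delta>"])
       (use assms in \<open>auto intro!: derivative_eq_intros\<close>)
  have "(slope \<delta> l has_real_derivative D h) (at h)" for h
    using DERIV_diff[OF 1 2] by (simp add: slope_def[abs_def] D_def)
  moreover have "D h \<ge> 0" for h
    unfolding D_def using assms logistic_bounds less_imp_le by (intro add_nonneg_nonneg mult_nonneg_nonneg) (auto simp: less_imp_le)
  ultimately show ?thesis
    by (rule that)
qed

lemma continuous_slope: "\<delta> > 0 \<Longrightarrow> continuous_on UNIV h \<Longrightarrow> continuous_on UNIV (\<lambda>x. slope \<delta> l (h x))"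
  and continuous_level: "\<delta> > 0 \<Longrightarrow> continuous_on UNIV h \<Longrightarrow> continuous_on UNIV (\<lambda>x. level \<delta> l (h x))"
  and continuous_pot: "\<delta> > 0 \<Longrightarrow> continuous_on UNIV h \<Longrightarrow> continuous_on UNIV (\<lambda>x. pot \<delta> l (h x))"
proof -
  assume d: "\<delta> > 0" and h: "continuous_on UNIV h"
  have L: "continuous_on UNIV logistic" "continuous_on UNIV softplus"
    using logistic_has_derivative softplus_has_derivative
    by (auto simp: continuous_on_eq_continuous_at intro: DERIV_isCont)
  have 1: "continuous_on UNIV (\<lambda>x. (h x - l) / \<delta>)" "continuous_on UNIV (\<lambda>x. (- h x - l) / \<delta>)"
    using d by (intro continuous_intros h; simp)+
  note c = continuous_on_compose2[OF L(1) 1(1) subset_UNIV] continuous_on_compose2[OF L(1) 1(2) subset_UNIV]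
    continuous_on_compose2[OF L(2) 1(1) subset_UNIV] continuous_on_compose2[OF L(2) 1(2) subset_UNIV]
  show "continuous_on UNIV (\<lambda>x. slope \<delta> l (h x))" "continuous_on UNIV (\<lambda>x. level \<delta> l (h x))" "continuous_on UNIV (\<lambda>x. pot \<delta> l (h x))"
    unfolding slope_def level_def pot_def by (intro continuous_intros c)+
qed

lemma test_function_logistic:
  assumes "test_function h"
  shows "test_function (\<lambda>x. logistic (h x))"
proof -
  have "1 + exp (- h x) \<noteq> 0" for x
    by (smt (verit) exp_gt_zero)
  then have "smooth (\<lambda>x. logistic (h x))"
    unfolding logistic_def using assms
    by (intro smooth_inverse smooth_add smooth_const smooth_exp smooth_minus) (auto simp: test_function_def)
  then show ?thesis
    using assms by (simp add: test_function_def periodic_def)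
qed

lemma test_function_slope:
  assumes "test_function h"
  shows "test_function (\<lambda>x. slope \<delta> l (h x))"
proof -
  have "test_function (\<lambda>x. logistic ((1 / \<delta>) * (c * h x - l)))" for c
    by (intro test_function_logistic test_function_mult test_function_const test_function_diff assms)
  from test_function_diff[OF this[of 1] this[of "-1"]] show ?thesis
    by (simp add: slope_def)
qed

lemma test_function_pot:
  assumes "\<delta> > 0" "test_function h"
  shows "test_function (\<lambda>x. pot \<delta> l (h x))"
proof -
  have "smooth (\<lambda>x. pot \<delta> l (h x))"
  proof (rule smoothI)
    show "((\<lambda>x. pot \<delta> l (h x)) has_derivative (\<lambda>v. slope \<delta> l (h x) * frechet_derivative h (at x) v)) (at x)" for x
      using has_derivative_compose[OF smooth_has_derivative[OF test_function_smooth[OF assms(2)], of x]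
          pot_has_derivative[OF assms(1), unfolded has_field_derivative_def]] .
    show "smooth (\<lambda>x. slope \<delta> l (h x) * frechet_derivative h (at x) v)" for v
      using test_function_smooth[OF test_function_slope[OF assms(2)]] test_function_smooth[OF assms(2)]
      by (intro smooth_mult smooth_derivative)
  qed
  then show ?thesis
    using assms by (simp add: test_function_def periodic_def)
qed

text \<open>Transport by a divergence-free field does not change the potential, and diffusion decreases it.\<close>

lemma slope_dissipation:
  assumes d: "\<delta> > 0" and w: "test_function w" and u: "Lp_torus 2 u" "weakly_div_free u" and nu: "\<nu> \<ge> 0"
    and H: "integrable torus_measure H"
  shows "(TINT x. slope \<delta> l (w x) * (H x - (\<Sum>i\<in>UNIV. u x $ i * pderiv_at i w x) + \<nu> * laplacian w x)) \<le>
    (TINT x. slope \<delta> l (w x) * H x)"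
proof -
  define \<phi> where "\<phi> x = slope \<delta> l (w x)" for x
  have \<phi>: "test_function \<phi>"
    unfolding \<phi>_def by (rule test_function_slope[OF w])
  have ws: "smooth w"
    by (rule test_function_smooth[OF w])
  have i1: "integrable torus_measure (\<lambda>x. \<phi> x * H x)"
    using integrable_torus_mult_continuous[OF H test_function_continuous[OF \<phi>]] by (simp add: mult.commute)
  have i2: "integrable torus_measure (\<lambda>x. u x $ i * (\<phi> x * pderiv_at i w x))" for i
    by (intro integrable_torus_mult_continuous L2_integrable(1) L2_components u test_function_continuous
        test_function_mult \<phi> test_function_pderiv w)
  have i2s: "integrable torus_measure (\<lambda>x. \<Sum>i\<in>UNIV. u x $ i * (\<phi> x * pderiv_at i w x))"
    by (intro Bochner_Integration.integrable_sum i2)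
  have i3: "integrable torus_measure (\<lambda>x. \<phi> x * laplacian w x)"
    by (intro integrable_torus_continuous test_function_continuous test_function_mult \<phi> test_function_laplacian w)
  have transport: "(TINT x. (\<Sum>i\<in>UNIV. u x $ i * (\<phi> x * pderiv_at i w x))) = 0"
  proof -
    have "pderiv_at i (\<lambda>x. pot \<delta> l (w x)) x = \<phi> x * pderiv_at i w x" for i x
      unfolding \<phi>_def by (rule pderiv_chain[OF ws pot_has_derivative[OF d]])
    moreover have "(TINT x. (\<Sum>i\<in>UNIV. u x $ i * pderiv_at i (\<lambda>x. pot \<delta> l (w x)) x)) = 0"
      using u(2) test_function_pot[OF d w, of l] unfolding weakly_div_free_def by blast
    ultimately show ?thesis
      by (simp only:)
  qed
  have diffusion: "(TINT x. \<phi> x * laplacian w x) \<le> 0"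
  proof -
    obtain D where D: "\<And>h. (slope \<delta> l has_real_derivative D h) (at h)" "\<And>h. D h \<ge> 0"
      using slope_has_derivative[OF d] by blast
    have dphi: "pderiv_at i \<phi> x = D (w x) * pderiv_at i w x" for i x
      unfolding \<phi>_def[abs_def] by (rule pderiv_chain[OF ws D(1)])
    have "(TINT x. \<phi> x * laplacian w x) = (\<Sum>i\<in>UNIV. TINT x. \<phi> x * pderiv_at i (pderiv_at i w) x)"
      unfolding laplacian_def sum_distrib_left
      by (intro Bochner_Integration.integral_sum integrable_torus_continuous test_function_continuous
          test_function_mult \<phi> test_function_pderiv w)
    also have "\<dots> = (\<Sum>i\<in>UNIV. - (TINT x. pderiv_at i \<phi> x * pderiv_at i w x))"
      by (intro sum.cong refl integral_torus_by_parts \<phi> test_function_pderiv w)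
    also have "\<dots> \<le> 0"
      using D(2) unfolding dphi
      by (intro sum_nonpos) (auto intro!: Bochner_Integration.integral_nonneg simp: mult.assoc)
    finally show ?thesis .
  qed
  have "(TINT x. \<phi> x * (H x - (\<Sum>i\<in>UNIV. u x $ i * pderiv_at i w x) + \<nu> * laplacian w x)) =
      (TINT x. \<phi> x * H x - (\<Sum>i\<in>UNIV. u x $ i * (\<phi> x * pderiv_at i w x)) + \<nu> * (\<phi> x * laplacian w x))"
    by (intro Bochner_Integration.integral_cong) (auto simp: algebra_simps sum_distrib_left)
  also have "\<dots> = (TINT x. \<phi> x * H x) - (TINT x. (\<Sum>i\<in>UNIV. u x $ i * (\<phi> x * pderiv_at i w x))) +
      \<nu> * (TINT x. \<phi> x * laplacian w x)"
    using i1 i2s i3 by simp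
  also have "\<dots> \<le> (TINT x. \<phi> x * H x)"
    using transport mult_nonneg_nonpos[OF nu diffusion] by simp
  finally show ?thesis
    by (simp add: \<phi>_def)
qed

text \<open>The integral of \<open>level\<close> is continuous in \<open>l\<close>.  It equals the measure of the torus at \<open>l = 0\<close> and tends to zero as
  \<open>l\<close> grows.\<close>

lemma threshold_exists:
  assumes d: "\<delta> > 0" and h: "continuous_on UNIV h" and s: "0 < s" "s \<le> measure lebesgue torus"
  obtains l where "l \<ge> 0" "(TINT x. level \<delta> l (h x)) = s"
proof -
  define F where "F l = (TINT x. level \<delta> l (h x))" for l
  have int: "integrable torus_measure (\<lambda>x. level \<delta> l (h x))" for l
    by (intro integrable_torus_continuous continuous_level d h)
  define A where "A = measure lebesgue torus"
  have A: "A > 0"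
    by (simp add: A_def measure_torus)
  have mA: "measure torus_measure torus = A"
    by (simp add: A_def measure_torus measure_torus_measure)
  obtain C where C: "C \<ge> 0" "\<And>x. x \<in> torus \<Longrightarrow> norm (h x) \<le> C"
    using continuous_bounded_torus[OF h] by blast
  \<comment> \<open>With this threshold each of the two exponential tails of \<open>level\<close> is at most \<open>s / (2 A)\<close>.\<close>
  define b where "b = C - \<delta> * ln (s / (2 * A))"
  have "s / (2 * A) \<le> 1"
    using s A by (simp add: A_def)
  then have "ln (s / (2 * A)) \<le> 0"
    using s A by (simp add: ln_le_zero_iff)
  then have b: "b \<ge> 0"
    using C(1) d mult_nonneg_nonpos[of \<delta> "ln (s / (2 * A))"] unfolding b_def by linarith
  have Fb: "F b \<le> s"
  proof -
    have "level \<delta> b (h x) \<le> s / A" if "x \<in> torus" for x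
    proof -
      have le: "logistic ((a - b) / \<delta>) \<le> s / (2 * A)" if "a \<le> C" for a
      proof -
        have "(a - b) / \<delta> \<le> (C - b) / \<delta>"
          using that d by (intro divide_right_mono) auto
        also have "\<dots> = ln (s / (2 * A))"
          using d by (simp add: b_def)
        finally have "logistic ((a - b) / \<delta>) \<le> exp (ln (s / (2 * A)))"
          using logistic_le_exp logistic_mono order_trans by blast
        then show ?thesis
          using s A by simp
      qed
      have "level \<delta> b (h x) \<le> s / (2 * A) + s / (2 * A)"
        unfolding level_def using C(2)[OF that] by (intro add_mono le) auto
      then show ?thesis
        by simp
    qed
    then have "F b \<le> (TINT x. s / A)"
      unfolding F_def by (intro integral_mono int) auto
    then show ?thesis
      using A mA by simp
  qed
  have F0: "F 0 = A"
    using mA by (simp add: F_def level_0)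
  have "((2 / \<delta>) * A)-lipschitz_on {0..b} F"
  proof (rule lipschitz_onI)
    fix l l'
    have "F l - F l' = (TINT x. level \<delta> l (h x) - level \<delta> l' (h x))"
      unfolding F_def using int by simp
    also have "\<bar>\<dots>\<bar> \<le> (TINT x. \<bar>level \<delta> l (h x) - level \<delta> l' (h x)\<bar>)"
      by (rule integral_abs_bound)
    also have "\<dots> \<le> (TINT x. (2 / \<delta>) * \<bar>l - l'\<bar>)"
    proof (intro integral_mono integrable_abs Bochner_Integration.integrable_diff int TM.integrable_const)
      show "\<bar>level \<delta> l (h x) - level \<delta> l' (h x)\<bar> \<le> (2 / \<delta>) * \<bar>l - l'\<bar>" for x
        using level_lipschitz[OF d, of l "h x" l' "h x"] by simp
    qed
    also have "\<dots> = (2 / \<delta>) * A * \<bar>l - l'\<bar>"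
      using mA by simp
    finally show "dist (F l) (F l') \<le> (2 / \<delta>) * A * dist l l'"
      by (simp add: dist_real_def)
  qed (use d A in simp)
  then have "continuous_on {0..b} F"
    by (rule lipschitz_on_continuous_on)
  then obtain l where "0 \<le> l" "F l = s"
    using IVT2'[of F b s 0] Fb F0 s(2) b by (auto simp: A_def)
  then show ?thesis
    using that by (simp add: F_def)
qed

text \<open>Raising the threshold by more than \<open>e\<close> strictly lowers \<open>level\<close> at every point.\<close>

lemma threshold_lipschitz:
  assumes d: "\<delta> > 0" and h: "continuous_on UNIV h" "continuous_on UNIV h'"
    and l: "(TINT x. level \<delta> l (h x)) = s" "(TINT x. level \<delta> l' (h' x)) = s"
    and e: "\<And>x. x \<in> torus \<Longrightarrow> \<bar>h x - h' x\<bar> \<le> e"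
  shows "\<bar>l - l'\<bar> \<le> e"
proof -
  have main: False if h: "continuous_on UNIV h" "continuous_on UNIV h'"
    and l: "(TINT x. level \<delta> l (h x)) = s" "(TINT x. level \<delta> l' (h' x)) = s"
    and e: "\<And>x. x \<in> torus \<Longrightarrow> \<bar>h x - h' x\<bar> \<le> e" and gt: "l' - l > e" for h h' l l'
  proof -
    have "(TINT x. level \<delta> l' (h' x)) < (TINT x. level \<delta> l (h x))"
    proof (rule TM.integral_less_AE_space)
      show "integrable torus_measure (\<lambda>x. level \<delta> l' (h' x))" "integrable torus_measure (\<lambda>x. level \<delta> l (h x))"
        by (intro integrable_torus_continuous continuous_level d h)+
      show "AE x in torus_measure. level \<delta> l' (h' x) < level \<delta> l (h x)"
      proof (rule AE_I2)
        fix x assume "x \<in> space torus_measure"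
        then have "\<bar>h' x - h x\<bar> \<le> e"
          using e[of x] by (simp add: abs_minus_commute)
        then show "level \<delta> l' (h' x) < level \<delta> l (h x)"
          using gt by (intro level_strict_antimono d) linarith
      qed
      show "emeasure torus_measure (space torus_measure) \<noteq> 0"
        using measure_torus_measure by (auto simp: measure_def)
    qed
    then show False
      using l by simp
  qed
  show ?thesis
  proof (rule ccontr)
    assume "\<not> ?thesis"
    then consider "l' - l > e" | "l - l' > e"
      by linarith
    then show False
    proof cases
      case 1
      then show False
        using main[OF h l e] by blast
    next
      case 2
      have "\<bar>h' x - h x\<bar> \<le> e" if "x \<in> torus" for x
        using e[OF that] by (simp add: abs_minus_commute)
      then show False
        using main[OF h(2,1) l(2,1) _ 2] by blast
    qed
  qed
qed

section \<open>Evolution of the maximal vorticity function\<close>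

lemma set_integral_increment:
  fixes f :: "real \<Rightarrow> real"
  assumes f: "set_integrable lebesgue {0..T} f" and t: "0 \<le> t'" "t' \<le> t" "t \<le> T"
  shows "(LINT \<tau>:{0..t}|lebesgue. f \<tau>) = (LINT \<tau>:{0..t'}|lebesgue. f \<tau>) + (LINT \<tau>:{t'<..t}|lebesgue. f \<tau>)"
proof -
  have "{0..t} = {0..t'} \<union> {t'<..t}"
    using t by auto
  moreover have "(LINT \<tau>:{0..t'} \<union> {t'<..t}|lebesgue. f \<tau>) = (LINT \<tau>:{0..t'}|lebesgue. f \<tau>) + (LINT \<tau>:{t'<..t}|lebesgue. f \<tau>)"
    using t by (intro set_integral_Un set_integrable_subset[OF f]) auto
  ultimately show ?thesis
    by simp
qed

lemma continuous_set_integral: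
  fixes f :: "real \<Rightarrow> real"
  assumes f: "set_integrable lebesgue {0..T} f"
  shows "continuous_on {0..T} (\<lambda>t. LINT \<tau>:{0..t}|lebesgue. f \<tau>)"
proof -
  have "continuous_on {0..T} (\<lambda>t. integral {0..t} f)"
    using set_lebesgue_integral_eq_integral(1)[OF f] by (rule indefinite_integral_continuous_1)
  moreover have "(LINT \<tau>:{0..t}|lebesgue. f \<tau>) = integral {0..t} f" if "t \<in> {0..T}" for t
    using that by (intro set_lebesgue_integral_eq_integral(2) set_integrable_subset[OF f]) auto
  ultimately show ?thesis
    by (metis (no_types, lifting) continuous_on_eq)
qed

lemma locally_decreasing:
  fixes W :: "real \<Rightarrow> real"
  assumes d: "d > 0" and W: "\<And>r t. 0 \<le> r \<Longrightarrow> r \<le> t \<Longrightarrow> t \<le> T \<Longrightarrow> t - r < d \<Longrightarrow> W t \<le> W r"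
    and t: "0 \<le> t" "t \<le> T"
  shows "W t \<le> W 0"
proof -
  obtain n :: nat where n: "t / d < real n"
    using reals_Archimedean2 by blast
  then have n0: "real n > 0"
    using d t by (smt (verit) divide_nonneg_pos)
  have "W (real k * (t / real n)) \<le> W 0" if "k \<le> n" for k
    using that
  proof (induction k)
    case (Suc k)
    have le: "real (Suc k) * (t / real n) \<le> t"
      using Suc.prems n0 t mult_right_mono[of "real (Suc k)" "real n" "t / real n"] by simp
    have "W (real (Suc k) * (t / real n)) \<le> W (real k * (t / real n))"
    proof (rule W)
      have "0 \<le> t / real n"
        using t n0 by simp
      then show "0 \<le> real k * (t / real n)" "real k * (t / real n) \<le> real (Suc k) * (t / real n)"
        by (auto intro!: mult_right_mono simp del: times_divide_eq_right)
      show "real (Suc k) * (t / real n) \<le> T"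
        using le t by linarith
      have "t / real n < d"
        using n n0 d by (simp add: field_simps)
      moreover have "real (Suc k) * (t / real n) - real k * (t / real n) = t / real n"
        by (simp add: distrib_right del: times_divide_eq_right)
      ultimately show "real (Suc k) * (t / real n) - real k * (t / real n) < d"
        by (simp only:)
    qed
    then show ?case
      using Suc by simp
  qed simp
  from this[of n] show ?thesis
    using n0 by simp
qed

text \<open>An increment inequality with coefficients frozen at the right end point integrates, without any
  differentiability in time: on a fine mesh the coefficients are almost constant.\<close>

lemma frozen_increments:
  fixes V :: "real \<Rightarrow> real" and P b :: "'j \<Rightarrow> real \<Rightarrow> real"
  assumes J: "finite J" and P: "\<And>j. j \<in> J \<Longrightarrow> continuous_on {0..T} (P j)"
    and b: "\<And>j. j \<in> J \<Longrightarrow> set_integrable lebesgue {0..T} (b j)"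
    and V: "\<And>r t. 0 \<le> r \<Longrightarrow> r \<le> t \<Longrightarrow> t \<le> T \<Longrightarrow> V t - V r \<le> (\<Sum>j\<in>J. P j t * (LINT \<tau>:{r<..t}|lebesgue. b j \<tau>))"
    and t: "0 \<le> t" "t \<le> T"
  shows "set_integrable lebesgue {0..T} (\<lambda>\<tau>. \<Sum>j\<in>J. P j \<tau> * b j \<tau>)"
    and "V t - V 0 \<le> (LINT \<tau>:{0..t}|lebesgue. \<Sum>j\<in>J. P j \<tau> * b j \<tau>)"
proof -
  have Pb: "set_integrable lebesgue {0..T} (\<lambda>\<tau>. P j \<tau> * b j \<tau>)" if "j \<in> J" for j
  proof (rule absolutely_integrable_bounded_measurable_product_real)
    show "P j \<in> borel_measurable (lebesgue_on {0..T})"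
      by (intro continuous_imp_measurable_on_sets_lebesgue P that) simp
    show "bounded (P j ` {0..T})"
      by (intro compact_imp_bounded compact_continuous_image P that) simp
  qed (use b that in auto)
  show sum: "set_integrable lebesgue {0..T} (\<lambda>\<tau>. \<Sum>j\<in>J. P j \<tau> * b j \<tau>)"
    using Pb unfolding set_integrable_def scaleR_sum_right by (intro Bochner_Integration.integrable_sum)
  define I where "I r = (LINT \<tau>:{0..r}|lebesgue. \<Sum>j\<in>J. P j \<tau> * b j \<tau>)" for r
  define B where "B r = (\<Sum>j\<in>J. LINT \<tau>:{0..r}|lebesgue. \<bar>b j \<tau>\<bar>)" for r
  have abs: "set_integrable lebesgue {0..T} (\<lambda>\<tau>. \<bar>b j \<tau>\<bar>)" if "j \<in> J" for j
    using b[OF that] by (rule set_integrable_abs)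
  have B_nonneg: "B r \<ge> 0" for r
    unfolding B_def set_lebesgue_integral_def by (intro sum_nonneg Bochner_Integration.integral_nonneg) simp
  have I0: "I 0 = 0" and B0: "B 0 = 0"
  proof -
    have "(LINT \<tau>:{0..0}|lebesgue. f \<tau>) = 0" for f :: "real \<Rightarrow> real"
      unfolding set_lebesgue_integral_def
      by (intro integral_eq_zero_AE AE_I'[of "{0}"]) (auto simp: indicator_def)
    then show "I 0 = 0" "B 0 = 0"
      unfolding I_def B_def by auto
  qed
  have main: "V t - I t - e * B t \<le> V 0" if e: "e > 0" for e
  proof -
    have "\<exists>d>0. \<forall>r\<in>{0..T}. \<forall>t\<in>{0..T}. dist t r < d \<longrightarrow> dist (P j t) (P j r) < e" if "j \<in> J" for j
      using compact_uniformly_continuous[OF P[OF that] compact_Icc] e unfolding uniformly_continuous_on_def by blast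
    then obtain d0 where d0: "\<And>j. j \<in> J \<Longrightarrow> d0 j > 0"
      "\<And>j r t. j \<in> J \<Longrightarrow> r \<in> {0..T} \<Longrightarrow> t \<in> {0..T} \<Longrightarrow> dist t r < d0 j \<Longrightarrow> dist (P j t) (P j r) < e"
      by metis
    define d where "d = Min (insert 1 (d0 ` J))"
    have d: "d > 0" "\<And>j. j \<in> J \<Longrightarrow> d \<le> d0 j"
      using J d0(1) by (auto simp: d_def)
    define W where "W r = V r - I r - e * B r" for r
    have "W t \<le> W 0"
    proof (rule locally_decreasing[OF d(1) _ t])
      fix r t assume rt: "0 \<le> r" "r \<le> t" "t \<le> T" "t - r < d"
      have sub: "{r<..t} \<subseteq> {0..T}"
        using rt by auto
      have int: "set_integrable lebesgue {r<..t} (\<lambda>\<tau>. P j \<tau> * b j \<tau>)" "set_integrable lebesgue {r<..t} (b j)"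
        "set_integrable lebesgue {r<..t} (\<lambda>\<tau>. \<bar>b j \<tau>\<bar>)" if "j \<in> J" for j
        by (intro set_integrable_subset[OF Pb[OF that]] set_integrable_subset[OF b[OF that]] set_integrable_subset[OF abs[OF that]] sub; simp)+
      have each: "P j t * (LINT \<tau>:{r<..t}|lebesgue. b j \<tau>) \<le>
          (LINT \<tau>:{r<..t}|lebesgue. P j \<tau> * b j \<tau>) + e * (LINT \<tau>:{r<..t}|lebesgue. \<bar>b j \<tau>\<bar>)" if j: "j \<in> J" for j
      proof -
        have "P j t * (LINT \<tau>:{r<..t}|lebesgue. b j \<tau>) = (LINT \<tau>:{r<..t}|lebesgue. P j t * b j \<tau>)"
          by simp
        also have "\<dots> \<le> (LINT \<tau>:{r<..t}|lebesgue. P j \<tau> * b j \<tau> + e * \<bar>b j \<tau>\<bar>)"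
        proof (rule set_integral_mono)
          show "set_integrable lebesgue {r<..t} (\<lambda>\<tau>. P j t * b j \<tau>)"
            using int(2)[OF j] by (rule set_integrable_mult_right)
          show "set_integrable lebesgue {r<..t} (\<lambda>\<tau>. P j \<tau> * b j \<tau> + e * \<bar>b j \<tau>\<bar>)"
            using int(1,3)[OF j] by (intro set_integral_add(1) set_integrable_mult_right)
          fix \<tau> assume \<tau>: "\<tau> \<in> {r<..t}"
          have "dist (P j t) (P j \<tau>) < e"
            using \<tau> rt d(2)[OF j] by (intro d0(2)[OF j]) (auto simp: dist_real_def)
          then have "(P j t - P j \<tau>) * b j \<tau> \<le> e * \<bar>b j \<tau>\<bar>"
            using abs_ge_self[of "(P j t - P j \<tau>) * b j \<tau>"] mult_right_mono[of "\<bar>P j t - P j \<tau>\<bar>" e "\<bar>b j \<tau>\<bar>"]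
            by (simp add: dist_real_def abs_mult)
          then show "P j t * b j \<tau> \<le> P j \<tau> * b j \<tau> + e * \<bar>b j \<tau>\<bar>"
            by (simp add: left_diff_distrib)
        qed
        also have "\<dots> = (LINT \<tau>:{r<..t}|lebesgue. P j \<tau> * b j \<tau>) + e * (LINT \<tau>:{r<..t}|lebesgue. \<bar>b j \<tau>\<bar>)"
          using int(1,3)[OF j] by (subst set_integral_add(2)) (auto intro: set_integrable_mult_right)
        finally show ?thesis .
      qed
      have "V t - V r \<le> (\<Sum>j\<in>J. (LINT \<tau>:{r<..t}|lebesgue. P j \<tau> * b j \<tau>) + e * (LINT \<tau>:{r<..t}|lebesgue. \<bar>b j \<tau>\<bar>))"
        by (rule order_trans[OF V[OF rt(1-3)] sum_mono[OF each]])
      also have "\<dots> = (LINT \<tau>:{r<..t}|lebesgue. \<Sum>j\<in>J. P j \<tau> * b j \<tau>) + e * (\<Sum>j\<in>J. LINT \<tau>:{r<..t}|lebesgue. \<bar>b j \<tau>\<bar>)"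
      proof -
        have "(LINT \<tau>:{r<..t}|lebesgue. \<Sum>j\<in>J. P j \<tau> * b j \<tau>) = (\<Sum>j\<in>J. LINT \<tau>:{r<..t}|lebesgue. P j \<tau> * b j \<tau>)"
          unfolding set_lebesgue_integral_def scaleR_sum_right
          using int(1) by (intro Bochner_Integration.integral_sum) (auto simp: set_integrable_def)
        then show ?thesis
          by (simp add: sum.distrib sum_distrib_left)
      qed
      also have "(LINT \<tau>:{r<..t}|lebesgue. \<Sum>j\<in>J. P j \<tau> * b j \<tau>) = I t - I r"
        using set_integral_increment[OF sum rt(1-3)] by (simp add: I_def)
      also have "(\<Sum>j\<in>J. LINT \<tau>:{r<..t}|lebesgue. \<bar>b j \<tau>\<bar>) = B t - B r"
      proof -
        have "B t = (\<Sum>j\<in>J. (LINT \<tau>:{0..r}|lebesgue. \<bar>b j \<tau>\<bar>) + (LINT \<tau>:{r<..t}|lebesgue. \<bar>b j \<tau>\<bar>))"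
          unfolding B_def by (intro sum.cong refl set_integral_increment[OF abs rt(1-3)])
        then show ?thesis
          by (simp add: B_def sum.distrib)
      qed
      finally show "W t \<le> W r"
        by (simp add: W_def algebra_simps)
    qed
    then show ?thesis
      by (simp add: W_def I0 B0)
  qed
  show "V t - V 0 \<le> (LINT \<tau>:{0..t}|lebesgue. \<Sum>j\<in>J. P j \<tau> * b j \<tau>)"
  proof (rule field_le_epsilon)
    fix e :: real assume e: "e > 0"
    define c where "c = e / (B t + 1)"
    have "c > 0" "c * B t \<le> e"
      using e B_nonneg[of t] by (auto simp: c_def field_simps)
    then show "V t - V 0 \<le> (LINT \<tau>:{0..t}|lebesgue. \<Sum>j\<in>J. P j \<tau> * b j \<tau>) + e"
      using main[of c] by (simp add: I_def)
  qed
qed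

text \<open>The smoothed maximal vorticity is a minimum over thresholds of convex integral functionals.  Its increments
  are therefore bounded by the slope at the later time, whose threshold depends continuously on time.\<close>

lemma maximal_vorticity_evolution:
  fixes a b :: "'j \<Rightarrow> real \<Rightarrow> real" and B :: "'j \<Rightarrow> real^2 \<Rightarrow> real" and m :: "real \<Rightarrow> real"
    and J :: "'j set"
  defines "w \<equiv> \<lambda>t y. \<Sum>j\<in>J. a j t * B j y"
  assumes J: "finite J" and B: "\<And>j. j \<in> J \<Longrightarrow> test_function (B j)"
    and b: "\<And>j. j \<in> J \<Longrightarrow> set_integrable lebesgue {0..T} (b j)"
    and a: "\<And>j t. j \<in> J \<Longrightarrow> t \<in> {0..T} \<Longrightarrow> a j t = a j 0 + (LINT \<tau>:{0..t}|lebesgue. b j \<tau>)"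
    and s: "0 < s" "s \<le> measure lebesgue torus"
    and m: "set_integrable lebesgue {0..T} m"
    and diss: "AE \<tau> in lebesgue. \<tau> \<in> {0<..<T} \<longrightarrow> (\<forall>\<delta>>0. \<forall>l. (TINT y. level \<delta> l (w \<tau> y)) = s \<longrightarrow>
        (TINT y. slope \<delta> l (w \<tau> y) * (\<Sum>j\<in>J. b j \<tau> * B j y)) \<le> m \<tau>)"
    and t: "t \<in> {0..T}"
  shows "maximal_vorticity s (w t) \<le> maximal_vorticity s (w 0) + (LINT \<tau>:{0..t}|lebesgue. m \<tau>)"
proof -
  have T: "0 \<le> T"
    using t by auto
  have Bc: "continuous_on UNIV (B j)" if "j \<in> J" for j
    by (intro test_function_continuous B that)
  have wc: "continuous_on UNIV (w t)" for t
    unfolding w_def by (intro continuous_intros Bc)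
  have wi: "integrable torus_measure (w t)" for t
    by (intro integrable_torus_continuous wc)
  have "\<exists>C\<ge>0. \<forall>x\<in>torus. \<bar>B j x\<bar> \<le> C" if "j \<in> J" for j
    using continuous_bounded_torus[OF Bc[OF that]] by (metis real_norm_def)
  then obtain C where C: "\<And>j. j \<in> J \<Longrightarrow> C j \<ge> 0" "\<And>j x. j \<in> J \<Longrightarrow> x \<in> torus \<Longrightarrow> \<bar>B j x\<bar> \<le> C j"
    by metis
  define E where "E t r = (\<Sum>j\<in>J. \<bar>a j t - a j r\<bar> * C j)" for t r
  have wE: "\<bar>w t x - w r x\<bar> \<le> E t r" if "x \<in> torus" for t r x
  proof -
    have "\<bar>w t x - w r x\<bar> = \<bar>\<Sum>j\<in>J. (a j t - a j r) * B j x\<bar>"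
      by (simp add: w_def sum_subtractf left_diff_distrib)
    also have "\<dots> \<le> (\<Sum>j\<in>J. \<bar>(a j t - a j r) * B j x\<bar>)"
      by (rule sum_abs)
    also have "\<dots> \<le> E t r"
      unfolding E_def using C(2) that by (intro sum_mono) (auto simp: abs_mult intro!: mult_left_mono)
    finally show ?thesis .
  qed
  have ac: "continuous_on {0..T} (a j)" if "j \<in> J" for j
  proof -
    have "continuous_on {0..T} (\<lambda>t. a j 0 + (LINT \<tau>:{0..t}|lebesgue. b j \<tau>))"
      by (intro continuous_intros continuous_set_integral b that)
    then show ?thesis
      by (rule continuous_on_eq) (rule a[OF that, symmetric])
  qed
  have bound: "maximal_vorticity s (w t) \<le> maximal_vorticity s (w 0) + (LINT \<tau>:{0..t}|lebesgue. m \<tau>) +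
      2 * (\<delta> * ln 2) * measure lebesgue torus" if d: "\<delta> > 0" for \<delta>
  proof -
    have "\<exists>l. l \<ge> 0 \<and> (TINT x. level \<delta> l (w \<tau> x)) = s" for \<tau>
      using threshold_exists[OF d wc s] by metis
    then obtain l where l: "\<And>\<tau>. l \<tau> \<ge> 0" "\<And>\<tau>. (TINT x. level \<delta> (l \<tau>) (w \<tau> x)) = s"
      by metis
    have lE: "\<bar>l t - l r\<bar> \<le> E t r" for t r
      by (rule threshold_lipschitz[OF d wc wc l(2) l(2) wE])
    \<comment> \<open>The smoothed maximal vorticity, and the pairings of its slope with the functions \<open>B j\<close>.\<close>
    define V where "V \<tau> = l \<tau> * s + (TINT x. pot \<delta> (l \<tau>) (w \<tau> x))" for \<tau>
    define P where "P j \<tau> = (TINT x. slope \<delta> (l \<tau>) (w \<tau> x) * B j x)" for j \<tau>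
    have ip: "integrable torus_measure (\<lambda>x. pot \<delta> k (w \<tau> x))" "integrable torus_measure (\<lambda>x. level \<delta> k (w \<tau> x))" for k \<tau>
      by (intro integrable_torus_continuous continuous_pot continuous_level d wc)+
    have sB: "integrable torus_measure (\<lambda>x. slope \<delta> k (w \<tau> x) * B j x)" if "j \<in> J" for k \<tau> j
      by (intro integrable_torus_continuous continuous_intros continuous_slope d wc Bc that)
    have sw: "integrable torus_measure (\<lambda>x. slope \<delta> k (w \<tau> x) * (w r x - w \<tau> x))" for k \<tau> r
      by (intro integrable_torus_continuous continuous_intros continuous_slope d wc)
    \<comment> \<open>By convexity; the choice of the threshold cancels the terms that are linear in \<open>k - l \<tau>\<close>.\<close>
    have tangent: "l \<tau> * s + (TINT x. pot \<delta> (l \<tau>) (w \<tau> x)) +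
        (TINT x. slope \<delta> (l \<tau>) (w \<tau> x) * (w r x - w \<tau> x)) \<le> k * s + (TINT x. pot \<delta> k (w r x))" for \<tau> r k
    proof -
      have "(TINT x. pot \<delta> (l \<tau>) (w \<tau> x) + slope \<delta> (l \<tau>) (w \<tau> x) * (w r x - w \<tau> x)
          - level \<delta> (l \<tau>) (w \<tau> x) * (k - l \<tau>)) \<le> (TINT x. pot \<delta> k (w r x))"
        by (intro integral_mono pot_tangent d ip Bochner_Integration.integrable_add Bochner_Integration.integrable_diff
            integrable_mult_left sw)
      also have "(TINT x. pot \<delta> (l \<tau>) (w \<tau> x) + slope \<delta> (l \<tau>) (w \<tau> x) * (w r x - w \<tau> x)
          - level \<delta> (l \<tau>) (w \<tau> x) * (k - l \<tau>)) = (TINT x. pot \<delta> (l \<tau>) (w \<tau> x)) +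
          (TINT x. slope \<delta> (l \<tau>) (w \<tau> x) * (w r x - w \<tau> x)) - s * (k - l \<tau>)"
        using ip sw l(2) by simp
      finally show ?thesis
        by (simp add: algebra_simps)
    qed
    have incr: "V t - V r \<le> (\<Sum>j\<in>J. P j t * (LINT \<tau>:{r<..t}|lebesgue. b j \<tau>))" if rt: "0 \<le> r" "r \<le> t" "t \<le> T" for r t
    proof -
      have aj: "a j t - a j r = (LINT \<tau>:{r<..t}|lebesgue. b j \<tau>)" if "j \<in> J" for j
        using set_integral_increment[OF b[OF that] rt] a[OF that, of t] a[OF that, of r] rt by simp
      have "(TINT x. slope \<delta> (l t) (w t x) * (w r x - w t x)) = - (\<Sum>j\<in>J. P j t * (a j t - a j r))"
      proof -
        have "(\<lambda>x. slope \<delta> (l t) (w t x) * (w r x - w t x)) = (\<lambda>x. \<Sum>j\<in>J. slope \<delta> (l t) (w t x) * B j x * (a j r - a j t))"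
          by (auto simp: fun_eq_iff w_def sum_subtractf[symmetric] sum_distrib_left algebra_simps intro!: sum.cong)
        then have "(TINT x. slope \<delta> (l t) (w t x) * (w r x - w t x)) =
            (\<Sum>j\<in>J. TINT x. slope \<delta> (l t) (w t x) * B j x * (a j r - a j t))"
          using sB by (simp add: Bochner_Integration.integral_sum)
        also have "\<dots> = (\<Sum>j\<in>J. P j t * (a j r - a j t))"
          by (simp add: P_def)
        also have "\<dots> = - (\<Sum>j\<in>J. P j t * (a j t - a j r))"
          by (simp add: sum_negf[symmetric] algebra_simps)
        finally show ?thesis .
      qed
      then have "V t - V r \<le> (\<Sum>j\<in>J. P j t * (a j t - a j r))"
        using tangent[of t r "l r"] unfolding V_def by linarith
      then show ?thesis
        using aj by simp
    qed
    have Pc: "continuous_on {0..T} (P j)" if j: "j \<in> J" for j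
    proof -
      have lip: "\<bar>P j t - P j r\<bar> \<le> (2 / \<delta>) * (2 * E t r) * (C j * (2 * pi)\<^sup>2)" for t r
      proof -
        have "P j t - P j r = (TINT x. slope \<delta> (l t) (w t x) * B j x - slope \<delta> (l r) (w r x) * B j x)"
          unfolding P_def using sB[OF j] by simp
        then have "\<bar>P j t - P j r\<bar> \<le> (TINT x. \<bar>slope \<delta> (l t) (w t x) * B j x - slope \<delta> (l r) (w r x) * B j x\<bar>)"
          by (simp only: integral_abs_bound)
        also have "\<dots> \<le> (TINT x. (2 / \<delta>) * (2 * E t r) * C j)"
        proof (rule integral_mono)
          show "integrable torus_measure (\<lambda>x. \<bar>slope \<delta> (l t) (w t x) * B j x - slope \<delta> (l r) (w r x) * B j x\<bar>)"
          proof -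
            have "integrable torus_measure (\<lambda>x. slope \<delta> (l t) (w t x) * B j x)"
              "integrable torus_measure (\<lambda>x. slope \<delta> (l r) (w r x) * B j x)"
              using sB[OF j] by blast+
            then show ?thesis
              by simp
          qed
          show "integrable torus_measure (\<lambda>x. (2 / \<delta>) * (2 * E t r) * C j)"
            by (rule TM.integrable_const)
          fix x assume "x \<in> space torus_measure"
          then have x: "x \<in> torus" by simp
          have "\<bar>slope \<delta> (l t) (w t x) - slope \<delta> (l r) (w r x)\<bar> \<le> (2 / \<delta>) * (\<bar>w t x - w r x\<bar> + \<bar>l t - l r\<bar>)"
            by (rule slope_lipschitz[OF d])
          also have "\<dots> \<le> (2 / \<delta>) * (2 * E t r)"
            using wE[OF x, of t r] lE[of t r] d by (intro mult_left_mono) auto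
          finally have "\<bar>slope \<delta> (l t) (w t x) - slope \<delta> (l r) (w r x)\<bar> * \<bar>B j x\<bar> \<le> (2 / \<delta>) * (2 * E t r) * C j"
            using C(2)[OF j x] C(1)[OF j] by (intro mult_mono) auto
          then show "\<bar>slope \<delta> (l t) (w t x) * B j x - slope \<delta> (l r) (w r x) * B j x\<bar> \<le> (2 / \<delta>) * (2 * E t r) * C j"
            by (simp add: left_diff_distrib[symmetric] abs_mult)
        qed
        also have "\<dots> = (2 / \<delta>) * (2 * E t r) * (C j * (2 * pi)\<^sup>2)"
          using measure_torus_measure by simp
        finally show ?thesis .
      qed
      have "(P j \<longlongrightarrow> P j r) (at r within {0..T})" if r: "r \<in> {0..T}" for r
      proof -
        have "((\<lambda>t. (2 / \<delta>) * (2 * E t r) * (C j * (2 * pi)\<^sup>2)) \<longlongrightarrow> (2 / \<delta>) * (2 * (\<Sum>i\<in>J. \<bar>a i r - a i r\<bar> * C i)) * (C j * (2 * pi)\<^sup>2)) (at r within {0..T})"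
          unfolding E_def using ac r by (intro tendsto_intros) (auto simp: continuous_on_def)
        then have "((\<lambda>t. (2 / \<delta>) * (2 * E t r) * (C j * (2 * pi)\<^sup>2)) \<longlongrightarrow> 0) (at r within {0..T})"
          by simp
        then have "((\<lambda>t. P j t - P j r) \<longlongrightarrow> 0) (at r within {0..T})"
          by (rule Lim_null_comparison[rotated]) (use lip in simp)
        then show ?thesis
          by (rule LIM_zero_cancel)
      qed
      then show ?thesis
        by (simp add: continuous_on_def)
    qed
    have t': "0 \<le> t" "t \<le> T"
      using t by auto
    have frozen: "set_integrable lebesgue {0..T} (\<lambda>\<tau>. \<Sum>j\<in>J. P j \<tau> * b j \<tau>)"
      "V t - V 0 \<le> (LINT \<tau>:{0..t}|lebesgue. \<Sum>j\<in>J. P j \<tau> * b j \<tau>)"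
      by (rule frozen_increments[OF J, where V = V and T = T and P = P and b = b]; (rule Pc b incr t'; assumption)?; rule t')+
    have "V t - V 0 \<le> (LINT \<tau>:{0..t}|lebesgue. \<Sum>j\<in>J. P j \<tau> * b j \<tau>)"
      by (rule frozen(2))
    also have "\<dots> \<le> (LINT \<tau>:{0..t}|lebesgue. m \<tau>)"
    proof (rule set_integral_mono_AE)
      show "set_integrable lebesgue {0..t} (\<lambda>\<tau>. \<Sum>j\<in>J. P j \<tau> * b j \<tau>)"
        using t' by (intro set_integrable_subset[OF frozen(1)]) auto
      show "set_integrable lebesgue {0..t} m"
        using t' by (intro set_integrable_subset[OF m]) auto
      have "AE \<tau> in lebesgue. \<tau> \<notin> {0, T}"
        by (intro AE_not_in) (simp add: negligible_iff_null_sets[symmetric] negligible_finite)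
      with diss show "AE \<tau>\<in>{0..t} in lebesgue. (\<Sum>j\<in>J. P j \<tau> * b j \<tau>) \<le> m \<tau>"
      proof eventually_elim
        case (elim \<tau>)
        show ?case
        proof
          assume "\<tau> \<in> {0..t}"
          then have "\<tau> \<in> {0<..<T}"
            using elim(2) t' by auto
          then have "(TINT y. slope \<delta> (l \<tau>) (w \<tau> y) * (\<Sum>j\<in>J. b j \<tau> * B j y)) \<le> m \<tau>"
            using elim(1) d l(2)[of \<tau>] by blast
          moreover have "(TINT y. slope \<delta> (l \<tau>) (w \<tau> y) * (\<Sum>j\<in>J. b j \<tau> * B j y)) = (\<Sum>j\<in>J. P j \<tau> * b j \<tau>)"
          proof -
            have "(\<lambda>y. slope \<delta> (l \<tau>) (w \<tau> y) * (\<Sum>j\<in>J. b j \<tau> * B j y)) = (\<lambda>y. \<Sum>j\<in>J. slope \<delta> (l \<tau>) (w \<tau> y) * B j y * b j \<tau>)"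
              by (auto simp: fun_eq_iff sum_distrib_left mult_ac)
            then have "(TINT y. slope \<delta> (l \<tau>) (w \<tau> y) * (\<Sum>j\<in>J. b j \<tau> * B j y)) =
                (\<Sum>j\<in>J. TINT y. slope \<delta> (l \<tau>) (w \<tau> y) * B j y * b j \<tau>)"
              using sB by (simp add: Bochner_Integration.integral_sum)
            then show ?thesis
              by (simp add: P_def)
          qed
          ultimately show "(\<Sum>j\<in>J. P j \<tau> * b j \<tau>) \<le> m \<tau>"
            by simp
        qed
      qed
    qed
    finally have VV: "V t \<le> V 0 + (LINT \<tau>:{0..t}|lebesgue. m \<tau>)"
      by simp
    have low: "maximal_vorticity s (w t) \<le> V t"
    proof -
      have "(TINT x. max 0 (\<bar>w t x\<bar> - l t)) \<le> (TINT x. pot \<delta> (l t) (w t x))"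
        by (intro integral_mono positive_part_integrable wi ip pot_bounds(1) d)
      then show ?thesis
        using maximal_vorticity_le[OF wi less_imp_le[OF s(1)] s(2), of t "l t"] unfolding V_def by linarith
    qed
    have up: "V 0 \<le> maximal_vorticity s (w 0) + 2 * (\<delta> * ln 2) * measure lebesgue torus"
    proof -
      obtain k where k: "k \<ge> 0" "maximal_vorticity s (w 0) = k * s + (TINT x. max 0 (\<bar>w 0 x\<bar> - k))"
        using maximal_vorticity_attained[OF wi s] by blast
      have "V 0 \<le> k * s + (TINT x. pot \<delta> k (w 0 x))"
        using tangent[of 0 0 k] by (simp add: V_def)
      also have "(TINT x. pot \<delta> k (w 0 x)) \<le> (TINT x. max 0 (\<bar>w 0 x\<bar> - k) + 2 * (\<delta> * ln 2))"
        by (intro integral_mono ip Bochner_Integration.integrable_add positive_part_integrable wi pot_bounds(2) d k TM.integrable_const)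
      also have "\<dots> = (TINT x. max 0 (\<bar>w 0 x\<bar> - k)) + 2 * (\<delta> * ln 2) * measure lebesgue torus"
        using positive_part_integrable[OF wi] measure_torus_measure measure_torus by simp
      finally show ?thesis
        using k(2) by simp
    qed
    show ?thesis
      using VV low up by linarith
  qed
  show ?thesis
  proof (rule field_le_epsilon)
    fix e :: real assume e: "e > 0"
    define c where "c = 2 * ln 2 * measure lebesgue torus"
    have c: "c > 0"
      by (simp add: c_def measure_torus)
    show "maximal_vorticity s (w t) \<le> maximal_vorticity s (w 0) + (LINT \<tau>:{0..t}|lebesgue. m \<tau>) + e"
    proof -
      have "2 * (e / c * ln 2) * measure lebesgue torus = (e / c) * c"
        unfolding c_def by (simp only: mult_ac)
      also have "\<dots> = e"
        using c by simp
      finally show ?thesis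
        using bound[of "e / c"] e c by simp
    qed
  qed
qed

section \<open>The Navier-Stokes equations tested in space\<close>

abbreviation time_measure :: "real \<Rightarrow> real measure" where
  "time_measure T \<equiv> lebesgue_on {0<..<T}"

lemma interval_sets: "{0<..<T::real} \<in> sets borel" "{0<..<T::real} \<in> sets lebesgue"
  by auto

interpretation time: finite_measure "time_measure T" for T
  by (rule finite_measure_lebesgue_on) simp

lemma time_integrable_iff: "integrable (time_measure T) f \<longleftrightarrow> set_integrable lebesgue {0..T} (f :: real \<Rightarrow> real)"
proof -
  have "integrable (time_measure T) f \<longleftrightarrow> set_integrable lebesgue {0<..<T} f"
    unfolding set_integrable_def by (subst integrable_restrict_space) auto
  also have "\<dots> \<longleftrightarrow> set_integrable lebesgue {0..T} f"
    by (rule set_integrable_discrete_difference[where X = "{0, T}"]) auto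
  finally show ?thesis .
qed

lemma time_integral: "(LINT t|time_measure T. f t) = (LINT t:{0..T}|lebesgue. (f t :: real))"
proof -
  have "(LINT t|time_measure T. f t) = (LINT t:{0<..<T}|lebesgue. f t)"
    unfolding set_lebesgue_integral_def by (subst integral_restrict_space) auto
  also have "\<dots> = (LINT t:{0..T}|lebesgue. f t)"
    by (rule set_integral_discrete_difference[where X = "{0, T}"]) auto
  finally show ?thesis .
qed

lemma time_AE_iff: "(AE t in time_measure T. P t) \<longleftrightarrow> (AE t in lebesgue. t \<in> {0<..<T} \<longrightarrow> P t)"
  by (rule AE_restrict_space_iff) simp

lemma Lp_norm_power: "p > 0 \<Longrightarrow> Lp_norm p h ^ p = (TINT x. norm (h x) ^ p)"
  unfolding Lp_norm_def by (intro real_root_pow_pos2 Bochner_Integration.integral_nonneg) auto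

lemma Lp_norm_nonneg: "p > 0 \<Longrightarrow> 0 \<le> Lp_norm p h"
  unfolding Lp_norm_def by (intro real_root_ge_zero Bochner_Integration.integral_nonneg) auto

text \<open>The inequality \<open>\<bar>h\<bar> \<le> h\<^sup>2 / r + r\<close>, with \<open>r\<close> the norm of \<open>h\<close>, keeps the bound linear in the norm; this matters because
  the force is only integrable in time with values in \<open>L\<^sup>2\<close>.\<close>

lemma L1_le_Lp_norm_2:
  fixes h :: "real^2 \<Rightarrow> 'b::euclidean_space"
  assumes h: "Lp_torus 2 h"
  shows "integrable torus_measure (\<lambda>x. norm (h x))"
    and "(TINT x. norm (h x)) \<le> ((2 * pi)\<^sup>2 + 1) * Lp_norm 2 h"
proof -
  have L: "Lp_torus 2 (\<lambda>x. norm (h x))"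
    using h by (auto simp: Lp_torus_def intro: borel_measurable_norm)
  show i: "integrable torus_measure (\<lambda>x. norm (h x))"
    by (rule L2_integrable(1)[OF L])
  define r where "r = Lp_norm 2 h"
  have r: "r \<ge> 0" "r\<^sup>2 = (TINT x. (norm (h x))\<^sup>2)"
    unfolding r_def using Lp_norm_nonneg[of 2 h] Lp_norm_power[of 2 h] by auto
  show "(TINT x. norm (h x)) \<le> ((2 * pi)\<^sup>2 + 1) * Lp_norm 2 h"
  proof (cases "r = 0")
    case True
    then have "(TINT x. (norm (h x))\<^sup>2) = 0"
      using r(2) by simp
    then have "AE x in torus_measure. (norm (h x))\<^sup>2 = 0"
      using L2_integrable(2)[OF L] by (subst (asm) integral_nonneg_eq_0_iff_AE) auto
    then have "(TINT x. norm (h x)) = 0"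
      by (intro integral_eq_zero_AE) auto
    then show ?thesis
      using r(1) by (simp add: r_def)
  next
    case False
    then have "r > 0"
      using r by simp
    then have "(TINT x. \<bar>norm (h x) * 1\<bar>) \<le>
        (1 / r) * (TINT x. (norm (h x))\<^sup>2) + (1 / (1 / r)) * (TINT x. 1\<^sup>2)"
      by (intro L2_mult(2)[OF L test_function_L2[OF test_function_const]]) auto
    also have "\<dots> = ((2 * pi)\<^sup>2 + 1) * r"
      using False measure_torus_measure unfolding r(2)[symmetric] by (simp add: power2_eq_square field_simps)
    finally show ?thesis
      by (simp add: r_def)
  qed
qed

lemma Lq_Lp_measurable:
  assumes "Lq_Lp q p T v"
  shows "(\<lambda>z. v (fst z) (snd z)) \<in> borel_measurable (spacetime_measure T)"
  using assms by (simp add: Lq_Lp_def case_prod_beta')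

lemma spacetime_snd_measurable:
  fixes \<psi> :: "real^2 \<Rightarrow> real"
  assumes "continuous_on UNIV \<psi>"
  shows "(\<lambda>z. \<psi> (snd z)) \<in> borel_measurable (spacetime_measure T)"
proof (rule continuous_imp_measurable_on_sets_lebesgue)
  show "continuous_on ({0<..<T} \<times> torus) (\<lambda>z. \<psi> (snd z))"
    by (intro continuous_on_compose2[OF assms] continuous_intros) auto
  show "{0<..<T} \<times> torus \<in> sets lebesgue"
    using borel_Times[OF interval_sets(1) torus_borel] by auto
qed

lemma spacetime_fst_measurable:
  assumes "b \<in> borel_measurable (time_measure T)"
  shows "(\<lambda>z. b (fst z) :: real) \<in> borel_measurable (spacetime_measure T)"
  by (rule measurable_fst_lebesgue_on_Times[OF interval_sets(1) torus_borel assms])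

lemma spacetime_mult_integrable:
  fixes h k :: "real \<times> (real^2) \<Rightarrow> real"
  assumes "integrable (spacetime_measure T) h" "k \<in> borel_measurable (spacetime_measure T)"
    "\<And>z. z \<in> {0<..<T} \<times> torus \<Longrightarrow> \<bar>k z\<bar> \<le> C"
  shows "integrable (spacetime_measure T) (\<lambda>z. h z * k z)"
proof (rule Bochner_Integration.integrable_bound)
  show "integrable (spacetime_measure T) (\<lambda>z. \<bar>C\<bar> * h z)"
    using assms(1) by simp
  show "AE z in spacetime_measure T. norm (h z * k z) \<le> norm (\<bar>C\<bar> * h z)"
  proof (rule AE_I2)
    fix z assume "z \<in> space (spacetime_measure T)"
    then have "\<bar>k z\<bar> \<le> \<bar>C\<bar>"
      using assms(3)[of z] by auto
    then show "norm (h z * k z) \<le> norm (\<bar>C\<bar> * h z)"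
      using mult_right_mono[of "\<bar>k z\<bar>" "\<bar>C\<bar>" "\<bar>h z\<bar>"] by (simp add: abs_mult mult.commute)
  qed
qed (use assms in simp)

lemma Lp_Lp_integrable:
  fixes v :: "real \<Rightarrow> real^2 \<Rightarrow> 'b::euclidean_space"
  assumes v: "Lq_Lp p p T v" and p: "p > 0"
  shows "integrable (spacetime_measure T) (\<lambda>z. norm (v (fst z) (snd z)) ^ p)"
proof (rule integrable_lebesgue_on_Times[OF interval_sets(1) torus_borel])
  show "(\<lambda>z. norm (v (fst z) (snd z)) ^ p) \<in> borel_measurable (spacetime_measure T)"
    by (rule borel_measurable_power[OF measurable_compose[OF Lq_Lp_measurable[OF v] borel_measurable_norm]])
  show "integrable (time_measure T) (\<lambda>t. Lp_norm p (v t) ^ p)"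
    using v by (simp add: Lq_Lp_def)
  have "AE t in time_measure T. Lp_torus p (v t)"
    using v by (simp add: Lq_Lp_def)
  then show "AE t in time_measure T. integrable torus_measure (\<lambda>x. norm (v (fst (t, x)) (snd (t, x))) ^ p) \<and>
      (TINT x. \<bar>norm (v (fst (t, x)) (snd (t, x))) ^ p\<bar>) \<le> Lp_norm p (v t) ^ p"
    by eventually_elim (use p in \<open>simp add: Lp_torus_def Lp_norm_power\<close>)
qed

lemma L1_L2_integrable:
  fixes v :: "real \<Rightarrow> real^2 \<Rightarrow> 'b::euclidean_space"
  assumes v: "Lq_Lp 1 2 T v"
  shows "integrable (spacetime_measure T) (\<lambda>z. norm (v (fst z) (snd z)))"
proof (rule integrable_lebesgue_on_Times[OF interval_sets(1) torus_borel])
  show "(\<lambda>z. norm (v (fst z) (snd z))) \<in> borel_measurable (spacetime_measure T)"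
    by (rule measurable_compose[OF Lq_Lp_measurable[OF v] borel_measurable_norm])
  show "integrable (time_measure T) (\<lambda>t. ((2 * pi)\<^sup>2 + 1) * Lp_norm 2 (v t))"
    using v by (simp add: Lq_Lp_def)
  have "AE t in time_measure T. Lp_torus 2 (v t)"
    using v by (simp add: Lq_Lp_def)
  then show "AE t in time_measure T. integrable torus_measure (\<lambda>x. norm (v (fst (t, x)) (snd (t, x)))) \<and>
      (TINT x. \<bar>norm (v (fst (t, x)) (snd (t, x)))\<bar>) \<le> ((2 * pi)\<^sup>2 + 1) * Lp_norm 2 (v t)"
    by eventually_elim (simp only: fst_conv snd_conv abs_norm_cancel, intro conjI L1_le_Lp_norm_2)
qed

lemma spacetime_dominated:
  fixes h :: "real \<times> (real^2) \<Rightarrow> real"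
  assumes "integrable (spacetime_measure T) g" "h \<in> borel_measurable (spacetime_measure T)" "\<And>z. \<bar>h z\<bar> \<le> g z"
  shows "integrable (spacetime_measure T) h"
proof (rule Bochner_Integration.integrable_bound[OF assms(1,2)])
  show "AE z in spacetime_measure T. norm (h z) \<le> norm (g z)"
  proof (rule AE_I2)
    show "norm (h z) \<le> norm (g z)" for z
      using assms(3)[of z] by simp
  qed
qed

lemma spacetime_const_integrable: "integrable (spacetime_measure T) (\<lambda>z. c :: real)"
proof (rule integrable_lebesgue_on_Times[OF interval_sets(1) torus_borel])
  show "integrable (time_measure T) (\<lambda>t. (TINT x. \<bar>c\<bar>))"
    by (rule time.integrable_const)
qed (auto intro: TM.integrable_const)

lemma velocity_integrable:
  fixes u :: "real \<Rightarrow> real^2 \<Rightarrow> real^2"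
  assumes u: "Lq_Lp 2 2 T u"
  shows "integrable (spacetime_measure T) (\<lambda>z. u (fst z) (snd z) $ i)"
    and "integrable (spacetime_measure T) (\<lambda>z. u (fst z) (snd z) $ i * u (fst z) (snd z) $ j)"
proof -
  have m: "(\<lambda>z. u (fst z) (snd z) $ i) \<in> borel_measurable (spacetime_measure T)" for i
    by (rule vec_nth_measurable[OF Lq_Lp_measurable[OF u]])
  have i: "integrable (spacetime_measure T) (\<lambda>z. (norm (u (fst z) (snd z)))\<^sup>2)"
    by (rule Lp_Lp_integrable[OF u]) simp
  have le: "\<bar>v $ i\<bar> \<le> norm v" for v :: "real^2" and i
    by (rule component_le_norm_cart)
  show "integrable (spacetime_measure T) (\<lambda>z. u (fst z) (snd z) $ i)"
  proof (rule spacetime_dominated[OF _ m])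
    show "integrable (spacetime_measure T) (\<lambda>z. 1 + (norm (u (fst z) (snd z)))\<^sup>2)"
      by (intro Bochner_Integration.integrable_add spacetime_const_integrable i)
    have "a \<le> 1 + a\<^sup>2" for a :: real
      using zero_le_power2[of "2 * a - 1"] by (simp add: power2_eq_square algebra_simps)
    then show "\<bar>u (fst z) (snd z) $ i\<bar> \<le> 1 + (norm (u (fst z) (snd z)))\<^sup>2" for z
      by (rule order_trans[OF le])
  qed
  show "integrable (spacetime_measure T) (\<lambda>z. u (fst z) (snd z) $ i * u (fst z) (snd z) $ j)"
  proof (rule spacetime_dominated[OF i])
    show "\<bar>u (fst z) (snd z) $ i * u (fst z) (snd z) $ j\<bar> \<le> (norm (u (fst z) (snd z)))\<^sup>2" for z
      unfolding abs_mult power2_eq_square by (intro mult_mono le) auto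
  qed (intro borel_measurable_times m)
qed

lemma force_integrable:
  fixes f :: "real \<Rightarrow> real^2 \<Rightarrow> real^2"
  assumes f: "Lq_Lp 1 2 T f"
  shows "integrable (spacetime_measure T) (\<lambda>z. f (fst z) (snd z) $ i)"
proof (rule spacetime_dominated[OF L1_L2_integrable[OF f]])
  show "(\<lambda>z. f (fst z) (snd z) $ i) \<in> borel_measurable (spacetime_measure T)"
    by (rule vec_nth_measurable[OF Lq_Lp_measurable[OF f]])
qed (rule component_le_norm_cart)

lemma spacetime_mult_test:
  assumes "integrable (spacetime_measure T) h" "test_function \<phi>"
  shows "integrable (spacetime_measure T) (\<lambda>z. h z * \<phi> (snd z))"
proof -
  have c: "continuous_on UNIV \<phi>"
    by (rule test_function_continuous[OF assms(2)])
  obtain C where "C \<ge> 0" "\<And>x. x \<in> torus \<Longrightarrow> norm (\<phi> x) \<le> C"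
    using continuous_bounded_torus[OF c] by blast
  then show ?thesis
    by (intro spacetime_mult_integrable[OF assms(1) spacetime_snd_measurable[OF c], of C]) auto
qed

text \<open>The spatial part of the weak formulation, tested against the field with stream function \<open>\<phi>\<close>.\<close>

definition flux :: "real \<Rightarrow> (real^2 \<Rightarrow> real^2) \<Rightarrow> (real^2 \<Rightarrow> real^2) \<Rightarrow> (real^2 \<Rightarrow> real) \<Rightarrow> real^2 \<Rightarrow> real" where
  "flux \<nu> u f \<phi> x = (\<Sum>i\<in>UNIV. u x $ i * (u x \<bullet> pderiv_at i (perp_grad \<phi>) x)) +
     \<nu> * (u x \<bullet> laplacian (perp_grad \<phi>) x) + f x \<bullet> perp_grad \<phi> x"

lemma flux_integrable:
  assumes u: "Lq_Lp 2 2 T u" and f: "Lq_Lp 1 2 T f" and \<phi>: "test_function \<phi>"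
  shows "integrable (spacetime_measure T) (\<lambda>z. flux \<nu> (u (fst z)) (f (fst z)) \<phi> (snd z))"
    and "integrable (spacetime_measure T) (\<lambda>z. u (fst z) (snd z) \<bullet> perp_grad \<phi> (snd z))"
proof -
  have s: "smooth \<phi>"
    by (rule test_function_smooth[OF \<phi>])
  have perp: "integrable (spacetime_measure T) (\<lambda>z. v (fst z) (snd z) \<bullet> perp_grad \<eta> (snd z))"
    if "\<And>i. integrable (spacetime_measure T) (\<lambda>z. v (fst z) (snd z) $ i)" "test_function \<eta>" for v \<eta>
    unfolding inner_perp_grad
    by (intro Bochner_Integration.integrable_diff spacetime_mult_test that test_function_pderiv)
  show "integrable (spacetime_measure T) (\<lambda>z. u (fst z) (snd z) \<bullet> perp_grad \<phi> (snd z))"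
    by (intro perp velocity_integrable u \<phi>)
  have "integrable (spacetime_measure T) (\<lambda>z. u (fst z) (snd z) $ i * (u (fst z) (snd z) \<bullet> pderiv_at i (perp_grad \<phi>) (snd z)))" for i
    unfolding pderiv_perp_grad[OF s] inner_perp_grad right_diff_distrib mult.assoc[symmetric]
    by (intro Bochner_Integration.integrable_diff spacetime_mult_test velocity_integrable u test_function_pderiv \<phi>)
  moreover have "integrable (spacetime_measure T) (\<lambda>z. \<nu> * (u (fst z) (snd z) \<bullet> laplacian (perp_grad \<phi>) (snd z)))"
    unfolding laplacian_perp_grad[OF s]
    by (intro integrable_mult_right perp velocity_integrable u test_function_laplacian \<phi>)
  moreover have "integrable (spacetime_measure T) (\<lambda>z. f (fst z) (snd z) \<bullet> perp_grad \<phi> (snd z))"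
    by (intro perp force_integrable f \<phi>)
  ultimately show "integrable (spacetime_measure T) (\<lambda>z. flux \<nu> (u (fst z)) (f (fst z)) \<phi> (snd z))"
    unfolding flux_def by (intro Bochner_Integration.integrable_add Bochner_Integration.integrable_sum)
qed

lemma ns_test_field_product:
  assumes c: "\<And>h :: real \<times> (real^2) \<Rightarrow> real. smooth h \<Longrightarrow> smooth (\<lambda>z. c (h z))"
    and z: "t0 < T" "\<And>t. t \<ge> t0 \<Longrightarrow> c t = 0" and \<phi>: "test_function \<phi>"
  shows "ns_test_field T (\<lambda>t x. c t *\<^sub>R perp_grad \<phi> x)"
  unfolding ns_test_field_def
proof (intro conjI allI)
  have s: "smooth \<phi>"
    by (rule test_function_smooth[OF \<phi>])
  have "smooth (\<lambda>z::real \<times> (real^2). c (fst z) *\<^sub>R perp_grad \<phi> (snd z))"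
    by (rule smooth_scaleR[OF c[OF smooth_linear[OF bounded_linear_fst]]
          smooth_compose_linear[OF smooth_perp_grad[OF s] bounded_linear_snd]])
  then show "smooth (\<lambda>(t, x). c t *\<^sub>R perp_grad \<phi> x)"
    by (simp add: case_prod_beta')
  show "periodic (\<lambda>x. c t *\<^sub>R perp_grad \<phi> x)" for t
    using periodic_perp_grad[OF \<phi>] by (simp add: periodic_def)
  show "(\<Sum>i\<in>UNIV. pderiv_at i (\<lambda>x. c t *\<^sub>R perp_grad \<phi> x) x $ i) = 0" for t x
  proof -
    have "pderiv_at i (\<lambda>x. c t *\<^sub>R perp_grad \<phi> x) x = c t *\<^sub>R perp_grad (pderiv_at i \<phi>) x" for i
      by (simp add: pderiv_scaleR[OF smooth_const smooth_perp_grad[OF s]] pderiv_const pderiv_perp_grad[OF s])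
    then show ?thesis
      using pderiv_commute[OF s, of 1 2 x] by (simp add: UNIV_2 perp_grad_nth)
  qed
  show "\<exists>T'<T. \<forall>t\<ge>T'. \<forall>x. c t *\<^sub>R perp_grad \<phi> x = 0"
    using z by (intro exI[of _ t0]) simp
qed

lemma perp_grad_Lp: "test_function \<phi> \<Longrightarrow> Lp_torus 2 (perp_grad \<phi>)"
proof -
  assume "test_function \<phi>"
  then have c: "continuous_on UNIV (perp_grad \<phi>)"
    by (intro smooth_continuous smooth_perp_grad test_function_smooth)
  have "integrable torus_measure (\<lambda>x. (norm (perp_grad \<phi> x))\<^sup>2)"
    by (intro integrable_torus_continuous continuous_intros c)
  then show ?thesis
    using continuous_measurable_torus[OF c] by (simp add: Lp_torus_def)
qed

text \<open>With \<open>t \<mapsto> c t\<close> times the field with stream function \<open>\<phi>\<close> as test field, the weak formulation becomes an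
  identity on the time axis.\<close>

lemma navier_stokes_time_identity:
  assumes ns: "navier_stokes_solution \<nu> T u0 f u" and f: "Lq_Lp 1 2 T f" and \<phi>: "test_function \<phi>"
    and c: "\<And>h :: real \<times> (real^2) \<Rightarrow> real. smooth h \<Longrightarrow> smooth (\<lambda>z. c (h z))"
    and c': "\<And>t. (c has_real_derivative c' t) (at t)" "continuous_on UNIV c'"
    and z: "t0 < T" "\<And>t. t \<ge> t0 \<Longrightarrow> c t = 0"
    and bd: "\<And>t. \<bar>c t\<bar> \<le> 1" "\<And>t. \<bar>c' t\<bar> \<le> C"
  shows "(LINT t|time_measure T. c' t * (TINT x. u t x \<bullet> perp_grad \<phi> x)) +
    (LINT t|time_measure T. c t * (TINT x. flux \<nu> (u t) (f t) \<phi> x)) +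
    c 0 * (TINT x. u0 x \<bullet> perp_grad \<phi> x) = 0"
proof -
  have s: "smooth \<phi>"
    by (rule test_function_smooth[OF \<phi>])
  have u: "Lq_Lp 2 2 T u"
    using ns by (simp add: navier_stokes_solution_def L2_H1_def)
  define A where "A z = u (fst z) (snd z) \<bullet> perp_grad \<phi> (snd z)" for z
  define B where "B z = flux \<nu> (u (fst z)) (f (fst z)) \<phi> (snd z)" for z
  have AB: "integrable (spacetime_measure T) A" "integrable (spacetime_measure T) B"
    unfolding A_def B_def by (rule flux_integrable(2)[OF u f \<phi>], rule flux_integrable(1)[OF u f \<phi>])
  have cc: "continuous_on UNIV c"
    using c'(1) by (auto simp: continuous_on_eq_continuous_at intro: DERIV_isCont)
  have tm: "(\<lambda>z. k (fst z)) \<in> borel_measurable (spacetime_measure T)" if "continuous_on UNIV k" for k :: "real \<Rightarrow> real"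
    using that by (intro spacetime_fst_measurable continuous_imp_measurable_on_sets_lebesgue) (auto intro: continuous_on_subset)
  have i: "integrable (spacetime_measure T) (\<lambda>z. A z * c' (fst z))" "integrable (spacetime_measure T) (\<lambda>z. B z * c (fst z))"
    by (rule spacetime_mult_integrable[OF AB(1) tm[OF c'(2)]], rule bd,
        rule spacetime_mult_integrable[OF AB(2) tm[OF cc]], rule bd)
  note fub = integral_lebesgue_on_Times[OF interval_sets(1) torus_borel]
  have "(LINT z|spacetime_measure T. (case z of (t, x) \<Rightarrow>
            u t x \<bullet> vector_derivative (\<lambda>r. c r *\<^sub>R perp_grad \<phi> x) (at t)
          + (\<Sum>i\<in>UNIV. u t x $ i * (u t x \<bullet> pderiv_at i (\<lambda>x. c t *\<^sub>R perp_grad \<phi> x) x))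
          + \<nu> * (u t x \<bullet> laplacian (\<lambda>x. c t *\<^sub>R perp_grad \<phi> x) x)
          + f t x \<bullet> (c t *\<^sub>R perp_grad \<phi> x)))
        + (TINT x. u0 x \<bullet> (c 0 *\<^sub>R perp_grad \<phi> x)) = 0"
    using ns unfolding navier_stokes_solution_def
    by (elim conjE) (drule spec[of _ "\<lambda>t x. c t *\<^sub>R perp_grad \<phi> x"], erule mp, rule ns_test_field_product[OF c z \<phi>])
  moreover have "(\<lambda>z. case z of (t, x) \<Rightarrow>
            u t x \<bullet> vector_derivative (\<lambda>r. c r *\<^sub>R perp_grad \<phi> x) (at t)
          + (\<Sum>i\<in>UNIV. u t x $ i * (u t x \<bullet> pderiv_at i (\<lambda>x. c t *\<^sub>R perp_grad \<phi> x) x))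
          + \<nu> * (u t x \<bullet> laplacian (\<lambda>x. c t *\<^sub>R perp_grad \<phi> x) x)
          + f t x \<bullet> (c t *\<^sub>R perp_grad \<phi> x)) = (\<lambda>z. A z * c' (fst z) + B z * c (fst z))"
  proof
    fix z :: "real \<times> (real^2)"
    obtain t x where z: "z = (t, x)" by (cases z)
    have vd: "vector_derivative (\<lambda>r. c r *\<^sub>R perp_grad \<phi> x) (at t) = c' t *\<^sub>R perp_grad \<phi> x"
      using c'(1)[of t] by (intro vector_derivative_at) (auto intro!: derivative_eq_intros)
    have pd: "pderiv_at i (\<lambda>x. c t *\<^sub>R perp_grad \<eta> x) x = c t *\<^sub>R pderiv_at i (perp_grad \<eta>) x" if "smooth \<eta>" for i \<eta> x
      by (simp add: pderiv_scaleR[OF smooth_const smooth_perp_grad[OF that]] pderiv_const)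
    have lap: "laplacian (\<lambda>x. c t *\<^sub>R perp_grad \<phi> x) x = c t *\<^sub>R laplacian (perp_grad \<phi>) x"
    proof -
      have 1: "pderiv_at i (\<lambda>x. c t *\<^sub>R perp_grad \<phi> x) = (\<lambda>x. c t *\<^sub>R perp_grad (pderiv_at i \<phi>) x)" for i
        by (intro ext) (simp only: pd[OF s] pderiv_perp_grad[OF s])
      have 2: "pderiv_at i (perp_grad \<phi>) = perp_grad (pderiv_at i \<phi>)" for i
        by (intro ext) (rule pderiv_perp_grad[OF s])
      show ?thesis
        unfolding laplacian_def 1 2 pd[OF smooth_pderiv[OF s]] by (simp add: scaleR_sum_right)
    qed
    show "(case z of (t, x) \<Rightarrow>
            u t x \<bullet> vector_derivative (\<lambda>r. c r *\<^sub>R perp_grad \<phi> x) (at t)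
          + (\<Sum>i\<in>UNIV. u t x $ i * (u t x \<bullet> pderiv_at i (\<lambda>x. c t *\<^sub>R perp_grad \<phi> x) x))
          + \<nu> * (u t x \<bullet> laplacian (\<lambda>x. c t *\<^sub>R perp_grad \<phi> x) x)
          + f t x \<bullet> (c t *\<^sub>R perp_grad \<phi> x)) = A z * c' (fst z) + B z * c (fst z)"
      unfolding z A_def B_def flux_def by (simp add: vd pd[OF s] lap UNIV_2 algebra_simps)
  qed
  ultimately have "(LINT z|spacetime_measure T. A z * c' (fst z) + B z * c (fst z)) + c 0 * (TINT x. u0 x \<bullet> perp_grad \<phi> x) = 0"
    by simp
  then have "(LINT z|spacetime_measure T. A z * c' (fst z)) + (LINT z|spacetime_measure T. B z * c (fst z)) +
      c 0 * (TINT x. u0 x \<bullet> perp_grad \<phi> x) = 0"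
    using i by simp
  then show ?thesis
    unfolding fub(3)[OF i(1)] fub(3)[OF i(2)] by (simp add: A_def B_def mult.commute)
qed

text \<open>Letting the cut-off in time approach the indicator function of \<open>[0, t)\<close> yields the equation in integrated form.\<close>

lemma navier_stokes_integrated_interior:
  assumes T: "T > 0" and ns: "navier_stokes_solution \<nu> T u0 f u" and wc: "weakly_continuous_L2 T u"
    and f: "Lq_Lp 1 2 T f" and \<phi>: "test_function \<phi>" and t0: "t0 \<in> {0<..<T}"
  shows "(TINT x. u t0 x \<bullet> perp_grad \<phi> x) = (TINT x. u0 x \<bullet> perp_grad \<phi> x) +
    (LINT t:{0..t0}|lebesgue. TINT x. flux \<nu> (u t) (f t) \<phi> x)"
proof -
  have u: "Lq_Lp 2 2 T u"
    using ns by (simp add: navier_stokes_solution_def L2_H1_def)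
  define a where "a t = (TINT x. u t x \<bullet> perp_grad \<phi> x)" for t
  define b where "b t = (TINT x. flux \<nu> (u t) (f t) \<phi> x)" for t
  define a0 where "a0 = (TINT x. u0 x \<bullet> perp_grad \<phi> x)"
  have ac: "continuous_on {0..T} a"
    using wc perp_grad_Lp[OF \<phi>] unfolding weakly_continuous_L2_def a_def by blast
  have bi: "integrable (time_measure T) b"
    using integral_lebesgue_on_Times(2)[OF interval_sets(1) torus_borel flux_integrable(1)[OF u f \<phi>]]
    unfolding b_def by simp
  obtain S \<eta> where S: "\<And>x. (S has_real_derivative - \<eta> x) (at x)"
    "continuous_on UNIV \<eta>" "\<And>x. \<eta> x \<ge> 0" "\<And>x. x \<notin> {-1<..<0} \<Longrightarrow> \<eta> x = 0"
    "\<And>x. x \<le> -1 \<Longrightarrow> S x = 1" "\<And>x. x \<ge> 0 \<Longrightarrow> S x = 0"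
    "\<And>h :: real \<times> (real^2) \<Rightarrow> real. smooth h \<Longrightarrow> smooth (\<lambda>z. S (h z))"
    by (rule smooth_step_exists) (rule that)
  have S_anti: "S y \<le> S x" if "x \<le> y" for x y
  proof (rule DERIV_nonpos_imp_nonincreasing[OF that])
    fix z
    show "\<exists>l. (S has_real_derivative l) (at z) \<and> l \<le> 0"
      using S(1,3)[of z] by (intro exI[of _ "- \<eta> z"]) simp
  qed
  have S01: "0 \<le> S x" "S x \<le> 1" for x
    using S_anti[of x "max x 0"] S(6)[of "max x 0"] S_anti[of "min x (-1)" x] S(5)[of "min x (-1)"] by auto
  have "compact (\<eta> ` {-1..0})"
    using S(2) by (intro compact_continuous_image) (auto intro: continuous_on_subset)
  then obtain M where M: "\<forall>x\<in>{-1..0}. \<bar>\<eta> x\<bar> \<le> M"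
    using compact_imp_bounded[of "\<eta> ` {-1..0}"] unfolding bounded_iff by (auto simp: image_iff)
  have M0: "M \<ge> 0"
    using bspec[OF M, of 0] by auto
  have etaM: "\<bar>\<eta> x\<bar> \<le> M" for x
    using bspec[OF M, of x] S(4)[of x] M0 by (cases "x \<in> {-1<..<0}") auto
  \<comment> \<open>The cut-off drops from one to zero on \<open>[t0 - 1/n, t0]\<close>, and its derivative is minus a mollifier \<open>e n\<close>
    concentrated to the left of \<open>t0\<close>.\<close>
  define c where "c n t = S (real n * (t - t0))" for n t
  define e where "e n t = real n * \<eta> (real n * (t - t0))" for n t
  have c_deriv: "(c n has_real_derivative - e n t) (at t)" for n t
  proof -
    have "((\<lambda>t. real n * (t - t0)) has_real_derivative real n) (at t)"
      by (auto intro!: derivative_eq_intros)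
    from DERIV_chain2[where f = S, OF S(1) this] show ?thesis
      by (simp add: c_def[abs_def] e_def mult.commute)
  qed
  have e_cont: "continuous_on UNIV (e n)" for n
    unfolding e_def by (intro continuous_intros continuous_on_compose2[OF S(2)]) auto
  have id: "(LINT t|time_measure T. - e n t * a t) + (LINT t|time_measure T. c n t * b t) + c n 0 * a0 = 0" for n
    unfolding a_def b_def a0_def
  proof (rule navier_stokes_time_identity[OF ns f \<phi>, where ?t0.0 = t0 and C = "real n * M"])
    show "smooth (\<lambda>z. c n (h z))" if "smooth h" for h :: "real \<times> (real^2) \<Rightarrow> real"
      unfolding c_def by (intro S(7) smooth_mult smooth_const smooth_diff that)
    show "continuous_on UNIV (\<lambda>t. - e n t)"
      by (intro continuous_intros e_cont)
    show "c n t = 0" if "t \<ge> t0" for t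
      unfolding c_def using that by (intro S(6)) simp
    show "\<bar>c n t\<bar> \<le> 1" for t
      using S01[of "real n * (t - t0)"] by (simp add: c_def)
    show "\<bar>- e n t\<bar> \<le> real n * M" for t
      using mult_left_mono[OF etaM[of "real n * (t - t0)"], of "real n"] by (simp add: e_def abs_mult)
  qed (use t0 c_deriv in auto)
  have e_nonneg: "e n t \<ge> 0" for n t
    using S(3) by (simp add: e_def)
  have small: "\<forall>\<^sub>F n in sequentially. 1 / real n < r" if "r > 0" for r
    using order_tendstoD(2)[OF lim_inverse_n that] by (simp add: inverse_eq_divide)
  have t0pos: "t0 > 0"
    using t0 by simp
  have cn0: "\<forall>\<^sub>F n in sequentially. c n 0 = 1"
    using small[OF t0pos] eventually_gt_at_top[of 0]
  proof eventually_elim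
    case (elim n)
    then have "real n * (0 - t0) \<le> -1"
      by (simp add: field_simps)
    then show ?case
      unfolding c_def by (rule S(5))
  qed
  have e_mass: "(LINT t|time_measure T. e n t) = c n 0" for n
  proof -
    have ai: "set_integrable lebesgue {0..T} (e n)"
      by (intro absolutely_integrable_continuous_real continuous_on_subset[OF e_cont]) simp
    have "((\<lambda>t. - e n t) has_integral c n T - c n 0) {0..T}"
      using T c_deriv
      by (intro fundamental_theorem_of_calculus)
         (auto simp: has_real_derivative_iff_has_vector_derivative[symmetric] intro: DERIV_subset)
    moreover have "c n T = 0"
      unfolding c_def using t0 by (intro S(6)) simp
    ultimately have "(e n has_integral c n 0) {0..T}"
      using has_integral_neg[of "\<lambda>t. - e n t" "- c n 0" "{0..T}"] by simp
    then show ?thesis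
      unfolding time_integral set_lebesgue_integral_eq_integral(2)[OF ai] by (rule integral_unique)
  qed
  have am: "a \<in> borel_measurable (time_measure T)"
    using ac by (intro continuous_imp_measurable_on_sets_lebesgue) (auto intro: continuous_on_subset)
  have em: "k \<in> borel_measurable (time_measure T)" if "continuous_on UNIV k" for k :: "real \<Rightarrow> real"
    using that by (intro continuous_imp_measurable_on_sets_lebesgue) (auto intro: continuous_on_subset)
  obtain Ca where Ca: "\<forall>t\<in>{0..T}. \<bar>a t\<bar> \<le> Ca"
    using compact_imp_bounded[OF compact_continuous_image[OF ac compact_Icc]] unfolding bounded_iff by auto
  have e_int: "integrable (time_measure T) (e n)" for n
    unfolding time_integrable_iff by (intro absolutely_integrable_continuous_real continuous_on_subset[OF e_cont]) simp
  have ea_int: "integrable (time_measure T) (\<lambda>t. e n t * a t)" for n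
  proof (rule Bochner_Integration.integrable_bound)
    show "integrable (time_measure T) (\<lambda>t. \<bar>Ca\<bar> * e n t)"
      using e_int by simp
    show "(\<lambda>t. e n t * a t) \<in> borel_measurable (time_measure T)"
      by (intro borel_measurable_times em e_cont am)
    show "AE t in time_measure T. norm (e n t * a t) \<le> norm (\<bar>Ca\<bar> * e n t)"
    proof (rule AE_I2)
      fix t assume "t \<in> space (time_measure T)"
      then have "\<bar>a t\<bar> \<le> \<bar>Ca\<bar>"
        using bspec[OF Ca, of t] by auto
      then show "norm (e n t * a t) \<le> norm (\<bar>Ca\<bar> * e n t)"
        using mult_right_mono[of "\<bar>a t\<bar>" "\<bar>Ca\<bar>" "\<bar>e n t\<bar>"] by (simp add: abs_mult mult.commute)
    qed
  qed
  have X: "(\<lambda>n. LINT t|time_measure T. - e n t * a t) \<longlonglongrightarrow> - a t0"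
  proof (rule LIMSEQ_I)
    fix r :: real assume r: "r > 0"
    have "continuous (at t0 within {0..T}) a"
      using ac t0 by (auto simp: continuous_on_eq_continuous_within)
    then obtain d where d: "d > 0" "\<And>t. t \<in> {0..T} \<Longrightarrow> dist t t0 < d \<Longrightarrow> dist (a t) (a t0) < r / 2"
      using r unfolding continuous_within_eps_delta by (meson half_gt_zero)
    have "\<forall>\<^sub>F n in sequentially. norm ((LINT t|time_measure T. - e n t * a t) - - a t0) < r"
      using small[OF d(1)] cn0 eventually_gt_at_top[of 0]
    proof eventually_elim
      case (elim n)
      have "(LINT t|time_measure T. - e n t * a t) - - a t0 = (LINT t|time_measure T. e n t * (a t0 - a t))"
        using e_int[of n] ea_int[of n] e_mass[of n] elim(2) by (simp add: right_diff_distrib)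
      also have "norm \<dots> \<le> (LINT t|time_measure T. norm (e n t * (a t0 - a t)))"
        by (rule integral_norm_bound)
      also have "\<dots> \<le> (LINT t|time_measure T. e n t * (r / 2))"
      proof (rule integral_mono)
        show "integrable (time_measure T) (\<lambda>t. norm (e n t * (a t0 - a t)))"
          using e_int[of n] ea_int[of n] by (simp add: right_diff_distrib)
        show "integrable (time_measure T) (\<lambda>t. e n t * (r / 2))"
          using e_int[of n] by simp
        fix t assume t: "t \<in> space (time_measure T)"
        show "norm (e n t * (a t0 - a t)) \<le> e n t * (r / 2)"
        proof (cases "real n * (t - t0) \<in> {-1<..<0}")
          case True
          then have "dist t t0 < 1 / real n"
            using elim(3) by (auto simp: dist_real_def abs_if field_simps)
          then have "dist (a t) (a t0) < r / 2"
            using elim(1) t by (intro d(2)) auto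
          then show ?thesis
            using mult_left_mono[of "dist (a t) (a t0)" "r / 2" "e n t"] e_nonneg[of n t]
            by (simp add: abs_mult dist_real_def abs_minus_commute)
        next
          case False
          then show ?thesis
            by (simp add: e_def S(4))
        qed
      qed
      also have "\<dots> = r / 2"
        using e_mass[of n] elim(2) by simp
      finally show ?case
        using r by simp
    qed
    then show "\<exists>N. \<forall>n\<ge>N. norm ((LINT t|time_measure T. - e n t * a t) - - a t0) < r"
      by (simp add: eventually_sequentially)
  qed
  have Y: "(\<lambda>n. LINT t|time_measure T. c n t * b t) \<longlonglongrightarrow> (LINT t|time_measure T. indicator {..<t0} t * b t)"
  proof (rule integral_dominated_convergence[where w = "\<lambda>t. \<bar>b t\<bar>"])
    have bm: "b \<in> borel_measurable (time_measure T)"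
      using bi by simp
    have cc: "continuous_on UNIV (c n)" for n
      using c_deriv by (auto simp: continuous_on_eq_continuous_at intro: DERIV_isCont)
    show "(\<lambda>t. c n t * b t) \<in> borel_measurable (time_measure T)" for n
      by (intro borel_measurable_times em cc bm)
    have "(\<lambda>t. indicator {..<t0} t :: real) \<in> borel_measurable (time_measure T)"
      by (intro measurable_restrict_space1 borel_measurable_indicator) auto
    then show "(\<lambda>t. indicator {..<t0} t * b t) \<in> borel_measurable (time_measure T)"
      using bm by (rule borel_measurable_times)
    show "integrable (time_measure T) (\<lambda>t. \<bar>b t\<bar>)"
      using bi by simp
    show "AE t in time_measure T. (\<lambda>n. c n t * b t) \<longlonglongrightarrow> indicator {..<t0} t * b t"
    proof (rule AE_I2)
      fix t
      have "\<forall>\<^sub>F n in sequentially. c n t = indicator {..<t0} t"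
      proof (cases "t < t0")
        case True
        then have "t0 - t > 0" by simp
        from small[OF this] show ?thesis
          using eventually_gt_at_top[of 0]
        proof eventually_elim
          case (elim n)
          then have "real n * (t - t0) \<le> -1"
            by (simp add: field_simps)
          then show ?case
            using True S(5) by (simp add: c_def)
        qed
      next
        case False
        then show ?thesis
          using S(6) by (simp add: c_def)
      qed
      then show "(\<lambda>n. c n t * b t) \<longlonglongrightarrow> indicator {..<t0} t * b t"
        by (intro tendsto_mult tendsto_eventually tendsto_const)
    qed
    show "AE t in time_measure T. norm (c n t * b t) \<le> \<bar>b t\<bar>" for n
      using S01 by (intro AE_I2) (auto simp: c_def abs_mult intro!: mult_left_le_one_le)
  qed
  have Y': "(LINT t|time_measure T. indicator {..<t0} t * b t) = (LINT t:{0..t0}|lebesgue. b t)"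
  proof -
    have "(LINT t|time_measure T. indicator {..<t0} t * b t) = (LINT t:{0<..<T}|lebesgue. indicator {..<t0} t * b t)"
      unfolding set_lebesgue_integral_def by (subst integral_restrict_space) auto
    also have "\<dots> = (LINT t:{0<..<t0}|lebesgue. b t)"
      unfolding set_lebesgue_integral_def using t0
      by (intro Bochner_Integration.integral_cong) (auto simp: indicator_def)
    also have "\<dots> = (LINT t:{0..t0}|lebesgue. b t)"
      by (rule set_integral_discrete_difference[where X = "{0, t0}"]) auto
    finally show ?thesis .
  qed
  have "(\<lambda>n. c n 0 * a0) \<longlonglongrightarrow> 1 * a0"
    by (intro tendsto_mult tendsto_eventually cn0 tendsto_const)
  with X Y have "(\<lambda>n. (LINT t|time_measure T. - e n t * a t) + (LINT t|time_measure T. c n t * b t) + c n 0 * a0)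
      \<longlonglongrightarrow> - a t0 + (LINT t|time_measure T. indicator {..<t0} t * b t) + 1 * a0"
    by (intro tendsto_add)
  then have "- a t0 + (LINT t|time_measure T. indicator {..<t0} t * b t) + 1 * a0 = 0"
    unfolding id by (simp add: LIMSEQ_const_iff)
  then show ?thesis
    unfolding Y' by (simp add: a_def b_def[abs_def] a0_def)
qed

lemma navier_stokes_integrated:
  assumes T: "T > 0" and ns: "navier_stokes_solution \<nu> T u0 f u" and wc: "weakly_continuous_L2 T u"
    and f: "Lq_Lp 1 2 T f" and \<phi>: "test_function \<phi>"
  shows "set_integrable lebesgue {0..T} (\<lambda>t. TINT x. flux \<nu> (u t) (f t) \<phi> x)"
    and "t \<in> {0..T} \<Longrightarrow> (TINT x. u t x \<bullet> perp_grad \<phi> x) = (TINT x. u0 x \<bullet> perp_grad \<phi> x) +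
    (LINT t:{0..t}|lebesgue. TINT x. flux \<nu> (u t) (f t) \<phi> x)"
proof -
  have u: "Lq_Lp 2 2 T u"
    using ns by (simp add: navier_stokes_solution_def L2_H1_def)
  define a where "a t = (TINT x. u t x \<bullet> perp_grad \<phi> x)" for t
  define b where "b t = (TINT x. flux \<nu> (u t) (f t) \<phi> x)" for t
  define a0 where "a0 = (TINT x. u0 x \<bullet> perp_grad \<phi> x)"
  have ac: "continuous_on {0..T} a"
    using wc perp_grad_Lp[OF \<phi>] unfolding weakly_continuous_L2_def a_def by blast
  show bi: "set_integrable lebesgue {0..T} b"
    using integral_lebesgue_on_Times(2)[OF interval_sets(1) torus_borel flux_integrable(1)[OF u f \<phi>]]
    unfolding b_def time_integrable_iff[symmetric] by simp
  have cl: "closure {0<..<T} = {0..T}"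
    using T by simp
  have "continuous_on (closure {0<..<T}) (\<lambda>t. a t - (LINT t:{0..t}|lebesgue. b t))"
    unfolding cl by (intro continuous_intros ac continuous_set_integral bi)
  moreover have "a t - (LINT t:{0..t}|lebesgue. b t) = a0" if "t \<in> {0<..<T}" for t
    using navier_stokes_integrated_interior[OF T ns wc f \<phi> that] by (simp add: a_def b_def a0_def)
  ultimately have "a t - (LINT t:{0..t}|lebesgue. b t) = a0" if "t \<in> {0..T}" for t
    using continuous_constant_on_closure[of "{0<..<T}" "\<lambda>t. a t - (LINT t:{0..t}|lebesgue. b t)" a0 t] that cl by simp
  then show "t \<in> {0..T} \<Longrightarrow> (TINT x. u t x \<bullet> perp_grad \<phi> x) = (TINT x. u0 x \<bullet> perp_grad \<phi> x) +
    (LINT t:{0..t}|lebesgue. TINT x. flux \<nu> (u t) (f t) \<phi> x)"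
    by (simp add: a_def b_def a0_def algebra_simps)
qed

section \<open>The mollified vorticity equation\<close>

text \<open>Both sides integrate \<open>h\<close> against the Laplacian of the kernel, once computed in \<open>y\<close> and once in \<open>x\<close>; second
  derivatives do not see the reflection.\<close>

lemma laplacian_mollify:
  fixes A B :: "nat \<Rightarrow> real^2 \<Rightarrow> real"
  assumes h: "integrable torus_measure h" and e: "finite J" "\<And>j. test_function (A j)" "\<And>j. test_function (B j)"
    "\<And>x y. cos_kernel m n (x - y) = (\<Sum>j\<in>J. A j x * B j y)"
  shows "laplacian (mollify (cos_kernel m n) h) y = (\<Sum>j\<in>J. (TINT x. h x * laplacian (A j) x) * B j y)"
proof -
  have sA: "smooth (A j)" and sB: "smooth (B j)" for j
    using e by (auto intro: test_function_smooth)
  have sk: "smooth (cos_kernel m n)"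
    by (rule test_function_smooth[OF cos_kernel_test_function(1)])
  have dA: "pderiv_at i (cos_kernel m n) (x - y) = (\<Sum>j\<in>J. pderiv_at i (A j) x * B j y)" for i x y
  proof -
    have "pderiv_at i (cos_kernel m n) (x - y) = pderiv_at i (\<lambda>x. cos_kernel m n (x - y)) x"
      by (rule pderiv_shift[OF sk, symmetric])
    also have "\<dots> = (\<Sum>j\<in>J. pderiv_at i (A j) x * B j y)"
      unfolding e(4) by (simp add: pderiv_sum pderiv_mult pderiv_const smooth_mult smooth_const sA)
    finally show ?thesis .
  qed
  have dB: "pderiv_at i (cos_kernel m n) (x - y) = - (\<Sum>j\<in>J. A j x * pderiv_at i (B j) y)" for i x y
  proof -
    have "pderiv_at i (cos_kernel m n) (x - y) = - pderiv_at i (\<lambda>y. cos_kernel m n (x - y)) y"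
      by (simp add: pderiv_reflect[OF sk])
    also have "pderiv_at i (\<lambda>y. cos_kernel m n (x - y)) y = (\<Sum>j\<in>J. A j x * pderiv_at i (B j) y)"
      unfolding e(4) by (simp add: pderiv_sum pderiv_cmult smooth_mult smooth_const sB)
    finally show ?thesis .
  qed
  have A2: "pderiv_at i (pderiv_at i (cos_kernel m n)) (x - y) = (\<Sum>j\<in>J. pderiv_at i (pderiv_at i (A j)) x * B j y)" for i x y
  proof -
    have "pderiv_at i (pderiv_at i (cos_kernel m n)) (x - y) = pderiv_at i (\<lambda>x. pderiv_at i (cos_kernel m n) (x - y)) x"
      by (rule pderiv_shift[OF smooth_pderiv[OF sk], symmetric])
    also have "\<dots> = (\<Sum>j\<in>J. pderiv_at i (pderiv_at i (A j)) x * B j y)"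
      unfolding dA by (simp add: pderiv_sum pderiv_mult pderiv_const smooth_mult smooth_const smooth_pderiv sA)
    finally show ?thesis .
  qed
  have B2: "pderiv_at i (pderiv_at i (cos_kernel m n)) (x - y) = (\<Sum>j\<in>J. A j x * pderiv_at i (pderiv_at i (B j)) y)" for i x y
  proof -
    have "pderiv_at i (pderiv_at i (cos_kernel m n)) (x - y) = - pderiv_at i (\<lambda>y. pderiv_at i (cos_kernel m n) (x - y)) y"
      by (simp add: pderiv_reflect[OF smooth_pderiv[OF sk]])
    also have "pderiv_at i (\<lambda>y. pderiv_at i (cos_kernel m n) (x - y)) y =
        pderiv_at i (\<lambda>y. \<Sum>j\<in>J. (- A j x) * pderiv_at i (B j) y) y"
      unfolding dB by (simp add: sum_negf)
    also have "\<dots> = (\<Sum>j\<in>J. (- A j x) * pderiv_at i (pderiv_at i (B j)) y)"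
      by (subst pderiv_sum) (intro smooth_mult smooth_const smooth_pderiv sB, simp only: pderiv_cmult[OF smooth_pderiv[OF sB]])
    finally show ?thesis
      by (simp add: sum_negf)
  qed
  have iA: "integrable torus_measure (\<lambda>x. h x * pderiv_at i (pderiv_at i (A j)) x)" for i j
    by (intro integrable_torus_mult_continuous h test_function_continuous test_function_pderiv e)
  have iA0: "integrable torus_measure (\<lambda>x. h x * A j x)" for j
    by (intro integrable_torus_mult_continuous h test_function_continuous e)
  have M: "mollify (cos_kernel m n) h = (\<lambda>y. \<Sum>j\<in>J. (TINT x. h x * A j x) * B j y)"
    by (intro ext mollify_expansion[OF h e(1,2,4)])
  have d1: "pderiv_at i (mollify (cos_kernel m n) h) = (\<lambda>y. \<Sum>j\<in>J. (TINT x. h x * A j x) * pderiv_at i (B j) y)" for i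
    unfolding M by (intro ext) (subst pderiv_sum, intro smooth_mult smooth_const sB, simp only: pderiv_cmult[OF sB])
  have d2: "pderiv_at i (pderiv_at i (mollify (cos_kernel m n) h)) y =
      (\<Sum>j\<in>J. (TINT x. h x * A j x) * pderiv_at i (pderiv_at i (B j)) y)" for i
    unfolding d1 by (subst pderiv_sum, intro smooth_mult smooth_const smooth_pderiv sB, simp only: pderiv_cmult[OF smooth_pderiv[OF sB]])
  have swap: "(\<Sum>j\<in>J. (TINT x. h x * a j x) * b j) = (TINT x. h x * (\<Sum>j\<in>J. a j x * b j))"
    if "\<And>j. integrable torus_measure (\<lambda>x. h x * a j x)" for a and b :: "nat \<Rightarrow> real"
    using that by (simp add: sum_distrib_left mult.assoc[symmetric])
  have "pderiv_at i (pderiv_at i (mollify (cos_kernel m n) h)) y =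
      (\<Sum>j\<in>J. (TINT x. h x * pderiv_at i (pderiv_at i (A j)) x) * B j y)" for i
    unfolding d2 swap[OF iA0] swap[OF iA] A2[symmetric] B2[symmetric] ..
  moreover have "(TINT x. h x * laplacian (A j) x) = (\<Sum>i\<in>UNIV. TINT x. h x * pderiv_at i (pderiv_at i (A j)) x)" for j
    unfolding laplacian_def using iA by (simp add: sum_distrib_left)
  ultimately show ?thesis
    unfolding laplacian_def[of "mollify _ _"] by (simp add: UNIV_2 distrib_right sum.distrib)
qed

text \<open>Testing the equation against every \<open>A j\<close> of a separable mollifier is the same as mollifying the
  vorticity equation.  The transport term becomes transport of the mollified vorticity plus the commutator.\<close>

lemma mollified_vorticity_equation:
  fixes A B :: "nat \<Rightarrow> real^2 \<Rightarrow> real"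
  assumes H: "H1_field u G" and curl: "has_weak_curl f g" and fL: "Lp_torus 2 f"
    and e: "finite J" "\<And>j. test_function (A j)" "\<And>j. test_function (B j)"
    "\<And>x y. diag_kernel n (x - y) = (\<Sum>j\<in>J. A j x * B j y)"
  shows "(\<Sum>j\<in>J. (TINT x. u x \<bullet> perp_grad (A j) x) * B j y) = mollify (diag_kernel n) (curl_of G) y"
    and "(\<Sum>j\<in>J. (TINT x. flux \<nu> u f (A j) x) * B j y) =
      commutator n u (curl_of G) y + mollify (diag_kernel n) g y -
      (\<Sum>i\<in>UNIV. u y $ i * pderiv_at i (mollify (diag_kernel n) (curl_of G)) y) +
      \<nu> * laplacian (mollify (diag_kernel n) (curl_of G)) y"
proof -
  let ?w = "curl_of G" and ?k = "diag_kernel n"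
  have w: "Lp_torus 2 ?w" "integrable torus_measure ?w"
    using H1_fieldD(4)[OF H] L2_integrable by auto
  have g: "integrable torus_measure g"
    using curl unfolding has_weak_curl_def by (intro Lp1_iff_integrable[THEN iffD1]) simp
  show "(\<Sum>j\<in>J. (TINT x. u x \<bullet> perp_grad (A j) x) * B j y) = mollify ?k ?w y"
    unfolding mollify_expansion[OF w(2) e(1,2,4)] H1_field_curl[OF H e(2)] ..
  have sA: "smooth (A j)" for j
    using e by (auto intro: test_function_smooth)
  have sk: "smooth ?k"
    by (rule test_function_smooth[OF cos_kernel_test_function(1)])
  have dA: "pderiv_at i ?k (x - y) = (\<Sum>j\<in>J. pderiv_at i (A j) x * B j y)" for i x
  proof -
    have "pderiv_at i ?k (x - y) = pderiv_at i (\<lambda>x. ?k (x - y)) x"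
      by (rule pderiv_shift[OF sk, symmetric])
    also have "\<dots> = (\<Sum>j\<in>J. pderiv_at i (A j) x * B j y)"
      unfolding e(4) by (simp add: pderiv_sum pderiv_mult pderiv_const smooth_mult smooth_const sA)
    finally show ?thesis .
  qed
  have i: "integrable torus_measure (\<lambda>x. ?w x * (\<Sum>i\<in>UNIV. u x $ i * pderiv_at i (A j) x))" for j
    unfolding sum_distrib_left mult.assoc[symmetric]
    by (intro Bochner_Integration.integrable_sum L2_triple_integrable w H1_fieldD[OF H] test_function_pderiv e)
  have "(\<Sum>j\<in>J. (TINT x. ?w x * (\<Sum>i\<in>UNIV. u x $ i * pderiv_at i (A j) x)) * B j y) =
      (TINT x. (\<Sum>j\<in>J. ?w x * (\<Sum>i\<in>UNIV. u x $ i * pderiv_at i (A j) x) * B j y))"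
    using i by (subst Bochner_Integration.integral_sum) simp_all
  also have "\<dots> = (TINT x. ?w x * (\<Sum>i\<in>UNIV. u x $ i * pderiv_at i ?k (x - y)))"
    unfolding dA by (intro Bochner_Integration.integral_cong refl)
      (simp add: UNIV_2 sum_distrib_left sum.distrib algebra_simps)
  finally have transport: "(\<Sum>j\<in>J. (TINT x. ?w x * (\<Sum>i\<in>UNIV. u x $ i * pderiv_at i (A j) x)) * B j y) =
      commutator n u ?w y - (\<Sum>i\<in>UNIV. u y $ i * pderiv_at i (mollify ?k ?w) y)"
    by (simp add: commutator_def)
  have "(\<Sum>j\<in>J. (TINT x. flux \<nu> u f (A j) x) * B j y) =
      (\<Sum>j\<in>J. (TINT x. ?w x * (\<Sum>i\<in>UNIV. u x $ i * pderiv_at i (A j) x)) * B j y) +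
      \<nu> * (\<Sum>j\<in>J. (TINT x. ?w x * laplacian (A j) x) * B j y) +
      (\<Sum>j\<in>J. (TINT x. g x * A j x) * B j y)"
    unfolding flux_def H1_field_vorticity_form[OF H curl fL e(2)]
    by (simp add: distrib_right sum.distrib sum_distrib_left mult.assoc)
  then show "(\<Sum>j\<in>J. (TINT x. flux \<nu> u f (A j) x) * B j y) =
      commutator n u ?w y + mollify ?k g y - (\<Sum>i\<in>UNIV. u y $ i * pderiv_at i (mollify ?k ?w) y) +
      \<nu> * laplacian (mollify ?k ?w) y"
    unfolding transport mollify_expansion[OF g e(1,2,4)] laplacian_mollify[OF w(2) e] by simp
qed

text \<open>A subsequence converges almost everywhere; Fatou's lemma upgrades this to convergence in the mean of the whole
  sequence.\<close>

lemma L1_complete: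
  fixes s :: "nat \<Rightarrow> 'a \<Rightarrow> real"
  assumes s: "\<And>n. integrable M (s n)" and c: "\<And>e. e > 0 \<Longrightarrow> \<exists>N. \<forall>i\<ge>N. \<forall>j\<ge>N. (LINT x|M. \<bar>s i x - s j x\<bar>) < e"
  obtains h where "integrable M h" "(\<lambda>n. LINT x|M. \<bar>s n x - h x\<bar>) \<longlonglongrightarrow> 0"
proof -
  obtain r where r: "strict_mono r" "AE x in M. Cauchy (\<lambda>i. s (r i) x)"
    by (rule cauchy_L1_AE_cauchy_subseq[of M s]) (use s c in \<open>auto simp: real_norm_def\<close>)
  have sm: "s n \<in> borel_measurable M" for n
    using s by (rule borel_measurable_integrable)
  define h where "h x = lim (\<lambda>i. s (r i) x)" for x
  have hm: "h \<in> borel_measurable M"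
    unfolding h_def by (intro borel_measurable_lim_metric sm)
  have lim: "AE x in M. (\<lambda>i. s (r i) x) \<longlonglongrightarrow> h x"
    using r(2) by eventually_elim (simp add: h_def Cauchy_convergent convergent_LIMSEQ_iff[symmetric])
  have fatou: "(\<integral>\<^sup>+x. ennreal \<bar>s n x - h x\<bar> \<partial>M) \<le> ennreal e"
    if N: "\<forall>i\<ge>N. \<forall>j\<ge>N. (LINT x|M. \<bar>s i x - s j x\<bar>) < e" and n: "n \<ge> N" for e N n
  proof -
    have "(\<integral>\<^sup>+x. ennreal \<bar>s n x - h x\<bar> \<partial>M) = (\<integral>\<^sup>+x. liminf (\<lambda>i. ennreal \<bar>s n x - s (r i) x\<bar>) \<partial>M)"
    proof (rule nn_integral_cong_AE)
      show "AE x in M. ennreal \<bar>s n x - h x\<bar> = liminf (\<lambda>i. ennreal \<bar>s n x - s (r i) x\<bar>)"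
        using lim
      proof eventually_elim
        case (elim x)
        have "(\<lambda>i. ennreal \<bar>s n x - s (r i) x\<bar>) \<longlonglongrightarrow> ennreal \<bar>s n x - h x\<bar>"
          by (intro tendsto_ennrealI tendsto_rabs tendsto_diff tendsto_const elim)
        then show ?case
          by (intro lim_imp_Liminf[symmetric]) auto
      qed
    qed
    also have "\<dots> \<le> liminf (\<lambda>i. \<integral>\<^sup>+x. ennreal \<bar>s n x - s (r i) x\<bar> \<partial>M)"
      using sm by (intro nn_integral_liminf) measurable
    also have "\<dots> \<le> ennreal e"
    proof (rule Liminf_le)
      have "(\<integral>\<^sup>+x. ennreal \<bar>s n x - s (r i) x\<bar> \<partial>M) \<le> ennreal e" if "i \<ge> N" for i
      proof -
        have "(\<integral>\<^sup>+x. ennreal \<bar>s n x - s (r i) x\<bar> \<partial>M) = ennreal (LINT x|M. \<bar>s n x - s (r i) x\<bar>)"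
          using s by (intro nn_integral_eq_integral) auto
        then show ?thesis
          using N n order_trans[OF that seq_suble[OF r(1), of i]] by (simp only:) (intro ennreal_leI less_imp_le, blast)
      qed
      then show "\<forall>\<^sub>F i in sequentially. (\<integral>\<^sup>+x. ennreal \<bar>s n x - s (r i) x\<bar> \<partial>M) \<le> ennreal e"
        by (auto simp: eventually_sequentially)
    qed simp
    finally show ?thesis .
  qed
  obtain N where N: "\<forall>i\<ge>N. \<forall>j\<ge>N. (LINT x|M. \<bar>s i x - s j x\<bar>) < 1"
    using c[of 1] by auto
  have "integrable M (\<lambda>x. s N x - h x)"
  proof (rule integrableI_bounded)
    show "(\<integral>\<^sup>+x. ennreal (norm (s N x - h x)) \<partial>M) < \<infinity>"
      using le_less_trans[OF fatou[OF N order_refl] ennreal_less_top] by simp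
  qed (use sm hm in measurable)
  from Bochner_Integration.integrable_diff[OF s[of N] this] have h: "integrable M h"
    by simp
  have "(\<lambda>n. LINT x|M. \<bar>s n x - h x\<bar>) \<longlonglongrightarrow> 0"
  proof (rule LIMSEQ_I)
    fix e :: real assume e: "e > 0"
    then obtain N where N: "\<forall>i\<ge>N. \<forall>j\<ge>N. (LINT x|M. \<bar>s i x - s j x\<bar>) < e / 2"
      using c[of "e / 2"] by auto
    have "norm ((LINT x|M. \<bar>s n x - h x\<bar>) - 0) < e" if "n \<ge> N" for n
    proof -
      have "ennreal (LINT x|M. \<bar>s n x - h x\<bar>) = (\<integral>\<^sup>+x. ennreal \<bar>s n x - h x\<bar> \<partial>M)"
        using s h by (intro nn_integral_eq_integral[symmetric]) auto
      also have "\<dots> \<le> ennreal (e / 2)"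
        by (rule fatou[OF N that])
      finally have "(LINT x|M. \<bar>s n x - h x\<bar>) \<le> e / 2"
        using e by (subst (asm) ennreal_le_iff) auto
      then show ?thesis
        using e by simp
    qed
    then show "\<exists>N. \<forall>n\<ge>N. norm ((LINT x|M. \<bar>s n x - h x\<bar>) - 0) < e"
      by blast
  qed
  then show thesis
    by (rule that[OF h])
qed

text \<open>Slices are controlled for almost every time only; completeness of Lebesgue measure takes care of the rest.\<close>

lemma borel_measurable_time_cong_AE:
  assumes "integrable (time_measure T) F" "AE t in time_measure T. F t = (f t :: real)"
  shows "integrable (time_measure T) f"
proof -
  have "integrable lebesgue (\<lambda>t. indicator {0<..<T} t *\<^sub>R F t)"
    using assms(1) by (subst (asm) integrable_restrict_space) auto
  moreover have ae: "AE t in lebesgue. indicator {0<..<T} t *\<^sub>R F t = indicator {0<..<T} t *\<^sub>R f t"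
    using assms(2) unfolding time_AE_iff by eventually_elim (auto simp: indicator_def)
  moreover have "(\<lambda>t. indicator {0<..<T} t *\<^sub>R f t) \<in> borel_measurable lebesgue"
    using borel_measurable_integrable[OF calculation(1)] ae by (rule borel_measurable_AE)
  ultimately have "integrable lebesgue (\<lambda>t. indicator {0<..<T} t *\<^sub>R f t)"
    by (subst integrable_cong_AE[symmetric]) auto
  then show ?thesis
    by (subst integrable_restrict_space) auto
qed

lemma maximal_vorticity_time_integrable:
  assumes g: "Lq_Lp 1 1 T g" and s: "0 \<le> s" "s \<le> measure lebesgue torus"
  shows "integrable (time_measure T) (\<lambda>t. maximal_vorticity s (g t))"
proof (cases "s = 0")
  case True
  then show ?thesis
    by (simp add: maximal_vorticity_0)
next
  case False
  define L where "L q t = \<bar>q\<bar> * s + (TINT x. max 0 (\<bar>g t x\<bar> - \<bar>q\<bar>))" for q t :: real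
  define F where "F t = (INF q\<in>\<rat>. L q t)" for t
  have gi: "AE t in time_measure T. integrable torus_measure (g t)"
    using g unfolding Lq_Lp_def Lp1_iff_integrable by simp
  have gs: "integrable (spacetime_measure T) (\<lambda>z. \<bar>g (fst z) (snd z)\<bar>)"
    using Lp_Lp_integrable[OF g] by simp
  have gm: "(\<lambda>z. g (fst z) (snd z)) \<in> borel_measurable (spacetime_measure T)"
    by (rule Lq_Lp_measurable[OF g])
  note fub = integral_lebesgue_on_Times(2)[OF interval_sets(1) torus_borel]
  have Li: "integrable (time_measure T) (L q)" for q
  proof -
    have "integrable (spacetime_measure T) (\<lambda>z. max 0 (\<bar>g (fst z) (snd z)\<bar> - \<bar>q\<bar>))"
    proof (rule spacetime_dominated[OF gs])
      show "(\<lambda>z. max 0 (\<bar>g (fst z) (snd z)\<bar> - \<bar>q\<bar>)) \<in> borel_measurable (spacetime_measure T)"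
        using gm by measurable
    qed auto
    from fub[OF this] show ?thesis
      unfolding L_def by (intro Bochner_Integration.integrable_add time.integrable_const) simp
  qed
  have Lpos: "0 \<le> L q t" for q t
    unfolding L_def using s by (intro add_nonneg_nonneg Bochner_Integration.integral_nonneg) auto
  have bdd: "bdd_below ((\<lambda>q. L q t) ` \<rat>)" for t
    using Lpos by (intro bdd_belowI[of _ 0]) auto
  have Fm: "F \<in> borel_measurable (time_measure T)"
    unfolding F_def by (intro borel_measurable_cINF countable_rat bdd borel_measurable_integrable Li)
  have Fi: "integrable (time_measure T) F"
  proof (rule Bochner_Integration.integrable_bound[OF Li[of 0] Fm])
    show "AE t in time_measure T. norm (F t) \<le> norm (L 0 t)"
    proof (rule AE_I2)
      fix t
      have "0 \<le> F t"
        unfolding F_def using Lpos by (intro cINF_greatest) (auto intro: Rats_0)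
      moreover have "F t \<le> L 0 t"
        unfolding F_def by (intro cINF_lower bdd) simp
      ultimately show "norm (F t) \<le> norm (L 0 t)"
        by simp
    qed
  qed
  show ?thesis
  proof (rule borel_measurable_time_cong_AE[OF Fi])
    show "AE t in time_measure T. F t = maximal_vorticity s (g t)"
      using gi
    proof eventually_elim
      case (elim t)
      show ?case
        using maximal_vorticity_Inf[OF elim] s False by (simp add: F_def L_def)
    qed
  qed
qed

section \<open>Stability of the mollified vorticity in time\<close>

locale navier_stokes_vorticity =
  fixes \<nu> T :: real and u0 :: "real^2 \<Rightarrow> real^2" and f u :: "real \<Rightarrow> real^2 \<Rightarrow> real^2"
    and \<omega>0 :: "real^2 \<Rightarrow> real" and g :: "real \<Rightarrow> real^2 \<Rightarrow> real" and G :: "real \<Rightarrow> real^2 \<Rightarrow> real^2^2"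
    and J :: "nat \<Rightarrow> nat set" and A B :: "nat \<Rightarrow> nat \<Rightarrow> real^2 \<Rightarrow> real"
  assumes T: "T > 0" and \<nu>: "\<nu> > 0" and f: "Lq_Lp 1 2 T f"
    and ns: "navier_stokes_solution \<nu> T u0 f u" and wc: "weakly_continuous_L2 T u"
    and curl0: "has_weak_curl u0 \<omega>0" and g: "Lq_Lp 1 1 T g"
    and curl: "AE t in time_measure T. has_weak_curl (f t) (g t)"
    and G: "Lq_Lp 2 2 T G"
    and grad: "AE t in time_measure T. \<forall>i j. has_weak_pderiv i (\<lambda>x. u t x $ j) (\<lambda>x. G t x $ j $ i)"
    and expansion: "\<And>n. finite (J n)" "\<And>n j. test_function (A n j)" "\<And>n j. test_function (B n j)"
      "\<And>n x y. diag_kernel n (x - y) = (\<Sum>j\<in>J n. A n j x * B n j y)"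
begin

text \<open>For a.e. time \<open>coef\<close> are the coefficients of the mollified vorticity.  Unlike the vorticity they are
  defined at every time, and \<open>rate\<close> is their time derivative.\<close>

definition coef :: "nat \<Rightarrow> nat \<Rightarrow> real \<Rightarrow> real" where
  "coef n j t = (TINT x. u t x \<bullet> perp_grad (A n j) x)"

definition rate :: "nat \<Rightarrow> nat \<Rightarrow> real \<Rightarrow> real" where
  "rate n j t = (TINT x. flux \<nu> (u t) (f t) (A n j) x)"

definition moll :: "nat \<Rightarrow> real \<Rightarrow> real^2 \<Rightarrow> real" where
  "moll n t y = (\<Sum>j\<in>J n. coef n j t * B n j y)"

text \<open>What drives the mollified vorticity after transport and diffusion are accounted for.  The formula involves the
  velocity and the coefficients only, which makes it jointly measurable in time and space.\<close>

definition source :: "nat \<Rightarrow> real \<Rightarrow> real^2 \<Rightarrow> real" where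
  "source n t y = (\<Sum>j\<in>J n. rate n j t * B n j y) + (\<Sum>i\<in>UNIV. u t y $ i * (\<Sum>j\<in>J n. coef n j t * pderiv_at i (B n j) y)) -
     \<nu> * (\<Sum>j\<in>J n. coef n j t * laplacian (B n j) y)"

definition source_error :: "nat \<Rightarrow> real \<Rightarrow> real" where
  "source_error n t = (TINT y. \<bar>source n t y - g t y\<bar>)"

text \<open>The times at which the vorticity is square integrable and the equation can be read in space.\<close>

definition good :: "real \<Rightarrow> bool" where
  "good t \<longleftrightarrow> H1_field (u t) (G t) \<and> Lp_torus 2 (f t) \<and> has_weak_curl (f t) (g t)"

lemma u_L2: "Lq_Lp 2 2 T u"
  using ns by (simp add: navier_stokes_solution_def L2_H1_def)

lemma AE_good: "AE t in time_measure T. good t"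
proof -
  have "AE t in time_measure T. Lp_torus 2 (u t)" "AE t in time_measure T. Lp_torus 2 (G t)"
    "AE t in time_measure T. Lp_torus 2 (f t)" "AE t in time_measure T. weakly_div_free (u t)"
    using u_L2 G f ns unfolding Lq_Lp_def navier_stokes_solution_def by simp_all
  then show ?thesis
    using curl grad by eventually_elim (simp add: good_def H1_field_def)
qed

lemma rate_integrable: "set_integrable lebesgue {0..T} (rate n j)"
  using navier_stokes_integrated(1)[OF T ns wc f expansion(2)] by (simp add: rate_def[abs_def])

lemma coef_integrated:
  assumes "t \<in> {0..T}"
  shows "coef n j t = coef n j 0 + (LINT \<tau>:{0..t}|lebesgue. rate n j \<tau>)"
    and "coef n j 0 = (TINT x. \<omega>0 x * A n j x)"
proof -
  have int: "coef n j t = (TINT x. u0 x \<bullet> perp_grad (A n j) x) + (LINT \<tau>:{0..t}|lebesgue. rate n j \<tau>)"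
    if "t \<in> {0..T}" for t
    using navier_stokes_integrated(2)[OF T ns wc f expansion(2) that] by (simp add: coef_def rate_def[abs_def])
  have "(LINT \<tau>:{0..0::real}|lebesgue. rate n j \<tau>) = 0"
  proof -
    have "(LINT \<tau>:{0..0::real}|lebesgue. rate n j \<tau>) = (LINT \<tau>:{}|lebesgue. rate n j \<tau>)"
      by (rule set_integral_discrete_difference[where X = "{0}"]) auto
    then show ?thesis
      by (simp add: set_lebesgue_integral_def)
  qed
  then have 0: "coef n j 0 = (TINT x. u0 x \<bullet> perp_grad (A n j) x)"
    using int[of 0] T by simp
  then show "coef n j t = coef n j 0 + (LINT \<tau>:{0..t}|lebesgue. rate n j \<tau>)"
    using int[OF assms] by simp
  show "coef n j 0 = (TINT x. \<omega>0 x * A n j x)"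
    unfolding 0 inner_perp_grad using curl0 expansion(2) unfolding has_weak_curl_def by simp
qed

lemma \<omega>0_integrable: "integrable torus_measure \<omega>0"
  using curl0 unfolding has_weak_curl_def by (intro Lp1_iff_integrable[THEN iffD1]) simp

lemma test_function_moll: "test_function (moll n t)"
  unfolding moll_def by (intro test_function_sum test_function_mult test_function_const expansion)

lemma moll_integrable: "integrable torus_measure (moll n t)"
  by (intro integrable_torus_continuous test_function_continuous test_function_moll)

lemma moll_0: "moll n 0 = mollify (diag_kernel n) \<omega>0"
proof
  fix y
  have "0 \<in> {0..T}"
    using T by simp
  then show "moll n 0 y = mollify (diag_kernel n) \<omega>0 y"
    unfolding moll_def mollify_expansion[OF \<omega>0_integrable expansion(1,2,4)] by (simp only: coef_integrated(2))
qed

lemma moll_0_tendsto: "(\<lambda>n. TINT y. \<bar>moll n 0 y - \<omega>0 y\<bar>) \<longlonglongrightarrow> 0"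
  unfolding moll_0 by (rule mollify_tendsto_L1[OF approx_identity_diag Lp1_iff_integrable[THEN iffD2, OF \<omega>0_integrable]])

lemma moll_derivatives:
  "pderiv_at i (moll n t) y = (\<Sum>j\<in>J n. coef n j t * pderiv_at i (B n j) y)"
  "laplacian (moll n t) y = (\<Sum>j\<in>J n. coef n j t * laplacian (B n j) y)"
proof -
  have sB: "smooth (B n j)" for j
    using expansion by (auto intro: test_function_smooth)
  have 1: "pderiv_at i (moll n t) = (\<lambda>y. \<Sum>j\<in>J n. coef n j t * pderiv_at i (B n j) y)" for i
    unfolding moll_def[abs_def]
    by (intro ext) (subst pderiv_sum, intro smooth_mult smooth_const sB, simp only: pderiv_cmult[OF sB])
  show "pderiv_at i (moll n t) y = (\<Sum>j\<in>J n. coef n j t * pderiv_at i (B n j) y)"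
    by (simp only: 1)
  have "pderiv_at i (pderiv_at i (moll n t)) y = (\<Sum>j\<in>J n. coef n j t * pderiv_at i (pderiv_at i (B n j)) y)" for i
    unfolding 1 by (subst pderiv_sum, intro smooth_mult smooth_const smooth_pderiv sB, simp only: pderiv_cmult[OF smooth_pderiv[OF sB]])
  then show "laplacian (moll n t) y = (\<Sum>j\<in>J n. coef n j t * laplacian (B n j) y)"
    by (simp add: laplacian_def UNIV_2 distrib_left sum.distrib)
qed

lemma rate_eq: "(\<Sum>j\<in>J n. rate n j t * B n j y) =
    source n t y - (\<Sum>i\<in>UNIV. u t y $ i * pderiv_at i (moll n t) y) + \<nu> * laplacian (moll n t) y"
  by (simp add: source_def moll_derivatives)

lemma good_source:
  assumes "good t"
  shows "source n t y = commutator n (u t) (curl_of (G t)) y + mollify (diag_kernel n) (g t) y"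
proof -
  have H: "H1_field (u t) (G t)" and c: "has_weak_curl (f t) (g t)" and fL: "Lp_torus 2 (f t)"
    using assms by (simp_all add: good_def)
  note eq = mollified_vorticity_equation(1)[where J = "J n" and A = "A n" and B = "B n", OF H c fL expansion]
    mollified_vorticity_equation(2)[where J = "J n" and A = "A n" and B = "B n" and \<nu> = \<nu> and y = y, OF H c fL expansion]
  have "moll n t = mollify (diag_kernel n) (curl_of (G t))"
    unfolding moll_def[abs_def] coef_def by (intro ext eq(1))
  then show ?thesis
    using rate_eq[of n t y] eq(2) by (simp add: rate_def)
qed

lemma good_integrable:
  assumes "good t"
  shows "integrable torus_measure (g t)" "integrable torus_measure (source n t)"
    and "integrable torus_measure (commutator n (u t) (curl_of (G t)))"
proof -
  have H: "H1_field (u t) (G t)" and c: "has_weak_curl (f t) (g t)"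
    using assms by (simp_all add: good_def)
  show "integrable torus_measure (g t)"
    using c unfolding has_weak_curl_def by (intro Lp1_iff_integrable[THEN iffD1]) simp
  then have m: "integrable torus_measure (mollify (diag_kernel n) (g t))"
    by (rule integrable_torus_continuous[OF test_function_continuous[OF test_function_mollify]])
  show s: "integrable torus_measure (source n t)"
    unfolding source_def
    by (intro Bochner_Integration.integrable_add Bochner_Integration.integrable_diff Bochner_Integration.integrable_sum
        integrable_torus_mult_continuous integrable_mult_right integrable_torus_continuous L2_integrable(1) H1_fieldD[OF H]
        continuous_intros test_function_continuous test_function_pderiv test_function_laplacian expansion)
  have "commutator n (u t) (curl_of (G t)) = (\<lambda>y. source n t y - mollify (diag_kernel n) (g t) y)"
    using good_source[OF assms] by auto
  then show "integrable torus_measure (commutator n (u t) (curl_of (G t)))"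
    using Bochner_Integration.integrable_diff[OF s m] by simp
qed

text \<open>The majorant is integrable in time because \<open>\<nabla>u\<close> is square integrable in space and time.\<close>

lemma good_source_error:
  assumes "good t"
  shows "source_error n t \<le> (TINT y. \<bar>commutator n (u t) (curl_of (G t)) y\<bar>) +
      (TINT y. \<bar>mollify (diag_kernel n) (g t) y - g t y\<bar>)"
    and "source_error n t \<le> 3520 * Lp_norm 2 (G t) ^ 2 + 4 * Lp_norm 1 (g t) ^ 1"
    and "(\<lambda>n. source_error n t) \<longlonglongrightarrow> 0"
proof -
  have H: "H1_field (u t) (G t)"
    using assms by (simp add: good_def)
  note i = good_integrable[OF assms]
  have L1: "Lp_torus 1 (g t)"
    by (rule Lp1_iff_integrable[THEN iffD2, OF i(1)])
  have m: "integrable torus_measure (mollify (diag_kernel n) (g t))" for n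
    by (rule integrable_torus_continuous[OF test_function_continuous[OF test_function_mollify[OF i(1)]]])
  show le: "source_error n t \<le> (TINT y. \<bar>commutator n (u t) (curl_of (G t)) y\<bar>) +
      (TINT y. \<bar>mollify (diag_kernel n) (g t) y - g t y\<bar>)" for n
  proof -
    have "source_error n t \<le> (TINT y. \<bar>commutator n (u t) (curl_of (G t)) y\<bar> + \<bar>mollify (diag_kernel n) (g t) y - g t y\<bar>)"
      unfolding source_error_def good_source[OF assms]
      by (intro integral_mono integrable_abs Bochner_Integration.integrable_add Bochner_Integration.integrable_diff i m) simp
    also have "\<dots> = (TINT y. \<bar>commutator n (u t) (curl_of (G t)) y\<bar>) +
      (TINT y. \<bar>mollify (diag_kernel n) (g t) y - g t y\<bar>)"
      by (intro Bochner_Integration.integral_add integrable_abs Bochner_Integration.integrable_diff i m)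
    finally show ?thesis .
  qed
  have mass: "kernel_mass (diag_kernel n) = 1"
    using approx_identity_diag by (simp add: approx_identity_def)
  have "(TINT y. \<bar>mollify (diag_kernel n) (g t) y - g t y\<bar>) \<le> 4 * (TINT x. \<bar>g t x\<bar>)"
    using order_trans[OF mollify_error(1)[OF conv_kernel_cos_kernel mass L1] oscillation_integrable(2)[OF L1 conv_kernel_cos_kernel]]
    unfolding mass by simp
  moreover have "Lp_norm 1 (g t) ^ 1 = (TINT x. \<bar>g t x\<bar>)"
    using Lp_norm_power[of 1 "g t"] by simp
  moreover have "Lp_norm 2 (G t) ^ 2 = (TINT x. (norm (G t x))\<^sup>2)"
    using Lp_norm_power[of 2 "G t"] by simp
  ultimately show "source_error n t \<le> 3520 * Lp_norm 2 (G t) ^ 2 + 4 * Lp_norm 1 (g t) ^ 1"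
    using le[of n] commutator_uniform_bound[OF H, of n] by linarith
  have "(\<lambda>n. (TINT y. \<bar>commutator n (u t) (curl_of (G t)) y\<bar>) +
      (TINT y. \<bar>mollify (diag_kernel n) (g t) y - g t y\<bar>)) \<longlonglongrightarrow> 0 + 0"
    by (intro tendsto_add commutator_tendsto_0[OF H] mollify_tendsto_L1[OF approx_identity_diag L1])
  then have lim: "(\<lambda>n. (TINT y. \<bar>commutator n (u t) (curl_of (G t)) y\<bar>) +
      (TINT y. \<bar>mollify (diag_kernel n) (g t) y - g t y\<bar>)) \<longlonglongrightarrow> 0"
    by simp
  show "(\<lambda>n. source_error n t) \<longlonglongrightarrow> 0"
    by (rule tendsto_sandwich[OF _ _ tendsto_const lim]) (use le in \<open>auto simp: source_error_def\<close>)
qed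

lemma source_error_integrable: "integrable (time_measure T) (source_error n)"
proof -
  note fub = integral_lebesgue_on_Times(2)[OF interval_sets(1) torus_borel]
  have cm: "coef n j \<in> borel_measurable (time_measure T)" for j
    using fub[OF flux_integrable(2)[OF u_L2 f expansion(2)[of n j]]] unfolding coef_def[abs_def]
    by (intro borel_measurable_integrable) simp
  have rm: "rate n j \<in> borel_measurable (time_measure T)" for j
    using rate_integrable unfolding time_integrable_iff[symmetric] by (rule borel_measurable_integrable)
  have um: "(\<lambda>z. u (fst z) (snd z) $ i) \<in> borel_measurable (spacetime_measure T)" for i
    by (rule vec_nth_measurable[OF Lq_Lp_measurable[OF u_L2]])
  have gm: "(\<lambda>z. g (fst z) (snd z)) \<in> borel_measurable (spacetime_measure T)"
    by (rule Lq_Lp_measurable[OF g])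
  have tm: "(\<lambda>z. \<psi> (snd z)) \<in> borel_measurable (spacetime_measure T)" if "test_function \<psi>" for \<psi>
    by (rule spacetime_snd_measurable[OF test_function_continuous[OF that]])
  have "integrable (spacetime_measure T) (\<lambda>z. \<bar>source n (fst z) (snd z) - g (fst z) (snd z)\<bar>)"
  proof (rule integrable_abs, rule integrable_lebesgue_on_Times[OF interval_sets(1) torus_borel])
    show "(\<lambda>z. source n (fst z) (snd z) - g (fst z) (snd z)) \<in> borel_measurable (spacetime_measure T)"
      unfolding source_def
      by (intro borel_measurable_diff borel_measurable_add borel_measurable_sum borel_measurable_times borel_measurable_const
          spacetime_fst_measurable[OF cm] spacetime_fst_measurable[OF rm] um gm tm expansion test_function_pderiv test_function_laplacian)
    show "integrable (time_measure T) (\<lambda>t. 3520 * Lp_norm 2 (G t) ^ 2 + 4 * Lp_norm 1 (g t) ^ 1)"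
      using G g unfolding Lq_Lp_def by (intro Bochner_Integration.integrable_add integrable_mult_right) blast+
    show "AE t in time_measure T. integrable torus_measure (\<lambda>y. source n (fst (t, y)) (snd (t, y)) - g (fst (t, y)) (snd (t, y))) \<and>
        (TINT y. \<bar>source n (fst (t, y)) (snd (t, y)) - g (fst (t, y)) (snd (t, y))\<bar>) \<le>
        3520 * Lp_norm 2 (G t) ^ 2 + 4 * Lp_norm 1 (g t) ^ 1"
      using AE_good
    proof eventually_elim
      case (elim t)
      then show ?case
        using good_source_error(2)[OF elim, of n] good_integrable(1,2)[OF elim] by (simp add: source_error_def)
    qed
  qed
  from fub[OF this] show ?thesis
    by (simp add: source_error_def[abs_def])
qed

lemma source_error_nonneg: "0 \<le> source_error n t"
  by (simp add: source_error_def)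

lemma source_error_tendsto: "(\<lambda>n. LINT t|time_measure T. source_error n t) \<longlonglongrightarrow> 0"
proof -
  have "(\<lambda>n. LINT t|time_measure T. source_error n t) \<longlonglongrightarrow> (LINT t|time_measure T. 0)"
  proof (rule integral_dominated_convergence[where w = "\<lambda>t. 3520 * Lp_norm 2 (G t) ^ 2 + 4 * Lp_norm 1 (g t) ^ 1"])
    show "integrable (time_measure T) (\<lambda>t. 3520 * Lp_norm 2 (G t) ^ 2 + 4 * Lp_norm 1 (g t) ^ 1)"
      using G g unfolding Lq_Lp_def by (intro Bochner_Integration.integrable_add integrable_mult_right) blast+
    show "source_error n \<in> borel_measurable (time_measure T)" for n
      using source_error_integrable by (rule borel_measurable_integrable)
    show "AE t in time_measure T. (\<lambda>n. source_error n t) \<longlonglongrightarrow> 0"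
      using AE_good by eventually_elim (rule good_source_error(3))
    show "AE t in time_measure T. norm (source_error n t) \<le> 3520 * Lp_norm 2 (G t) ^ 2 + 4 * Lp_norm 1 (g t) ^ 1" for n
      using AE_good by eventually_elim (use good_source_error(2) source_error_nonneg in \<open>simp only: real_norm_def abs_of_nonneg\<close>)
  qed simp
  then show ?thesis
    by simp
qed

end

lemma time_integral_upto:
  assumes e: "integrable (time_measure T) e" "\<And>t. 0 \<le> e t" and t: "t \<in> {0..T}"
  shows "(LINT \<tau>:{0..t}|lebesgue. e \<tau>) \<le> (LINT \<tau>|time_measure T. (e \<tau> :: real))"
proof -
  have i: "set_integrable lebesgue {0..T} e"
    using e(1) by (simp only: time_integrable_iff)
  have j: "set_integrable lebesgue {0..t} e"
    by (rule set_integrable_subset[OF i]) (use t in auto)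
  show ?thesis
    unfolding time_integral set_lebesgue_integral_def
    using i j t e(2) unfolding set_integrable_def by (intro integral_mono) (auto simp: indicator_def)
qed

context navier_stokes_vorticity
begin

lemma linear_combination_derivatives:
  assumes p: "smooth p" and q: "smooth (q :: real^2 \<Rightarrow> real)"
  shows "pderiv_at i (\<lambda>y. p y - c * q y) y = pderiv_at i p y - c * pderiv_at i q y"
    and "laplacian (\<lambda>y. p y - c * q y) y = laplacian p y - c * laplacian q y"
proof -
  have 1: "pderiv_at i (\<lambda>y. p y - c * q y) = (\<lambda>y. pderiv_at i p y - c * pderiv_at i q y)" if "smooth p" "smooth q" for i p and q :: "real^2 \<Rightarrow> real"
    by (intro ext) (simp add: pderiv_diff pderiv_cmult smooth_mult smooth_const that)
  show "pderiv_at i (\<lambda>y. p y - c * q y) y = pderiv_at i p y - c * pderiv_at i q y"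
    by (simp only: 1[OF p q])
  show "laplacian (\<lambda>y. p y - c * q y) y = laplacian p y - c * laplacian q y"
    unfolding laplacian_def 1[OF p q] 1[OF smooth_pderiv[OF p] smooth_pderiv[OF q]]
    by (simp add: sum_subtractf sum_distrib_left)
qed

text \<open>For \<open>c = 0\<close> this is the estimate for one mollification, and for \<open>c = 1\<close> it compares two of them; both mollified
  vorticities are transported by the same velocity.\<close>

lemma moll_evolution:
  assumes s: "0 < s" "s \<le> measure lebesgue torus" and m: "integrable (time_measure T) \<mu>"
    and le: "\<And>t. good t \<Longrightarrow> maximal_vorticity s (\<lambda>y. source n t y - c * source m t y) \<le> \<mu> t"
    and t: "t \<in> {0..T}"
  shows "maximal_vorticity s (\<lambda>y. moll n t y - c * moll m t y) \<le>
    maximal_vorticity s (\<lambda>y. moll n 0 y - c * moll m 0 y) + (LINT \<tau>:{0..t}|lebesgue. \<mu> \<tau>)"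
proof -
  define K where "K = J n <+> J m"
  define a where "a = case_sum (coef n) (coef m)"
  define b where "b = case_sum (rate n) (rate m)"
  define E where "E = case_sum (B n) (\<lambda>j y. - c * B m j y)"
  have fin: "finite K"
    by (simp add: K_def expansion)
  have sum_a: "(\<Sum>j\<in>K. a j t * E j y) = moll n t y - c * moll m t y" for t y
    unfolding K_def a_def E_def moll_def
    by (subst sum.Plus) (simp_all add: expansion sum_negf sum_distrib_left mult.left_commute)
  have sum_b: "(\<Sum>j\<in>K. b j t * E j y) = (\<Sum>j\<in>J n. rate n j t * B n j y) - c * (\<Sum>j\<in>J m. rate m j t * B m j y)" for t y
    unfolding K_def b_def E_def
    by (subst sum.Plus) (simp_all add: expansion sum_negf sum_distrib_left mult.left_commute)
  have "maximal_vorticity s (\<lambda>y. \<Sum>j\<in>K. a j t * E j y) \<le>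
      maximal_vorticity s (\<lambda>y. \<Sum>j\<in>K. a j 0 * E j y) + (LINT \<tau>:{0..t}|lebesgue. \<mu> \<tau>)"
  proof (rule maximal_vorticity_evolution[where T = T and b = b])
    show "finite K"
      by (rule fin)
    show "test_function (E j)" for j
      unfolding E_def by (cases j) (simp_all only: sum.case expansion test_function_mult[OF test_function_const expansion(3)])
    show "set_integrable lebesgue {0..T} (b j)" for j
      unfolding b_def by (cases j) (simp_all add: rate_integrable)
    show "a j t = a j 0 + (LINT \<tau>:{0..t}|lebesgue. b j \<tau>)" if "t \<in> {0..T}" for j t
      unfolding a_def b_def using coef_integrated(1)[OF that] by (cases j) simp_all
    show "set_integrable lebesgue {0..T} \<mu>"
      using m by (simp only: time_integrable_iff)
    show "AE \<tau> in lebesgue. \<tau> \<in> {0<..<T} \<longrightarrow> (\<forall>\<delta>>0. \<forall>l. (TINT y. level \<delta> l (\<Sum>j\<in>K. a j \<tau> * E j y)) = s \<longrightarrow>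
        (TINT y. slope \<delta> l (\<Sum>j\<in>K. a j \<tau> * E j y) * (\<Sum>j\<in>K. b j \<tau> * E j y)) \<le> \<mu> \<tau>)"
      unfolding time_AE_iff[symmetric] using AE_good
    proof (eventually_elim, intro allI impI)
      fix \<tau> \<delta> l :: real
      assume g: "good \<tau>" and d: "0 < \<delta>" and lev: "(TINT y. level \<delta> l (\<Sum>j\<in>K. a j \<tau> * E j y)) = s"
      define w where "w y = moll n \<tau> y - c * moll m \<tau> y" for y
      define H where "H y = source n \<tau> y - c * source m \<tau> y" for y
      have ws: "smooth (moll k \<tau>)" for k
        by (rule test_function_smooth[OF test_function_moll])
      have w: "test_function w"
        unfolding w_def by (intro test_function_diff test_function_mult test_function_const test_function_moll)
      have wc: "continuous_on UNIV w"
        by (rule test_function_continuous[OF w])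
      have Hi: "integrable torus_measure H"
        unfolding H_def by (intro Bochner_Integration.integrable_diff integrable_mult_right good_integrable(2)[OF g])
      have eq: "(\<Sum>j\<in>K. b j \<tau> * E j y) = H y - (\<Sum>i\<in>UNIV. u \<tau> y $ i * pderiv_at i w y) + \<nu> * laplacian w y" for y
        unfolding sum_b rate_eq H_def w_def[abs_def] linear_combination_derivatives[OF ws ws]
        by (simp add: UNIV_2 algebra_simps)
      have u: "Lp_torus 2 (u \<tau>)" "weakly_div_free (u \<tau>)"
        using g by (simp_all add: good_def H1_field_def)
      have "(TINT y. slope \<delta> l (w y) * (\<Sum>j\<in>K. b j \<tau> * E j y)) \<le> (TINT y. slope \<delta> l (w y) * H y)"
        unfolding eq by (rule slope_dissipation[OF d w u less_imp_le[OF \<nu>] Hi])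
      also have "\<dots> \<le> maximal_vorticity s H"
      proof (rule maximal_vorticity_pairing[OF Hi s])
        show "(\<lambda>y. slope \<delta> l (w y)) \<in> borel_measurable torus_measure"
          by (intro continuous_measurable_torus continuous_slope d wc)
        have "(TINT y. \<bar>slope \<delta> l (w y)\<bar>) \<le> (TINT y. level \<delta> l (w y))"
          by (intro integral_mono integrable_torus_continuous continuous_on_rabs continuous_slope continuous_level d wc slope_level)
        then show "(TINT y. \<bar>slope \<delta> l (w y)\<bar>) \<le> s"
          using lev by (simp add: sum_a w_def)
      qed (rule slope_level)
      also have "\<dots> \<le> \<mu> \<tau>"
        unfolding H_def[abs_def] by (rule le[OF g])
      finally show "(TINT y. slope \<delta> l (\<Sum>j\<in>K. a j \<tau> * E j y) * (\<Sum>j\<in>K. b j \<tau> * E j y)) \<le> \<mu> \<tau>"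
        by (simp only: sum_a w_def)
    qed
  qed (use s t in simp_all)
  then show ?thesis
    by (simp only: sum_a)
qed

lemma moll_maximal_vorticity_le:
  assumes s: "0 < s" "s \<le> measure lebesgue torus" and t: "t \<in> {0..T}"
  shows "maximal_vorticity s (moll n t) \<le> maximal_vorticity s (moll n 0) +
    (LINT \<tau>:{0..t}|lebesgue. maximal_vorticity s (g \<tau>)) + (LINT \<tau>|time_measure T. source_error n \<tau>)"
proof -
  have Mi: "integrable (time_measure T) (\<lambda>\<tau>. maximal_vorticity s (g \<tau>))"
    using s by (intro maximal_vorticity_time_integrable[OF g]) simp_all
  have sub: "set_integrable lebesgue {0..t} h" if "integrable (time_measure T) h" for h :: "real \<Rightarrow> real"
    by (rule set_integrable_subset[of _ "{0..T}"]) (use that t time_integrable_iff in auto)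
  have "maximal_vorticity s (\<lambda>y. moll n t y - 0 * moll n t y) \<le>
      maximal_vorticity s (\<lambda>y. moll n 0 y - 0 * moll n 0 y) + (LINT \<tau>:{0..t}|lebesgue. maximal_vorticity s (g \<tau>) + source_error n \<tau>)"
  proof (rule moll_evolution[OF s _ _ t])
    show "integrable (time_measure T) (\<lambda>\<tau>. maximal_vorticity s (g \<tau>) + source_error n \<tau>)"
      by (intro Bochner_Integration.integrable_add Mi source_error_integrable)
    show "maximal_vorticity s (\<lambda>y. source n \<tau> y - 0 * source n \<tau> y) \<le> maximal_vorticity s (g \<tau>) + source_error n \<tau>" if "good \<tau>" for \<tau>
      using maximal_vorticity_lipschitz[OF good_integrable(2)[OF that, of n] good_integrable(1)[OF that], of s] s
      by (simp add: source_error_def)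
  qed
  moreover have "(LINT \<tau>:{0..t}|lebesgue. maximal_vorticity s (g \<tau>) + source_error n \<tau>) =
      (LINT \<tau>:{0..t}|lebesgue. maximal_vorticity s (g \<tau>)) + (LINT \<tau>:{0..t}|lebesgue. source_error n \<tau>)"
    by (intro set_integral_add sub Mi source_error_integrable)
  ultimately show ?thesis
    using time_integral_upto[OF source_error_integrable source_error_nonneg t, of n] by simp
qed

text \<open>At \<open>s = (2 \<pi>)\<^sup>2\<close> the maximal vorticity is the \<open>L\<^sup>1\<close> norm.  Applied to the difference of two
  mollifications, the evolution estimate shows that they form a Cauchy sequence in \<open>L\<^sup>1\<close> at every time.\<close>

lemma moll_difference_le:
  assumes t: "t \<in> {0..T}"
  shows "(TINT y. \<bar>moll n t y - moll m t y\<bar>) \<le> (TINT y. \<bar>moll n 0 y - moll m 0 y\<bar>) +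
    (LINT \<tau>|time_measure T. source_error n \<tau>) + (LINT \<tau>|time_measure T. source_error m \<tau>)"
proof -
  let ?s = "measure lebesgue torus"
  have s: "0 < ?s" "?s \<le> ?s"
    by (simp_all add: measure_torus)
  have tot: "maximal_vorticity ?s (\<lambda>y. moll n t y - moll m t y) = (TINT y. \<bar>moll n t y - moll m t y\<bar>)" for t
    by (intro maximal_vorticity_total Bochner_Integration.integrable_diff moll_integrable)
  have "maximal_vorticity ?s (\<lambda>y. moll n t y - 1 * moll m t y) \<le>
      maximal_vorticity ?s (\<lambda>y. moll n 0 y - 1 * moll m 0 y) + (LINT \<tau>:{0..t}|lebesgue. source_error n \<tau> + source_error m \<tau>)"
  proof (rule moll_evolution[OF s _ _ t])
    show "integrable (time_measure T) (\<lambda>\<tau>. source_error n \<tau> + source_error m \<tau>)"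
      by (intro Bochner_Integration.integrable_add source_error_integrable)
    fix \<tau> assume good: "good \<tau>"
    note i = good_integrable(1,2)[OF good]
    have "maximal_vorticity ?s (\<lambda>y. source n \<tau> y - source m \<tau> y) \<le> (TINT y. \<bar>source n \<tau> y - source m \<tau> y\<bar>)"
      by (intro maximal_vorticity_le_L1 Bochner_Integration.integrable_diff i) simp_all
    also have "\<dots> \<le> (TINT y. \<bar>source n \<tau> y - g \<tau> y\<bar> + \<bar>source m \<tau> y - g \<tau> y\<bar>)"
      by (intro integral_mono integrable_abs Bochner_Integration.integrable_add Bochner_Integration.integrable_diff i) simp
    also have "\<dots> = source_error n \<tau> + source_error m \<tau>"
      unfolding source_error_def
      by (intro Bochner_Integration.integral_add integrable_abs Bochner_Integration.integrable_diff i)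
    finally show "maximal_vorticity ?s (\<lambda>y. source n \<tau> y - 1 * source m \<tau> y) \<le> source_error n \<tau> + source_error m \<tau>"
      by simp
  qed
  then have "(TINT y. \<bar>moll n t y - moll m t y\<bar>) \<le> (TINT y. \<bar>moll n 0 y - moll m 0 y\<bar>) +
      (LINT \<tau>:{0..t}|lebesgue. source_error n \<tau> + source_error m \<tau>)"
    by (simp add: tot)
  also have "(LINT \<tau>:{0..t}|lebesgue. source_error n \<tau> + source_error m \<tau>) \<le> (LINT \<tau>|time_measure T. source_error n \<tau> + source_error m \<tau>)"
    by (intro time_integral_upto Bochner_Integration.integrable_add source_error_integrable add_nonneg_nonneg source_error_nonneg t)
  also have "\<dots> = (LINT \<tau>|time_measure T. source_error n \<tau>) + (LINT \<tau>|time_measure T. source_error m \<tau>)"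
    by (intro Bochner_Integration.integral_add source_error_integrable)
  finally show ?thesis
    by simp
qed

lemma moll_limit_exists:
  assumes t: "t \<in> {0..T}"
  obtains h where "integrable torus_measure h" "(\<lambda>n. TINT y. \<bar>moll n t y - h y\<bar>) \<longlonglongrightarrow> 0"
proof (rule L1_complete)
  show "integrable torus_measure (moll n t)" for n
    by (rule moll_integrable)
  fix e :: real assume e: "e > 0"
  define d where "d n = (TINT y. \<bar>moll n 0 y - \<omega>0 y\<bar>) + (LINT \<tau>|time_measure T. source_error n \<tau>)" for n
  have "d \<longlonglongrightarrow> 0 + 0"
    unfolding d_def by (intro tendsto_add moll_0_tendsto source_error_tendsto)
  then have "\<forall>\<^sub>F n in sequentially. d n < e / 2"
    using e by (intro order_tendstoD(2)[of d 0]) auto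
  then obtain N where N: "\<And>n. n \<ge> N \<Longrightarrow> d n < e / 2"
    by (auto simp: eventually_sequentially)
  have "(TINT y. \<bar>moll i t y - moll j t y\<bar>) < e" if "i \<ge> N" "j \<ge> N" for i j
  proof -
    have "(TINT y. \<bar>moll i 0 y - moll j 0 y\<bar>) \<le>
        (TINT y. \<bar>moll i 0 y - \<omega>0 y\<bar> + \<bar>moll j 0 y - \<omega>0 y\<bar>)"
      by (intro integral_mono integrable_abs Bochner_Integration.integrable_add Bochner_Integration.integrable_diff
          moll_integrable \<omega>0_integrable) simp
    also have "\<dots> = (TINT y. \<bar>moll i 0 y - \<omega>0 y\<bar>) + (TINT y. \<bar>moll j 0 y - \<omega>0 y\<bar>)"
      by (intro Bochner_Integration.integral_add integrable_abs Bochner_Integration.integrable_diff moll_integrable \<omega>0_integrable)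
    finally show ?thesis
      using moll_difference_le[OF t, of i j] N[OF that(1)] N[OF that(2)] unfolding d_def by linarith
  qed
  then show "\<exists>N. \<forall>i\<ge>N. \<forall>j\<ge>N. (TINT y. \<bar>moll i t y - moll j t y\<bar>) < e"
    by blast
qed (rule that)

text \<open>The kernels are even, so that mollification moves from the vorticity to the test function, whose first
  derivatives then converge in \<open>L\<^sup>2\<close>.\<close>

lemma moll_limit_curl:
  assumes t: "t \<in> {0..T}" and h: "integrable torus_measure h"
    and lim: "(\<lambda>n. TINT y. \<bar>moll n t y - h y\<bar>) \<longlonglongrightarrow> 0"
  shows "has_weak_curl (u t) h"
proof -
  have uL: "Lp_torus 2 (u t)"
    using wc t by (simp add: weakly_continuous_L2_def)
  have ui: "Lp_torus 2 (\<lambda>x. u t x $ i)" for i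
    by (rule L2_components[OF uL])
  have "integrable torus_measure (u t)"
    by (rule integrable_norm_cancel[OF L1_le_Lp_norm_2(1)[OF uL]]) (use uL in \<open>simp add: Lp_torus_def\<close>)
  then have u1: "Lp_torus 1 (u t)"
    by (rule Lp1_iff_integrable[THEN iffD2])
  have "(TINT x. h x * \<phi> x) =
      (TINT x. u t x $ 1 * pderiv_at 2 \<phi> x - u t x $ 2 * pderiv_at 1 \<phi> x)" if \<phi>: "test_function \<phi>" for \<phi>
  proof -
    define P where "P n = mollify (diag_kernel n) \<phi>" for n
    have \<phi>c: "continuous_on UNIV \<phi>"
      by (rule test_function_continuous[OF \<phi>])
    have \<phi>i: "integrable torus_measure \<phi>"
      by (rule integrable_torus_continuous[OF \<phi>c])
    have P: "P n x = (\<Sum>j\<in>J n. (TINT y. \<phi> y * B n j y) * A n j x)" for n x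
      unfolding P_def
    proof (rule mollify_expansion[OF \<phi>i expansion(1,3)])
      fix x y
      show "diag_kernel n (x - y) = (\<Sum>j\<in>J n. B n j x * A n j y)"
        using cos_kernel_even[of "Suc n" "Suc n" "y - x"] expansion(4)[of n y x] by (simp add: mult.commute)
    qed
    have dP: "pderiv_at i (P n) x = (\<Sum>j\<in>J n. (TINT y. \<phi> y * B n j y) * pderiv_at i (A n j) x)" for i n x
    proof -
      have sA: "smooth (A n j)" for j
        by (rule test_function_smooth[OF expansion(2)])
      have "P n = (\<lambda>x. \<Sum>j\<in>J n. (TINT y. \<phi> y * B n j y) * A n j x)"
        by (intro ext P)
      then show ?thesis
        by (simp only:) (subst pderiv_sum, intro smooth_mult smooth_const sA, simp only: pderiv_cmult[OF sA])
    qed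
    have pair: "integrable torus_measure (\<lambda>x. u t x $ i * \<psi> x)" if "continuous_on UNIV \<psi>" for i \<psi>
      by (intro integrable_torus_mult_continuous L2_integrable(1) ui that)
    have dPc: "continuous_on UNIV (pderiv_at i (P n))" for i n
      unfolding P_def by (intro test_function_continuous test_function_pderiv test_function_mollify \<phi>i)
    have dual: "(TINT y. moll n t y * \<phi> y) =
        (TINT x. pderiv_at 2 (P n) x * u t x $ 1) - (TINT x. pderiv_at 1 (P n) x * u t x $ 2)" for n
    proof -
      have ci: "integrable torus_measure (\<lambda>y. coef n j t * (\<phi> y * B n j y))" for j
        by (intro integrable_mult_right integrable_torus_mult_continuous \<phi>i test_function_continuous expansion)
      have pi: "integrable torus_measure (\<lambda>x. u t x \<bullet> perp_grad (A n j) x)" for j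
        unfolding inner_perp_grad
        by (intro Bochner_Integration.integrable_diff pair test_function_continuous test_function_pderiv expansion)
      have "(TINT y. moll n t y * \<phi> y) = (TINT y. (\<Sum>j\<in>J n. coef n j t * (\<phi> y * B n j y)))"
        by (intro Bochner_Integration.integral_cong refl) (simp add: moll_def sum_distrib_left sum_distrib_right mult_ac)
      also have "\<dots> = (\<Sum>j\<in>J n. coef n j t * (TINT y. \<phi> y * B n j y))"
        using ci by (subst Bochner_Integration.integral_sum) simp_all
      also have "\<dots> = (\<Sum>j\<in>J n. (TINT x. (TINT y. \<phi> y * B n j y) * (u t x \<bullet> perp_grad (A n j) x)))"
        by (simp add: coef_def mult.commute)
      also have "\<dots> = (TINT x. (\<Sum>j\<in>J n. (TINT y. \<phi> y * B n j y) * (u t x \<bullet> perp_grad (A n j) x)))"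
        by (intro Bochner_Integration.integral_sum[symmetric] integrable_mult_right pi)
      also have "\<dots> = (TINT x. u t x $ 1 * pderiv_at 2 (P n) x - u t x $ 2 * pderiv_at 1 (P n) x)"
        unfolding dP inner_perp_grad
        by (intro Bochner_Integration.integral_cong refl) (simp add: sum_distrib_left sum_subtractf right_diff_distrib mult_ac)
      also have "\<dots> = (TINT x. u t x $ 1 * pderiv_at 2 (P n) x) - (TINT x. u t x $ 2 * pderiv_at 1 (P n) x)"
        by (intro Bochner_Integration.integral_diff pair dPc)
      finally show ?thesis
        by (simp add: mult.commute)
    qed
    have conv: "(\<lambda>n. TINT x. pderiv_at i (P n) x * u t x $ j) \<longlonglongrightarrow>
        (TINT x. pderiv_at i \<phi> x * u t x $ j)" for i j
    proof -
      have "has_weak_pderiv i \<phi> (pderiv_at i \<phi>)"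
        unfolding has_weak_pderiv_def using integral_torus_by_parts[OF \<phi>]
        by (auto intro: test_function_L2 test_function_pderiv \<phi>)
      then have eq: "pderiv_at i (P n) = mollify (diag_kernel n) (pderiv_at i \<phi>)" for n
        unfolding P_def by (intro ext pderiv_mollify_weak)
      have L: "Lp_torus 2 (pderiv_at i \<phi>)"
        by (intro test_function_L2 test_function_pderiv \<phi>)
      have "Lp_torus 2 (pderiv_at i (P n))" for n
        unfolding P_def by (intro test_function_L2 test_function_pderiv test_function_mollify \<phi>i)
      moreover have "(\<lambda>n. TINT x. (pderiv_at i (P n) x - pderiv_at i \<phi> x)\<^sup>2) \<longlonglongrightarrow> 0"
        unfolding eq by (rule mollify_tendsto_L2[OF approx_identity_diag L])
      ultimately show ?thesis
        by (intro L2_pairing_tendsto L ui)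
    qed
    have lim1: "(\<lambda>n. TINT y. moll n t y * \<phi> y) \<longlonglongrightarrow>
        (TINT x. pderiv_at 2 \<phi> x * u t x $ 1) - (TINT x. pderiv_at 1 \<phi> x * u t x $ 2)"
      unfolding dual by (intro tendsto_diff conv)
    obtain C where C: "C \<ge> 0" "\<And>x. x \<in> torus \<Longrightarrow> norm (\<phi> x) \<le> C"
      using continuous_bounded_torus[OF \<phi>c] by blast
    have lim2: "(\<lambda>n. TINT y. moll n t y * \<phi> y) \<longlonglongrightarrow> (TINT x. h x * \<phi> x)"
    proof (rule LIM_zero_cancel, rule tendsto_rabs_zero_cancel)
      have bound: "\<bar>(TINT y. moll n t y * \<phi> y) - (TINT x. h x * \<phi> x)\<bar> \<le>
          C * (TINT y. \<bar>moll n t y - h y\<bar>)" for n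
      proof -
        have i: "integrable torus_measure (\<lambda>y. moll n t y * \<phi> y)" "integrable torus_measure (\<lambda>y. h y * \<phi> y)"
          by (intro integrable_torus_mult_continuous moll_integrable h \<phi>c)+
        have "(TINT y. moll n t y * \<phi> y) - (TINT x. h x * \<phi> x) =
            (TINT y. moll n t y * \<phi> y - h y * \<phi> y)"
          by (rule Bochner_Integration.integral_diff[OF i, symmetric])
        then have "\<bar>(TINT y. moll n t y * \<phi> y) - (TINT x. h x * \<phi> x)\<bar> \<le>
            (TINT y. \<bar>moll n t y * \<phi> y - h y * \<phi> y\<bar>)"
          using integral_abs_bound by (simp only:)
        also have "\<dots> \<le> (TINT y. C * \<bar>moll n t y - h y\<bar>)"
        proof (rule integral_mono)
          show "\<bar>moll n t y * \<phi> y - h y * \<phi> y\<bar> \<le> C * \<bar>moll n t y - h y\<bar>" if "y \<in> space torus_measure" for y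
          proof -
            have "\<bar>moll n t y * \<phi> y - h y * \<phi> y\<bar> = \<bar>\<phi> y\<bar> * \<bar>moll n t y - h y\<bar>"
              unfolding left_diff_distrib[symmetric] abs_mult by (rule mult.commute)
            also have "\<dots> \<le> C * \<bar>moll n t y - h y\<bar>"
              using C(2)[of y] that by (intro mult_right_mono) simp_all
            finally show ?thesis .
          qed
        qed (intro integrable_abs Bochner_Integration.integrable_diff i integrable_mult_right moll_integrable h)+
        finally show ?thesis
          by simp
      qed
      have Clim: "(\<lambda>n. C * (TINT y. \<bar>moll n t y - h y\<bar>)) \<longlonglongrightarrow> 0"
        using tendsto_mult_right_zero[OF lim] by simp
      show "(\<lambda>n. \<bar>(TINT y. moll n t y * \<phi> y) - (TINT x. h x * \<phi> x)\<bar>) \<longlonglongrightarrow> 0"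
        by (rule tendsto_sandwich[OF _ _ tendsto_const Clim]) (use bound in auto)
    qed
    have "(TINT x. u t x $ 1 * pderiv_at 2 \<phi> x - u t x $ 2 * pderiv_at 1 \<phi> x) =
        (TINT x. u t x $ 1 * pderiv_at 2 \<phi> x) - (TINT x. u t x $ 2 * pderiv_at 1 \<phi> x)"
      by (intro Bochner_Integration.integral_diff pair test_function_continuous test_function_pderiv \<phi>)
    then show ?thesis
      using LIMSEQ_unique[OF lim2 lim1] by (simp add: mult.commute)
  qed
  then show ?thesis
    unfolding has_weak_curl_def using u1 Lp1_iff_integrable[THEN iffD2, OF h] by blast
qed

lemma moll_limit_maximal_vorticity:
  assumes t: "t \<in> {0..T}" and h: "integrable torus_measure h"
    and lim: "(\<lambda>n. TINT y. \<bar>moll n t y - h y\<bar>) \<longlonglongrightarrow> 0" and s: "s \<in> {0..measure lebesgue torus}"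
  shows "maximal_vorticity s h \<le> maximal_vorticity s \<omega>0 + (LINT \<tau>:{0..t}|lebesgue. maximal_vorticity s (g \<tau>))"
proof (cases "s = 0")
  case True
  then show ?thesis
    by (simp add: maximal_vorticity_0)
next
  case False
  define I where "I = (LINT \<tau>:{0..t}|lebesgue. maximal_vorticity s (g \<tau>))"
  have s: "0 < s" "0 \<le> s" "s \<le> measure lebesgue torus"
    using s False by auto
  have "(\<lambda>n. maximal_vorticity s \<omega>0 + (TINT y. \<bar>moll n 0 y - \<omega>0 y\<bar>) + I +
      (LINT \<tau>|time_measure T. source_error n \<tau>) + (TINT y. \<bar>moll n t y - h y\<bar>)) \<longlonglongrightarrow>
      maximal_vorticity s \<omega>0 + 0 + I + 0 + 0"
    by (intro tendsto_add tendsto_const moll_0_tendsto source_error_tendsto lim)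
  then have "maximal_vorticity s h \<le> maximal_vorticity s \<omega>0 + 0 + I + 0 + 0"
  proof (rule LIMSEQ_le_const, intro exI allI impI)
    fix n
    have "maximal_vorticity s h \<le> maximal_vorticity s (moll n t) + (TINT y. \<bar>moll n t y - h y\<bar>)"
      using maximal_vorticity_lipschitz[OF h moll_integrable[of n t] s(2,3)] by (simp add: abs_minus_commute)
    moreover have "maximal_vorticity s (moll n 0) \<le> maximal_vorticity s \<omega>0 + (TINT y. \<bar>moll n 0 y - \<omega>0 y\<bar>)"
      by (rule maximal_vorticity_lipschitz[OF moll_integrable \<omega>0_integrable s(2,3)])
    ultimately show "maximal_vorticity s h \<le> maximal_vorticity s \<omega>0 + (TINT y. \<bar>moll n 0 y - \<omega>0 y\<bar>) + I +
        (LINT \<tau>|time_measure T. source_error n \<tau>) + (TINT y. \<bar>moll n t y - h y\<bar>)"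
      using moll_maximal_vorticity_le[OF s(1,3) t, of n] unfolding I_def by linarith
  qed
  then show ?thesis
    by (simp add: I_def)
qed

end

section \<open>The maximal vorticity estimate\<close>

theorem proposition4p5:
  fixes \<nu> T :: real
    and u0 :: "real^2 \<Rightarrow> real^2"
    and f u :: "real \<Rightarrow> real^2 \<Rightarrow> real^2"
    and \<omega>0 :: "real^2 \<Rightarrow> real"
    and g :: "real \<Rightarrow> real^2 \<Rightarrow> real"
  assumes "T > 0" and "\<nu> > 0"
    and "Lp_torus 2 u0" and "weakly_div_free u0"
    and "Lq_Lp 1 2 T f" and "AE t in lebesgue_on {0<..<T}. weakly_div_free (f t)"
    and "navier_stokes_solution \<nu> T u0 f u" and "weakly_continuous_L2 T u"
    and "has_weak_curl u0 \<omega>0"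
    and "Lq_Lp 1 1 T g" and "AE t in lebesgue_on {0<..<T}. has_weak_curl (f t) (g t)"
  shows "\<exists>\<omega> :: real \<Rightarrow> real^2 \<Rightarrow> real. \<forall>t\<in>{0..T}.
           has_weak_curl (u t) (\<omega> t) \<and>
           (\<forall>s\<in>{0..measure lebesgue torus}.
              maximal_vorticity s (\<omega> t) \<le>
                maximal_vorticity s \<omega>0 + (LINT \<tau>:{0..t}|lebesgue. maximal_vorticity s (g \<tau>)))"
proof -
  obtain G :: "real \<Rightarrow> real^2 \<Rightarrow> real^2^2" where G: "Lq_Lp 2 2 T G"
    "AE t in time_measure T. \<forall>i j. has_weak_pderiv i (\<lambda>x. u t x $ j) (\<lambda>x. G t x $ j $ i)"
    using assms(7) unfolding navier_stokes_solution_def L2_H1_def by blast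
  have "\<forall>n. \<exists>q :: nat set \<times> (nat \<Rightarrow> real^2 \<Rightarrow> real) \<times> (nat \<Rightarrow> real^2 \<Rightarrow> real). finite (fst q) \<and>
      (\<forall>j. test_function (fst (snd q) j)) \<and> (\<forall>j. test_function (snd (snd q) j)) \<and>
      (\<forall>x y. diag_kernel n (x - y) = (\<Sum>j\<in>fst q. fst (snd q) j x * snd (snd q) j y))"
  proof
    fix n
    obtain J :: "nat set" and A B where "finite J" "\<And>j. test_function (A j)" "\<And>j. test_function (B j)"
      "\<And>x y. diag_kernel n (x - y) = (\<Sum>j\<in>J. A j x * B j y)"
      by (rule cos_kernel_expansion[of "Suc n" "Suc n"]) (rule that)
    then show "\<exists>q :: nat set \<times> (nat \<Rightarrow> real^2 \<Rightarrow> real) \<times> (nat \<Rightarrow> real^2 \<Rightarrow> real). finite (fst q) \<and>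
      (\<forall>j. test_function (fst (snd q) j)) \<and> (\<forall>j. test_function (snd (snd q) j)) \<and>
      (\<forall>x y. diag_kernel n (x - y) = (\<Sum>j\<in>fst q. fst (snd q) j x * snd (snd q) j y))"
      by (intro exI[of _ "(J, A, B)"]) simp
  qed
  from choice[OF this] obtain q :: "nat \<Rightarrow> nat set \<times> (nat \<Rightarrow> real^2 \<Rightarrow> real) \<times> (nat \<Rightarrow> real^2 \<Rightarrow> real)"
    where q: "\<forall>n. finite (fst (q n)) \<and>
      (\<forall>j. test_function (fst (snd (q n)) j)) \<and> (\<forall>j. test_function (snd (snd (q n)) j)) \<and>
      (\<forall>x y. diag_kernel n (x - y) = (\<Sum>j\<in>fst (q n). fst (snd (q n)) j x * snd (snd (q n)) j y))"
    by blast
  interpret navier_stokes_vorticity \<nu> T u0 f u \<omega>0 g G "\<lambda>n. fst (q n)" "\<lambda>n. fst (snd (q n))" "\<lambda>n. snd (snd (q n))"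
  proof
    show "T > 0" "\<nu> > 0" "Lq_Lp 1 2 T f" "navier_stokes_solution \<nu> T u0 f u" "weakly_continuous_L2 T u"
      "has_weak_curl u0 \<omega>0" "Lq_Lp 1 1 T g" "AE t in time_measure T. has_weak_curl (f t) (g t)"
      by (rule assms)+
  qed (use G q in blast)+
  have "\<forall>t\<in>{0..T}. \<exists>h. integrable torus_measure h \<and> (\<lambda>n. TINT y. \<bar>moll n t y - h y\<bar>) \<longlonglongrightarrow> 0"
    using moll_limit_exists by blast
  from bchoice[OF this] obtain \<omega> where \<omega>: "\<forall>t\<in>{0..T}. integrable torus_measure (\<omega> t) \<and>
      (\<lambda>n. TINT y. \<bar>moll n t y - \<omega> t y\<bar>) \<longlonglongrightarrow> 0"
    by blast
  show ?thesis
  proof (intro exI[of _ \<omega>] ballI conjI)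
    fix t s assume t: "t \<in> {0..T}"
    note w = conjunct1[OF bspec[OF \<omega> t]] conjunct2[OF bspec[OF \<omega> t]]
    show "has_weak_curl (u t) (\<omega> t)"
      by (rule moll_limit_curl[OF t w])
    show "maximal_vorticity s (\<omega> t) \<le> maximal_vorticity s \<omega>0 + (LINT \<tau>:{0..t}|lebesgue. maximal_vorticity s (g \<tau>))"
      if "s \<in> {0..measure lebesgue torus}"
      by (rule moll_limit_maximal_vorticity[OF t w that])
  qed
qed

end
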